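(* Consider disjoint sets $R,B\subseteq[u]$ of $n_R$ red balls and $n_B$ blue balls with $n_R+n_B>|\Sigma|/2$, and let $f=n_R/(n_R+n_B)$. Let $k\le |\Sigma|/(4d\log|\Sigma|)$. Let $X^{\mathcal M}$ be the estimator $(\#\text{red bins})/k^\star$ obtained from MinHash with $k$-partitioning of $R\cup B$ using a mixed tabulation hash function with $d$ derived characters. There is $\varepsilon=O\!\left(\sqrt{\frac{\log|\Sigma|(\log\log|\Sigma|)^2}{|\Sigma|}}\right)$ such that the following holds. Let $\overline X^{\mathcal R}$ be the same estimator in the experiment using a fully random hash function on $\lfloor n_R(1+\varepsilon)\rfloor$ red balls and $\lceil n_B(1-\varepsilon)\rceil$ blue balls. Then for every $\delta$, \[\Pr[X^{\mathcal M}\ge(1+\delta)f]\le \Pr[\overline X^{\mathcal R}\ge(1+\delta)f]+\tilde O(|\Sigma|^{1-\lfloor d/2\rfloor}).\] Likewise, letting $\underline X^{\mathcal R}$ be the estimator in the fully random experiment with $\lceil n_R(1-\varepsilon)\rceil$ red balls and $\lfloor n_B(1+\varepsilon)\rfloor$ blue balls, \[\Pr[X^{\mathcal M}\le(1-\delta)f]\le \Pr[\underline X^{\mathcal R}\le(1-\delta)f]+\tilde O(|\Sigma|^{1-\lfloor d/2\rfloor}).\]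
   Context: Simple tabulation: fix an integer $c\ge1$ and an alphabet $\Sigma$ whose size is a power of two. A key $x\in[u]$ is viewed as a vector $(x_0,\dots,x_{c-1})$ of $c$ characters in $\Sigma$. A simple tabulation function $g:\Sigma^c\to\mathcal R$ ($\mathcal R=[2^r]$ bit strings, or $\mathcal R=\Sigma^d$) is given by $c$ independent fully random tables $T_i:\Sigma\to\mathcal R$ with $g(x)=T_0[x_0]\oplus\cdots\oplus T_{c-1}[x_{c-1}]$ (bitwise XOR). Mixed tabulation with parameters $c,d$: independent simple tabulation functions $h_1:\Sigma^c\to\Sigma^d$, $h_2:\Sigma^{c+d}\to\mathcal R$, derived key $h_1^\star(x)=x\cdot h_1(x)$ (concatenation), $h(x)=h_2(h_1^\star(x))$. Standing assumptions: $c,d=O(1)$, $u^{1/c}\le|\Sigma|\le u^{1/(c-1)}$; constants in $O,\tilde O$ may depend on $c,d$, and $\tilde O$ hides polylogarithmic factors in $|\Sigma|$. MinHash with $k$-partitioning: for each ball $x$ the first $\lceil\lg k\rceil$ bits of $h(x)$ determine which of $k$ bins $x$ falls in, and the remaining bits form its local hash value; in each non-empty bin the ball with the smallest local hash value is selected. A bin is red if its selected ball is red; $k^\star$ is the number of non-empty bins, and the estimator of $f$ is $(\#\text{red bins})/k^\star$. A fully random hash function assigns independent uniform values in $\mathcal R$ to distinct balls. *)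

theory Defs
  imports "HOL-Probability.Product_PMF" "HOL-Library.Landau_Symbols"
begin

unbundle bit_operations_syntax

text \<open>
  The alphabet is \<open>\<Sigma> = {..<2 ^ s}\<close>, so that characters are strings of \<open>s\<close> bits. A vector in
  \<open>\<Sigma>\<^sup>m\<close> is represented by the number below \<open>2 ^ (s * m)\<close> whose digits in base \<open>2 ^ s\<close> are its
  characters, least significant digit first. In this representation, bitwise exclusive or on
  numbers is the characterwise exclusive or of vectors.
\<close>

definition character :: "nat \<Rightarrow> nat \<Rightarrow> nat \<Rightarrow> nat" where
  "character s x i = x div (2 ^ s) ^ i mod 2 ^ s"

primrec simple_tab :: "nat \<Rightarrow> nat \<Rightarrow> (nat \<Rightarrow> nat \<Rightarrow> nat) \<Rightarrow> nat \<Rightarrow> nat" where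
  "simple_tab s 0 T x = 0"
| "simple_tab s (Suc m) T x = simple_tab s m T x XOR T m (character s x m)"

definition random_tables :: "nat \<Rightarrow> nat \<Rightarrow> nat \<Rightarrow> (nat \<Rightarrow> nat \<Rightarrow> nat) pmf" where
  "random_tables s m r =
     Pi_pmf {..<m} (\<lambda>_. 0) (\<lambda>_. Pi_pmf {..<2 ^ s} 0 (\<lambda>_. pmf_of_set {..<2 ^ r}))"

text \<open>For \<open>x < 2 ^ (s * c)\<close>, the vector \<open>x + 2 ^ (s * c) * y\<close> is the concatenation of
  \<open>x \<in> \<Sigma>\<^sup>c\<close> and \<open>y\<close>. The range \<open>\<Sigma>\<^sup>d\<close> of the first function is \<open>{..<2 ^ (s * d)}\<close>.\<close>

definition derived_key :: "nat \<Rightarrow> nat \<Rightarrow> (nat \<Rightarrow> nat) \<Rightarrow> nat \<Rightarrow> nat" where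
  "derived_key s c h1 x = x + 2 ^ (s * c) * h1 x"

definition mixed_tabulation :: "nat \<Rightarrow> nat \<Rightarrow> nat \<Rightarrow> nat \<Rightarrow> (nat \<Rightarrow> nat) pmf" where
  "mixed_tabulation s c d r =
     bind_pmf (random_tables s c (s * d)) (\<lambda>T1.
     bind_pmf (random_tables s (c + d) r) (\<lambda>T2.
     return_pmf (\<lambda>x. simple_tab s (c + d) T2 (derived_key s c (simple_tab s c T1) x))))"

definition fully_random :: "'a set \<Rightarrow> nat \<Rightarrow> ('a \<Rightarrow> nat) pmf" where
  "fully_random A r = Pi_pmf A 0 (\<lambda>_. pmf_of_set {..<2 ^ r})"

text \<open>
  Hash values are strings of \<open>r\<close> bits, most significant bit first. The first \<open>\<lceil>lg k\<rceil>\<close> bits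
  name the bin, so if \<open>k\<close> is not a power of two it is implicitly rounded up to one.
\<close>

definition bin_bits :: "nat \<Rightarrow> nat" where
  "bin_bits k = nat \<lceil>log 2 (real k)\<rceil>"

definition bin_of :: "nat \<Rightarrow> nat \<Rightarrow> nat \<Rightarrow> nat" where
  "bin_of r k v = v div 2 ^ (r - bin_bits k)"

definition local_hash :: "nat \<Rightarrow> nat \<Rightarrow> nat \<Rightarrow> nat" where
  "local_hash r k v = v mod 2 ^ (r - bin_bits k)"

definition nonempty_bins :: "nat \<Rightarrow> nat \<Rightarrow> ('a \<Rightarrow> nat) \<Rightarrow> 'a set \<Rightarrow> nat set" where
  "nonempty_bins r k h A = (\<lambda>x. bin_of r k (h x)) ` A"

definition smallest_in_bin :: "nat \<Rightarrow> nat \<Rightarrow> ('a \<Rightarrow> nat) \<Rightarrow> 'a set \<Rightarrow> nat \<Rightarrow> 'a set" where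
  "smallest_in_bin r k h A b =
     {x. is_arg_min (\<lambda>y. local_hash r k (h y)) (\<lambda>y. y \<in> A \<and> bin_of r k (h y) = b) x}"

text \<open>In each non-empty bin the ball with the smallest local hash value is selected. Since local
  hash values have finitely many bits, this ball need not be unique; ties are broken uniformly at
  random, independently for each bin. (If there are no ties, the selection is deterministic.)\<close>

definition minhash_selection ::
    "nat \<Rightarrow> nat \<Rightarrow> ('a \<Rightarrow> nat) \<Rightarrow> 'a set \<Rightarrow> (nat \<Rightarrow> 'a) pmf" where
  "minhash_selection r k h A =
     Pi_pmf (nonempty_bins r k h A) undefined (\<lambda>b. pmf_of_set (smallest_in_bin r k h A b))"

definition minhash_estimator ::
    "nat \<Rightarrow> nat \<Rightarrow> 'a set \<Rightarrow> 'a set \<Rightarrow> ('a \<Rightarrow> nat) pmf \<Rightarrow> real pmf" where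
  "minhash_estimator r k R B H =
     bind_pmf H (\<lambda>h.
     bind_pmf (minhash_selection r k h (R \<union> B)) (\<lambda>sel.
     return_pmf (real (card {b \<in> nonempty_bins r k h (R \<union> B). sel b \<in> R}) /
                 real (card (nonempty_bins r k h (R \<union> B))))))"

definition mixed_estimator ::
    "nat \<Rightarrow> nat \<Rightarrow> nat \<Rightarrow> nat \<Rightarrow> nat \<Rightarrow> nat set \<Rightarrow> nat set \<Rightarrow> real pmf" where
  "mixed_estimator s c d r k R B = minhash_estimator r k R B (mixed_tabulation s c d r)"

text \<open>The fully random experiment only depends on the numbers of balls: the \<open>a\<close> red balls are
  \<open>{..<a}\<close> and the \<open>b\<close> blue balls are \<open>{a..<a + b}\<close>. The counts are integers as they arise by
  rounding; a negative count means that there are no such balls.\<close>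

definition random_estimator :: "nat \<Rightarrow> nat \<Rightarrow> int \<Rightarrow> int \<Rightarrow> real pmf" where
  "random_estimator r k a b =
     minhash_estimator r k {..<nat a} {nat a..<nat a + nat b}
       (fully_random {..<nat a + nat b} r)"

definition soft_O :: "(nat \<Rightarrow> real) \<Rightarrow> (nat \<Rightarrow> real) set" where
  "soft_O g = {f. \<exists>a::nat. f \<in> O(\<lambda>n. g n * ln (real n) ^ a)}"

end

theory Submission
  imports Defs "HOL-Real_Asymp.Real_Asymp"
begin

text \<open>Write D for \<open>d div 2\<close> and |\<Sigma>| = 2^s. Call a set of keys independent
  if no nonempty subset contains every character an even number of times in every position, that is,
  if the incidence vectors of the keys are linearly independent over the field with two elements. A
  simple tabulation function is fully random on such a set
  (\<open>simple_tab_indep_uniform\<close>). Hence mixed tabulation acts as a fully random function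
  on every set of keys whose derived keys are independent.

  The first pillar is \<open>prob_dependent\<close>. Select the keys for which some bits of the hash
  value take a prescribed value; if at most 3/4 |\<Sigma>| keys are expected to be selected, their
  derived keys are dependent with probability |\<Sigma>|^(1-D) only, up to powers of log |\<Sigma>|.
  A dependent set has a nonempty subset S in which each derived character occurs an even number of
  times. Each of D rounds uses two derived positions and walks inside S, each key sharing with the
  next one a character in the two positions alternately. While the keys met are independent, a step
  costs a factor (expected number of selected keys) / |\<Sigma>| <= 3/4, so that a walk of
  logarithmic length is unlikely. When the walk first meets a key that is the XOR of known keys,
  there are two cases. Either the link to this key is a new equation between random characters,
  which gains a factor 1/|\<Sigma>|; or the equation follows from earlier links, and then keys on
  the walk sum to zero in every position. Such tuples of keys are rare by a count with Euclidean
  norms (\<open>zero_sums_weight\<close>, \<open>walk_op_norm\<close>). So each round gains a factor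
  polylog/|\<Sigma>|, while the start of the walk costs a factor |\<Sigma>|.

  The second pillar is \<open>deviation_prob_bound\<close>: the number of selected keys deviates
  from its mean by a relative error of order sqrt(log |\<Sigma>| / |\<Sigma>|) log log |\<Sigma>|.
  Concentration of simple tabulation up to polylogarithmic factors
  (\<open>simple_tab_concentration\<close>) suffices where the mean is |\<Sigma>| times a power of
  log |\<Sigma>|. From there, O(log log |\<Sigma>|) further bits halve the set one after the other
  (\<open>halving\<close>), each with an error of order sqrt(log |\<Sigma>| / |\<Sigma>|). Together
  with independence this yields \<open>filtered_count_bound\<close>: the number of selected keys is
  stochastically comparable with a binomial count for slightly more, or slightly fewer, keys.

  For the estimator, consider only the balls whose first few local hash bits vanish. If these
  survivors hit every bin, the selected balls are among them. The number of filter bits is chosen so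
  that between |\<Sigma>|/4 and |\<Sigma>|/2 survivors are expected. By the bound on
  \<open>k\<close> they hit every bin with high probability (\<open>miss_bound_small\<close>). Their
  derived keys are independent with high probability, so bins and remaining bits are fully random on
  them, and the probability of many red bins is a function of the numbers of red and blue survivors
  alone, increasing in the first and decreasing in the second (\<open>mixed_estimator_le\<close>,
  \<open>red_prob_of_mono\<close>). The same reduction applies to the fully random experiment
  (\<open>red_prob_filter_le\<close>). It remains to compare the pairs of survivor counts. Under
  mixed tabulation the two counts may be correlated; but the count of the more frequent colour is so
  concentrated that a constant separates it from its counterpart in the other experiment, and the
  count of the other colour is compared by stochastic domination
  (\<open>expectation_le_first\<close>, \<open>expectation_le_second\<close>). If the hash value has
  too few bits for the filter, random tie breaking supplies further ones
  (\<open>red_share_refine\<close>). The lower tail is the upper tail with the colours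
  exchanged.\<close>

abbreviation (input) prob :: "'a pmf \<Rightarrow> 'a set \<Rightarrow> real" where
  "prob M \<equiv> measure_pmf.prob M"

abbreviation (input) expect :: "'a pmf \<Rightarrow> ('a \<Rightarrow> real) \<Rightarrow> real" where
  "expect M \<equiv> measure_pmf.expectation M"

abbreviation (input) uniform_bits :: "nat \<Rightarrow> nat pmf" where
  "uniform_bits r \<equiv> pmf_of_set {..<2 ^ r}"

abbreviation (input) "binom \<equiv> binomial_pmf"

abbreviation (input) "table_pair s c d b \<equiv> pair_pmf (random_tables s c (s * d)) (random_tables s (c + d) b)"

abbreviation (input) "derived s c T1 \<equiv> derived_key s c (simple_tab s c T1)"

lemmas prob_mono = measure_pmf.finite_measure_mono

section \<open>Simple tabulation on linearly independent sets of keys\<close>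

interpretation xorsum: comm_monoid_set "(XOR) :: nat \<Rightarrow> nat \<Rightarrow> nat" 0
 by standard (auto simp: xor.commute xor.left_commute xor.assoc)

abbreviation xsum :: "('a \<Rightarrow> nat) \<Rightarrow> 'a set \<Rightarrow> nat" where
 "xsum \<equiv> xorsum.F"

text \<open>The keys of \<open>S\<close> sum to zero as vectors over the field with two elements,
  with one coordinate for each position and character. The map \<open>\<kappa>\<close> from indices
  to keys lets the notion serve for keys, derived keys and walks alike.\<close>

definition even_chars :: "nat \<Rightarrow> nat \<Rightarrow> ('a \<Rightarrow> nat) \<Rightarrow> 'a set \<Rightarrow> bool" where
 "even_chars s m \<kappa> S \<longleftrightarrow> (\<forall>i<m. \<forall>a. even (card {x \<in> S. character s (\<kappa> x) i = a}))"

text \<open>Linear independence of these vectors. Two indices with the same key form an even set, so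
  \<open>\<kappa>\<close> is injective on an independent set.\<close>

definition indep :: "nat \<Rightarrow> nat \<Rightarrow> ('a \<Rightarrow> nat) \<Rightarrow> 'a set \<Rightarrow> bool" where
 "indep s m \<kappa> J \<longleftrightarrow> finite J \<and> (\<forall>S\<subseteq>J. S \<noteq> {} \<longrightarrow> \<not> even_chars s m \<kappa> S)"

abbreviation (input) "derived_indep s c d T1 \<equiv> indep s (c + d) (derived s c T1)"

lemma simple_tab_eq_xsum: "simple_tab s m T x = xsum (\<lambda>i. T i (character s x i)) {..<m}"
 by (induction m) (simp_all add: lessThan_Suc xor.commute)

lemma xsum_const_if:
 assumes "finite A"
 shows "xsum (\<lambda>x. if P x then g else 0) A = (if odd (card {x \<in> A. P x}) then g else 0)"
 using assms
proof (induction A rule: finite_induct)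
 case (insert y A)
 have "{x \<in> insert y A. P x} = (if P y then insert y {x \<in> A. P x} else {x \<in> A. P x})" by auto
 with insert show ?case by auto
qed simp

lemma xor_less_power: "a < 2 ^ r \<Longrightarrow> b < 2 ^ r \<Longrightarrow> a XOR b < 2 ^ r" for a b :: nat
 by (metis take_bit_nat_eq_self_iff take_bit_xor)

lemma xsum_less: "finite A \<Longrightarrow> (\<And>x. x \<in> A \<Longrightarrow> f x < 2 ^ r) \<Longrightarrow> xsum f A < 2 ^ r"
 by (induction A rule: finite_induct) (auto intro: xor_less_power)

lemma simple_tab_less: "(\<And>i a. T i a < 2 ^ r) \<Longrightarrow> simple_tab s m T x < 2 ^ r"
 by (simp add: simple_tab_eq_xsum xsum_less)

lemma simple_tab_xor:
 "simple_tab s m (\<lambda>i a. T i a XOR T' i a) x = simple_tab s m T x XOR simple_tab s m T' x"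
 by (simp add: simple_tab_eq_xsum xorsum.distrib)

lemma simple_tab_xsum:
 "finite A \<Longrightarrow> simple_tab s m (\<lambda>i a. xsum (\<lambda>z. T z i a) A) x = xsum (\<lambda>z. simple_tab s m (T z) x) A"
 unfolding simple_tab_eq_xsum by (rule xorsum.swap)

text \<open>Simple tabulation is linear in its tables; this is multiplication of bit tables by the
  fixed string \<open>g\<close>.\<close>

lemma simple_tab_scale:
 assumes "\<And>i a. \<theta> i a < 2"
 shows "simple_tab s m (\<lambda>i a. if \<theta> i a = 1 then g else 0) x =
  (if simple_tab s m \<theta> x = 1 then g else 0)"
proof -
 have "\<theta> = (\<lambda>i a. if \<theta> i a = 1 then 1 else 0)" using assms
  by (intro ext) (metis less_2_cases_iff One_nat_def)
 then have "simple_tab s m \<theta> x = simple_tab s m (\<lambda>i a. if \<theta> i a = 1 then 1 else 0) x" by metis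
 then show ?thesis unfolding simple_tab_eq_xsum by (simp add: xsum_const_if)
qed

lemma indep_subset: "indep s m \<kappa> J \<Longrightarrow> I \<subseteq> J \<Longrightarrow> indep s m \<kappa> I"
 unfolding indep_def by (meson finite_subset order_trans)

text \<open>Induction on the size of \<open>J\<close>. Correct each unit table by the dual vectors
  of \<open>J - {x}\<close>, so that it vanishes on these keys. If all corrected tables vanished at
  \<open>x\<close> as well, then \<open>x\<close> would be the XOR of the keys whose dual vector is
  1 at \<open>x\<close>, against independence.\<close>

lemma indep_dual_vector:
 assumes "indep s m \<kappa> J" "x \<in> J"
 shows "\<exists>\<theta>. (\<forall>i a. \<theta> i a < 2) \<and> (\<forall>y\<in>J. simple_tab s m \<theta> (\<kappa> y) = of_bool (y = x))"
 using assms
proof (induction "card J" arbitrary: J x rule: less_induct)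
 case less
 define I where "I = J - {x}"
 have fin: "finite J" "finite I" using less.prems by (auto simp: indep_def I_def)
 have "card I < card J" using fin less.prems unfolding I_def by (metis card_Diff1_less)
 moreover have "indep s m \<kappa> I" using less.prems(1) by (rule indep_subset) (auto simp: I_def)
 ultimately have "\<forall>y\<in>I. \<exists>\<theta>. (\<forall>i a. \<theta> i a < 2) \<and> (\<forall>z\<in>I. simple_tab s m \<theta> (\<kappa> z) = of_bool (z = y))"
  using less.hyps by blast
 then obtain \<theta> where th: "\<And>y i a. y \<in> I \<Longrightarrow> \<theta> y i a < 2"
  "\<And>y z. y \<in> I \<Longrightarrow> z \<in> I \<Longrightarrow> simple_tab s m (\<theta> y) (\<kappa> z) = of_bool (z = y)"
  by metis
 define E where "E j e = (\<lambda>i a. of_bool (i = j \<and> a = e) :: nat)" for j e :: nat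
 define H where "H j e = {y \<in> I. character s (\<kappa> y) j = e}" for j e
 \<comment> \<open>The unit table at position \<open>j\<close> and character \<open>e\<close>, minus
   its interpolation on \<open>I\<close>.\<close>
 define T where "T j e = (\<lambda>i a. E j e i a XOR xsum (\<lambda>y. \<theta> y i a) (H j e))" for j e
 have E: "simple_tab s m (E j e) z = of_bool (character s z j = e)" if "j < m" for j e z
 proof -
  have "simple_tab s m (E j e) z = xsum (\<lambda>i. if i = j \<and> character s z j = e then 1 else 0) {..<m}"
   unfolding simple_tab_eq_xsum E_def by (intro xorsum.cong) auto
  moreover have "{i \<in> {..<m}. i = j \<and> character s z j = e} = (if character s z j = e then {j} else {})"
   using that by auto
  ultimately show ?thesis by (auto simp: xsum_const_if)
 qed
 have ev: "simple_tab s m (T j e) (\<kappa> z) =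
  of_bool (character s (\<kappa> z) j = e) XOR xsum (\<lambda>y. simple_tab s m (\<theta> y) (\<kappa> z)) (H j e)"
  if "j < m" for j e z
  unfolding T_def using fin that by (simp add: simple_tab_xor simple_tab_xsum H_def E)
 have T0: "simple_tab s m (T j e) (\<kappa> z) = 0" if "j < m" "z \<in> I" for j e z
 proof -
  have "xsum (\<lambda>y. simple_tab s m (\<theta> y) (\<kappa> z)) (H j e) = xsum (\<lambda>y. if z = y then 1 else 0) (H j e)"
   using th that by (intro xorsum.cong) (auto simp: H_def)
  also have "\<dots> = (if odd (card {y \<in> H j e. z = y}) then 1 else 0)"
   using fin by (intro xsum_const_if) (auto simp: H_def)
  also have "{y \<in> H j e. z = y} = (if z \<in> H j e then {z} else {})" by auto
  finally show ?thesis using that by (auto simp: ev H_def)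
 qed
 have T2: "T j e i a < 2" for j e i a
 proof -
  have "E j e i a < 2 ^ 1" "xsum (\<lambda>y. \<theta> y i a) (H j e) < 2 ^ 1"
   using th fin by (auto simp: E_def H_def intro!: xsum_less[where r = 1, simplified])
  from xor_less_power[OF this] show ?thesis by (simp add: T_def)
 qed
 show ?case
 proof (cases "\<exists>j<m. \<exists>e. simple_tab s m (T j e) (\<kappa> x) \<noteq> 0")
  case True
  then obtain j e where je: "j < m" "simple_tab s m (T j e) (\<kappa> x) \<noteq> 0" by blast
  have "simple_tab s m (T j e) (\<kappa> x) < 2 ^ 1" using T2 by (intro simple_tab_less) simp
  with je have "simple_tab s m (T j e) (\<kappa> x) = 1" by simp
  then show ?thesis using T2 T0 je by (intro exI[of _ "T j e"]) (auto simp: I_def)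
 next
  case False
  \<comment> \<open>Since all corrected tables vanish at \<open>x\<close>, the key of
    \<open>x\<close> is the sum of the keys of \<open>A\<close>.\<close>
  define A where "A = {y \<in> I. simple_tab s m (\<theta> y) (\<kappa> x) = 1}"
  have "even_chars s m \<kappa> (insert x A)" unfolding even_chars_def
  proof (intro allI impI)
   fix j e assume j: "j < m"
   have v: "simple_tab s m (\<theta> y) (\<kappa> x) < 2 ^ 1" if "y \<in> I" for y
    using th that by (intro simple_tab_less) simp
   have "xsum (\<lambda>y. simple_tab s m (\<theta> y) (\<kappa> x)) (H j e) =
     xsum (\<lambda>y. if simple_tab s m (\<theta> y) (\<kappa> x) = 1 then 1 else 0) (H j e)"
    using v by (intro xorsum.cong) (auto simp: H_def less_2_cases_iff)
   also have "\<dots> = (if odd (card {y \<in> H j e. simple_tab s m (\<theta> y) (\<kappa> x) = 1}) then 1 else 0)"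
    using fin by (intro xsum_const_if) (auto simp: H_def)
   also have "{y \<in> H j e. simple_tab s m (\<theta> y) (\<kappa> x) = 1} = {y \<in> A. character s (\<kappa> y) j = e}"
    by (auto simp: H_def A_def)
   finally have eq: "xsum (\<lambda>y. simple_tab s m (\<theta> y) (\<kappa> x)) (H j e) =
    (if odd (card {y \<in> A. character s (\<kappa> y) j = e}) then 1 else 0)" .
   have "simple_tab s m (T j e) (\<kappa> x) = 0" using False j by blast
   then have *: "of_bool (character s (\<kappa> x) j = e) XOR
     (if odd (card {y \<in> A. character s (\<kappa> y) j = e}) then 1 else 0) = (0::nat)"
    unfolding ev[OF j] eq .
   define B where "B = {y \<in> A. character s (\<kappa> y) j = e}"
   have B: "x \<notin> B" "finite B" using fin by (auto simp: A_def I_def B_def)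
   have "{y \<in> insert x A. character s (\<kappa> y) j = e} =
    (if character s (\<kappa> x) j = e then insert x B else B)" by (auto simp: B_def)
   then show "even (card {y \<in> insert x A. character s (\<kappa> y) j = e})"
    using * B unfolding B_def[symmetric] by (cases "character s (\<kappa> x) j = e"; cases "even (card B)") simp_all
  qed
  moreover have "insert x A \<subseteq> J" using less.prems by (auto simp: A_def I_def)
  ultimately show ?thesis using less.prems(1) unfolding indep_def by blast
 qed
qed

lemma indep_interpolation:
 assumes "indep s m \<kappa> J" "\<And>x. x \<in> J \<Longrightarrow> g x < 2 ^ r"
 shows "\<exists>T. (\<forall>i a. T i a < 2 ^ r) \<and> (\<forall>y\<in>J. simple_tab s m T (\<kappa> y) = g y)"
proof -
 have fin: "finite J" using assms by (simp add: indep_def)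
 obtain \<theta> where th: "\<And>x i a. x \<in> J \<Longrightarrow> \<theta> x i a < 2"
  "\<And>x y. x \<in> J \<Longrightarrow> y \<in> J \<Longrightarrow> simple_tab s m (\<theta> x) (\<kappa> y) = of_bool (y = x)"
  using indep_dual_vector[OF assms(1)] by metis
 define T where "T = (\<lambda>i a. xsum (\<lambda>x. if \<theta> x i a = 1 then g x else 0) J)"
 have "simple_tab s m T (\<kappa> y) = g y" if "y \<in> J" for y
 proof -
  have *: "simple_tab s m (\<lambda>i a. if \<theta> x i a = 1 then g x else 0) (\<kappa> y) =
    (if x = y then g x else 0)" if "x \<in> J" for x
   using simple_tab_scale[OF th(1)[OF that]] th(2)[OF that \<open>y \<in> J\<close>] by auto
  have "simple_tab s m T (\<kappa> y) = xsum (\<lambda>x. if x = y then g x else 0) J"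
   unfolding T_def simple_tab_xsum[OF fin] using * by (intro xorsum.cong) auto
  also have "\<dots> = g y" using that fin by (subst xorsum.delta) auto
  finally show ?thesis .
 qed
 moreover have "T i a < 2 ^ r" for i a
  unfolding T_def using assms fin by (intro xsum_less) auto
 ultimately show ?thesis by blast
qed

definition table_set :: "nat \<Rightarrow> nat \<Rightarrow> nat \<Rightarrow> (nat \<Rightarrow> nat \<Rightarrow> nat) set" where
 "table_set s m r = PiE_dflt {..<m} (\<lambda>_. 0) (\<lambda>_. PiE_dflt {..<2 ^ s} 0 (\<lambda>_. {..<2 ^ r}))"

lemma table_set_iff:
 "T \<in> table_set s m r \<longleftrightarrow>
  (\<forall>i a. T i a < 2 ^ r) \<and> (\<forall>i a. (i \<ge> m \<or> a \<ge> 2 ^ s) \<longrightarrow> T i a = 0)"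
proof
 assume T: "T \<in> table_set s m r"
 have "T i a < 2 ^ r \<and> ((i \<ge> m \<or> a \<ge> 2 ^ s) \<longrightarrow> T i a = 0)" for i a
 proof (cases "i < m")
  case True
  with T have "T i \<in> PiE_dflt {..<2 ^ s} 0 (\<lambda>_. {..<2 ^ r})"
   by (simp add: table_set_def PiE_dflt_def)
  with True show ?thesis by (cases "a < 2 ^ s") (simp_all add: PiE_dflt_def)
 next
  case False
  with T have "T i = (\<lambda>_. 0)" by (simp add: table_set_def PiE_dflt_def)
  then show ?thesis by simp
 qed
 then show "(\<forall>i a. T i a < 2 ^ r) \<and> (\<forall>i a. (i \<ge> m \<or> a \<ge> 2 ^ s) \<longrightarrow> T i a = 0)" by blast
next
 assume "(\<forall>i a. T i a < 2 ^ r) \<and> (\<forall>i a. (i \<ge> m \<or> a \<ge> 2 ^ s) \<longrightarrow> T i a = 0)"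
 then show "T \<in> table_set s m r" by (simp add: table_set_def PiE_dflt_def fun_eq_iff)
qed

lemma finite_table_set: "finite (table_set s m r)" "table_set s m r \<noteq> {}"
 unfolding table_set_def by (intro finite_PiE_dflt) (auto simp: PiE_dflt_empty_iff lessThan_empty_iff)

lemma random_tables_eq: "random_tables s m r = pmf_of_set (table_set s m r)"
 unfolding random_tables_def table_set_def
 by (simp add: Pi_pmf_of_set finite_PiE_dflt lessThan_empty_iff)

lemma simple_tab_cong:
 assumes "\<And>i a. i < m \<Longrightarrow> a < 2 ^ s \<Longrightarrow> T i a = T' i a"
 shows "simple_tab s m T x = simple_tab s m T' x"
 unfolding simple_tab_eq_xsum using assms by (intro xorsum.cong) (auto simp: character_def)

lemma pmf_of_setI:
 assumes "finite G" "set_pmf M \<subseteq> G" "\<And>g h. g \<in> G \<Longrightarrow> h \<in> G \<Longrightarrow> pmf M g = pmf M h"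
 shows "M = pmf_of_set G"
proof -
 have ne: "G \<noteq> {}" using assms(2) set_pmf_not_empty by fastforce
 then obtain g0 where g0: "g0 \<in> G" by blast
 have eq: "pmf M g = pmf M g0" if "g \<in> G" for g using that g0 by (rule assms(3))
 have "(\<Sum>g\<in>G. pmf M g) = 1" by (rule sum_pmf_eq_1[OF assms(1,2)])
 moreover have "(\<Sum>g\<in>G. pmf M g) = (\<Sum>g\<in>G. pmf M g0)" by (rule sum.cong[OF refl eq])
 ultimately have "card G * pmf M g0 = 1" by simp
 then have g0': "pmf M g0 = 1 / card G" using ne assms(1) by (simp add: field_simps)
 have out: "pmf M g = 0" if "g \<notin> G" for g using assms(2) that by (auto simp: set_pmf_iff)
 show ?thesis
 proof (rule pmf_eqI)
  fix g
  show "pmf M g = pmf (pmf_of_set G) g"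
   using eq[of g] g0' out[of g] assms(1) ne by (cases "g \<in> G") simp_all
 qed
qed

text \<open>Evaluation on \<open>J\<close> is linear in the tables. Adding a table that interpolates
  the difference of two value vectors permutes the tables and carries the fibre of one vector onto
  that of the other, so all fibres have the same size.\<close>

theorem simple_tab_indep_uniform:
 assumes "indep s m \<kappa> J"
 shows "map_pmf (\<lambda>T x. if x \<in> J then simple_tab s m T (\<kappa> x) else 0) (random_tables s m r) =
  Pi_pmf J 0 (\<lambda>_. (uniform_bits r))"
proof -
 define ev where "ev = (\<lambda>T x. if x \<in> J then simple_tab s m T (\<kappa> x) else 0)"
 have fin: "finite J" using assms by (simp add: indep_def)
 define G where "G = PiE_dflt J 0 (\<lambda>_. {..<2 ^ r :: nat})"
 have finG: "finite G" using fin unfolding G_def by auto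
 have "map_pmf ev (random_tables s m r) = pmf_of_set G"
 proof (rule pmf_of_setI[OF finG])
  show "set_pmf (map_pmf ev (random_tables s m r)) \<subseteq> G"
   using finite_table_set by (auto simp: random_tables_eq G_def PiE_dflt_def ev_def table_set_iff
     intro!: simple_tab_less)
  fix g h assume gh: "g \<in> G" "h \<in> G"
  have "g x XOR h x < 2 ^ r" if "x \<in> J" for x
   using gh that by (intro xor_less_power) (auto simp: G_def PiE_dflt_def)
  from indep_interpolation[OF assms, of "\<lambda>x. g x XOR h x", OF this] obtain T0 where
   T0: "\<And>i a. T0 i a < 2 ^ r" "\<And>y. y \<in> J \<Longrightarrow> simple_tab s m T0 (\<kappa> y) = g y XOR h y" by blast
  \<comment> \<open>Entries beyond the actual tables are reset to the default, so that adding
    \<open>U\<close> maps \<open>table_set\<close> to itself.\<close>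
  define U where "U = (\<lambda>i a. if i < m \<and> a < 2 ^ s then T0 i a else 0)"
  define \<phi> where "\<phi> = (\<lambda>T i a. T i a XOR U i a)"
  have U: "simple_tab s m U (\<kappa> y) = g y XOR h y" if "y \<in> J" for y
   using T0(2)[OF that] by (simp add: U_def cong: simple_tab_cong)
  have bij: "bij_betw \<phi> (table_set s m r) (table_set s m r)"
  proof (rule bij_betwI[where g = \<phi>])
   show "\<phi> \<in> table_set s m r \<rightarrow> table_set s m r"
    using T0 by (auto simp: table_set_iff \<phi>_def U_def intro!: xor_less_power)
   then show "\<phi> \<in> table_set s m r \<rightarrow> table_set s m r" .
  qed (auto simp: \<phi>_def xor.assoc)
  have inv: "map_pmf \<phi> (random_tables s m r) = random_tables s m r"
   unfolding random_tables_eq using finite_table_set bij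
   by (subst map_pmf_of_set_bij_betw[OF bij]) auto
  have ev: "ev (\<phi> T) = h \<longleftrightarrow> ev T = g" for T
  proof -
   have "ev (\<phi> T) x = h x \<longleftrightarrow> ev T x = g x" for x
   proof (cases "x \<in> J")
    case True
    then have "ev (\<phi> T) x = simple_tab s m T (\<kappa> x) XOR (g x XOR h x)"
     by (simp add: ev_def \<phi>_def simple_tab_xor U)
    moreover have "p XOR (q XOR w) = w \<longleftrightarrow> p = q" for p q w :: nat
     by (metis xor.assoc xor.commute xor.left_neutral xor_self_eq)
    ultimately show ?thesis using True by (simp add: ev_def)
   next
    case False
    then show ?thesis using gh by (auto simp: ev_def G_def PiE_dflt_def)
   qed
   then show ?thesis by (simp add: fun_eq_iff)
  qed
  have "pmf (map_pmf ev (random_tables s m r)) h =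
   measure (random_tables s m r) ((\<lambda>T. ev (\<phi> T)) -` {h})"
   by (subst inv[symmetric]) (simp add: map_pmf_comp pmf_map)
  also have "(\<lambda>T. ev (\<phi> T)) -` {h} = ev -` {g}" using ev by auto
  finally show "pmf (map_pmf ev (random_tables s m r)) g = pmf (map_pmf ev (random_tables s m r)) h"
   by (simp add: pmf_map)
 qed
 also have "\<dots> = Pi_pmf J 0 (\<lambda>_. (uniform_bits r))"
  unfolding G_def using fin by (subst Pi_pmf_of_set) (auto simp: lessThan_empty_iff)
 finally show ?thesis unfolding ev_def .
qed

lemma character_add_high:
 assumes "x < 2 ^ (s * c)"
 shows "character s (x + 2 ^ (s * c) * y) i =
  (if i < c then character s x i else character s y (i - c))"
proof (cases "i < c")
 case True
 define q :: nat where "q = 2 ^ (s * (c - i - 1))"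
 have "s * c = s * i + (s + s * (c - i - 1))" using True
  by (metis Suc_diff_Suc add_diff_inverse_nat add_mult_distrib2 diff_Suc_1 diff_diff_left
    less_imp_le_nat linorder_not_less mult_Suc_right plus_1_eq_Suc add.commute)
 then have "(2::nat) ^ (s * c) = 2 ^ (s * i) * (2 ^ s * q)" by (simp add: power_add q_def)
 then have "x + 2 ^ (s * c) * y = x + (2 ^ s * (q * y)) * 2 ^ (s * i)" by (simp add: mult_ac)
 then have "(x + 2 ^ (s * c) * y) div 2 ^ (s * i) = 2 ^ s * (q * y) + x div 2 ^ (s * i)"
  by (simp only:) (rule div_mult_self1, simp)
 then show ?thesis using True by (simp add: character_def power_mult[symmetric])
next
 case False
 then have "s * i = s * c + s * (i - c)" by (metis add_mult_distrib2 le_add_diff_inverse not_less)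
 then have e: "(2::nat) ^ (s * i) = 2 ^ (s * c) * 2 ^ (s * (i - c))" by (simp add: power_add)
 have "(x + 2 ^ (s * c) * y) div 2 ^ (s * i) = y div 2 ^ (s * (i - c))"
  unfolding e div_mult2_eq using assms by simp
 then show ?thesis using False by (simp add: character_def power_mult[symmetric])
qed

lemma character_less: "character s x i < 2 ^ s"
 by (simp add: character_def)

section \<open>Weighted counts of tuples of keys that sum to zero\<close>

lemma sum_UN_le:
 fixes f :: "'a \<Rightarrow> real"
 assumes "finite I" "\<And>i. i \<in> I \<Longrightarrow> finite (A i)" "\<And>x. f x \<ge> 0"
 shows "sum f (\<Union>i\<in>I. A i) \<le> (\<Sum>i\<in>I. sum f (A i))"
 using assms(1,2)
proof (induction I rule: finite_induct)
 case (insert i I)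
 have "sum f (A i \<union> (\<Union>i\<in>I. A i)) \<le> sum f (A i) + sum f (\<Union>i\<in>I. A i)"
  using insert sum.union_inter[of "A i" "\<Union>i\<in>I. A i" f] sum_nonneg[of "A i \<inter> (\<Union>i\<in>I. A i)" f] assms(3)
  by simp
 then show ?case using insert by (fastforce intro: order.trans)
qed simp

definition even_maps :: "'k set \<Rightarrow> 'a set \<Rightarrow> ('k \<Rightarrow> 'a) set" where
 "even_maps J Q = {\<alpha> \<in> PiE J (\<lambda>_. Q). \<forall>a. even (card {k \<in> J. \<alpha> k = a})}"

lemma finite_even_maps: "finite J \<Longrightarrow> finite Q \<Longrightarrow> finite (even_maps J Q)"
 unfolding even_maps_def by (rule finite_subset[of _ "PiE J (\<lambda>_. Q)"]) (auto intro: finite_PiE)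

text \<open>Fix an index \<open>k0\<close>. An even map takes its value there at another index
  \<open>k1\<close> too; Cauchy-Schwarz bounds this pair by the product of its norms, and the map
  remains even on the other indices. There are fewer than \<open>card J\<close> choices of
  \<open>k1\<close> each time, whence a generous power of \<open>card J\<close>.\<close>

lemma even_maps_weight:
 fixes v :: "'k \<Rightarrow> 'a \<Rightarrow> real"
 assumes "finite J" "finite Q" "\<And>k a. v k a \<ge> 0"
 shows "(\<Sum>\<alpha>\<in>even_maps J Q. \<Prod>k\<in>J. v k (\<alpha> k)) \<le>
  real (card J) ^ card J * (\<Prod>k\<in>J. L2_set (v k) Q)"
 using assms(1)
proof (induction "card J" arbitrary: J rule: less_induct)
 case less
 show ?case
 proof (cases "J = {}")
  case True
  then show ?thesis by (simp add: even_maps_def)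
 next
  case False
  then obtain k0 where k0: "k0 \<in> J" by blast
  define J' where "J' k1 = J - {k0, k1}" for k1
  define ext where "ext k1 = (\<lambda>(a, \<beta>). (\<beta> :: 'k \<Rightarrow> 'a)(k0 := a, k1 := a))" for k1
  have finJ': "finite (J' k1)" for k1 using less.prems by (simp add: J'_def)
  \<comment> \<open>An even map may be covered for several \<open>k1\<close>; only an upper bound is
    wanted.\<close>
  have sub: "even_maps J Q \<subseteq> (\<Union>k1\<in>J - {k0}. ext k1 ` (Q \<times> even_maps (J' k1) Q))"
  proof
   fix \<alpha> assume al: "\<alpha> \<in> even_maps J Q"
   then have ev: "even (card {k \<in> J. \<alpha> k = a})" for a by (simp add: even_maps_def)
   have "{k \<in> J. \<alpha> k = \<alpha> k0} \<noteq> {k0}" using ev[of "\<alpha> k0"] by auto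
   then obtain k1 where k1: "k1 \<in> J" "k1 \<noteq> k0" "\<alpha> k1 = \<alpha> k0" using k0 by blast
   define \<beta> where "\<beta> = restrict \<alpha> (J' k1)"
   have "even (card {k \<in> J' k1. \<beta> k = a})" for a
   proof (cases "a = \<alpha> k0")
    case True
    have "{k \<in> J. \<alpha> k = a} = insert k0 (insert k1 {k \<in> J' k1. \<beta> k = a})"
     using True k0 k1 by (auto simp: J'_def \<beta>_def)
    moreover have "card (insert k0 (insert k1 {k \<in> J' k1. \<beta> k = a})) = card {k \<in> J' k1. \<beta> k = a} + 2"
     using k1 less.prems by (subst card_insert_disjoint; (subst card_insert_disjoint)?) (auto simp: J'_def)
    ultimately show ?thesis using ev[of a] by simp
   next
    case False
    then have "{k \<in> J. \<alpha> k = a} = {k \<in> J' k1. \<beta> k = a}"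
     using k1 by (auto simp: J'_def \<beta>_def)
    then show ?thesis using ev[of a] by simp
   qed
   moreover have "\<alpha> \<in> PiE J (\<lambda>_. Q)" using al by (simp add: even_maps_def)
   ultimately have "\<beta> \<in> even_maps (J' k1) Q" "\<alpha> k0 \<in> Q"
    using k0 by (auto simp: even_maps_def \<beta>_def J'_def PiE_def Pi_def)
   moreover have "\<alpha> = ext k1 (\<alpha> k0, \<beta>)"
   proof
    fix k show "\<alpha> k = ext k1 (\<alpha> k0, \<beta>) k"
     using k1 al k0 by (auto simp: ext_def \<beta>_def J'_def even_maps_def PiE_def extensional_def)
   qed
   ultimately show "\<alpha> \<in> (\<Union>k1\<in>J - {k0}. ext k1 ` (Q \<times> even_maps (J' k1) Q))"
    using k1 by blast
  qed
  have nonneg: "0 \<le> (\<Prod>k\<in>J. v k (\<alpha> k))" for \<alpha> using assms(3) by (intro prod_nonneg) auto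
  define N where "N = (\<Prod>k\<in>J. L2_set (v k) Q)"
  have finU: "finite (\<Union>k1\<in>J - {k0}. ext k1 ` (Q \<times> even_maps (J' k1) Q))"
   using less.prems assms finJ' by (intro finite_UN_I finite_imageI finite_SigmaI finite_even_maps) auto
  have one: "(\<Sum>\<alpha>\<in>ext k1 ` (Q \<times> even_maps (J' k1) Q). \<Prod>k\<in>J. v k (\<alpha> k)) \<le> real (card J) ^ (card J - 2) * N"
   if k1: "k1 \<in> J - {k0}" for k1
  proof -
   have J: "J = insert k0 (insert k1 (J' k1))" "k0 \<notin> insert k1 (J' k1)" "k1 \<notin> J' k1"
    using k0 k1 by (auto simp: J'_def)
   have cardJ: "card J = card (J' k1) + 2" using J finJ'[of k1]
    by (metis add_2_eq_Suc' card_insert_disjoint finite_insert)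
   have "(\<Sum>\<alpha>\<in>ext k1 ` (Q \<times> even_maps (J' k1) Q). \<Prod>k\<in>J. v k (\<alpha> k)) \<le>
     (\<Sum>p\<in>Q \<times> even_maps (J' k1) Q. \<Prod>k\<in>J. v k (ext k1 p k))"
    using nonneg finJ' assms by (intro order.trans[OF sum_image_le]) (auto simp: finite_even_maps o_def)
   also have "\<dots> = (\<Sum>p\<in>Q \<times> even_maps (J' k1) Q.
     v k0 (fst p) * v k1 (fst p) * (\<Prod>k\<in>J' k1. v k (snd p k)))"
   proof (rule sum.cong[OF refl])
    fix p assume "p \<in> Q \<times> even_maps (J' k1) Q"
    have "(\<Prod>k\<in>J' k1. v k (ext k1 p k)) = (\<Prod>k\<in>J' k1. v k (snd p k))"
     by (intro prod.cong) (auto simp: ext_def J'_def split: prod.splits)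
    then show "(\<Prod>k\<in>J. v k (ext k1 p k)) = v k0 (fst p) * v k1 (fst p) * (\<Prod>k\<in>J' k1. v k (snd p k))"
     using J(2,3) finJ'[of k1] by (subst J(1)) (auto simp: ext_def split: prod.splits)
   qed
   also have "\<dots> = (\<Sum>a\<in>Q. v k0 a * v k1 a) * (\<Sum>\<beta>\<in>even_maps (J' k1) Q. \<Prod>k\<in>J' k1. v k (\<beta> k))"
    by (simp add: sum.cartesian_product' sum_product)
   also have "\<dots> \<le> (L2_set (v k0) Q * L2_set (v k1) Q) *
     (real (card (J' k1)) ^ card (J' k1) * (\<Prod>k\<in>J' k1. L2_set (v k) Q))"
   proof (rule mult_mono)
    show "(\<Sum>a\<in>Q. v k0 a * v k1 a) \<le> L2_set (v k0) Q * L2_set (v k1) Q"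
     using L2_set_mult_ineq[of "v k0" "v k1" Q] assms(3) by simp
    show "(\<Sum>\<beta>\<in>even_maps (J' k1) Q. \<Prod>k\<in>J' k1. v k (\<beta> k)) \<le>
      real (card (J' k1)) ^ card (J' k1) * (\<Prod>k\<in>J' k1. L2_set (v k) Q)"
     using less.hyps[of "J' k1"] cardJ finJ' by simp
   qed (auto intro!: sum_nonneg prod_nonneg mult_nonneg_nonneg assms(3) L2_set_nonneg)
   also have "\<dots> = real (card (J' k1)) ^ card (J' k1) * N"
   proof -
    have "N = L2_set (v k0) Q * (L2_set (v k1) Q * (\<Prod>k\<in>J' k1. L2_set (v k) Q))"
     unfolding N_def using J(2,3) finJ'[of k1] by (subst J(1)) simp
    then show ?thesis by (simp add: mult_ac)
   qed
   also have "\<dots> \<le> real (card J) ^ (card J - 2) * N"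
    using cardJ unfolding N_def
    by (intro mult_right_mono) (auto intro!: prod_nonneg power_mono L2_set_nonneg)
   finally show ?thesis .
  qed
  have "(\<Sum>\<alpha>\<in>even_maps J Q. \<Prod>k\<in>J. v k (\<alpha> k)) \<le>
   (\<Sum>\<alpha>\<in>(\<Union>k1\<in>J - {k0}. ext k1 ` (Q \<times> even_maps (J' k1) Q)). \<Prod>k\<in>J. v k (\<alpha> k))"
   using sub finU nonneg by (intro sum_mono2) auto
  also have "\<dots> \<le> (\<Sum>k1\<in>J - {k0}. \<Sum>\<alpha>\<in>ext k1 ` (Q \<times> even_maps (J' k1) Q). \<Prod>k\<in>J. v k (\<alpha> k))"
   using less.prems nonneg assms finJ'
   by (intro sum_UN_le finite_imageI finite_SigmaI finite_even_maps) auto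
  also have "\<dots> \<le> (\<Sum>k1\<in>J - {k0}. real (card J) ^ (card J - 2) * N)"
   by (rule sum_mono[OF one])
  also have "\<dots> = real (card J - 1) * (real (card J) ^ (card J - 2) * N)"
   using k0 less.prems by simp
  also have "\<dots> \<le> real (card J) ^ card J * N"
  proof (cases "card J \<ge> 2")
   case True
   have N0: "N \<ge> 0" unfolding N_def by (intro prod_nonneg) (auto intro: L2_set_nonneg)
   have "real (card J - 1) * real (card J) ^ (card J - 2) \<le> real (card J) ^ 2 * real (card J) ^ (card J - 2)"
   proof (rule mult_right_mono)
    have "real (card J - 1) \<le> real (card J)" by simp
    also have "\<dots> \<le> real (card J) ^ 2" using True by (simp add: power2_eq_square)
    finally show "real (card J - 1) \<le> real (card J) ^ 2" .
   qed simp
   also have "\<dots> = real (card J) ^ card J" using True by (metis power_add le_add_diff_inverse)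
   finally show ?thesis using N0 by (simp add: mult_right_mono mult.assoc[symmetric])
  next
   case False
   have "N \<ge> 0" unfolding N_def by (intro prod_nonneg) (auto intro: L2_set_nonneg)
   moreover have "card J - 1 = 0" using False by simp
   ultimately show ?thesis by simp
  qed
  finally show ?thesis unfolding N_def .
 qed
qed

lemma L2_set_L2_set:
 "L2_set (\<lambda>a. L2_set (\<lambda>x. w (x + n * a)) {..<n}) {..<q} = L2_set w {..<n * (q::nat)}"
proof (cases "n = 0")
 case False
 have "(\<Sum>a<q. (L2_set (\<lambda>x. w (x + n * a)) {..<n})\<^sup>2) = (\<Sum>a<q. \<Sum>x<n. (w (x + n * a))\<^sup>2)"
  by (simp add: L2_set_def sum_nonneg)
 also have "\<dots> = (\<Sum>p\<in>{..<q} \<times> {..<n}. (w (snd p + n * fst p))\<^sup>2)"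
  by (simp add: sum.cartesian_product split_def)
 also have "\<dots> = (\<Sum>x<n * q. (w x)\<^sup>2)"
 proof (rule sum.reindex_bij_witness[of _ "\<lambda>x. (x div n, x mod n)" "\<lambda>p. snd p + n * fst p"])
  fix p assume p: "p \<in> {..<q} \<times> {..<n}"
  have "snd p + n * fst p < n + n * fst p" using p by auto
  also have "n + n * fst p = n * Suc (fst p)" by simp
  also have "\<dots> \<le> n * q" using p by (intro mult_le_mono2) auto
  finally show "snd p + n * fst p \<in> {..<n * q}" by simp
 qed (use False in \<open>auto simp: less_mult_imp_div_less mult.commute\<close>)
 finally show ?thesis by (simp add: L2_set_def)
qed (simp add: L2_set_def)

definition zero_sums :: "nat \<Rightarrow> nat \<Rightarrow> 'k set \<Rightarrow> ('k \<Rightarrow> nat) set" where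
 "zero_sums s c J = {z \<in> PiE J (\<lambda>_. {..<2 ^ (s * c)}). even_chars s c z J}"

lemma finite_zero_sums: "finite J \<Longrightarrow> finite (zero_sums s c J)"
 unfolding zero_sums_def by (rule finite_subset[of _ "PiE J (\<lambda>_. {..<2 ^ (s * c)})"]) (auto intro: finite_PiE)

text \<open>Positions are split off one by one: the last characters form an even map, the remaining
  ones a zero sum with one position less, and iterating the norm over both gives the norm over whole
  keys. For the indicator of a set of n keys this says that about n^(\<open>card J\<close> / 2) of
  its tuples sum to zero; the weights make it possible to iterate over the rounds of the walk
  argument.\<close>

theorem zero_sums_weight:
 fixes w :: "'k \<Rightarrow> nat \<Rightarrow> real"
 assumes "finite J" "\<And>k x. w k x \<ge> 0"
 shows "(\<Sum>z\<in>zero_sums s c J. \<Prod>k\<in>J. w k (z k)) \<le>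
  (real (card J) ^ card J) ^ c * (\<Prod>k\<in>J. L2_set (w k) {..<2 ^ (s * c)})"
 using assms(2)
proof (induction c arbitrary: w)
 case 0
 have "zero_sums s 0 J = {\<lambda>k\<in>J. 0}"
  by (auto simp: zero_sums_def even_chars_def PiE_def extensional_def fun_eq_iff Pi_def)
 moreover have "(\<Prod>k\<in>J. w k (restrict (\<lambda>k. 0) J k)) = (\<Prod>k\<in>J. w k 0)" by (intro prod.cong) auto
 ultimately show ?case using 0 by (simp add: L2_set_def lessThan_Suc)
next
 case (Suc c)
 define n :: nat where "n = 2 ^ (s * c)"
 define q :: nat where "q = 2 ^ s"
 define C where "C = real (card J) ^ card J"
 define join where "join = (\<lambda>(\<alpha>, z') k. if k \<in> J then z' k + n * \<alpha> k else undefined :: nat)"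
 have n: "n > 0" by (simp add: n_def)
 have nq: "2 ^ (s * Suc c) = n * q" by (simp add: n_def q_def power_add)
 have sub: "zero_sums s (Suc c) J \<subseteq> join ` (even_maps J {..<q} \<times> zero_sums s c J)"
 proof
  fix z assume z: "z \<in> zero_sums s (Suc c) J"
  define \<alpha> where "\<alpha> = (\<lambda>k\<in>J. z k div n)"
  define z' where "z' = (\<lambda>k\<in>J. z k mod n)"
  have zk: "z k < n * q" if "k \<in> J" for k using z that nq by (auto simp: zero_sums_def)
  have split: "z k = z' k + n * \<alpha> k" if "k \<in> J" for k using that by (simp add: \<alpha>_def z'_def)
  have z'n: "z' k < n" if "k \<in> J" for k using that n by (simp add: z'_def)
  have alq: "\<alpha> k < q" if "k \<in> J" for k using zk[OF that] that
   by (simp add: \<alpha>_def less_mult_imp_div_less mult.commute)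
  have ch: "character s (z k) i = (if i < c then character s (z' k) i else character s (\<alpha> k) (i - c))"
   if "k \<in> J" for k i
   using character_add_high[of "z' k" s c "\<alpha> k" i] z'n[OF that] split[OF that] by (simp add: n_def)
  have "even_chars s c z' J" unfolding even_chars_def
  proof (intro allI impI)
   fix i a assume i: "i < c"
   have "{x \<in> J. character s (z' x) i = a} = {x \<in> J. character s (z x) i = a}" using ch i by auto
   then show "even (card {x \<in> J. character s (z' x) i = a})"
    using z i by (auto simp: zero_sums_def even_chars_def)
  qed
  then have 1: "z' \<in> zero_sums s c J" using z'n by (auto simp: zero_sums_def n_def z'_def)
  have "even (card {k \<in> J. \<alpha> k = a})" for a
  proof -
   have "{k \<in> J. \<alpha> k = a} = {k \<in> J. character s (z k) c = a}"
    using ch alq by (auto simp: character_def q_def)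
   then show ?thesis using z by (auto simp: zero_sums_def even_chars_def)
  qed
  then have 2: "\<alpha> \<in> even_maps J {..<q}" using alq by (auto simp: even_maps_def \<alpha>_def)
  have "z = join (\<alpha>, z')" using z split
   by (auto simp: join_def fun_eq_iff zero_sums_def PiE_def extensional_def)
  with 1 2 show "z \<in> join ` (even_maps J {..<q} \<times> zero_sums s c J)" by blast
 qed
 have nonneg: "0 \<le> (\<Prod>k\<in>J. w k (z k))" for z using Suc.prems by (intro prod_nonneg) auto
 have fin: "finite (even_maps J {..<q} \<times> zero_sums s c J)"
  using assms by (simp add: finite_even_maps finite_zero_sums)
 have "(\<Sum>z\<in>zero_sums s (Suc c) J. \<Prod>k\<in>J. w k (z k)) \<le>
   (\<Sum>z\<in>join ` (even_maps J {..<q} \<times> zero_sums s c J). \<Prod>k\<in>J. w k (z k))"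
  using sub nonneg fin by (intro sum_mono2) auto
 also have "\<dots> \<le> (\<Sum>p\<in>even_maps J {..<q} \<times> zero_sums s c J. \<Prod>k\<in>J. w k (join p k))"
  using fin nonneg by (intro order.trans[OF sum_image_le]) (auto simp: o_def)
 also have "\<dots> = (\<Sum>\<alpha>\<in>even_maps J {..<q}. \<Sum>z'\<in>zero_sums s c J. \<Prod>k\<in>J. w k (z' k + n * \<alpha> k))"
  by (simp add: sum.cartesian_product split_def join_def)
 also have "\<dots> \<le> (\<Sum>\<alpha>\<in>even_maps J {..<q}. C ^ c * (\<Prod>k\<in>J. L2_set (\<lambda>x. w k (x + n * \<alpha> k)) {..<n}))"
  unfolding C_def n_def
  by (intro sum_mono Suc.IH) (use Suc.prems in auto)
 also have "\<dots> = C ^ c * (\<Sum>\<alpha>\<in>even_maps J {..<q}. \<Prod>k\<in>J. L2_set (\<lambda>x. w k (x + n * \<alpha> k)) {..<n})"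
  by (simp add: sum_distrib_left)
 also have "\<dots> \<le> C ^ c * (C * (\<Prod>k\<in>J. L2_set (\<lambda>a. L2_set (\<lambda>x. w k (x + n * a)) {..<n}) {..<q}))"
  unfolding C_def using assms
  by (intro mult_left_mono even_maps_weight[of J "{..<q}" "\<lambda>k a. L2_set (\<lambda>x. w k (x + n * a)) {..<n}"])
   (auto intro: L2_set_nonneg)
 also have "\<dots> = C ^ Suc c * (\<Prod>k\<in>J. L2_set (w k) {..<n * q})"
  by (simp add: L2_set_L2_set)
 finally show ?case unfolding nq C_def .
qed

section \<open>Probabilities of equations between derived characters\<close>

lemma prob_bind:
 "prob (bind_pmf M f) S = expect M (\<lambda>x. prob (f x) S)"
proof -
 have "ennreal (prob (bind_pmf M f) S) = (\<integral>\<^sup>+x. ennreal (prob (f x) S) \<partial>M)"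
  by (simp add: measure_pmf.emeasure_eq_measure[symmetric])
 also have "\<dots> = ennreal (expect M (\<lambda>x. prob (f x) S))"
  by (intro nn_integral_eq_integral measure_pmf.integrable_const_bound[where B = 1]) auto
 finally show ?thesis by (simp add: integral_nonneg_AE)
qed

lemma prob_pair:
 "prob (pair_pmf A B) S = expect A (\<lambda>x. prob B {y. (x, y) \<in> S})"
proof -
 have "pair_pmf A B = bind_pmf A (\<lambda>x. map_pmf (Pair x) B)"
  by (simp add: pair_pmf_def map_pmf_def)
 then show ?thesis by (simp add: prob_bind vimage_def)
qed

lemma expectation_bounds:
 fixes f :: "'a \<Rightarrow> real"
 assumes "\<And>x. x \<in> set_pmf M \<Longrightarrow> f x \<le> u" "\<And>x. x \<in> set_pmf M \<Longrightarrow> l \<le> f x"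
 shows "expect M f \<le> u" "l \<le> expect M f"
proof -
 have i: "integrable (measure_pmf M) f"
  by (rule measure_pmf.integrable_const_bound[where B = "max \<bar>l\<bar> \<bar>u\<bar>"])
   (use assms in \<open>auto simp: AE_measure_pmf_iff abs_le_iff max_def intro: order.trans\<close>, fastforce+)
 show "expect M f \<le> u"
  using assms i by (intro measure_pmf.integral_le_const) (auto simp: AE_measure_pmf_iff)
 show "l \<le> expect M f"
  using assms i by (intro measure_pmf.integral_ge_const) (auto simp: AE_measure_pmf_iff)
qed

lemma character_derived_key:
 assumes "x < 2 ^ (s * c)"
 shows "character s (derived_key s c h x) i =
  (if i < c then character s x i else character s (h x) (i - c))"
 unfolding derived_key_def by (rule character_add_high[OF assms])

lemma character_ext:
 assumes "x < 2 ^ (s * d)" "y < 2 ^ (s * d)" "\<And>j. j < d \<Longrightarrow> character s x j = character s y j"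
 shows "x = y"
 using assms
proof (induction d arbitrary: x y)
 case (Suc d)
 have split: "character s z i =
   (if i < d then character s (z mod 2 ^ (s * d)) i else character s (z div 2 ^ (s * d)) (i - d))" for z i
  using character_add_high[of "z mod 2 ^ (s * d)" s d "z div 2 ^ (s * d)" i] by simp
 have top: "z div 2 ^ (s * d) < 2 ^ s" if "z < 2 ^ (s * Suc d)" for z :: nat
  using that by (simp add: less_mult_imp_div_less power_add mult.commute)
 have "x mod 2 ^ (s * d) = y mod 2 ^ (s * d)"
 proof (rule Suc.IH)
  fix j assume "j < d"
  then show "character s (x mod 2 ^ (s * d)) j = character s (y mod 2 ^ (s * d)) j"
   using Suc.prems(3)[of j] split[of x j] split[of y j] by simp
 qed auto
 moreover have "x div 2 ^ (s * d) = y div 2 ^ (s * d)"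
  using Suc.prems(3)[of d] split[of x d] split[of y d] top[OF Suc.prems(1)] top[OF Suc.prems(2)]
  by (simp add: character_def)
 ultimately show ?case by (metis div_mult_mod_eq)
qed simp

text \<open>An even set of derived keys is already even in the first \<open>c\<close> positions,
  which are those of the keys themselves.\<close>

lemma indep_derived:
 assumes "indep s c id I" "I \<subseteq> {..<2 ^ (s * c)}"
 shows "indep s (c + d) (derived_key s c h) I"
 unfolding indep_def
proof (intro conjI allI impI)
 show "finite I" using assms(1) by (simp add: indep_def)
 fix S assume S: "S \<subseteq> I" "S \<noteq> {}"
 show "\<not> even_chars s (c + d) (derived_key s c h) S"
 proof
  assume ev: "even_chars s (c + d) (derived_key s c h) S"
  have "even_chars s c id S" unfolding even_chars_def
  proof (intro allI impI)
   fix i a assume i: "i < c"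
   have "{x \<in> S. character s (id x) i = a} = {x \<in> S. character s (derived_key s c h x) i = a}"
    using S(1) assms(2) i character_derived_key by auto
   then show "even (card {x \<in> S. character s (id x) i = a})"
    using ev i by (simp add: even_chars_def)
  qed
  with S assms(1) show False by (auto simp: indep_def)
 qed
qed

definition dchar :: "nat \<Rightarrow> nat \<Rightarrow> (nat \<Rightarrow> nat \<Rightarrow> nat) \<Rightarrow> nat \<Rightarrow> nat \<Rightarrow> nat" where
 "dchar s c T x j = character s (simple_tab s c T x) j"

definition selected :: "nat \<Rightarrow> nat \<Rightarrow> nat \<Rightarrow> nat set \<Rightarrow> nat \<Rightarrow> (nat \<Rightarrow> nat \<Rightarrow> nat) \<Rightarrow>
  (nat \<Rightarrow> nat \<Rightarrow> nat) \<Rightarrow> nat set" where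
 "selected s c d X v T1 T2 =
  {x \<in> X. simple_tab s (c + d) T2 (derived s c T1 x) = v}"

lemma prob_simple_tab_const:
 assumes "indep s m \<kappa> I" "v < 2 ^ b"
 shows "prob (random_tables s m b) {T. \<forall>x\<in>I. simple_tab s m T (\<kappa> x) = v} = (1 / 2 ^ b) ^ card I"
proof -
 have fin: "finite I" using assms by (simp add: indep_def)
 let ?ev = "\<lambda>T x. if x \<in> I then simple_tab s m T (\<kappa> x) else 0"
 have "{T. \<forall>x\<in>I. simple_tab s m T (\<kappa> x) = v} = ?ev -` (Pi I (\<lambda>_. {v}))"
  by (auto simp: Pi_def)
 then have "prob (random_tables s m b) {T. \<forall>x\<in>I. simple_tab s m T (\<kappa> x) = v} =
   prob (map_pmf ?ev (random_tables s m b)) (Pi I (\<lambda>_. {v}))" by simp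
 also have "\<dots> = prob (Pi_pmf I 0 (\<lambda>_. (uniform_bits b))) (Pi I (\<lambda>_. {v}))"
  by (simp only: simple_tab_indep_uniform[OF assms(1)])
 also have "\<dots> = (\<Prod>x\<in>I. prob (uniform_bits b) {v})"
  by (rule measure_Pi_pmf_Pi[OF fin])
 also have "prob (uniform_bits b) {v} = 1 / 2 ^ b"
  using assms(2) by (subst measure_pmf_of_set) (auto simp: lessThan_empty_iff)
 finally show ?thesis by simp
qed

text \<open>A constraint on the derived characters of \<open>I\<close> is pivoted on a set \<open>P\<close> of cells if the
 characters in \<open>P\<close> are functions of the other characters of \<open>I\<close>.\<close>

definition pivoted :: "nat set \<Rightarrow> nat \<Rightarrow> (nat \<times> nat) set \<Rightarrow> ((nat \<Rightarrow> nat \<Rightarrow> nat) \<Rightarrow> bool) \<Rightarrow> bool" where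
 "pivoted I d P \<D> \<longleftrightarrow> P \<subseteq> I \<times> {..<d} \<and> (\<forall>g g'. \<D> g \<longrightarrow> \<D> g' \<longrightarrow>
   (\<forall>x\<in>I. \<forall>j<d. (x, j) \<notin> P \<longrightarrow> g x j = g' x j) \<longrightarrow> (\<forall>x\<in>I. \<forall>j<d. g x j = g' x j))"

text \<open>On independent keys all derived characters are independent and uniform. A solution of
  the constraint is determined by its characters outside \<open>P\<close>, so at most one assignment
  in |\<Sigma>|^(\<open>card P\<close>) is a solution.\<close>

lemma prob_pivoted:
 assumes "indep s c id I" "pivoted I d P \<D>"
 shows "prob (random_tables s c (s * d)) {T. \<D> (dchar s c T)} \<le> 1 / (2 ^ s) ^ card P"
proof -
 have fin: "finite I" using assms by (simp add: indep_def)
 have P: "P \<subseteq> I \<times> {..<d}" using assms by (simp add: pivoted_def)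
 have finP: "finite P" using P fin by (meson finite_SigmaI finite_lessThan finite_subset)
 let ?ev = "\<lambda>T x. if x \<in> I then simple_tab s c T (id x) else 0"
 define G where "G = PiE_dflt I 0 (\<lambda>_. {..<2 ^ (s * d) :: nat})"
 define B where "B = ?ev ` {T. \<D> (dchar s c T)} \<inter> G"
 define C where "C = I \<times> {..<d} - P"
 define \<phi> where "\<phi> H = restrict (\<lambda>(x, j). character s (H x) j) C" for H :: "nat \<Rightarrow> nat"
 have finG: "finite G" "G \<noteq> {}" "card G = (2 ^ (s * d)) ^ card I"
  unfolding G_def using fin by (auto simp: card_PiE_dflt lessThan_empty_iff)
 have inj: "inj_on \<phi> B"
 proof (rule inj_onI)
  fix H H' assume H: "H \<in> B" "H' \<in> B" and eq: "\<phi> H = \<phi> H'"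
  then obtain T T' where T: "H = ?ev T" "\<D> (dchar s c T)" "H' = ?ev T'" "\<D> (dchar s c T')"
   by (auto simp: B_def)
  have c: "dchar s c T x j = character s (H x) j" "dchar s c T' x j = character s (H' x) j" if "x \<in> I" for x j
   using that T by (auto simp: dchar_def)
  have "\<forall>x\<in>I. \<forall>j<d. (x, j) \<notin> P \<longrightarrow> dchar s c T x j = dchar s c T' x j"
  proof (intro ballI allI impI)
   fix x j assume *: "x \<in> I" "j < d" "(x, j) \<notin> P"
   then have "(x, j) \<in> C" by (simp add: C_def)
   then have "\<phi> H (x, j) = character s (H x) j" "\<phi> H' (x, j) = character s (H' x) j"
    by (simp_all add: \<phi>_def)
   then show "dchar s c T x j = dchar s c T' x j" using eq c * by simp
  qed
  then have e: "\<forall>x\<in>I. \<forall>j<d. dchar s c T x j = dchar s c T' x j"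
   using assms(2) T(2,4) unfolding pivoted_def by blast
  have "H x = H' x" if x: "x \<in> I" for x
  proof (rule character_ext)
   show "H x < 2 ^ (s * d)" "H' x < 2 ^ (s * d)" using H x by (auto simp: B_def G_def PiE_dflt_def)
   show "character s (H x) j = character s (H' x) j" if "j < d" for j
    using e c[OF x, of j] x that by metis
  qed
  moreover have "H x = H' x" if "x \<notin> I" for x using T that by simp
  ultimately show "H = H'" by blast
 qed
 have finC: "finite C" unfolding C_def using fin by (intro finite_Diff finite_SigmaI) auto
 have "\<phi> ` B \<subseteq> PiE C (\<lambda>_. {..<2 ^ s})"
  by (auto simp: \<phi>_def character_less simp del: restrict_apply intro!: restrict_PiE_iff[THEN iffD2])
 then have "card (\<phi> ` B) \<le> card (PiE C (\<lambda>_. {..<2 ^ s :: nat}))"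
  using finC by (intro card_mono finite_PiE) simp_all
 also have "\<dots> = (2 ^ s) ^ card C" using finC by (simp add: card_PiE)
 finally have cardB: "card B \<le> (2 ^ s) ^ card C" unfolding card_image[OF inj] .
 have cardC: "card C + card P = card I * d"
 proof -
  have "card P \<le> card (I \<times> {..<d})" using P fin by (intro card_mono) auto
  moreover have "card C = card (I \<times> {..<d}) - card P"
   unfolding C_def by (rule card_Diff_subset[OF finP P])
  ultimately show ?thesis by (simp add: card_cartesian_product)
 qed
 have "prob (random_tables s c (s * d)) {T. \<D> (dchar s c T)} \<le>
   prob (random_tables s c (s * d)) (?ev -` (?ev ` {T. \<D> (dchar s c T)}))"
  by (intro prob_mono) auto
 also have "\<dots> = prob (map_pmf ?ev (random_tables s c (s * d))) (?ev ` {T. \<D> (dchar s c T)})"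
  by simp
 also have "map_pmf ?ev (random_tables s c (s * d)) = pmf_of_set G"
  unfolding simple_tab_indep_uniform[OF assms(1)] G_def using fin
  by (subst Pi_pmf_of_set) (auto simp: lessThan_empty_iff)
 also have "prob (pmf_of_set G) (?ev ` {T. \<D> (dchar s c T)}) = card B / card G"
  using finG by (simp add: measure_pmf_of_set B_def Int_commute)
 also have "\<dots> \<le> real ((2 ^ s) ^ card C) / card G"
  by (rule divide_right_mono[OF of_nat_mono[OF cardB]]) simp
 also have "\<dots> = 1 / (2 ^ s) ^ card P"
 proof -
  have "real (card G) = (2 ^ s) ^ (card C + card P)"
   unfolding cardC finG by (simp add: power_mult[symmetric] mult_ac)
  then show ?thesis by (simp add: power_add)
 qed
 finally show ?thesis .
qed

text \<open>For fixed first tables the derived keys of \<open>I\<close> are still independent, so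
  the second function is uniform on them. The two factors stem from the two independent
  functions.\<close>

lemma prob_pivoted_selected:
 assumes "indep s c id I" "pivoted I d P \<D>" "I \<subseteq> X" "X \<subseteq> {..<2 ^ (s * c)}" "v < 2 ^ b"
 shows "prob (table_pair s c d b)
   {(T1, T2). I \<subseteq> selected s c d X v T1 T2 \<and> \<D> (dchar s c T1)} \<le>
   (1 / 2 ^ b) ^ card I / (2 ^ s) ^ card P"
proof -
 let ?A = "random_tables s c (s * d)"
 have "prob (random_tables s (c + d) b)
   {T2. I \<subseteq> selected s c d X v T1 T2 \<and> \<D> (dchar s c T1)} =
   (1 / 2 ^ b) ^ card I * indicator {T. \<D> (dchar s c T)} T1" for T1
 proof (cases "\<D> (dchar s c T1)")
  case True
  have "{T2. I \<subseteq> selected s c d X v T1 T2 \<and> \<D> (dchar s c T1)} =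
   {T2. \<forall>x\<in>I. simple_tab s (c + d) T2 (derived s c T1 x) = v}"
   using True assms(3) by (auto simp: selected_def)
  moreover have "derived_indep s c d T1 I"
   using assms by (intro indep_derived) auto
  ultimately show ?thesis using True assms(5) by (simp add: prob_simple_tab_const)
 qed simp
 then have "prob (pair_pmf ?A (random_tables s (c + d) b))
   {(T1, T2). I \<subseteq> selected s c d X v T1 T2 \<and> \<D> (dchar s c T1)} =
   (1 / 2 ^ b) ^ card I * prob ?A {T. \<D> (dchar s c T)}"
  by (simp add: prob_pair)
 also have "\<dots> \<le> (1 / 2 ^ b) ^ card I * (1 / (2 ^ s) ^ card P)"
  by (intro mult_left_mono prob_pivoted[OF assms(1,2)]) auto
 finally show ?thesis by simp
qed

section \<open>Keys that are XORs of other keys\<close>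

lemma character_xor: "character s (x XOR y) i = character s x i XOR character s y i"
 by (simp add: character_def power_mult[symmetric] take_bit_eq_mod[symmetric] drop_bit_eq_div[symmetric])

lemma character_xsum: "finite A \<Longrightarrow> character s (xsum f A) i = xsum (\<lambda>x. character s (f x) i) A"
 by (induction A rule: finite_induct) (simp_all add: character_xor, simp add: character_def)

text \<open>In the vector space over the field with two elements, \<open>y\<close> is the sum of the
  keys of \<open>A\<close>. Every simple tabulation function then maps \<open>y\<close> to the XOR
  of their values.\<close>

definition rep :: "nat \<Rightarrow> nat \<Rightarrow> nat \<Rightarrow> nat set \<Rightarrow> bool" where
 "rep s c y A \<longleftrightarrow> (\<forall>i<c. \<forall>a. character s y i = a \<longleftrightarrow> odd (card {b \<in> A. character s b i = a}))"

lemma rep_simple_tab: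
 assumes "rep s c y A" "finite A"
 shows "simple_tab s c T y = xsum (simple_tab s c T) A"
proof -
 have "xsum (\<lambda>b. T i (character s b i)) A = T i (character s y i)" if "i < c" for i
 proof -
  have "xsum (\<lambda>b. T i (character s b i)) A =
    xsum (\<lambda>a. xsum (\<lambda>b. T i (character s b i)) {b \<in> A. character s b i = a}) {..<2 ^ s}"
   using assms(2) by (intro xorsum.group[symmetric]) (auto simp: character_less)
  also have "\<dots> = xsum (\<lambda>a. if a = character s y i then T i a else 0) {..<2 ^ s}"
  proof (rule xorsum.cong[OF refl])
   fix a
   have "xsum (\<lambda>b. T i (character s b i)) {b \<in> A. character s b i = a} =
     xsum (\<lambda>b. if True then T i a else 0) {b \<in> A. character s b i = a}"
    by (intro xorsum.cong) auto
   also have "\<dots> = (if odd (card {b \<in> A. character s b i = a}) then T i a else 0)"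
    using assms(2) by (subst xsum_const_if) auto
   also have "odd (card {b \<in> A. character s b i = a}) \<longleftrightarrow> a = character s y i"
    using assms(1)[unfolded rep_def, rule_format, OF that, of a] by auto
   finally show "xsum (\<lambda>b. T i (character s b i)) {b \<in> A. character s b i = a} =
     (if a = character s y i then T i a else 0)" .
  qed
  also have "\<dots> = T i (character s y i)"
   by (subst xorsum.delta) (auto simp: character_less)
  finally show ?thesis .
 qed
 then have "simple_tab s c T y = xsum (\<lambda>i. xsum (\<lambda>b. T i (character s b i)) A) {..<c}"
  unfolding simple_tab_eq_xsum by (intro xorsum.cong) auto
 also have "\<dots> = xsum (simple_tab s c T) A"
  unfolding simple_tab_eq_xsum by (rule xorsum.swap)
 finally show ?thesis .
qed

lemma rep_dchar:
 assumes "rep s c y A" "finite A"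
 shows "dchar s c T y j = xsum (\<lambda>b. dchar s c T b j) A"
 unfolding dchar_def rep_simple_tab[OF assms] by (rule character_xsum[OF assms(2)])

text \<open>Each character of a represented key occurs in the same position of some key of
  \<open>I\<close>, which leaves at most \<open>N\<close> choices per position.\<close>

lemma card_rep_le:
 assumes "finite I" "card I \<le> N" "X \<subseteq> {..<2 ^ (s * c)}"
 shows "card {y \<in> X. \<exists>A\<subseteq>I. rep s c y A} \<le> N ^ c"
proof -
 let ?R = "{y \<in> X. \<exists>A\<subseteq>I. rep s c y A}"
 let ?P = "PiE {..<c} (\<lambda>i. (\<lambda>b. character s b i) ` I)"
 let ?f = "\<lambda>y. restrict (character s y) {..<c}"
 have inj: "inj_on ?f ?R"
 proof (rule inj_onI)
  fix x y assume *: "x \<in> ?R" "y \<in> ?R" "?f x = ?f y"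
  have "character s x i = character s y i" if "i < c" for i
   using fun_cong[OF *(3), of i] that by simp
  then show "x = y" using * assms(3) by (intro character_ext[of x s c y]) auto
 qed
 have "?f ` ?R \<subseteq> ?P"
 proof (rule image_subsetI)
  fix y assume "y \<in> ?R"
  then obtain A where A: "A \<subseteq> I" "rep s c y A" by blast
  show "?f y \<in> ?P"
  proof (rule PiE_I)
   fix i assume i: "i \<in> {..<c}"
   then have "odd (card {b \<in> A. character s b i = character s y i})" using A(2) by (auto simp: rep_def)
   then have "{b \<in> A. character s b i = character s y i} \<noteq> {}" by (metis card.empty even_zero)
   then obtain b where "b \<in> A" "character s b i = character s y i" by blast
   then show "?f y i \<in> (\<lambda>b. character s b i) ` I" using A(1) i by (intro image_eqI[of _ _ b]) auto
  qed simp
 qed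
 then have "card ?R \<le> card ?P" using inj assms(1)
  by (intro card_inj_on_le[OF inj] finite_PiE) auto
 also have "\<dots> = (\<Prod>i<c. card ((\<lambda>b. character s b i) ` I))" by (simp add: card_PiE)
 also have "\<dots> \<le> (\<Prod>i<c. N)"
  using assms card_image_le[OF assms(1)] by (intro prod_mono) (auto intro: order.trans)
 finally show ?thesis by simp
qed

text \<open>Adding \<open>y\<close> fails either because \<open>y\<close> is in \<open>I\<close>,
  and then it represents itself, or because an even set arises, which must contain
  \<open>y\<close>.\<close>

lemma dependent_rep:
 assumes "indep s c id I" "\<not> (indep s c id (insert y I) \<and> y \<notin> I)"
 shows "\<exists>A\<subseteq>I. rep s c y A"
proof (cases "y \<in> I")
 case True
 have "{b \<in> {y}. character s b i = a} = (if character s y i = a then {y} else {})" for i a by auto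
 then have "rep s c y {y}" by (simp add: rep_def)
 then show ?thesis using True by blast
next
 case False
 then obtain S where S: "S \<subseteq> insert y I" "S \<noteq> {}" "even_chars s c id S"
  using assms by (auto simp: indep_def)
 have "\<not> S \<subseteq> I" using S assms(1) by (auto simp: indep_def)
 then have y: "y \<in> S" using S(1) by blast
 define A where "A = S - {y}"
 have fin: "finite A" using S(1) assms(1) unfolding A_def indep_def by (auto intro: finite_subset)
 have "rep s c y A" unfolding rep_def
 proof (intro allI impI)
  fix i a assume i: "i < c"
  define B where "B = {b \<in> A. character s b i = a}"
  have B: "finite B" "y \<notin> B" using fin by (auto simp: B_def A_def)
  have "{x \<in> S. character s (id x) i = a} = (if character s y i = a then insert y B else B)"
   using y by (auto simp: B_def A_def)
  moreover have "even (card {x \<in> S. character s (id x) i = a})" using S(3) i by (auto simp: even_chars_def)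
  ultimately show "(character s y i = a) = odd (card {b \<in> A. character s b i = a})"
   using B unfolding B_def[symmetric] by (cases "character s y i = a") simp_all
 qed
 then show ?thesis using S(1) by (intro exI[of _ A]) (auto simp: A_def)
qed

section \<open>Walks along shared derived characters\<close>

definition walk :: "nat \<Rightarrow> (nat \<Rightarrow> nat) \<Rightarrow> nat \<Rightarrow> nat" where
 "walk x z t = (if t = 0 then x else z t)"

text \<open>Round \<open>k\<close> owns the derived positions 2k and 2k+1 and uses them alternately,
  so that a key is entered through one position and left through the other.\<close>

definition pos :: "nat \<Rightarrow> nat \<Rightarrow> nat" where
 "pos k t = 2 * k + t mod 2"

definition chain :: "nat \<Rightarrow> nat \<Rightarrow> (nat \<Rightarrow> nat) \<Rightarrow> nat \<Rightarrow> (nat \<Rightarrow> nat \<Rightarrow> nat) \<Rightarrow> bool" where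
 "chain k x z m g \<longleftrightarrow> (\<forall>t<m. g (walk x z t) (pos k t) = g (walk x z (Suc t)) (pos k t))"

text \<open>The cardinality expresses that the \<open>m\<close> new keys are distinct and lie
  outside \<open>I\<close>. The anchor of the walk, at index 0, belongs to \<open>I\<close> and is
  not among the new keys.\<close>

definition fresh :: "nat \<Rightarrow> nat \<Rightarrow> nat set \<Rightarrow> (nat \<Rightarrow> nat) \<Rightarrow> nat \<Rightarrow> bool" where
 "fresh s c I z m \<longleftrightarrow> indep s c id (I \<union> z ` {1..m}) \<and> card (I \<union> z ` {1..m}) = card I + m"

text \<open>The link at step \<open>t\<close> makes the character of the newly entered key a copy of
  its predecessor's.\<close>

definition chain_pivots :: "nat \<Rightarrow> (nat \<Rightarrow> nat) \<Rightarrow> nat \<Rightarrow> (nat \<times> nat) set" where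
 "chain_pivots k z m = (\<lambda>t. (z (Suc t), pos k t)) ` {..<m}"

lemma pos_less: "2 * k + 1 < d \<Longrightarrow> pos k t < d" and pos_le: "pos k t < 2 * k + 2"
 by (auto simp: pos_def intro: le_less_trans[of _ "2 * k + 1"])

lemma pos_eq_iff: "pos k t = pos k t' \<longleftrightarrow> even t = even t'"
 by (auto simp: pos_def mod2_eq_if)

lemma freshD:
 assumes "fresh s c I z m" "finite I"
 shows "inj_on z {1..m}" "z ` {1..m} \<inter> I = {}"
proof -
 have "card (I \<union> z ` {1..m}) + card (I \<inter> z ` {1..m}) = card I + card (z ` {1..m})"
  using assms(2) card_Un_Int[of I "z ` {1..m}"] by simp
 moreover have "card (z ` {1..m}) \<le> m" using card_image_le[of "{1..m}" z] by simp
 moreover have "card (I \<union> z ` {1..m}) = card I + m" using assms(1) unfolding fresh_def by blast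
 ultimately have *: "card (z ` {1..m}) = m" "card (I \<inter> z ` {1..m}) = 0" by linarith+
 show "inj_on z {1..m}" using *(1) by (intro eq_card_imp_inj_on) auto
 show "z ` {1..m} \<inter> I = {}" using *(2) assms(2) by (metis card_0_eq finite_Int inf_commute)
qed

lemma inj_on_walk:
 assumes "fresh s c I z m" "finite I" "x \<in> I"
 shows "inj_on (walk x z) {0..m}"
proof (rule inj_onI)
 note F = freshD[OF assms(1,2)]
 fix t t' assume t: "t \<in> {0..m}" "t' \<in> {0..m}" and eq: "walk x z t = walk x z t'"
 have ne: "z r \<noteq> x" if "1 \<le> r" "r \<le> m" for r
 proof -
  have "z r \<in> z ` {1..m}" using that by (intro imageI) simp
  then show ?thesis using F(2) assms(3) by blast
 qed
 show "t = t'"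
 proof (cases "t = 0 \<or> t' = 0")
  case True
  then show ?thesis using ne[of t] ne[of t'] eq t by (auto simp: walk_def split: if_splits)
 next
  case False
  then show ?thesis using inj_onD[OF F(1), of t t'] eq t by (auto simp: walk_def)
 qed
qed

lemma walk_in: "x \<in> I \<Longrightarrow> t \<le> m \<Longrightarrow> walk x z t \<in> I \<union> z ` {1..m}"
 by (auto simp: walk_def)

lemma card_chain_pivots:
 assumes "fresh s c I z m" "finite I" "P \<subseteq> I \<times> UNIV" "finite P"
 shows "card (P \<union> chain_pivots k z m) = card P + m"
proof -
 note F = freshD[OF assms(1,2)]
 have "inj_on (\<lambda>t. (z (Suc t), pos k t)) {..<m}"
 proof (rule inj_onI)
  fix t t' assume "t \<in> {..<m}" "t' \<in> {..<m}" "(z (Suc t), pos k t) = (z (Suc t'), pos k t')"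
  then show "t = t'" using inj_onD[OF F(1), of "Suc t" "Suc t'"] by simp
 qed
 then have "card (chain_pivots k z m) = m" by (simp add: chain_pivots_def card_image)
 moreover have "P \<inter> chain_pivots k z m = {}"
 proof -
  have "z (Suc t) \<notin> I" if "t < m" for t
  proof -
   have "z (Suc t) \<in> z ` {1..m}" using that by (intro imageI) simp
   then show ?thesis using F(2) by blast
  qed
  then show ?thesis using assms(3) unfolding chain_pivots_def by blast
 qed
 ultimately show ?thesis using assms(4)
  by (simp add: card_Un_disjoint finite_imageI[of "{..<m}", folded chain_pivots_def[of k z m]] chain_pivots_def)
qed

text \<open>The character through which a key is left is not a pivot: the key was entered at the
  other position, and the old pivots lie in positions of other rounds. So every new pivot is a copy
  of a free character; once these agree, the old constraint settles the rest.\<close>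

lemma chain_agree:
 assumes piv: "pivoted I d P \<D>" and P: "P \<subseteq> I \<times> {2 * k + 2..<d}" and fr: "fresh s c I z m"
  and I: "finite I" "x \<in> I" and k: "2 * k + 1 < d"
  and g: "\<D> g" "\<D> g'" "chain k x z m g" "chain k x z m g'"
  and agree: "\<And>y j. y \<in> I \<union> z ` {1..m} \<Longrightarrow> j < d \<Longrightarrow> (y, j) \<notin> P \<union> chain_pivots k z m \<Longrightarrow> g y j = g' y j"
  and y: "y \<in> I \<union> z ` {1..m}" "j < d"
 shows "g y j = g' y j"
proof -
 note F = freshD[OF fr I(1)]
 have new: "g (z (Suc t)) (pos k t) = g' (z (Suc t)) (pos k t)" if "t < m" for t
 proof -
  have "(walk x z t, pos k t) \<notin> chain_pivots k z m"
  proof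
   assume "(walk x z t, pos k t) \<in> chain_pivots k z m"
   then obtain t' where t': "t' < m" "walk x z t = z (Suc t')" "pos k t = pos k t'"
    by (auto simp: chain_pivots_def)
   have "walk x z t = walk x z (Suc t')" using t' by (simp add: walk_def)
   then have "t = Suc t'" using inj_onD[OF inj_on_walk[OF fr I]] t' that by auto
   then show False using t'(3) by (simp add: pos_eq_iff)
  qed
  moreover have "(walk x z t, pos k t) \<notin> P" using P pos_le[of k t] by auto
  ultimately have np: "(walk x z t, pos k t) \<notin> P \<union> chain_pivots k z m" by blast
  have "g (walk x z t) (pos k t) = g' (walk x z t) (pos k t)"
   by (rule agree[OF walk_in[OF I(2)] pos_less[OF k] np]) (use that in simp)
  then show ?thesis using g(3,4) that by (simp add: chain_def walk_def)
 qed
 have off: "g y j = g' y j" if "y \<in> I \<union> z ` {1..m}" "j < d" "(y, j) \<notin> P" for y j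
  using agree[OF that(1,2)] new that(3) by (auto simp: chain_pivots_def)
 have "\<forall>y\<in>I. \<forall>j<d. g y j = g' y j"
  using piv g off unfolding pivoted_def by blast
 moreover have "(y, j) \<notin> P" if "y \<notin> I" using that P by auto
 ultimately show ?thesis using off y by blast
qed

lemma pivoted_chain:
 assumes "pivoted I d P \<D>" "P \<subseteq> I \<times> {2 * k + 2..<d}" "fresh s c I z m"
  "finite I" "x \<in> I" "2 * k + 1 < d"
 shows "pivoted (I \<union> z ` {1..m}) d (P \<union> chain_pivots k z m) (\<lambda>g. \<D> g \<and> chain k x z m g)"
 unfolding pivoted_def
proof (intro conjI allI impI ballI)
 show "P \<union> chain_pivots k z m \<subseteq> (I \<union> z ` {1..m}) \<times> {..<d}"
  using assms(2,6) by (auto simp: chain_pivots_def pos_less)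
 fix g g' y j
 assume g: "\<D> g \<and> chain k x z m g" and g': "\<D> g' \<and> chain k x z m g'"
  and ag: "\<forall>y\<in>I \<union> z ` {1..m}. \<forall>j<d. (y, j) \<notin> P \<union> chain_pivots k z m \<longrightarrow> g y j = g' y j"
  and y: "y \<in> I \<union> z ` {1..m}" and j: "j < d"
 show "g y j = g' y j"
  by (rule chain_agree[OF assms(1-6) conjunct1[OF g] conjunct1[OF g'] conjunct2[OF g] conjunct2[OF g']
     ag[rule_format] y j])
qed

text \<open>The keys paired by the chain at the position of step \<open>m\<close>; \<open>degenerate\<close> says that \<open>B\<close> is a
 union of such pairs.\<close>

definition degenerate :: "nat \<Rightarrow> (nat \<Rightarrow> nat) \<Rightarrow> nat \<Rightarrow> nat set \<Rightarrow> bool" where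
 "degenerate x z m B \<longleftrightarrow>
  (\<forall>t<m. even t = even m \<longrightarrow> (walk x z t \<in> B \<longleftrightarrow> walk x z (Suc t) \<in> B)) \<and>
  (\<forall>b\<in>B. \<exists>t<m. even t = even m \<and> (b = walk x z t \<or> b = walk x z (Suc t)))"

text \<open>The additional equation says that the characters of \<open>B\<close> at the position of
  step \<open>m\<close> sum to zero. Links at this position form a matching and make the characters
  of matched keys equal. Some \<open>b0\<close> in \<open>B\<close> is unmatched or has its partner
  outside \<open>B\<close>, so its character does not cancel and is determined by the others: one
  more pivot.\<close>

lemma pivoted_nondegenerate:
 assumes piv: "pivoted I d P \<D>" and P: "P \<subseteq> I \<times> {2 * k + 2..<d}" and fr: "fresh s c I z m"
  and I: "finite I" "x \<in> I" and k: "2 * k + 1 < d"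
  and B: "B \<subseteq> I \<union> z ` {1..m}" "\<not> degenerate x z m B"
 shows "\<exists>\<pi>. pivoted (I \<union> z ` {1..m}) d (insert (\<pi>, pos k m) (P \<union> chain_pivots k z m))
   (\<lambda>g. \<D> g \<and> chain k x z m g \<and> xsum (\<lambda>b. g b (pos k m)) B = 0) \<and>
  (\<pi>, pos k m) \<notin> P \<union> chain_pivots k z m"
proof -
 define q where "q = pos k m"
 let ?I = "I \<union> z ` {1..m}"
 let ?w = "walk x z"
 note inj = inj_onD[OF inj_on_walk[OF fr I]]
 have finB: "finite B" using B(1) I(1) by (meson finite_UnI finite_atLeastAtMost finite_imageI finite_subset)
 define paired where "paired b \<longleftrightarrow> (\<exists>t<m. even t = even m \<and> (b = ?w t \<or> b = ?w (Suc t)))" for b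
 obtain b0 where b0: "b0 \<in> B"
  "\<And>t. t < m \<Longrightarrow> even t = even m \<Longrightarrow> b0 = ?w t \<Longrightarrow> ?w (Suc t) \<notin> B"
  "\<And>t. t < m \<Longrightarrow> even t = even m \<Longrightarrow> b0 = ?w (Suc t) \<Longrightarrow> ?w t \<notin> B"
 proof -
  from B(2) consider t where "t < m" "even t = even m" "?w t \<in> B" "?w (Suc t) \<notin> B"
   | t where "t < m" "even t = even m" "?w t \<notin> B" "?w (Suc t) \<in> B"
   | b where "b \<in> B" "\<not> paired b"
   unfolding degenerate_def paired_def by blast
  then show ?thesis
  proof cases
   case (1 t)
   have "t' = t" if "t' < m" "?w t = ?w t'" for t' using inj[of t t'] that 1 by auto
   moreover have "t = Suc t'" if "t' < m" "?w t = ?w (Suc t')" for t' using inj[of t "Suc t'"] that 1 by auto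
   ultimately show ?thesis using 1 by (intro that[of "?w t"]) (blast, metis, metis even_Suc)
  next
   case (2 t)
   have "t' = t" if "t' < m" "?w (Suc t) = ?w (Suc t')" for t' using inj[of "Suc t" "Suc t'"] that 2 by auto
   moreover have "Suc t = t'" if "t' < m" "?w (Suc t) = ?w t'" for t' using inj[of "Suc t" t'] that 2 by auto
   ultimately show ?thesis using 2 by (intro that[of "?w (Suc t)"]) (blast, metis even_Suc, metis)
  next
   case (3 b)
   then show ?thesis by (intro that[of b]) (auto simp: paired_def)
  qed
 qed
 \<comment> \<open>If \<open>b0\<close> is entered by a link at this position, its character is a
   pivot already. The new pivot is then its predecessor, whose character was free so far.\<close>
 obtain \<pi> where pi_cases: "(\<exists>t<m. even t = even m \<and> b0 = ?w (Suc t) \<and> \<pi> = ?w t) \<or>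
  ((\<forall>t<m. even t = even m \<longrightarrow> b0 \<noteq> ?w (Suc t)) \<and> \<pi> = b0)"
  by (cases "\<exists>t<m. even t = even m \<and> b0 = ?w (Suc t)") blast+
 have piI: "\<pi> \<in> ?I" using pi_cases
 proof
  assume "\<exists>t<m. even t = even m \<and> b0 = ?w (Suc t) \<and> \<pi> = ?w t"
  then obtain t where "t < m" "\<pi> = ?w t" by blast
  then show ?thesis using walk_in[OF I(2), of t m z] by simp
 qed (use b0(1) B(1) in blast)
 have nonP: "(b, q) \<notin> P" for b using P pos_le[of k m] by (auto simp: q_def)
 have pivI: "(b, q) \<in> chain_pivots k z m \<Longrightarrow> \<exists>t<m. even t = even m \<and> b = ?w (Suc t)" for b
 proof -
  assume "(b, q) \<in> chain_pivots k z m"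
  then obtain t where t: "t < m" "b = z (Suc t)" "pos k m = pos k t"
   unfolding chain_pivots_def q_def by blast
  then have "even t = even m" by (simp add: pos_eq_iff)
  moreover have "b = ?w (Suc t)" using t by (simp add: walk_def)
  ultimately show ?thesis using t(1) by blast
 qed
 have wt_nonpiv: "(?w t, q) \<notin> chain_pivots k z m" if "t < m" "even t = even m" for t
 proof
  assume "(?w t, q) \<in> chain_pivots k z m"
  then obtain t' where t': "t' < m" "even t' = even m" "?w t = ?w (Suc t')" using pivI by blast
  then have "t = Suc t'" using inj[of t "Suc t'"] that by auto
  then show False using t' that by auto
 qed
 have pi_nonpiv: "(\<pi>, q) \<notin> chain_pivots k z m"
  using pi_cases wt_nonpiv pivI by metis
 have "pivoted ?I d (insert (\<pi>, q) (P \<union> chain_pivots k z m))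
  (\<lambda>g. \<D> g \<and> chain k x z m g \<and> xsum (\<lambda>b. g b q) B = 0)"
  unfolding pivoted_def
 proof (intro conjI allI impI ballI)
  show "insert (\<pi>, q) (P \<union> chain_pivots k z m) \<subseteq> ?I \<times> {..<d}"
   using P k piI by (auto simp: chain_pivots_def pos_less q_def)
  fix g g' y j
  assume g: "\<D> g \<and> chain k x z m g \<and> xsum (\<lambda>b. g b q) B = 0"
   and g': "\<D> g' \<and> chain k x z m g' \<and> xsum (\<lambda>b. g' b q) B = 0"
   and ag: "\<forall>y\<in>?I. \<forall>j<d. (y, j) \<notin> insert (\<pi>, q) (P \<union> chain_pivots k z m) \<longrightarrow> g y j = g' y j"
   and y: "y \<in> ?I" "j < d"
  have q: "q < d" using k by (simp add: q_def pos_less)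
  have ch: "g (?w (Suc t)) q = g (?w t) q" "g' (?w (Suc t)) q = g' (?w t) q"
   if "t < m" "even t = even m" for t
   using g g' that unfolding chain_def q_def by (metis pos_eq_iff)+
  have other: "g b q = g' b q" if b: "b \<in> B" "b \<noteq> b0" for b
  proof (cases "(b, q) \<in> chain_pivots k z m")
   case True
   then obtain t where t: "t < m" "even t = even m" "b = ?w (Suc t)" using pivI by blast
   have "?w t \<noteq> \<pi>"
   proof
    assume w: "?w t = \<pi>"
    from pi_cases show False
    proof
     assume "\<exists>t<m. even t = even m \<and> b0 = ?w (Suc t) \<and> \<pi> = ?w t"
     then obtain t' where t': "t' < m" "b0 = ?w (Suc t')" "\<pi> = ?w t'" by blast
     then have "t = t'" using inj[of t t'] w t by auto
     then show False using t t' b by simp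
    next
     assume "(\<forall>t<m. even t = even m \<longrightarrow> b0 \<noteq> ?w (Suc t)) \<and> \<pi> = b0"
     then show False using b0(2)[OF t(1,2)] w t(3) b by simp
    qed
   qed
   then have "g (?w t) q = g' (?w t) q"
    using ag nonP wt_nonpiv[OF t(1,2)] q walk_in[OF I(2), of t m z] t by auto
   then show ?thesis using ch[OF t(1,2)] t(3) by simp
  next
   case False
   have "b \<noteq> \<pi>"
   proof
    assume "b = \<pi>"
    with pi_cases b obtain t where t: "t < m" "even t = even m" "b0 = ?w (Suc t)" "b = ?w t" by blast
    then show False using b0(3)[OF t(1-3)] b by simp
   qed
   then show ?thesis using ag nonP False q b B(1) by auto
  qed
  have "xsum (\<lambda>b. h b q) B = h b0 q XOR xsum (\<lambda>b. h b q) (B - {b0})" for h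
   using finB b0(1) by (simp add: xorsum.remove)
  moreover have "xsum (\<lambda>b. g b q) (B - {b0}) = xsum (\<lambda>b. g' b q) (B - {b0})"
   using other by (intro xorsum.cong) auto
  ultimately have "g b0 q XOR xsum (\<lambda>b. g' b q) (B - {b0}) = g' b0 q XOR xsum (\<lambda>b. g' b q) (B - {b0})"
   using g g' by metis
  then have "g b0 q = g' b0 q"
   by (metis xor.assoc xor.right_neutral xor_self_eq)
  then have "g \<pi> q = g' \<pi> q" using pi_cases ch by metis
  then have "g y j = g' y j" if "y \<in> ?I" "j < d" "(y, j) \<notin> P \<union> chain_pivots k z m" for y j
  proof (cases "(y, j) = (\<pi>, q)")
   case True
   then show ?thesis using \<open>g \<pi> q = g' \<pi> q\<close> by simp
  next
   case False
   with that(3) have "(y, j) \<notin> insert (\<pi>, q) (P \<union> chain_pivots k z m)" by (simp only: insert_iff simp_thms)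
   then show ?thesis by (rule ag[rule_format, OF that(1,2)])
  qed
  then show "g y j = g' y j"
   using y by (rule chain_agree[OF piv P fr I k conjunct1[OF g] conjunct1[OF g']
     conjunct1[OF conjunct2[OF g]] conjunct1[OF conjunct2[OF g']]])
 qed
 then show ?thesis using pi_nonpiv nonP unfolding q_def by blast
qed

text \<open>The indices of walk keys that occur in a vanishing sum: the last step \<open>m\<close>
  and the starts \<open>K\<close> of the links involved, each with its successor.\<close>

definition linked :: "nat \<Rightarrow> nat set \<Rightarrow> nat set" where
 "linked m K = insert m K \<union> Suc ` insert m K"

definition patterns :: "nat \<Rightarrow> nat set set" where
 "patterns m = {K. K \<subseteq> {t. t < m \<and> even t = even m} \<and> K \<noteq> {}}"

lemma linked_patterns:
 assumes "K \<in> patterns m"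
 shows "finite K" "linked m K \<subseteq> {0..Suc m}" "card (linked m K) = 2 * card K + 2"
  "0 \<in> K \<Longrightarrow> 1 \<in> linked m K" "0 \<in> linked m K \<longleftrightarrow> 0 \<in> K" "finite (linked m K)"
  "0 \<in> K \<Longrightarrow> 0 < m" "card K \<ge> 1"
proof -
 have K: "K \<subseteq> {t. t < m \<and> even t = even m}" "K \<noteq> {}" using assms by (auto simp: patterns_def)
 show fin: "finite K" using K(1) by (rule finite_subset) auto
 show "linked m K \<subseteq> {0..Suc m}" using K by (auto simp: linked_def)
 show "finite (linked m K)" using fin by (simp add: linked_def)
 have "insert m K \<inter> Suc ` insert m K = {}" using K(1) by auto (metis (mono_tags) even_Suc mem_Collect_eq subsetD)+
 then have "card (linked m K) = card (insert m K) + card (Suc ` insert m K)"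
  unfolding linked_def using fin by (intro card_Un_disjoint) auto
 also have "\<dots> = 2 * card (insert m K)" by (subst card_image) (simp_all add: inj_on_def del: image_insert)
 also have "card (insert m K) = card K + 1" using K(1) fin by (subst card_insert_disjoint) auto
 finally show "card (linked m K) = 2 * card K + 2" by simp
 show "0 \<in> K \<Longrightarrow> 1 \<in> linked m K" by (auto simp: linked_def image_iff)
 have "m \<noteq> 0" using K by auto
 then show "0 \<in> linked m K \<longleftrightarrow> 0 \<in> K" "0 \<in> K \<Longrightarrow> 0 < m" by (auto simp: linked_def)
 show "card K \<ge> 1" using fin K(2) by (simp add: Suc_leI card_gt_0_iff)
qed

lemma finite_patterns: "finite (patterns m)"
 unfolding patterns_def by (rule finite_subset[of _ "Pow {..<m}"]) auto

text \<open>The last key has no link at this position, so it lies in \<open>A\<close>, and the rest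
  of \<open>A\<close> is a union of linked pairs with starts \<open>K\<close>. With the key
  \<open>z (Suc m)\<close> represented by \<open>A\<close>, these keys sum to zero. \<open>K\<close>
  is nonempty, as otherwise \<open>z (Suc m)\<close> would equal its predecessor.\<close>

lemma degenerate_zero_sum:
 assumes fr: "fresh s c I z m" and I: "finite I" "x \<in> I" "I \<union> z ` {1..m} \<subseteq> {..<2 ^ (s * c)}"
  and A: "A \<subseteq> I \<union> z ` {1..m}" "rep s c (z (Suc m)) A"
  and y: "z (Suc m) \<noteq> walk x z m" "z (Suc m) < 2 ^ (s * c)"
  and deg: "degenerate x z m (sym_diff A {walk x z m})"
 shows "{t. t < m \<and> even t = even m \<and> walk x z t \<in> A} \<in> patterns m"
  "even_chars s c (walk x z) (linked m {t. t < m \<and> even t = even m \<and> walk x z t \<in> A})"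
proof -
 let ?w = "walk x z"
 define B where "B = sym_diff A {?w m}"
 define K where "K = {t. t < m \<and> even t = even m \<and> ?w t \<in> A}"
 define J where "J = insert m K \<union> Suc ` K"
 note injo = inj_on_walk[OF fr I(1,2)]
 note inj = inj_onD[OF injo]
 have pairB: "?w t \<in> B \<longleftrightarrow> ?w (Suc t) \<in> B" if "t < m" "even t = even m" for t
  using deg that unfolding degenerate_def B_def by blast
 have coverB: "\<exists>t<m. even t = even m \<and> (b = ?w t \<or> b = ?w (Suc t))" if "b \<in> B" for b
  using deg that unfolding degenerate_def B_def by blast
 have ne: "?w t \<noteq> ?w m" "?w (Suc t) \<noteq> ?w m" if "t < m" "even t = even m" for t
 proof -
  show "?w t \<noteq> ?w m" using inj[of t m] that by auto
  have "Suc t \<noteq> m" using that by auto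
  then show "?w (Suc t) \<noteq> ?w m" using inj[of "Suc t" m] that by auto
 qed
 \<comment> \<open>Every key of the degenerate set belongs to a linked pair, and no pair at this
   position contains the last key.\<close>
 have "?w m \<notin> B" using coverB ne by metis
 then have wA: "?w m \<in> A" and BA: "B = A - {?w m}" by (auto simp: B_def)
 have AJ: "A = ?w ` J"
 proof
  show "A \<subseteq> ?w ` J"
  proof
   fix a assume a: "a \<in> A"
   show "a \<in> ?w ` J"
   proof (cases "a = ?w m")
    case False
    then have "a \<in> B" using a BA by blast
    then obtain t where t: "t < m" "even t = even m" "a = ?w t \<or> a = ?w (Suc t)" using coverB by blast
    then have "?w t \<in> B" using pairB[OF t(1,2)] \<open>a \<in> B\<close> by metis
    then have "t \<in> K" using t BA by (simp add: K_def)
    then show ?thesis using t(3) unfolding J_def by blast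
   qed (simp add: J_def)
  qed
  show "?w ` J \<subseteq> A"
  proof (rule image_subsetI)
   fix j assume "j \<in> J"
   then consider "j = m" | "j \<in> K" | t where "t \<in> K" "j = Suc t" unfolding J_def by blast
   then show "?w j \<in> A"
   proof cases
    case (3 t)
    then have t: "t < m" "even t = even m" "?w t \<in> A" by (auto simp: K_def)
    then have "?w t \<in> B" using BA ne by blast
    then show ?thesis using pairB[OF t(1,2)] BA 3 by blast
   qed (use wA in \<open>auto simp: K_def\<close>)
  qed
 qed
 have finK: "finite K" by (simp add: K_def)
 have J: "J \<subseteq> {0..m}" "finite J" "linked m K = insert (Suc m) J" "Suc m \<notin> J"
  using finK by (auto simp: J_def K_def linked_def)
 have injJ: "inj_on ?w J" using injo J(1) by (rule inj_on_subset)
 have "even_chars s c ?w (linked m K)" unfolding even_chars_def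
 proof (intro allI impI)
  fix i a assume i: "i < c"
  define E where "E = {t \<in> J. character s (?w t) i = a}"
  have "?w ` E = {b \<in> A. character s b i = a}" unfolding E_def AJ by auto
  moreover have "card (?w ` E) = card E"
   by (rule card_image[OF inj_on_subset[OF injJ]]) (auto simp: E_def)
  ultimately have "character s (z (Suc m)) i = a \<longleftrightarrow> odd (card E)"
   using A(2) i unfolding rep_def by metis
  moreover have "{t \<in> linked m K. character s (?w t) i = a} =
    (if character s (z (Suc m)) i = a then insert (Suc m) E else E)"
   using J(3) by (auto simp: E_def walk_def)
  moreover have "finite E" "Suc m \<notin> E" using J by (auto simp: E_def)
  ultimately show "even (card {t \<in> linked m K. character s (?w t) i = a})"
   by (cases "character s (z (Suc m)) i = a") simp_all
 qed
 then show "even_chars s c ?w (linked m {t. t < m \<and> even t = even m \<and> ?w t \<in> A})"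
  unfolding K_def .
 have "K \<noteq> {}"
 proof
  assume "K = {}"
  then have Aw: "A = {?w m}" using AJ by (simp add: J_def)
  have wI: "?w m \<in> I \<union> z ` {1..m}" using walk_in[OF I(2)] by blast
  have "z (Suc m) = ?w m"
  proof (rule character_ext)
   show "?w m < 2 ^ (s * c)" using wI I(3) by blast
   fix i assume i: "i < c"
   have "{b \<in> {?w m}. character s b i = character s (?w m) i} = {?w m}" by auto
   then show "character s (z (Suc m)) i = character s (?w m) i"
    using A(2) i unfolding rep_def Aw by simp
  qed (use y in auto)
  then show False using y by simp
 qed
 then show "{t. t < m \<and> even t = even m \<and> ?w t \<in> A} \<in> patterns m"
  unfolding K_def patterns_def by auto
qed

section \<open>The recursion over the rounds\<close>

definition zero_walks :: "nat \<Rightarrow> nat \<Rightarrow> nat set \<Rightarrow> nat \<Rightarrow> nat \<Rightarrow> nat set \<Rightarrow> (nat \<Rightarrow> nat) set" where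
 "zero_walks s c X x m K = {z \<in> PiE {1..Suc m} (\<lambda>_. X). even_chars s c (walk x z) (linked m K)}"

text \<open>The contribution of degenerate walks, as a linear operator on functions of the anchor.
  If the anchor \<open>x\<close> takes part in the vanishing sum, the next round is anchored at
  \<open>z 1\<close>: the weights of the two rounds then sit at two different keys of the sum, and
  each gets its own norm. If not, \<open>x\<close> can serve again, as it is free of the
  sum.\<close>

definition walk_op :: "nat \<Rightarrow> nat \<Rightarrow> nat set \<Rightarrow> nat \<Rightarrow> real \<Rightarrow> (nat \<Rightarrow> real) \<Rightarrow> nat \<Rightarrow> real" where
 "walk_op s c X L p g x = (\<Sum>m<L. \<Sum>K\<in>patterns m. \<Sum>z\<in>zero_walks s c X x m K.
   (p / 2 ^ s) ^ m * g (if 0 \<in> K then z 1 else x))"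

text \<open>With \<open>k\<close> rounds still to come. The three terms belong to walks that end
  with a new equation, to degenerate walks, and to walks that stay fresh for \<open>L\<close>
  steps.\<close>

primrec walk_bound :: "nat \<Rightarrow> nat \<Rightarrow> nat set \<Rightarrow> nat \<Rightarrow> nat \<Rightarrow> real \<Rightarrow> nat \<Rightarrow> nat \<Rightarrow> real" where
 "walk_bound s c X L N p 0 x = 1"
| "walk_bound s c X L N p (Suc k) x =
  real L * real N ^ c / 2 ^ s * walk_bound s c X L N p k x
  + walk_op s c X L p (walk_bound s c X L N p k) x
  + (real (card X) * p / 2 ^ s) ^ L"

lemma walk_op_nonneg: "p \<ge> 0 \<Longrightarrow> (\<And>x. g x \<ge> 0) \<Longrightarrow> walk_op s c X L p g x \<ge> 0"
 unfolding walk_op_def by (intro sum_nonneg mult_nonneg_nonneg zero_le_power) auto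

lemma walk_bound_nonneg: "p \<ge> 0 \<Longrightarrow> walk_bound s c X L N p k x \<ge> 0"
 by (induction k arbitrary: x) (simp_all add: walk_op_nonneg)

lemma prob_UN_le:
 assumes "finite I" "\<And>i. i \<in> I \<Longrightarrow> prob M (A i) \<le> f i"
 shows "prob M (\<Union>i\<in>I. A i) \<le> sum f I"
proof -
 have "prob M (\<Union>i\<in>I. A i) \<le> (\<Sum>i\<in>I. prob M (A i))"
  by (rule measure_pmf.finite_measure_subadditive_finite[OF assms(1)]) auto
 also have "\<dots> \<le> sum f I" by (rule sum_mono[OF assms(2)])
 finally show ?thesis .
qed

lemma fresh_cong: "(\<And>t. t \<in> {1..m} \<Longrightarrow> z t = z' t) \<Longrightarrow> fresh s c I z m = fresh s c I z' m"
proof -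
 assume "\<And>t. t \<in> {1..m} \<Longrightarrow> z t = z' t"
 then have "z ` {1..m} = z' ` {1..m}" by (rule image_cong[OF refl])
 then show ?thesis unfolding fresh_def by (simp only:)
qed

lemma xsum_sym_diff: "finite A \<Longrightarrow> xsum f (sym_diff A {w}) = xsum f A XOR f w"
proof (cases "w \<in> A")
 case True
 assume "finite A"
 then have "xsum f A = f w XOR xsum f (A - {w})" using True by (simp add: xorsum.remove)
 moreover have "sym_diff A {w} = A - {w}" using True by auto
 ultimately show ?thesis by (simp add: xor.assoc xor.commute) (metis xor.assoc xor.left_neutral xor_self_eq)
next
 case False
 assume "finite A"
 moreover have "sym_diff A {w} = insert w A" using False by auto
 ultimately show ?thesis using False by (simp add: xor.commute)
qed

text \<open>\<open>I\<close> and \<open>\<D>\<close> record the keys and equations exposed by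
  earlier rounds. The set \<open>S\<close> is a witness of dependence, of which only the evenness in
  the derived positions is kept.\<close>

definition even_event :: "nat \<Rightarrow> nat \<Rightarrow> nat \<Rightarrow> nat set \<Rightarrow> nat \<Rightarrow> nat \<Rightarrow> nat \<Rightarrow> nat set \<Rightarrow>
  ((nat \<Rightarrow> nat \<Rightarrow> nat) \<Rightarrow> bool) \<Rightarrow> ((nat \<Rightarrow> nat \<Rightarrow> nat) \<times> (nat \<Rightarrow> nat \<Rightarrow> nat)) set" where
 "even_event s c d X v D x I \<D> = {(T1, T2). I \<subseteq> selected s c d X v T1 T2 \<and> \<D> (dchar s c T1) \<and>
  (\<exists>S\<subseteq>selected s c d X v T1 T2. x \<in> S \<and> (\<forall>j<2 * D. \<forall>a. even (card {y \<in> S. dchar s c T1 y j = a})))}"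

text \<open>An even class is not a singleton, so each key of \<open>S\<close> has a partner in
  \<open>S\<close> with the same character in the required position.\<close>

lemma walk_exists:
 assumes fin: "finite S" and x: "x \<in> S" and kD: "k < D"
  and ev: "\<And>j a. j < 2 * D \<Longrightarrow> even (card {y \<in> S. g y j = a})"
 shows "\<exists>w. w 0 = x \<and> (\<forall>t. w t \<in> S \<and> w (Suc t) \<noteq> w t \<and> g (w (Suc t)) (pos k t) = g (w t) (pos k t))"
proof -
 have "\<exists>y'\<in>S. y' \<noteq> y \<and> g y' j = g y j" if "y \<in> S" "j < 2 * D" for y j
 proof (rule ccontr)
  assume "\<not> ?thesis"
  then have "{y' \<in> S. g y' j = g y j} = {y}" using that(1) by auto
  then show False using ev[OF that(2), of "g y j"] by simp
 qed
 then obtain f where f: "f y j \<in> S" "f y j \<noteq> y" "g (f y j) j = g y j" if "y \<in> S" "j < 2 * D" for y j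
  by metis
 define w where "w = rec_nat x (\<lambda>t y. f y (pos k t))"
 have w: "w 0 = x" "w (Suc t) = f (w t) (pos k t)" for t by (simp_all add: w_def)
 have p: "pos k t < 2 * D" for t using pos_le[of k t] kD by linarith
 have "w t \<in> S" for t by (induction t) (simp_all add: w x f p)
 then show ?thesis using w f p by metis
qed

lemma first_stale:
 assumes "fresh s c I w 0" "\<not> fresh s c I w L"
 shows "\<exists>m<L. fresh s c I w m \<and> \<not> fresh s c I w (Suc m)"
proof (rule ccontr)
 assume no: "\<not> ?thesis"
 have "m \<le> L \<Longrightarrow> fresh s c I w m" for m
 proof (induction m)
  case (Suc m)
  then show ?case using no by (meson Suc_le_lessD less_imp_le_nat)
 qed (use assms in simp)
 then show False using assms by blast
qed

lemma stale_rep: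
 assumes "fresh s c I w m" "\<not> fresh s c I w (Suc m)" "finite I"
 shows "\<exists>A\<subseteq>I \<union> w ` {1..m}. rep s c (w (Suc m)) A"
proof (rule dependent_rep)
 show "indep s c id (I \<union> w ` {1..m})" using assms(1) by (simp add: fresh_def)
 show "\<not> (indep s c id (insert (w (Suc m)) (I \<union> w ` {1..m})) \<and> w (Suc m) \<notin> I \<union> w ` {1..m})"
 proof
  assume *: "indep s c id (insert (w (Suc m)) (I \<union> w ` {1..m})) \<and> w (Suc m) \<notin> I \<union> w ` {1..m}"
  have "{1..Suc m} = insert (Suc m) {1..m}" by auto
  then have e: "I \<union> w ` {1..Suc m} = insert (w (Suc m)) (I \<union> w ` {1..m})"
   by (simp only: image_insert Un_insert_right)
  have "card (insert (w (Suc m)) (I \<union> w ` {1..m})) = Suc (card (I \<union> w ` {1..m}))"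
   using * assms(3) by (intro card_insert_disjoint) auto
  moreover have "card (I \<union> w ` {1..m}) = card I + m" using assms(1) unfolding fresh_def by blast
  ultimately have "fresh s c I w (Suc m)" unfolding fresh_def e using * by simp
  then show False using assms(2) by blast
 qed
qed

lemma degenerate_cong:
 assumes "degenerate x z m B" "\<And>t. t \<le> m \<Longrightarrow> walk x z' t = walk x z t"
 shows "degenerate x z' m B"
 unfolding degenerate_def
proof (intro conjI allI impI ballI)
 fix t assume t: "t < m" "even t = even m"
 then show "walk x z' t \<in> B \<longleftrightarrow> walk x z' (Suc t) \<in> B"
  using assms(1) assms(2)[of t] assms(2)[of "Suc t"] unfolding degenerate_def by simp
next
 fix b assume "b \<in> B"
 then obtain t where t: "t < m" "even t = even m" "b = walk x z t \<or> b = walk x z (Suc t)"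
  using assms(1) unfolding degenerate_def by blast
 then show "\<exists>t<m. even t = even m \<and> (b = walk x z' t \<or> b = walk x z' (Suc t))"
  using assms(2)[of t] assms(2)[of "Suc t"] by auto
qed

text \<open>\<open>p\<close> is the probability that a key is selected, \<open>L\<close> limits the
  length of the walk of a round, and \<open>N\<close> bounds the number of keys exposed in all
  rounds: the first anchor and at most \<open>L\<close> keys per round.\<close>

context
 fixes s c d b v D L :: nat and X :: "nat set" and p :: real and N :: nat
 assumes X: "X \<subseteq> {..<2 ^ (s * c)}" and v: "v < 2 ^ b" and c: "c \<ge> 1" and D: "2 * D \<le> d"
  and p: "p = 1 / 2 ^ b" and lam: "real (card X) * p \<le> 2 ^ s" and N: "N = 1 + D * L"
begin

abbreviation "tables \<equiv> table_pair s c d b"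
abbreviation "ev \<equiv> even_event s c d X v D"
abbreviation "wb \<equiv> walk_bound s c X L N p"

private lemma finX: "finite X"
 using X finite_subset by blast

private lemma p0: "p > 0"
 by (simp add: p)

text \<open>There are at most \<open>card X ^ L\<close> walks, and each prescribes \<open>L\<close>
  more selected keys and \<open>L\<close> more pivots.\<close>

private lemma prob_long:
 assumes st: "x \<in> I" "I \<subseteq> X" "P \<subseteq> I \<times> {2 * k + 2..<d}" "pivoted I d P \<D>" and k: "k < D"
 shows "prob tables (\<Union>z\<in>{z \<in> PiE {1..L} (\<lambda>_. X). fresh s c I z L}.
   {(T1, T2). I \<union> z ` {1..L} \<subseteq> selected s c d X v T1 T2 \<and>
    (\<D> (dchar s c T1) \<and> chain k x z L (dchar s c T1))}) \<le>
  p ^ card I / (2 ^ s) ^ card P * (real (card X) * p / 2 ^ s) ^ L"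
proof -
 let ?Z = "{z \<in> PiE {1..L} (\<lambda>_. X). fresh s c I z L}"
 have finI: "finite I" using st(2) finX finite_subset by blast
 have finP: "finite P" using st(3) finI by (meson finite_SigmaI finite_atLeastLessThan finite_subset)
 have kd: "2 * k + 1 < d" using k D by linarith
 have "prob tables (\<Union>z\<in>?Z. {(T1, T2). I \<union> z ` {1..L} \<subseteq> selected s c d X v T1 T2 \<and>
    (\<D> (dchar s c T1) \<and> chain k x z L (dchar s c T1))}) \<le>
   (\<Sum>z\<in>?Z. p ^ (card I + L) / (2 ^ s) ^ (card P + L))"
 proof (rule prob_UN_le)
  show "finite ?Z" using finX by (intro finite_subset[OF _ finite_PiE[of "{1..L}" "\<lambda>_. X"]]) auto
  fix z assume "z \<in> ?Z"
  then have z: "z ` {1..L} \<subseteq> X" "fresh s c I z L" by auto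
  have "card (I \<union> z ` {1..L}) = card I + L" "indep s c id (I \<union> z ` {1..L})"
   using z(2) unfolding fresh_def by blast+
  moreover have "card (P \<union> chain_pivots k z L) = card P + L"
   using st(3) by (intro card_chain_pivots[OF z(2) finI _ finP]) auto
  ultimately show "prob tables {(T1, T2). I \<union> z ` {1..L} \<subseteq> selected s c d X v T1 T2 \<and>
    (\<D> (dchar s c T1) \<and> chain k x z L (dchar s c T1))} \<le> p ^ (card I + L) / (2 ^ s) ^ (card P + L)"
   using prob_pivoted_selected[OF _ pivoted_chain[OF st(4,3) z(2) finI st(1) kd] _ X v] z(1) st(2)
   unfolding p by (metis (no_types, lifting) Un_least)
 qed
 also have "\<dots> = real (card ?Z) * (p ^ (card I + L) / (2 ^ s) ^ (card P + L))" by simp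
 also have "\<dots> \<le> real (card X) ^ L * (p ^ (card I + L) / (2 ^ s) ^ (card P + L))"
 proof (rule mult_right_mono)
  have "card ?Z \<le> card (PiE {1..L} (\<lambda>_. X))" using finX by (intro card_mono finite_PiE) auto
  also have "\<dots> = card X ^ L" by (simp add: card_PiE)
  finally show "real (card ?Z) \<le> real (card X) ^ L" by (metis of_nat_le_iff of_nat_power)
 qed (use p0 in simp)
 also have "\<dots> = p ^ card I / (2 ^ s) ^ card P * (real (card X) * p / 2 ^ s) ^ L"
  by (simp add: power_add power_mult_distrib power_divide)
 finally show ?thesis .
qed

private lemma lam_pow: "(real (card X) * p / 2 ^ s) ^ m \<le> 1"
 using lam p0 by (intro power_le_one) auto

text \<open>Either the walk of this round stays fresh for \<open>L\<close> steps
  (\<open>EL\<close>), or its first stale step leads to a key represented by the exposed ones. There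
  are at most \<open>N ^ c\<close> such keys. In the nondegenerate case (\<open>EN\<close>) the link
  to the stale key is an additional pivot, worth 1/|\<Sigma>|. In the degenerate case
  (\<open>ED\<close>) the link gives nothing new, but the walk belongs to the few with a vanishing
  sum. In the last two cases the next round runs with the enlarged set of keys and
  equations.\<close>

private lemma step:
 assumes IH: "\<And>x I P \<D>. x \<in> I \<Longrightarrow> I \<subseteq> X \<Longrightarrow> indep s c id I \<Longrightarrow> card I \<le> 1 + (D - k) * L \<Longrightarrow>
   P \<subseteq> I \<times> {2 * k..<d} \<Longrightarrow> pivoted I d P \<D> \<Longrightarrow>
   prob tables (ev x I \<D>) \<le> p ^ card I / (2 ^ s) ^ card P * wb k x"
  and k: "k < D"
  and st: "x \<in> I" "I \<subseteq> X" "indep s c id I" "card I \<le> 1 + (D - Suc k) * L"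
   "P \<subseteq> I \<times> {2 * k + 2..<d}" "pivoted I d P \<D>"
 shows "prob tables (ev x I \<D>) \<le> p ^ card I / (2 ^ s) ^ card P * wb (Suc k) x"
proof -
 define W where "W = p ^ card I / (2 ^ s) ^ card P"
 have W0: "W \<ge> 0" using p0 by (simp add: W_def)
 have finI: "finite I" using st(2) finX finite_subset by blast
 have finP: "finite P" using st(5) finI by (meson finite_SigmaI finite_atLeastLessThan finite_subset)
 have kd: "2 * k + 1 < d" using k D by linarith
 have Dk: "(D - k) * L = (D - Suc k) * L + L" using k by (simp add: Suc_diff_Suc[symmetric])
 define New where "New z m = I \<union> z ` {1..m}" for z :: "nat \<Rightarrow> nat" and m :: nat
 define Z where "Z m = {z \<in> PiE {1..m} (\<lambda>_. X). fresh s c I z m}" for m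
 define Cl where "Cl m z = {y \<in> X. \<exists>A\<subseteq>New z m. rep s c y A}" for m z
 \<comment> \<open>One representation is fixed for each key, so that the union bound runs over keys
   and not over representing subsets.\<close>
 define Ar where "Ar m z y = (SOME A. A \<subseteq> New z m \<and> rep s c y A)" for m z y
 define B where "B m z y = sym_diff (Ar m z y) {walk x z m}" for m z y
 define EL where "EL = (\<Union>z\<in>Z L. {(T1, T2). New z L \<subseteq> selected s c d X v T1 T2 \<and>
    (\<D> (dchar s c T1) \<and> chain k x z L (dchar s c T1))})"
 define EN where "EN m z y = (if degenerate x z m (B m z y) then {} else
  ev x (New z m) (\<lambda>g. \<D> g \<and> chain k x z m g \<and> xsum (\<lambda>b. g b (pos k m)) (B m z y) = 0))" for m z y
 define ED where "ED m K z = ev (if 0 \<in> K then z 1 else x) (New z m) (\<lambda>g. \<D> g \<and> chain k x z m g)"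
  for m and K :: "nat set" and z
 define ZD where "ZD m K = {z \<in> zero_walks s c X x m K. fresh s c I z m}" for m K
 have Ar: "Ar m z y \<subseteq> New z m" "rep s c y (Ar m z y)" if "y \<in> Cl m z" for m z y
  using that someI_ex[of "\<lambda>A. A \<subseteq> New z m \<and> rep s c y A"] unfolding Cl_def Ar_def by blast+
 have finNew: "finite (New z m)" for z m using finI by (simp add: New_def)
 have cover: "ev x I \<D> \<subseteq> EL \<union> (\<Union>m<L. \<Union>z\<in>Z m. \<Union>y\<in>Cl m z. EN m z y) \<union>
   (\<Union>m<L. \<Union>K\<in>patterns m. \<Union>z\<in>ZD m K. ED m K z)"
 proof
  fix T assume T: "T \<in> ev x I \<D>"
  obtain T1 T2 where TT: "T = (T1, T2)" by (cases T)
  define Y where "Y = selected s c d X v T1 T2"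
  define g where "g = dchar s c T1"
  have YX: "Y \<subseteq> X" by (auto simp: Y_def selected_def)
  have T': "I \<subseteq> Y \<and> \<D> g \<and> (\<exists>S\<subseteq>Y. x \<in> S \<and> (\<forall>j<2 * D. \<forall>a. even (card {y \<in> S. g y j = a})))"
   using T unfolding TT even_event_def Y_def g_def by (simp only: mem_Collect_eq case_prod_conv)
  have IY: "I \<subseteq> Y" by (rule conjunct1[OF T'])
  have Dg: "\<D> g" by (rule conjunct1[OF conjunct2[OF T']])
  from conjunct2[OF conjunct2[OF T']] obtain S where
   S: "S \<subseteq> Y" "x \<in> S" "\<forall>j<2 * D. \<forall>a. even (card {y \<in> S. g y j = a})" by blast
  have inev: "T \<in> ev x' I' \<E>" if "x' \<in> S" "I' \<subseteq> Y" "\<E> g" for x' I' \<E>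
   unfolding even_event_def TT mem_Collect_eq case_prod_conv Y_def[symmetric] g_def[symmetric]
   using that S(1,3) by blast
  have finS: "finite S" by (rule finite_subset[OF subset_trans[OF S(1) YX] finX])
  obtain w where w: "w 0 = x" "\<And>t. w t \<in> S" "\<And>t. w (Suc t) \<noteq> w t"
    "\<And>t. g (w (Suc t)) (pos k t) = g (w t) (pos k t)"
   using walk_exists[of S x k D g, OF finS S(2) k S(3)[rule_format]] by blast
  \<comment> \<open>The infinite walk is cut off, so that the union bounds run over finitely many
    functions.\<close>
  define r where "r m = restrict w {1..m}" for m
  have wk: "walk x w t = w t" for t by (simp add: walk_def w(1))
  have wr: "walk x (r m) t = w t" if "t \<le> m" for t m using that by (auto simp: walk_def r_def w(1))
  have ri: "r m ` {1..m'} = w ` {1..m'}" if "m' \<le> m" for m m'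
   using that by (intro image_cong) (auto simp: r_def)
  have fr: "fresh s c I (r m) m' = fresh s c I w m'" if "m' \<le> m" for m m'
   using that by (intro fresh_cong) (auto simp: r_def)
  have chr: "chain k x (r m) m' g" if "m' \<le> m" for m m'
   unfolding chain_def
  proof (intro allI impI)
   fix t assume "t < m'"
   then show "g (walk x (r m) t) (pos k t) = g (walk x (r m) (Suc t)) (pos k t)"
    using that w(4)[of t] by (simp add: wr)
  qed
  have rX: "r m \<in> PiE {1..m} (\<lambda>_. X)" for m using w(2) S(1) YX by (auto simp: r_def)
  have NewY: "New (r m) m' \<subseteq> Y" if "m' \<le> m" for m m'
   unfolding New_def ri[OF that] using IY w(2) S(1) by auto
  show "T \<in> EL \<union> (\<Union>m<L. \<Union>z\<in>Z m. \<Union>y\<in>Cl m z. EN m z y) \<union>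
   (\<Union>m<L. \<Union>K\<in>patterns m. \<Union>z\<in>ZD m K. ED m K z)"
  proof (cases "fresh s c I w L")
   case True
   then have "r L \<in> Z L" using rX fr[of L L] by (simp add: Z_def)
   moreover have "New (r L) L \<subseteq> Y" "chain k x (r L) L g" using NewY chr by auto
   ultimately have "T \<in> EL" unfolding EL_def TT using Dg unfolding Y_def g_def by blast
   then show ?thesis by blast
  next
   case False
   have "fresh s c I w 0" using st(3) by (simp add: fresh_def)
   then obtain m where m: "m < L" "fresh s c I w m" "\<not> fresh s c I w (Suc m)"
    using first_stale False by blast
   have rm: "r m \<in> Z m" using rX fr[of m m] m by (simp add: Z_def)
   define y where "y = w (Suc m)"
   have yX: "y \<in> X" using w(2)[of "Suc m"] S(1) YX by (auto simp: y_def)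
   have Newm: "New (r m) m = I \<union> w ` {1..m}" by (simp add: New_def ri del: One_nat_def)
   have "\<exists>A\<subseteq>New (r m) m. rep s c y A"
    unfolding Newm y_def by (rule stale_rep[OF m(2,3) finI])
   then have yC: "y \<in> Cl m (r m)" using yX by (simp add: Cl_def)
   show ?thesis
   proof (cases "degenerate x (r m) m (B m (r m) y)")
    case False
    have "g y (pos k m) = xsum (\<lambda>b. g b (pos k m)) (Ar m (r m) y)"
     unfolding g_def by (rule rep_dchar[OF Ar(2)[OF yC] finite_subset[OF Ar(1)[OF yC] finNew]])
    moreover have "g y (pos k m) = g (walk x (r m) m) (pos k m)" using w(4)[of m] by (simp add: y_def wr)
    ultimately have "xsum (\<lambda>b. g b (pos k m)) (B m (r m) y) = 0"
     unfolding B_def xsum_sym_diff[OF finite_subset[OF Ar(1)[OF yC] finNew]] by simp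
    then have "T \<in> EN m (r m) y" using False Dg chr[of m m] NewY[of m m] S(2)
     by (simp add: EN_def inev)
    then show ?thesis using m(1) rm yC by blast
   next
    case True
    \<comment> \<open>The stale key \<open>z (Suc m)\<close> takes part in the vanishing sum and is
      kept in the walk, although it is not added to the exposed keys \<open>New z m\<close>.\<close>
    define z where "z = r (Suc m)"
    define A where "A = Ar m (r m) y"
    have zy: "z (Suc m) = y" by (simp add: z_def r_def y_def)
    have Newz: "New z m = New (r m) m" by (simp add: New_def z_def ri del: One_nat_def)
    have wz: "walk x z t = walk x (r m) t" if "t \<le> m" for t using that by (simp add: z_def wr)
    have frz: "fresh s c I z m" using fr[of m "Suc m"] m(2) by (simp add: z_def)
    have degz: "degenerate x z m (sym_diff A {walk x z m})"
     using degenerate_cong[OF True wz] unfolding B_def A_def by (simp only: wz[OF order.refl])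
    define K where "K = {t. t < m \<and> even t = even m \<and> walk x z t \<in> A}"
    have h1: "I \<union> z ` {1..m} \<subseteq> {..<2 ^ (s * c)}"
     using NewY[of m m] YX X unfolding Newz[unfolded New_def[of z m]] by auto
    have h2: "A \<subseteq> I \<union> z ` {1..m}"
     using Ar(1)[OF yC] unfolding A_def Newz[unfolded New_def[of z m]] .
    have h3: "rep s c (z (Suc m)) A" unfolding zy A_def by (rule Ar(2)[OF yC])
    have h4: "z (Suc m) \<noteq> walk x z m" using w(3)[of m] by (simp add: zy y_def wz wr)
    have h5: "z (Suc m) < 2 ^ (s * c)" unfolding zy using yX X by auto
    have K: "K \<in> patterns m" "even_chars s c (walk x z) (linked m K)"
     unfolding K_def by (rule degenerate_zero_sum[OF frz finI st(1) h1 h2 h3 h4 h5 degz])+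
    have "z \<in> ZD m K" unfolding ZD_def zero_walks_def using K frz rX by (simp add: z_def)
    moreover have "(if 0 \<in> K then z 1 else x) \<in> S" using w(2) S(2) by (simp add: z_def r_def)
    then have "T \<in> ED m K z" unfolding ED_def
     using Dg chr[of m "Suc m"] NewY[of m "Suc m"] by (intro inev) (auto simp: z_def)
    ultimately show ?thesis using m(1) K(1) by blast
   qed
  qed
 qed
 have fresh_new: "indep s c id (New z m)" "card (New z m) = card I + m"
   "card (New z m) \<le> 1 + (D - k) * L" "New z m \<subseteq> X" "New z m \<noteq> {}"
   "card (P \<union> chain_pivots k z m) = card P + m" "finite (P \<union> chain_pivots k z m)"
   "P \<union> chain_pivots k z m \<subseteq> New z m \<times> {2 * k..<d}"
  if "fresh s c I z m" "z ` {1..m} \<subseteq> X" "m \<le> L" for z m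
 proof -
  show 1: "indep s c id (New z m)" "card (New z m) = card I + m"
   using that(1) unfolding fresh_def New_def by blast+
  show "card (New z m) \<le> 1 + (D - k) * L" using 1 st(4) that(3) Dk by linarith
  show "New z m \<subseteq> X" "New z m \<noteq> {}" using that st(1,2) by (auto simp: New_def)
  show "card (P \<union> chain_pivots k z m) = card P + m"
   using st(5) by (intro card_chain_pivots[OF that(1) finI _ finP]) auto
  show "finite (P \<union> chain_pivots k z m)" using finP by (simp add: chain_pivots_def)
  show "P \<union> chain_pivots k z m \<subseteq> New z m \<times> {2 * k..<d}"
   using st(5) pos_less[OF kd] by (fastforce simp: chain_pivots_def New_def pos_def)
 qed
 have boundL: "prob tables EL \<le> W * (real (card X) * p / 2 ^ s) ^ L"
  unfolding EL_def Z_def New_def W_def by (rule prob_long[OF st(1,2,5,6) k])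
 have boundN1: "prob tables (EN m z y) \<le> W * (p / 2 ^ s) ^ m / 2 ^ s * wb k x"
  if "m < L" "z \<in> Z m" "y \<in> Cl m z" for m z y
 proof (cases "degenerate x z m (B m z y)")
  case True
  then show ?thesis using p0 W0 by (simp add: EN_def walk_bound_nonneg)
 next
  case False
  have z: "fresh s c I z m" "z ` {1..m} \<subseteq> X" using that(2) by (auto simp: Z_def)
  note fn = fresh_new[OF z less_imp_le[OF that(1)]]
  have "B m z y \<subseteq> New z m" using Ar(1)[OF that(3)] walk_in[OF st(1), of m m z]
   unfolding B_def New_def by blast
  then obtain \<pi> where pi: "pivoted (New z m) d (insert (\<pi>, pos k m) (P \<union> chain_pivots k z m))
   (\<lambda>g. \<D> g \<and> chain k x z m g \<and> xsum (\<lambda>b. g b (pos k m)) (B m z y) = 0)"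
   "(\<pi>, pos k m) \<notin> P \<union> chain_pivots k z m"
   using pivoted_nondegenerate[OF st(6,5) z(1) finI st(1) kd _ False] unfolding New_def by blast
  have cP: "card (insert (\<pi>, pos k m) (P \<union> chain_pivots k z m)) = Suc (card P + m)"
   unfolding card_insert_disjoint[OF fn(7) pi(2)] fn(6) ..
  have "prob tables (EN m z y) \<le>
    p ^ card (New z m) / (2 ^ s) ^ card (insert (\<pi>, pos k m) (P \<union> chain_pivots k z m)) * wb k x"
  proof -
   have "insert (\<pi>, pos k m) (P \<union> chain_pivots k z m) \<subseteq> New z m \<times> {2 * k..<d}"
   proof -
    have "(\<pi>, pos k m) \<in> New z m \<times> {..<d}" using pi(1) unfolding pivoted_def by blast
    then show ?thesis using fn(8) by (auto simp: pos_def)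
   qed
   moreover have "x \<in> New z m" using st(1) by (simp add: New_def)
   ultimately show ?thesis using False IH[OF _ fn(4,1,3) _ pi(1)] by (simp add: EN_def)
  qed
  also have "\<dots> = W * (p / 2 ^ s) ^ m / 2 ^ s * wb k x"
   unfolding cP fn(2) by (simp add: W_def power_add power_divide)
  finally show ?thesis .
 qed
 have "prob tables (\<Union>m<L. \<Union>z\<in>Z m. \<Union>y\<in>Cl m z. EN m z y) \<le>
   (\<Sum>m<L. \<Sum>z\<in>Z m. \<Sum>y\<in>Cl m z. W * (p / 2 ^ s) ^ m / 2 ^ s * wb k x)"
 proof (intro prob_UN_le boundN1)
  show "finite (Z m)" for m using finX by (intro finite_subset[OF _ finite_PiE[of "{1..m}" "\<lambda>_. X"]]) (auto simp: Z_def)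
  show "finite (Cl m z)" for m z using finX by (simp add: Cl_def)
 qed auto
 also have "\<dots> \<le> (\<Sum>m<L. W * real N ^ c / 2 ^ s * wb k x)"
 proof (rule sum_mono)
  fix m assume m: "m \<in> {..<L}"
  define U where "U = W * (p / 2 ^ s) ^ m / 2 ^ s * wb k x"
  have U0: "U \<ge> 0" using p0 W0 by (simp add: U_def walk_bound_nonneg)
  have "(\<Sum>z\<in>Z m. \<Sum>y\<in>Cl m z. U) \<le> (\<Sum>z\<in>Z m. real N ^ c * U)"
  proof (rule sum_mono)
   fix z assume "z \<in> Z m"
   then have z: "fresh s c I z m" "z ` {1..m} \<subseteq> X" by (auto simp: Z_def)
   have "card (New z m) \<le> 1 + (D - k) * L" using fresh_new(3)[OF z] m by auto
   also have "\<dots> \<le> N" unfolding N by simp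
   finally have "card (Cl m z) \<le> N ^ c" unfolding Cl_def by (rule card_rep_le[OF finNew _ X])
   then have "real (card (Cl m z)) \<le> real N ^ c" by (metis of_nat_le_iff of_nat_power)
   then show "(\<Sum>y\<in>Cl m z. U) \<le> real N ^ c * U" using U0 by (simp add: mult_right_mono)
  qed
  also have "\<dots> = real (card (Z m)) * (real N ^ c * U)" by simp
  also have "\<dots> \<le> real (card X) ^ m * (real N ^ c * U)"
  proof (rule mult_right_mono)
   have "card (Z m) \<le> card (PiE {1..m} (\<lambda>_. X))" using finX unfolding Z_def by (intro card_mono finite_PiE) auto
   also have "\<dots> = card X ^ m" by (simp add: card_PiE)
   finally show "real (card (Z m)) \<le> real (card X) ^ m" by (metis of_nat_le_iff of_nat_power)
  qed (use U0 in simp)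
  also have "\<dots> = (real (card X) * p / 2 ^ s) ^ m * (W * real N ^ c / 2 ^ s * wb k x)"
   by (simp add: U_def power_mult_distrib power_divide)
  also have "\<dots> \<le> 1 * (W * real N ^ c / 2 ^ s * wb k x)"
   using W0 p0 lam_pow by (intro mult_right_mono) (auto simp: walk_bound_nonneg)
  finally show "(\<Sum>z\<in>Z m. \<Sum>y\<in>Cl m z. W * (p / 2 ^ s) ^ m / 2 ^ s * wb k x) \<le>
   W * real N ^ c / 2 ^ s * wb k x" unfolding U_def by simp
 qed
 finally have boundN: "prob tables (\<Union>m<L. \<Union>z\<in>Z m. \<Union>y\<in>Cl m z. EN m z y) \<le>
   W * (real L * real N ^ c / 2 ^ s * wb k x)" by (simp add: mult_ac)
 have boundD1: "prob tables (ED m K z) \<le> W * ((p / 2 ^ s) ^ m * wb k (if 0 \<in> K then z 1 else x))"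
  if "m < L" "K \<in> patterns m" "z \<in> ZD m K" for m K z
 proof -
  have z: "fresh s c I z m" "z \<in> PiE {1..Suc m} (\<lambda>_. X)" using that(3) by (auto simp: ZD_def zero_walks_def)
  have zX: "z ` {1..m} \<subseteq> X" using z(2) by auto
  note fn = fresh_new[OF z(1) zX less_imp_le[OF that(1)]]
  have "0 \<in> K \<Longrightarrow> 1 \<le> m" using linked_patterns(7)[OF that(2)] by simp
  then have "(if 0 \<in> K then z 1 else x) \<in> New z m" using st(1) by (auto simp: New_def)
  then have "prob tables (ED m K z) \<le> p ^ card (New z m) / (2 ^ s) ^ card (P \<union> chain_pivots k z m) *
    wb k (if 0 \<in> K then z 1 else x)"
   unfolding ED_def
   using pivoted_chain[OF st(6,5) z(1) finI st(1) kd] fn by (intro IH) (auto simp: New_def)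
  also have "\<dots> = W * ((p / 2 ^ s) ^ m * wb k (if 0 \<in> K then z 1 else x))"
   unfolding fn(2,6) by (simp add: W_def power_add power_divide)
  finally show ?thesis .
 qed
 have fin_zw: "finite (zero_walks s c X x m K)" for m K
  using finX by (intro finite_subset[OF _ finite_PiE[of "{1..Suc m}" "\<lambda>_. X"]]) (auto simp: zero_walks_def)
 have "prob tables (\<Union>m<L. \<Union>K\<in>patterns m. \<Union>z\<in>ZD m K. ED m K z) \<le>
   (\<Sum>m<L. \<Sum>K\<in>patterns m. \<Sum>z\<in>ZD m K. W * ((p / 2 ^ s) ^ m * wb k (if 0 \<in> K then z 1 else x)))"
  using fin_zw by (intro prob_UN_le boundD1 finite_patterns) (auto simp: ZD_def)
 also have "\<dots> \<le> (\<Sum>m<L. \<Sum>K\<in>patterns m. \<Sum>z\<in>zero_walks s c X x m K.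
   W * ((p / 2 ^ s) ^ m * wb k (if 0 \<in> K then z 1 else x)))"
  using fin_zw W0 p0
  by (intro sum_mono sum_mono2 mult_nonneg_nonneg zero_le_power) (auto simp: ZD_def walk_bound_nonneg)
 also have "\<dots> = W * walk_op s c X L p (wb k) x"
  unfolding walk_op_def by (simp add: sum_distrib_left)
 finally have boundD: "prob tables (\<Union>m<L. \<Union>K\<in>patterns m. \<Union>z\<in>ZD m K. ED m K z) \<le>
  W * walk_op s c X L p (wb k) x" .
 have "prob tables (ev x I \<D>) \<le> prob tables (EL \<union>
   (\<Union>m<L. \<Union>z\<in>Z m. \<Union>y\<in>Cl m z. EN m z y) \<union> (\<Union>m<L. \<Union>K\<in>patterns m. \<Union>z\<in>ZD m K. ED m K z))"
  using cover by (intro prob_mono) auto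
 also have "\<dots> \<le> prob tables (EL \<union> (\<Union>m<L. \<Union>z\<in>Z m. \<Union>y\<in>Cl m z. EN m z y)) +
   prob tables (\<Union>m<L. \<Union>K\<in>patterns m. \<Union>z\<in>ZD m K. ED m K z)"
  by (intro measure_Un_le) auto
 also have "\<dots> \<le> (prob tables EL + prob tables (\<Union>m<L. \<Union>z\<in>Z m. \<Union>y\<in>Cl m z. EN m z y)) +
   prob tables (\<Union>m<L. \<Union>K\<in>patterns m. \<Union>z\<in>ZD m K. ED m K z)"
  by (intro add_right_mono measure_Un_le) auto
 also have "\<dots> \<le> W * wb (Suc k) x"
  using boundL boundN boundD by (simp add: algebra_simps)
 finally show ?thesis unfolding W_def .
qed

private lemma even_event_prob:
 assumes "k \<le> D" "x \<in> I" "I \<subseteq> X" "indep s c id I" "card I \<le> 1 + (D - k) * L"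
   "P \<subseteq> I \<times> {2 * k..<d}" "pivoted I d P \<D>"
 shows "prob tables (ev x I \<D>) \<le> p ^ card I / (2 ^ s) ^ card P * wb k x"
 using assms
proof (induction k arbitrary: x I P \<D>)
 case 0
 have "prob tables (ev x I \<D>) \<le>
   prob tables {(T1, T2). I \<subseteq> selected s c d X v T1 T2 \<and> \<D> (dchar s c T1)}"
  by (intro prob_mono) (auto simp: even_event_def)
 also have "\<dots> \<le> p ^ card I / (2 ^ s) ^ card P"
  unfolding p by (rule prob_pivoted_selected[OF 0(4,7,3) X v])
 finally show ?case by simp
next
 case (Suc k)
 show ?case
 proof (rule step[OF _ _ Suc.prems(2,3,4,5) _ Suc.prems(7)])
  show "prob tables (ev x I \<D>) \<le> p ^ card I / (2 ^ s) ^ card P * wb k x"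
   if "x \<in> I" "I \<subseteq> X" "indep s c id I" "card I \<le> 1 + (D - k) * L"
    "P \<subseteq> I \<times> {2 * k..<d}" "pivoted I d P \<D>" for x I P \<D>
   using Suc.prems(1) by (intro Suc.IH[OF _ that]) simp
  show "k < D" using Suc.prems(1) by simp
  show "P \<subseteq> I \<times> {2 * k + 2..<d}" using Suc.prems(6) by simp
 qed
qed

text \<open>A nonempty even set of derived keys is even in the first \<open>2 * D\<close> derived
  positions. The union bound runs over one of its keys, which serves as the first anchor and is
  selected with probability \<open>p\<close>.\<close>

lemma prob_dependent_le_walk_bound:
 "prob tables
   {(T1, T2). \<not> derived_indep s c d T1 (selected s c d X v T1 T2)} \<le>
  (\<Sum>x\<in>X. p * wb D x)"
proof -
 have "{(T1, T2). \<not> derived_indep s c d T1 (selected s c d X v T1 T2)} \<subseteq>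
   (\<Union>x\<in>X. ev x {x} (\<lambda>_. True))"
 proof safe
  fix T1 T2
  let ?Y = "selected s c d X v T1 T2"
  assume n: "\<not> derived_indep s c d T1 ?Y"
  have YX: "?Y \<subseteq> X" by (auto simp: selected_def)
  obtain S where S: "S \<subseteq> ?Y" "S \<noteq> {}" "even_chars s (c + d) (derived s c T1) S"
   using n finite_subset[OF YX finX] by (auto simp: indep_def)
  obtain x where x: "x \<in> S" using S(2) by blast
  have "even (card {y \<in> S. dchar s c T1 y j = a})" if "j < 2 * D" for j a
  proof -
   have "character s (derived s c T1 y) (c + j) = dchar s c T1 y j" if "y \<in> S" for y
    using that S(1) YX X by (subst character_derived_key) (auto simp: dchar_def)
   then have "{y \<in> S. dchar s c T1 y j = a} =
     {y \<in> S. character s (derived s c T1 y) (c + j) = a}" by auto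
   then show ?thesis using S(3) that D unfolding even_chars_def by simp
  qed
  then have "(T1, T2) \<in> ev x {x} (\<lambda>_. True)" using x S(1) unfolding even_event_def by auto
  then show "(T1, T2) \<in> (\<Union>x\<in>X. ev x {x} (\<lambda>_. True))" using x S(1) YX by blast
 qed
 then have "prob tables
   {(T1, T2). \<not> derived_indep s c d T1 (selected s c d X v T1 T2)} \<le>
   prob tables (\<Union>x\<in>X. ev x {x} (\<lambda>_. True))"
  by (intro prob_mono) auto
 also have "\<dots> \<le> (\<Sum>x\<in>X. p * wb D x)"
 proof (rule prob_UN_le[OF finX])
  fix x assume x: "x \<in> X"
  have "indep s c id {x}" unfolding indep_def
  proof (intro conjI allI impI)
   fix S :: "nat set" assume "S \<subseteq> {x}" "S \<noteq> {}"
   then have "S = {x}" by auto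
   moreover have "{y \<in> {x}. character s (id y) 0 = character s x 0} = {x}" by auto
   ultimately show "\<not> even_chars s c id S" using c unfolding even_chars_def
    by (metis card_1_singleton_iff One_nat_def odd_one less_eq_Suc_le)
  qed simp
  then show "prob tables (ev x {x} (\<lambda>_. True)) \<le> p * wb D x"
   using even_event_prob[of D x "{x}" "{}" "\<lambda>_. True"] x by (simp add: pivoted_def)
 qed
 finally show ?thesis .
qed

end

section \<open>The Euclidean norm of the walk operator\<close>

text \<open>Indices inside the vanishing sum contribute norms by \<open>zero_sums_weight\<close>,
  the others are free and contribute plain sums.\<close>

lemma zero_walk_weight:
 fixes w :: "nat \<Rightarrow> nat \<Rightarrow> real"
 assumes X: "X \<subseteq> {..<2 ^ (s * c)}" and J: "J \<subseteq> A" "finite A" and w: "\<And>t x. w t x \<ge> 0"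
 shows "(\<Sum>u\<in>{u \<in> PiE A (\<lambda>_. X). even_chars s c u J}. \<Prod>t\<in>A. w t (u t)) \<le>
  (real (card J) ^ card J) ^ c * (\<Prod>t\<in>J. L2_set (w t) X) * (\<Prod>t\<in>A - J. sum (w t) X)"
proof -
 define w' where "w' t x = (if x \<in> X then w t x else 0)" for t x
 define h where "h = (\<lambda>(z1, z2) t. if t \<in> J then z1 t else z2 t :: nat)"
 let ?U = "{u \<in> PiE A (\<lambda>_. X). even_chars s c u J}"
 let ?P = "zero_sums s c J \<times> PiE (A - J) (\<lambda>_. X)"
 have finX: "finite X" using X finite_subset by blast
 have finJ: "finite J" using J finite_subset by blast
 have w'0: "w' t x \<ge> 0" for t x using w by (simp add: w'_def)
 have sub: "?U \<subseteq> h ` ?P"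
 proof
  fix u assume u: "u \<in> ?U"
  have "{x \<in> J. character s (restrict u J x) i = a} = {x \<in> J. character s (u x) i = a}" for i a by auto
  then have "even_chars s c (restrict u J) J" using u by (simp add: even_chars_def)
  then have "restrict u J \<in> zero_sums s c J" using u X J(1) by (auto simp: zero_sums_def)
  moreover have "restrict u (A - J) \<in> PiE (A - J) (\<lambda>_. X)" using u by auto
  moreover have "u = h (restrict u J, restrict u (A - J))"
   using u J(1) by (auto simp: h_def fun_eq_iff PiE_def extensional_def)
  ultimately show "u \<in> h ` ?P" by blast
 qed
 have finP: "finite ?P" using finX J finJ by (intro finite_cartesian_product finite_zero_sums finite_PiE) auto
 have "(\<Sum>u\<in>?U. \<Prod>t\<in>A. w t (u t)) = (\<Sum>u\<in>?U. \<Prod>t\<in>A. w' t (u t))"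
  by (intro sum.cong prod.cong refl) (auto simp: w'_def)
 also have "\<dots> \<le> (\<Sum>u\<in>h ` ?P. \<Prod>t\<in>A. w' t (u t))"
  using sub finP w'0 by (intro sum_mono2 finite_imageI prod_nonneg) auto
 also have "\<dots> \<le> (\<Sum>q\<in>?P. \<Prod>t\<in>A. w' t (h q t))"
  using finP w'0 by (intro order.trans[OF sum_image_le]) (auto simp: o_def intro!: prod_nonneg)
 also have "\<dots> = (\<Sum>q\<in>?P. (\<Prod>t\<in>J. w' t (fst q t)) * (\<Prod>t\<in>A - J. w' t (snd q t)))"
 proof (rule sum.cong[OF refl])
  fix q
  have "(\<Prod>t\<in>A. w' t (h q t)) = (\<Prod>t\<in>A - J. w' t (h q t)) * (\<Prod>t\<in>J. w' t (h q t))"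
   by (rule prod.subset_diff[OF J])
  also have "(\<Prod>t\<in>A - J. w' t (h q t)) = (\<Prod>t\<in>A - J. w' t (snd q t))"
   by (intro prod.cong) (auto simp: h_def split: prod.splits)
  also have "(\<Prod>t\<in>J. w' t (h q t)) = (\<Prod>t\<in>J. w' t (fst q t))"
   by (intro prod.cong) (auto simp: h_def split: prod.splits)
  finally show "(\<Prod>t\<in>A. w' t (h q t)) = (\<Prod>t\<in>J. w' t (fst q t)) * (\<Prod>t\<in>A - J. w' t (snd q t))"
   by (simp add: mult.commute)
 qed
 also have "\<dots> = (\<Sum>z\<in>zero_sums s c J. \<Prod>t\<in>J. w' t (z t)) * (\<Sum>z\<in>PiE (A - J) (\<lambda>_. X). \<Prod>t\<in>A - J. w' t (z t))"
  by (simp add: sum.cartesian_product' sum_product)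
 also have "(\<Sum>z\<in>PiE (A - J) (\<lambda>_. X). \<Prod>t\<in>A - J. w' t (z t)) = (\<Prod>t\<in>A - J. \<Sum>x\<in>X. w' t x)"
  using J finX by (intro prod_sum_PiE[symmetric]) auto
 also have "\<dots> = (\<Prod>t\<in>A - J. sum (w t) X)" by (intro prod.cong sum.cong) (auto simp: w'_def)
 also have "(\<Sum>z\<in>zero_sums s c J. \<Prod>t\<in>J. w' t (z t)) * (\<Prod>t\<in>A - J. sum (w t) X) \<le>
   ((real (card J) ^ card J) ^ c * (\<Prod>t\<in>J. L2_set (w' t) {..<2 ^ (s * c)})) * (\<Prod>t\<in>A - J. sum (w t) X)"
  using w by (intro mult_right_mono zero_sums_weight finJ w'0 prod_nonneg sum_nonneg) auto
 also have "(\<Prod>t\<in>J. L2_set (w' t) {..<2 ^ (s * c)}) = (\<Prod>t\<in>J. L2_set (w t) X)"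
 proof (rule prod.cong[OF refl])
  fix t
  have "(\<Sum>x<2 ^ (s * c). (w' t x)\<^sup>2) = (\<Sum>x\<in>X. (w' t x)\<^sup>2)"
   using X by (intro sum.mono_neutral_right) (auto simp: w'_def)
  also have "\<dots> = (\<Sum>x\<in>X. (w t x)\<^sup>2)" by (intro sum.cong) (auto simp: w'_def)
  finally show "L2_set (w' t) {..<2 ^ (s * c)} = L2_set (w t) X" by (simp add: L2_set_def)
 qed
 finally show ?thesis .
qed

lemma sum_zero_walks:
 "(\<Sum>x\<in>X. \<Sum>z\<in>zero_walks s c X x m K. F x z) =
  (\<Sum>u\<in>{u \<in> PiE {0..Suc m} (\<lambda>_. X). even_chars s c u (linked m K)}. F (u 0) (restrict u {1..Suc m}))"
 if "finite X" "linked m K \<subseteq> {0..Suc m}" for F :: "nat \<Rightarrow> (nat \<Rightarrow> nat) \<Rightarrow> real"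
proof -
 have fin: "finite (zero_walks s c X x m K)" for x
  using that(1) by (intro finite_subset[OF _ finite_PiE[of "{1..Suc m}" "\<lambda>_. X"]]) (auto simp: zero_walks_def)
 have ev: "even_chars s c u (linked m K) \<longleftrightarrow> even_chars s c u' (linked m K)"
  if "\<And>t. t \<le> Suc m \<Longrightarrow> u t = u' t" for u u'
 proof -
  have "{x \<in> linked m K. character s (u x) i = a} = {x \<in> linked m K. character s (u' x) i = a}" for i a
   using that \<open>linked m K \<subseteq> {0..Suc m}\<close> by auto
  then show ?thesis by (simp add: even_chars_def)
 qed
 have "(\<Sum>x\<in>X. \<Sum>z\<in>zero_walks s c X x m K. F x z) =
  (\<Sum>q\<in>Sigma X (\<lambda>x. zero_walks s c X x m K). F (fst q) (snd q))"
  using that(1) fin by (subst sum.Sigma) (auto simp: split_def)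
 also have "\<dots> = (\<Sum>u\<in>{u \<in> PiE {0..Suc m} (\<lambda>_. X). even_chars s c u (linked m K)}. F (u 0) (restrict u {1..Suc m}))"
 proof (rule sum.reindex_bij_witness[of _ "\<lambda>u. (u 0, restrict u {1..Suc m})" "\<lambda>(x, z). walk x z"])
  fix q assume q: "q \<in> Sigma X (\<lambda>x. zero_walks s c X x m K)"
  obtain x z where qq: "q = (x, z)" by (cases q)
  have z: "z \<in> PiE {1..Suc m} (\<lambda>_. X)" "even_chars s c (walk x z) (linked m K)" and x: "x \<in> X"
   using q by (auto simp: qq zero_walks_def)
  have r: "restrict (walk x z) {1..Suc m} = z"
   using z(1) by (auto simp: fun_eq_iff walk_def PiE_def extensional_def)
  show "(\<lambda>u. (u 0, restrict u {1..Suc m})) (case q of (x, z) \<Rightarrow> walk x z) = q"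
   unfolding qq using r by (simp add: walk_def[of _ _ 0])
  show "(case q of (x, z) \<Rightarrow> walk x z) \<in> {u \<in> PiE {0..Suc m} (\<lambda>_. X). even_chars s c u (linked m K)}"
   using z x unfolding qq by (auto simp: walk_def PiE_def extensional_def Pi_def)
  show "F ((case q of (x, z) \<Rightarrow> walk x z) 0) (restrict (case q of (x, z) \<Rightarrow> walk x z) {1..Suc m}) = F (fst q) (snd q)"
   unfolding qq using r by (simp add: walk_def[of _ _ 0])
 next
  fix u assume u: "u \<in> {u \<in> PiE {0..Suc m} (\<lambda>_. X). even_chars s c u (linked m K)}"
  have w: "walk (u 0) (restrict u {1..Suc m}) t = u t" for t
   using u by (auto simp: walk_def PiE_def extensional_def)
  then show "(case (u 0, restrict u {1..Suc m}) of (x, z) \<Rightarrow> walk x z) = u" by (simp add: fun_eq_iff del: One_nat_def)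
  have "walk (u 0) (restrict u {1..Suc m}) = u" using w by blast
  then show "(u 0, restrict u {1..Suc m}) \<in> Sigma X (\<lambda>x. zero_walks s c X x m K)"
   using u by (auto simp: zero_walks_def simp del: One_nat_def)
 qed
 finally show ?thesis .
qed

text \<open>An index of the vanishing sum with weight 1 contributes the square root of
  \<open>card X\<close>, a free one contributes \<open>card X\<close>. Of the
  \<open>2 * card K + 2\<close> indices in the sum, two carry \<open>f\<close> and \<open>g\<close>
  if 0 is in \<open>K\<close>; otherwise the free index 0 carries both, and Cauchy-Schwarz separates
  them. In either case each start in \<open>K\<close> saves a factor \<open>card X\<close> compared
  with \<open>m\<close> free keys.\<close>

lemma pattern_bound:
 fixes f g :: "nat \<Rightarrow> real"
 assumes X: "X \<subseteq> {..<2 ^ (s * c)}" and K: "K \<in> patterns m" and m: "m < L"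
  and f: "\<And>x. f x \<ge> 0" and g: "\<And>x. g x \<ge> 0"
 shows "(\<Sum>x\<in>X. \<Sum>z\<in>zero_walks s c X x m K. f x * g (if 0 \<in> K then z 1 else x)) \<le>
  (real (L + 1) ^ (4 * c)) ^ card K * real (card X) ^ (m - card K) * (L2_set f X * L2_set g X)"
proof -
 note lp = linked_patterns[OF K]
 have finX: "finite X" using X finite_subset by blast
 define J where "J = linked m K"
 define A where "A = {0..Suc m}"
 define T where "T = card J"
 define n where "n = real (card X)"
 have JA: "J \<subseteq> A" "finite A" "finite J" using lp by (auto simp: J_def A_def)
 have T: "T = 2 * card K + 2" using lp by (simp add: T_def J_def)
 have TA: "T \<le> m + 2" using card_mono[OF JA(2,1)] by (simp add: T_def A_def)
 have cAJ: "card (A - J) = m + 2 - T" using card_Diff_subset[OF JA(3,1)] by (simp add: T_def A_def)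
 define w where "w t x = (if 0 \<in> K then (if t = 0 then f x else if t = 1 then g x else 1)
   else (if t = 0 then f x * g x else 1))" for t x :: nat
 have w0: "w t x \<ge> 0" for t x using f g by (simp add: w_def)
 have one: "(\<Prod>t\<in>B. L2_set (\<lambda>_. 1) X) = sqrt n ^ card B" for B :: "nat set"
  by (simp add: L2_set_constant n_def)
 have "(\<Sum>x\<in>X. \<Sum>z\<in>zero_walks s c X x m K. f x * g (if 0 \<in> K then z 1 else x)) =
  (\<Sum>u\<in>{u \<in> PiE A (\<lambda>_. X). even_chars s c u J}. f (u 0) * g (if 0 \<in> K then restrict u {1..Suc m} 1 else u 0))"
  unfolding A_def J_def by (rule sum_zero_walks[OF finX lp(2)])
 also have "\<dots> = (\<Sum>u\<in>{u \<in> PiE A (\<lambda>_. X). even_chars s c u J}. \<Prod>t\<in>A. w t (u t))"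
 proof (rule sum.cong[OF refl])
  fix u
  have "(\<Prod>t\<in>A. w t (u t)) = w 0 (u 0) * w 1 (u 1) * (\<Prod>t\<in>{2..Suc m}. w t (u t))"
   unfolding A_def by (simp add: prod.atLeast_Suc_atMost numeral_2_eq_2 mult.assoc)
  also have "(\<Prod>t\<in>{2..Suc m}. w t (u t)) = 1" by (intro prod.neutral) (auto simp: w_def)
  finally show "f (u 0) * g (if 0 \<in> K then restrict u {1..Suc m} 1 else u 0) = (\<Prod>t\<in>A. w t (u t))"
   by (simp add: w_def)
 qed
 also have "\<dots> \<le> (real T ^ T) ^ c * (\<Prod>t\<in>J. L2_set (w t) X) * (\<Prod>t\<in>A - J. sum (w t) X)"
  unfolding T_def by (rule zero_walk_weight[OF X JA(1,2) w0])
 also have "\<dots> = (real T ^ T) ^ c * ((\<Prod>t\<in>J. L2_set (w t) X) * (\<Prod>t\<in>A - J. sum (w t) X))" by simp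
 also have "(\<Prod>t\<in>J. L2_set (w t) X) * (\<Prod>t\<in>A - J. sum (w t) X) \<le>
   n ^ (m - card K) * (L2_set f X * L2_set g X)"
 proof (cases "0 \<in> K")
  case True
  have J01: "0 \<in> J" "1 \<in> J" using lp(4,5) True by (auto simp: J_def)
  have "(\<Prod>t\<in>J. L2_set (w t) X) = L2_set (w 0) X * (L2_set (w 1) X * (\<Prod>t\<in>J - {0} - {1}. L2_set (w t) X))"
   using J01 JA by (subst prod.remove[of J 0], simp, simp, subst prod.remove[of "J - {0}" 1]) auto
  also have "(\<Prod>t\<in>J - {0} - {1}. L2_set (w t) X) = (\<Prod>t\<in>J - {0} - {1}. L2_set (\<lambda>_. 1) X)"
   using True by (intro prod.cong L2_set_cong refl) (auto simp: w_def)
  also have "\<dots> = sqrt n ^ (2 * card K)" unfolding one using J01 JA T by (simp add: T_def)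
  also have "\<dots> = n ^ card K" by (simp add: power_mult n_def)
  also have "L2_set (w 0) X = L2_set f X" using True by (intro L2_set_cong) (auto simp: w_def)
  also have "L2_set (w 1) X = L2_set g X" using True by (intro L2_set_cong) (auto simp: w_def)
  finally have 1: "(\<Prod>t\<in>J. L2_set (w t) X) = L2_set f X * (L2_set g X * n ^ card K)" .
  have "(\<Prod>t\<in>A - J. sum (w t) X) = (\<Prod>t\<in>A - J. n)"
  proof (rule prod.cong[OF refl])
   fix t assume t: "t \<in> A - J"
   have "t \<noteq> 0" using J01(1) t by (metis DiffD2)
   moreover have "t \<noteq> 1" using J01(2) t by (metis DiffD2)
   ultimately show "sum (w t) X = n" using True by (simp add: w_def n_def)
  qed
  then have 2: "(\<Prod>t\<in>A - J. sum (w t) X) = n ^ (m + 2 - T)" by (simp add: cAJ)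
  have "card K + (m + 2 - T) = m - card K" using T TA by linarith
  then show ?thesis unfolding 1 2 by (simp add: power_add[symmetric] mult_ac)
 next
  case False
  have J0: "0 \<in> A - J" using lp(5) False by (auto simp: J_def A_def)
  have "(\<Prod>t\<in>J. L2_set (w t) X) = (\<Prod>t\<in>J. L2_set (\<lambda>_. 1) X)"
   using J0 False by (intro prod.cong L2_set_cong refl) (auto simp: w_def)
  also have "\<dots> = sqrt n ^ (2 * (card K + 1))" unfolding one using T by (simp add: T_def)
  also have "\<dots> = n ^ (card K + 1)" by (simp only: power_mult) (simp add: n_def)
  finally have 1: "(\<Prod>t\<in>J. L2_set (w t) X) = n ^ (card K + 1)" .
  have "(\<Prod>t\<in>A - J. sum (w t) X) = sum (w 0) X * (\<Prod>t\<in>A - J - {0}. sum (w t) X)"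
   using J0 JA by (intro prod.remove) auto
  also have "(\<Prod>t\<in>A - J - {0}. sum (w t) X) = (\<Prod>t\<in>A - J - {0}. n)"
   using False by (intro prod.cong refl) (auto simp: w_def n_def)
  also have "\<dots> = n ^ (m + 1 - T)" using J0 cAJ by simp
  also have "sum (w 0) X = (\<Sum>x\<in>X. \<bar>f x\<bar> * \<bar>g x\<bar>)" using False f g by (intro sum.cong) (auto simp: w_def)
  finally have 2: "(\<Prod>t\<in>A - J. sum (w t) X) = (\<Sum>x\<in>X. \<bar>f x\<bar> * \<bar>g x\<bar>) * n ^ (m + 1 - T)" .
  have "card (A - J) > 0" using J0 JA by (auto simp: card_gt_0_iff)
  then have e: "card K + 1 + (m + 1 - T) = m - card K" using T TA cAJ by linarith
  have "(\<Prod>t\<in>J. L2_set (w t) X) * (\<Prod>t\<in>A - J. sum (w t) X) = n ^ (m - card K) * (\<Sum>x\<in>X. \<bar>f x\<bar> * \<bar>g x\<bar>)"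
   unfolding 1 2 e[symmetric] by (simp add: power_add mult_ac)
  also have "\<dots> \<le> n ^ (m - card K) * (L2_set f X * L2_set g X)"
   by (intro mult_left_mono L2_set_mult_ineq) (simp add: n_def)
  finally show ?thesis .
 qed
 also have "(real T ^ T) ^ c * (n ^ (m - card K) * (L2_set f X * L2_set g X)) \<le>
  (real (L + 1) ^ (4 * c)) ^ card K * (n ^ (m - card K) * (L2_set f X * L2_set g X))"
 proof (rule mult_right_mono)
  \<comment> \<open>\<open>T\<close> is at most \<open>m + 2\<close>, hence at most
    \<open>L + 1\<close>, and at most \<open>4 * card K\<close> since \<open>K\<close> is nonempty.
    So the combinatorial factor becomes a power of \<open>card K\<close>.\<close>
  have "(real T ^ T) ^ c \<le> (real (L + 1) ^ T) ^ c"
   using TA m by (intro power_mono) auto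
  also have "\<dots> = real (L + 1) ^ (T * c)" by (simp add: power_mult)
  also have "\<dots> \<le> real (L + 1) ^ (4 * c * card K)"
  proof (rule power_increasing)
   have "T \<le> 4 * card K" using T lp(8) by linarith
   then have "T * c \<le> (4 * card K) * c" by (rule mult_le_mono1)
   then show "T * c \<le> 4 * c * card K" by (simp add: mult_ac)
  qed simp
  also have "\<dots> = (real (L + 1) ^ (4 * c)) ^ card K" by (simp add: power_mult)
  finally show "(real T ^ T) ^ c \<le> (real (L + 1) ^ (4 * c)) ^ card K" .
 qed (simp add: n_def)
 finally show ?thesis by (simp add: n_def mult.assoc mult_left_mono)
qed

lemma sum_Pow_power: "finite A \<Longrightarrow> (\<Sum>K\<in>Pow A. (\<beta> :: real) ^ card K) = (1 + \<beta>) ^ card A"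
proof (induction A rule: finite_induct)
 case (insert a A)
 have "(\<Sum>K\<in>Pow (insert a A). \<beta> ^ card K) = (\<Sum>K\<in>Pow A. \<beta> ^ card K) + (\<Sum>K\<in>insert a ` Pow A. \<beta> ^ card K)"
  unfolding Pow_insert using insert by (intro sum.union_disjoint) auto
 also have "(\<Sum>K\<in>insert a ` Pow A. \<beta> ^ card K) = (\<Sum>K\<in>Pow A. \<beta> ^ card (insert a K))"
  using insert by (subst sum.reindex) (auto simp: inj_on_def)
 also have "\<dots> = (\<Sum>K\<in>Pow A. \<beta> * \<beta> ^ card K)"
  using insert finite_subset by (intro sum.cong refl) (subst card_insert_disjoint; auto)
 finally show ?case using insert by (simp add: sum_distrib_left[symmetric] algebra_simps)
qed simp

text \<open>Summing over all nonempty subsets gives (1 + \<beta>)^m - 1, which is linear in \<beta>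
  as long as \<open>L * \<beta>\<close> is at most 1.\<close>

lemma sum_patterns_le:
 assumes "\<beta> \<ge> 0" "real L * \<beta> \<le> 1" "m < L"
 shows "(\<Sum>K\<in>patterns m. \<beta> ^ card K) \<le> 2 * real L * \<beta>"
proof -
 have "(\<Sum>K\<in>patterns m. \<beta> ^ card K) \<le> (\<Sum>K\<in>Pow {..<m} - {{}}. \<beta> ^ card K)"
  using assms(1) by (intro sum_mono2) (auto simp: patterns_def)
 also have "\<dots> = (1 + \<beta>) ^ m - 1" by (subst sum_diff) (auto simp: sum_Pow_power)
 also have "\<dots> \<le> 2 * real L * \<beta>"
 proof -
  have "(1 + \<beta>) ^ m \<le> (1 + \<beta>) ^ L" using assms by (intro power_increasing) auto
  also have "\<dots> \<le> exp \<beta> ^ L" using assms by (intro power_mono) (auto simp: exp_ge_add_one_self)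
  also have "\<dots> = exp (real L * \<beta>)" by (simp add: exp_of_nat_mult)
  also have "\<dots> \<le> 1 + real L * \<beta> + (real L * \<beta>)\<^sup>2" using assms by (intro exp_bound) auto
  also have "(real L * \<beta>)\<^sup>2 \<le> real L * \<beta>"
   using assms by (simp add: power2_eq_square mult_left_le)
  finally show ?thesis by (simp add: mult_ac)
 qed
 finally show ?thesis .
qed

text \<open>Pair the image \<open>f\<close> of \<open>g\<close> with itself. By
  \<open>pattern_bound\<close> the pairing is at most a constant times the norms of \<open>f\<close>
  and \<open>g\<close>; divide by the norm of \<open>f\<close>. The constant is small because every
  pattern has at least one start and each start gives a factor \<beta>.\<close>

lemma walk_op_norm:
 assumes X: "X \<subseteq> {..<2 ^ (s * c)}" and p: "0 < p" "p \<le> 1" and lam: "real (card X) * p \<le> 2 ^ s"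
  and g: "\<And>x. g x \<ge> 0" and \<beta>: "\<beta> = real (L + 1) ^ (4 * c) / 2 ^ s" "real L * \<beta> \<le> 1"
 shows "L2_set (walk_op s c X L p g) X \<le> 2 * (real L)\<^sup>2 * \<beta> * L2_set g X"
proof -
 define f where "f = walk_op s c X L p g"
 define R where "R = L2_set f X * L2_set g X"
 have R0: "R \<ge> 0" by (simp add: R_def)
 have f0: "f x \<ge> 0" for x unfolding f_def using p g by (intro walk_op_nonneg) auto
 have b0: "\<beta> \<ge> 0" by (simp add: \<beta>)
 have one: "(\<Sum>x\<in>X. \<Sum>z\<in>zero_walks s c X x m K. (p / 2 ^ s) ^ m * (f x * g (if 0 \<in> K then z 1 else x))) \<le> \<beta> ^ card K * R"
  if m: "m < L" and K: "K \<in> patterns m" for m K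
 proof -
  define k where "k = card K"
  have km: "k \<le> m"
  proof -
   have "K \<subseteq> {..<m}" using K by (auto simp: patterns_def)
   then show ?thesis unfolding k_def using card_mono[of "{..<m}" K] by simp
  qed
  have "(\<Sum>x\<in>X. \<Sum>z\<in>zero_walks s c X x m K. (p / 2 ^ s) ^ m * (f x * g (if 0 \<in> K then z 1 else x))) =
   (p / 2 ^ s) ^ m * (\<Sum>x\<in>X. \<Sum>z\<in>zero_walks s c X x m K. f x * g (if 0 \<in> K then z 1 else x))"
   by (simp add: sum_distrib_left)
  also have "\<dots> \<le> (p / 2 ^ s) ^ m * ((real (L + 1) ^ (4 * c)) ^ k * real (card X) ^ (m - k) * R)"
   unfolding R_def k_def using p by (intro mult_left_mono pattern_bound[OF X K m f0 g]) auto
  \<comment> \<open>Only \<open>m - k\<close> of the \<open>m\<close> factors meet a factor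
    \<open>card X\<close>; the other \<open>k\<close> provide the denominators of \<beta>^k.\<close>
  also have "(p / 2 ^ s) ^ m * ((real (L + 1) ^ (4 * c)) ^ k * real (card X) ^ (m - k) * R) =
   ((real (card X) * p / 2 ^ s) ^ (m - k) * p ^ k) * (\<beta> ^ k * R)"
  proof -
   have "(p / 2 ^ s) ^ m = (p / 2 ^ s) ^ (m - k) * (p / 2 ^ s) ^ k"
    using km by (simp add: power_add[symmetric])
   then show ?thesis by (simp add: \<beta> power_mult_distrib power_divide mult_ac)
  qed
  also have "\<dots> \<le> (1 * 1) * (\<beta> ^ k * R)"
   using p lam b0 R0 by (intro mult_right_mono mult_mono power_le_one) (auto simp: divide_le_eq)
  finally show ?thesis by (simp add: k_def)
 qed
 have "(L2_set f X)\<^sup>2 = (\<Sum>x\<in>X. f x * f x)" by (simp add: L2_set_def sum_nonneg power2_eq_square)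
 also have "\<dots> = (\<Sum>x\<in>X. \<Sum>m<L. \<Sum>K\<in>patterns m. \<Sum>z\<in>zero_walks s c X x m K.
   (p / 2 ^ s) ^ m * (f x * g (if 0 \<in> K then z 1 else x)))"
  by (subst (2) f_def) (simp add: walk_op_def sum_distrib_left mult_ac)
 also have "\<dots> = (\<Sum>m<L. \<Sum>K\<in>patterns m. \<Sum>x\<in>X. \<Sum>z\<in>zero_walks s c X x m K.
   (p / 2 ^ s) ^ m * (f x * g (if 0 \<in> K then z 1 else x)))"
  by (subst sum.swap) (intro sum.cong refl sum.swap)
 also have "\<dots> \<le> (\<Sum>m<L. \<Sum>K\<in>patterns m. \<beta> ^ card K * R)"
  by (intro sum_mono one) auto
 also have "\<dots> = (\<Sum>m<L. (\<Sum>K\<in>patterns m. \<beta> ^ card K)) * R"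
  by (simp add: sum_distrib_right)
 also have "\<dots> \<le> (\<Sum>m<L. 2 * real L * \<beta>) * R"
  using R0 \<beta>(2) b0 by (intro mult_right_mono sum_mono sum_patterns_le) auto
 finally have *: "(L2_set f X)\<^sup>2 \<le> 2 * (real L)\<^sup>2 * \<beta> * L2_set g X * L2_set f X"
  by (simp add: R_def power2_eq_square mult_ac)
 show ?thesis
 proof (cases "L2_set f X = 0")
  case True
  then show ?thesis using b0 by (simp add: f_def[symmetric])
 next
  case False
  then have "L2_set f X > 0" by (simp add: less_le)
  then show ?thesis using * unfolding f_def[symmetric] power2_eq_square by (simp add: mult_le_cancel_right)
 qed
qed

text \<open>By the triangle inequality a round multiplies the norm by at most \<nu>, which combines
  the first two terms of the recursion, and adds the constant term of the long walks.\<close>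

lemma walk_bound_norm:
 assumes X: "X \<subseteq> {..<2 ^ (s * c)}" and p: "0 < p" "p \<le> 1" and lam: "real (card X) * p \<le> 2 ^ s"
  and \<nu>: "\<nu> = (real L * real N ^ c + 2 * (real L)\<^sup>2 * real (L + 1) ^ (4 * c)) / 2 ^ s" "\<nu> \<le> 1"
 shows "L2_set (walk_bound s c X L N p k) X \<le>
  sqrt (real (card X)) * (\<nu> ^ k + real k * (real (card X) * p / 2 ^ s) ^ L)"
proof -
 define \<beta> where "\<beta> = real (L + 1) ^ (4 * c) / 2 ^ s"
 define lb where "lb = (real (card X) * p / 2 ^ s) ^ L"
 have b0: "\<beta> \<ge> 0" and nu0: "\<nu> \<ge> 0" and l0: "lb \<ge> 0" using p by (simp_all add: \<beta>_def \<nu> lb_def)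
 have nub: "\<nu> = real L * real N ^ c / 2 ^ s + 2 * (real L)\<^sup>2 * \<beta>" by (simp add: \<nu>(1) \<beta>_def add_divide_distrib)
 have Lb: "real L * \<beta> \<le> 1"
 proof -
  have "real L * \<beta> \<le> 2 * (real L)\<^sup>2 * \<beta>"
   using b0 by (intro mult_right_mono) (cases L; auto simp: power2_eq_square algebra_simps)+
  also have "\<dots> \<le> \<nu>" unfolding nub by simp
  finally show ?thesis using \<nu>(2) by simp
 qed
 show ?thesis
 proof (induction k)
  case 0
  then show ?case by (simp add: L2_set_constant)
 next
  case (Suc k)
  define w where "w = walk_bound s c X L N p k"
  have w0: "w x \<ge> 0" for x unfolding w_def using p by (intro walk_bound_nonneg) auto
  have "L2_set (walk_bound s c X L N p (Suc k)) X =
   L2_set (\<lambda>x. (real L * real N ^ c / 2 ^ s * w x + walk_op s c X L p w x) + lb) X"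
   by (intro L2_set_cong) (simp_all add: w_def lb_def)
  also have "\<dots> \<le> L2_set (\<lambda>x. real L * real N ^ c / 2 ^ s * w x + walk_op s c X L p w x) X + L2_set (\<lambda>_. lb) X"
   by (rule L2_set_triangle_ineq)
  also have "\<dots> \<le> (L2_set (\<lambda>x. real L * real N ^ c / 2 ^ s * w x) X + L2_set (walk_op s c X L p w) X) + L2_set (\<lambda>_. lb) X"
   by (intro add_right_mono L2_set_triangle_ineq)
  also have "L2_set (\<lambda>x. real L * real N ^ c / 2 ^ s * w x) X = real L * real N ^ c / 2 ^ s * L2_set w X"
   by (rule L2_set_right_distrib[symmetric]) simp
  also have "L2_set (\<lambda>_. lb) X = sqrt (real (card X)) * lb" using l0 by (simp add: L2_set_constant)
  also have "real L * real N ^ c / 2 ^ s * L2_set w X + L2_set (walk_op s c X L p w) X + sqrt (real (card X)) * lb \<le>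
   real L * real N ^ c / 2 ^ s * L2_set w X + 2 * (real L)\<^sup>2 * \<beta> * L2_set w X + sqrt (real (card X)) * lb"
   by (intro add_right_mono add_left_mono walk_op_norm[OF X p lam w0 \<beta>_def Lb])
  also have "\<dots> = \<nu> * L2_set w X + sqrt (real (card X)) * lb" unfolding nub by (simp add: algebra_simps)
  also have "\<dots> \<le> \<nu> * (sqrt (real (card X)) * (\<nu> ^ k + real k * lb)) + sqrt (real (card X)) * lb"
   using Suc.IH nu0 unfolding w_def lb_def by (intro add_right_mono mult_left_mono)
  also have "\<dots> = sqrt (real (card X)) * (\<nu> ^ Suc k + (\<nu> * (real k * lb) + lb))" by (simp add: algebra_simps)
  also have "\<dots> \<le> sqrt (real (card X)) * (\<nu> ^ Suc k + (1 * (real k * lb) + lb))"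
   using \<nu>(2) l0 by (intro mult_left_mono add_left_mono add_right_mono mult_right_mono) auto
  finally show ?case by (simp add: algebra_simps lb_def)
 qed
qed

section \<open>The probability that selected derived keys are dependent\<close>

text \<open>Cauchy-Schwarz turns the sum over anchors into the norm of \<open>walk_bound\<close>.
  The two square roots of \<open>card X\<close> and the factor \<open>p\<close> combine to the
  expected number of selected keys, which is at most |\<Sigma>|.\<close>

lemma prob_dependent_explicit:
 fixes D L :: nat
 assumes X: "X \<subseteq> {..<2 ^ (s * c)}" and v: "v < 2 ^ b" and c: "c \<ge> 1" and D: "2 * D \<le> d"
  and lam: "real (card X) \<le> 3 / 4 * 2 ^ s * 2 ^ b"
  and \<nu>: "\<nu> = (real L * real (1 + D * L) ^ c + 2 * (real L)\<^sup>2 * real (L + 1) ^ (4 * c)) / 2 ^ s" "\<nu> \<le> 1"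
 shows "prob (table_pair s c d b)
   {(T1, T2). \<not> derived_indep s c d T1 (selected s c d X v T1 T2)} \<le>
   2 ^ s * (\<nu> ^ D + real D * (3 / 4) ^ L)"
proof -
 define p :: real where "p = 1 / 2 ^ b"
 define n where "n = real (card X)"
 define W where "W = walk_bound s c X L (1 + D * L) p D"
 have p: "0 < p" "p \<le> 1" by (simp_all add: p_def)
 have np: "n * p \<le> 3 / 4 * 2 ^ s" using lam by (simp add: p_def n_def field_simps)
 have nps: "n * p \<le> 2 ^ s" by (rule order.trans[OF np]) simp
 have lam': "(n * p / 2 ^ s) ^ L \<le> (3 / 4) ^ L"
  using np p by (intro power_mono) (auto simp: divide_le_eq n_def)
 have nu0: "\<nu> \<ge> 0" by (simp add: \<nu>)
 have "prob (table_pair s c d b)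
   {(T1, T2). \<not> derived_indep s c d T1 (selected s c d X v T1 T2)} \<le>
   (\<Sum>x\<in>X. p * W x)"
  unfolding W_def using nps
  by (intro prob_dependent_le_walk_bound[OF X v c D p_def _ refl]) (simp add: n_def)
 also have "\<dots> = p * (\<Sum>x\<in>X. \<bar>1\<bar> * \<bar>W x\<bar>)"
  using p by (simp add: sum_distrib_left W_def walk_bound_nonneg)
 also have "\<dots> \<le> p * (L2_set (\<lambda>_. 1) X * L2_set W X)"
  using p by (intro mult_left_mono L2_set_mult_ineq) auto
 also have "\<dots> \<le> p * (L2_set (\<lambda>_. 1) X * (sqrt n * (\<nu> ^ D + real D * (n * p / 2 ^ s) ^ L)))"
  unfolding W_def n_def using p nps
  by (intro mult_left_mono walk_bound_norm[OF X p _ \<nu>]) (auto simp: n_def)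
 also have "\<dots> = n * p * (\<nu> ^ D + real D * (n * p / 2 ^ s) ^ L)"
  by (simp add: L2_set_constant n_def)
 also have "\<dots> \<le> 2 ^ s * (\<nu> ^ D + real D * (3 / 4) ^ L)"
  using nps lam' nu0 p by (intro mult_mono add_left_mono mult_left_mono) (auto simp: n_def)
 finally show ?thesis .
qed

text \<open>Walks are limited to \<open>L = 3 * D * s\<close> steps: as (3/4)^3 <= 1/2, long walks
  have probability at most 2^(-sD), while \<nu> is still a polynomial in \<open>s\<close> divided by
  2^s.\<close>

theorem prob_dependent:
 fixes c d D :: nat
 assumes c: "c \<ge> 1" and D: "2 * D \<le> d"
 shows "\<exists>K e s0. \<forall>s\<ge>s0. \<forall>X b v. X \<subseteq> {..<2 ^ (s * c)} \<longrightarrow> v < 2 ^ b \<longrightarrow>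
  real (card X) \<le> 3 / 4 * 2 ^ s * 2 ^ b \<longrightarrow>
  prob (table_pair s c d b)
   {(T1, T2). \<not> derived_indep s c d T1 (selected s c d X v T1 T2)} \<le>
   K * real s ^ e * 2 ^ s / (2 ^ s) ^ D"
proof -
 define q where "q s = real (3 * D * s) * real (1 + D * (3 * D * s)) ^ c +
  2 * (real (3 * D * s))\<^sup>2 * real (3 * D * s + 1) ^ (4 * c)" for s :: nat
 define C where "C = real (3 * D) * real (1 + 3 * D * D) ^ c + 2 * (real (3 * D))\<^sup>2 * real (3 * D + 1) ^ (4 * c)"
 define e where "e = 4 * c + 2"
 have C0: "C \<ge> 0" by (simp add: C_def)
 have q: "q s \<le> C * real s ^ e" if s: "s \<ge> 1" for s
 proof -
  have "1 + D * (3 * D * s) \<le> (1 + 3 * D * D) * s"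
  proof -
   have "(1 + 3 * D * D) * s = s + D * (3 * D * s)" by (simp add: algebra_simps)
   then show ?thesis using s by simp
  qed
  then have "real (1 + D * (3 * D * s)) \<le> real (1 + 3 * D * D) * real s"
   by (simp only: of_nat_mult[symmetric] of_nat_le_iff)
  then have "real (1 + D * (3 * D * s)) ^ c \<le> (real (1 + 3 * D * D) * real s) ^ c"
   by (rule power_mono) (rule of_nat_0_le_iff)
  then have "real (3 * D * s) * real (1 + D * (3 * D * s)) ^ c \<le>
    real (3 * D * s) * (real (1 + 3 * D * D) * real s) ^ c" by (intro mult_left_mono) auto
  also have "\<dots> = real (3 * D) * real (1 + 3 * D * D) ^ c * real s ^ (c + 1)"
   by (simp add: power_mult_distrib mult_ac)
  also have "\<dots> \<le> real (3 * D) * real (1 + 3 * D * D) ^ c * real s ^ e"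
   using s by (intro mult_left_mono power_increasing) (auto simp: e_def)
  finally have 1: "real (3 * D * s) * real (1 + D * (3 * D * s)) ^ c \<le> \<dots>" .
  have "3 * D * s + 1 \<le> (3 * D + 1) * s" using s by simp
  then have "real (3 * D * s + 1) \<le> real (3 * D + 1) * real s"
   by (simp only: of_nat_mult[symmetric] of_nat_le_iff)
  then have "real (3 * D * s + 1) ^ (4 * c) \<le> (real (3 * D + 1) * real s) ^ (4 * c)"
   by (rule power_mono) (rule of_nat_0_le_iff)
  then have "2 * (real (3 * D * s))\<^sup>2 * real (3 * D * s + 1) ^ (4 * c) \<le>
   2 * (real (3 * D * s))\<^sup>2 * (real (3 * D + 1) * real s) ^ (4 * c)" by (intro mult_left_mono) auto
  also have "\<dots> = 2 * (real (3 * D))\<^sup>2 * real (3 * D + 1) ^ (4 * c) * real s ^ e"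
   by (simp add: power_mult_distrib e_def power_add power2_eq_square mult_ac)
  finally show ?thesis using 1 unfolding q_def C_def distrib_right by (rule add_mono[rotated])
 qed
 have "eventually (\<lambda>s::nat. C * real s ^ e \<le> 2 ^ s) at_top" by real_asymp
 then obtain s1 where s1: "\<And>s. s \<ge> s1 \<Longrightarrow> C * real s ^ e \<le> 2 ^ s"
  by (auto simp: eventually_at_top_linorder)
 have main: "prob (table_pair s c d b)
   {(T1, T2). \<not> derived_indep s c d T1 (selected s c d X v T1 T2)} \<le>
   (C ^ D + real D) * real s ^ (e * D) * 2 ^ s / (2 ^ s) ^ D"
  if s: "s \<ge> max 1 s1" and X: "X \<subseteq> {..<2 ^ (s * c)}" "v < 2 ^ b" "real (card X) \<le> 3 / 4 * 2 ^ s * 2 ^ b"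
  for s X b v
 proof -
  define \<nu> where "\<nu> = q s / 2 ^ s"
  have qs: "q s \<le> C * real s ^ e" using q s by simp
  have \<nu>1: "\<nu> \<le> 1" using qs s1[of s] s by (simp add: \<nu>_def)
  have q0: "q s \<ge> 0" by (simp add: q_def)
  have "prob (table_pair s c d b)
   {(T1, T2). \<not> derived_indep s c d T1 (selected s c d X v T1 T2)} \<le>
   2 ^ s * (\<nu> ^ D + real D * (3 / 4) ^ (3 * D * s))"
   by (rule prob_dependent_explicit[OF X(1,2) c D X(3) _ \<nu>1]) (simp add: \<nu>_def q_def)
  also have "\<dots> \<le> 2 ^ s * (C ^ D * real s ^ (e * D) / (2 ^ s) ^ D + real D * real s ^ (e * D) / (2 ^ s) ^ D)"
  proof (intro mult_left_mono add_mono)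
   have "\<nu> ^ D \<le> (C * real s ^ e / 2 ^ s) ^ D"
    unfolding \<nu>_def using qs q0 by (intro power_mono divide_right_mono) auto
   also have "\<dots> = C ^ D * real s ^ (e * D) / (2 ^ s) ^ D"
    by (simp add: power_mult_distrib power_divide power_mult)
   finally show "\<nu> ^ D \<le> C ^ D * real s ^ (e * D) / (2 ^ s) ^ D" .
   have "(3 / 4 :: real) ^ (3 * D * s) = ((3 / 4) ^ 3) ^ (D * s)" by (simp add: power_mult[symmetric] mult_ac)
   also have "\<dots> \<le> (1 / 2) ^ (D * s)" by (intro power_mono) (auto simp: power3_eq_cube)
   also have "\<dots> = 1 / (2 ^ s) ^ D" by (simp add: power_divide power_mult[symmetric] mult_ac)
   also have "\<dots> \<le> real s ^ (e * D) / (2 ^ s) ^ D"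
    using s by (intro divide_right_mono one_le_power) auto
   finally have "(3 / 4 :: real) ^ (3 * D * s) \<le> real s ^ (e * D) / (2 ^ s) ^ D" .
   from mult_left_mono[OF this, of "real D"]
   show "real D * (3 / 4) ^ (3 * D * s) \<le> real D * real s ^ (e * D) / (2 ^ s) ^ D" by simp
  qed auto
  also have "\<dots> = (C ^ D + real D) * real s ^ (e * D) * 2 ^ s / (2 ^ s) ^ D" by (simp add: field_simps)
  finally show ?thesis .
 qed
 show ?thesis
  by (rule exI[of _ "C ^ D + real D"], rule exI[of _ "e * D"], rule exI[of _ "max 1 s1"],
    intro allI impI, rule main, assumption+)
qed

section \<open>Weak concentration for simple tabulation\<close>

lemma expectation_const_indicator:
 "expect M (\<lambda>x. k + indicator B x) = k + prob M B" for k :: real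
 by (subst Bochner_Integration.integral_add)
  (auto intro!: measure_pmf.integrable_const_bound[where B = 1])

lemma integrable_const_indicator:
 "integrable (measure_pmf M) (\<lambda>x. k + indicator B x :: real)"
 by (intro Bochner_Integration.integrable_add measure_pmf.integrable_const)
  (auto intro!: measure_pmf.integrable_const_bound[where B = 1])

lemma exp_le_quadratic:
 fixes y :: real
 assumes "\<bar>y\<bar> \<le> 1"
 shows "exp y \<le> 1 + y + y\<^sup>2"
proof (cases "y \<ge> 0")
 case True
 then show ?thesis using assms by (intro exp_bound) auto
next
 case False
 define x where "x = - y"
 have x: "0 < x" "x \<le> 1" using False assms by (auto simp: x_def)
 have q: "0 < 1 + x + x\<^sup>2 / 2" using x by (simp add: add_pos_nonneg)
 \<comment> \<open>For negative arguments, the lower Taylor bound of exp \<open>x\<close> is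
   inverted.\<close>
 have "1 \<le> (1 - x + x\<^sup>2) * (1 + x + x\<^sup>2 / 2)"
 proof -
  have "(1 - x + x\<^sup>2) * (1 + x + x\<^sup>2 / 2) = 1 + x\<^sup>2 / 2 + x ^ 3 / 2 + x ^ 4 / 2"
   by (simp add: field_simps power2_eq_square power3_eq_cube power4_eq_xxxx)
  then show ?thesis using x by simp
 qed
 then have "1 / (1 + x + x\<^sup>2 / 2) \<le> 1 - x + x\<^sup>2" using q by (simp add: divide_le_eq)
 moreover have "exp y = 1 / exp x" by (simp add: x_def exp_minus field_simps)
 moreover have "1 / exp x \<le> 1 / (1 + x + x\<^sup>2 / 2)"
  using q x by (intro divide_left_mono exp_lower_Taylor_quadratic) auto
 ultimately show ?thesis by (simp add: x_def)
qed

text \<open>The exponential Markov inequality, with exp y <= 1 + y + y^2 for |y| <= 1. The parameter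
  \<theta> is left to the applications.\<close>

lemma prob_sum_ge:
 fixes Z :: "'a \<Rightarrow> 'b \<Rightarrow> real"
 assumes fin: "finite A" and finp: "\<And>a. a \<in> A \<Longrightarrow> finite (set_pmf (p a))"
  and mean: "\<And>a. a \<in> A \<Longrightarrow> expect (p a) (Z a) = 0"
  and bd: "\<And>a y. a \<in> A \<Longrightarrow> y \<in> set_pmf (p a) \<Longrightarrow> \<theta> * \<bar>Z a y\<bar> \<le> 1"
  and var: "\<And>a. a \<in> A \<Longrightarrow> expect (p a) (\<lambda>y. (Z a y)\<^sup>2) \<le> V a"
  and \<theta>: "\<theta> \<ge> 0"
 shows "prob (Pi_pmf A dflt p) {f. t \<le> (\<Sum>a\<in>A. Z a (f a))} \<le> exp (\<theta>\<^sup>2 * sum V A - \<theta> * t)"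
proof -
 let ?M = "Pi_pmf A dflt p"
 let ?u = "\<lambda>f. \<Prod>a\<in>A. exp (\<theta> * Z a (f a))"
 have u: "?u f = exp (\<theta> * (\<Sum>a\<in>A. Z a (f a)))" for f
  by (simp add: exp_sum[OF fin, symmetric] sum_distrib_left)
 have finM: "finite (set_pmf ?M)"
  using fin finp by (subst set_Pi_pmf) (auto intro!: finite_PiE_dflt)
 have "prob ?M {f. t \<le> (\<Sum>a\<in>A. Z a (f a))} \<le> prob ?M {f \<in> space (measure_pmf ?M). ?u f \<ge> exp (\<theta> * t)}"
  using \<theta> unfolding u by (intro prob_mono) (auto intro: mult_left_mono)
 also have "\<dots> \<le> expect ?M ?u / exp (\<theta> * t)"
  by (rule integral_Markov_inequality_measure[where A = "{}"])
   (use finM in \<open>auto intro!: integrable_measure_pmf_finite prod_nonneg\<close>)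
 also have "expect ?M ?u = (\<Prod>a\<in>A. expect (p a) (\<lambda>y. exp (\<theta> * Z a y)))"
  using finp by (intro expectation_prod_Pi_pmf fin) (auto intro: integrable_measure_pmf_finite)
 also have "\<dots> \<le> (\<Prod>a\<in>A. exp (\<theta>\<^sup>2 * V a))"
 proof (intro prod_mono conjI)
  fix a assume a: "a \<in> A"
  note i = integrable_measure_pmf_finite[OF finp[OF a]]
  show "0 \<le> expect (p a) (\<lambda>y. exp (\<theta> * Z a y))" by (intro integral_nonneg_AE) auto
  have "expect (p a) (\<lambda>y. exp (\<theta> * Z a y)) \<le>
    expect (p a) (\<lambda>y. 1 + \<theta> * Z a y + (\<theta> * Z a y)\<^sup>2)"
  proof (intro integral_mono_AE i AE_pmfI)
   fix y assume "y \<in> set_pmf (p a)"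
   then show "exp (\<theta> * Z a y) \<le> 1 + \<theta> * Z a y + (\<theta> * Z a y)\<^sup>2"
    using bd[OF a] \<theta> by (intro exp_le_quadratic) (auto simp: abs_mult)
  qed
  also have "\<dots> = 1 + \<theta> * expect (p a) (Z a) + \<theta>\<^sup>2 * expect (p a) (\<lambda>y. (Z a y)\<^sup>2)"
   by (simp add: power_mult_distrib i)
  also have "\<dots> \<le> 1 + \<theta>\<^sup>2 * V a" using mean[OF a] var[OF a] by (simp add: mult_left_mono)
  also have "\<dots> \<le> exp (\<theta>\<^sup>2 * V a)" by (rule exp_ge_add_one_self)
  finally show "expect (p a) (\<lambda>y. exp (\<theta> * Z a y)) \<le> exp (\<theta>\<^sup>2 * V a)" .
 qed
 also have "\<dots> = exp (\<theta>\<^sup>2 * sum V A)" by (simp add: exp_sum[OF fin, symmetric] sum_distrib_left)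
 finally show ?thesis by (simp add: exp_diff divide_right_mono)
qed

lemma prob_abs_sum_ge:
 fixes Z :: "'a \<Rightarrow> 'b \<Rightarrow> real"
 assumes fin: "finite A" and finp: "\<And>a. a \<in> A \<Longrightarrow> finite (set_pmf (p a))"
  and mean: "\<And>a. a \<in> A \<Longrightarrow> expect (p a) (Z a) = 0"
  and bd: "\<And>a y. a \<in> A \<Longrightarrow> y \<in> set_pmf (p a) \<Longrightarrow> \<theta> * \<bar>Z a y\<bar> \<le> 1"
  and var: "\<And>a. a \<in> A \<Longrightarrow> expect (p a) (\<lambda>y. (Z a y)\<^sup>2) \<le> V a"
  and \<theta>: "\<theta> \<ge> 0"
 shows "prob (Pi_pmf A dflt p) {f. t \<le> \<bar>\<Sum>a\<in>A. Z a (f a)\<bar>} \<le> 2 * exp (\<theta>\<^sup>2 * sum V A - \<theta> * t)"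
proof -
 let ?M = "Pi_pmf A dflt p"
 have "prob ?M {f. t \<le> \<bar>\<Sum>a\<in>A. Z a (f a)\<bar>} \<le>
   prob ?M ({f. t \<le> (\<Sum>a\<in>A. Z a (f a))} \<union> {f. t \<le> (\<Sum>a\<in>A. - Z a (f a))})"
  by (intro prob_mono) (auto simp: sum_negf abs_if)
 also have "\<dots> \<le> prob ?M {f. t \<le> (\<Sum>a\<in>A. Z a (f a))} + prob ?M {f. t \<le> (\<Sum>a\<in>A. - Z a (f a))}"
  by (intro measure_Un_le) auto
 also have "\<dots> \<le> exp (\<theta>\<^sup>2 * sum V A - \<theta> * t) + exp (\<theta>\<^sup>2 * sum V A - \<theta> * t)"
  by (intro add_mono prob_sum_ge) (use assms in auto)
 finally show ?thesis by simp
qed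

lemma character_mod: "i < m \<Longrightarrow> character s (x mod 2 ^ (s * m)) i = character s x i"
 using character_add_high[of "x mod 2 ^ (s * m)" s m "x div 2 ^ (s * m)" i] by simp

lemma simple_tab_mod:
 "simple_tab s m T (x mod 2 ^ (s * m)) = simple_tab s m T x"
 unfolding simple_tab_eq_xsum by (intro xorsum.cong) (auto simp: character_mod)

lemma random_tables_Suc:
 "random_tables s (Suc m) r = map_pmf (\<lambda>(T, y). T(m := y))
  (pair_pmf (random_tables s m r) (Pi_pmf {..<2 ^ s} 0 (\<lambda>_. (uniform_bits r))))"
 unfolding random_tables_def lessThan_Suc
 by (subst Pi_pmf_insert, simp, simp, subst pair_commute_pmf) (simp add: map_pmf_comp split_def)

lemma bij_betw_xor:
 fixes v :: nat
 assumes "v < 2 ^ b"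
 shows "bij_betw (\<lambda>y. v XOR y) {..<2 ^ b} {..<2 ^ b}"
 using assms by (intro bij_betwI[where g = "\<lambda>y. v XOR y"])
  (auto intro: xor_less_power simp: xor.assoc[symmetric])

lemma simple_tab_upd:
 "simple_tab s (Suc m) (T(m := y)) x = simple_tab s m T x XOR y (character s x m)"
proof -
 have "simple_tab s m (T(m := y)) x = simple_tab s m T x"
  unfolding simple_tab_eq_xsum by (intro xorsum.cong) auto
 then show ?thesis by simp
qed

text \<open>Weak concentration: conditionally on all tables but the last, the number of keys hashing to
 \<open>v\<close> is a sum over the last characters of independent variables, whose range is controlled by
 the concentration for keys with one character less.\<close>

theorem simple_tab_concentration:
 fixes \<tau> :: real
 assumes "J \<subseteq> {..<2 ^ (s * m)}" "v < 2 ^ b" "\<tau> \<ge> 1"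
 shows "prob (random_tables s m b)
   {T. \<bar>real (card {x \<in> J. simple_tab s m T x = v}) - real (card J) / 2 ^ b\<bar> >
    (sqrt (real (card J) / 2 ^ b) + 1) * (2 * \<tau>) ^ m} \<le>
   real m * (2 ^ s * 2 ^ b) ^ m * 2 * exp (1 - \<tau>)"
 using assms
proof (induction m arbitrary: J v)
 case 0
 then have "J \<subseteq> {0}" by auto
 then have "J = {} \<or> J = {0}" by auto
 moreover have "{x. x = (0::nat) \<and> v = 0} = (if v = 0 then {0} else {})" by auto
 moreover have "0 \<le> 1 / (2::real) ^ b" "1 / (2::real) ^ b \<le> 1" by (simp_all add: divide_le_eq)
 ultimately have "\<bar>real (card {x \<in> J. (0::nat) = v}) - real (card J) / 2 ^ b\<bar> \<le> 1"
  by (cases "v = 0") auto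
 moreover have "0 \<le> sqrt (real (card J) / 2 ^ b)" by simp
 moreover have "(sqrt (real (card J) / 2 ^ b) + 1) * (2 * \<tau>) ^ 0 = sqrt (real (card J) / 2 ^ b) + 1" by simp
 ultimately have "\<not> \<bar>real (card {x \<in> J. (0::nat) = v}) - real (card J) / 2 ^ b\<bar> >
   (sqrt (real (card J) / 2 ^ b) + 1) * (2 * \<tau>) ^ 0" by linarith
 then have "{T :: nat \<Rightarrow> nat \<Rightarrow> nat. \<bar>real (card {x \<in> J. simple_tab s 0 T x = v}) - real (card J) / 2 ^ b\<bar> >
    (sqrt (real (card J) / 2 ^ b) + 1) * (2 * \<tau>) ^ 0} = {}" unfolding simple_tab.simps by blast
 then show ?case by (simp only: measure_empty)
next
 case (Suc m)
 define A where "A = (2 * \<tau>) ^ m"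
 define p :: real where "p = 1 / 2 ^ b"
 define E where "E = real m * (2 ^ s * 2 ^ b) ^ m * 2 * exp (1 - \<tau>)"
 define n where "n = real (card J)"
 define Ja where "Ja a = {x \<in> J. character s x m = a}" for a
 define na where "na a = real (card (Ja a))" for a
 define N where "N T a w = real (card {x \<in> Ja a. simple_tab s m T x = w})" for T a w
 define Bad where "Bad a w = {T. \<bar>N T a w - na a * p\<bar> > (sqrt (na a * p) + 1) * A}" for a w
 define M where "M = (sqrt (n * p) + 1) * A"
 let ?R = "Pi_pmf {..<2 ^ s} 0 (\<lambda>_. (uniform_bits b))"
 have finJ: "finite J" using Suc.prems(1) finite_subset by blast
 have A1: "A \<ge> 1" unfolding A_def using Suc.prems(3) by (intro one_le_power) auto
 have p0: "p > 0" by (simp add: p_def)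
 have na_le: "na a \<le> n" for a unfolding na_def n_def Ja_def using finJ by (intro of_nat_mono card_mono) auto
 have sum_na: "(\<Sum>a<2 ^ s. na a) = n"
 proof -
  have "J = (\<Union>a\<in>{..<2 ^ s}. Ja a)" by (auto simp: Ja_def character_less)
  then have "card J = (\<Sum>a<2 ^ s. card (Ja a))"
   using finJ by (subst (1) \<open>J = _\<close>) (intro card_UN_disjoint, auto simp: Ja_def)
  then show ?thesis by (simp add: na_def n_def)
 qed
 \<comment> \<open>Among keys with the same last character, dropping this character is injective, so
   the induction hypothesis applies to the shortened keys.\<close>
 have bad: "prob (random_tables s m b) (Bad a w) \<le> E" if "w < 2 ^ b" for a w
 proof -
  let ?f = "\<lambda>x. x mod 2 ^ (s * m)"
  have inj: "inj_on ?f (Ja a)"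
  proof (rule inj_onI)
   fix x y assume *: "x \<in> Ja a" "y \<in> Ja a" "?f x = ?f y"
   have "character s x i = character s y i" if "i < Suc m" for i
   proof (cases "i < m")
    case True
    then show ?thesis using *(3) by (metis character_mod)
   next
    case False
    then show ?thesis using that * by (simp add: Ja_def less_Suc_eq)
   qed
   then show "x = y" using * Suc.prems(1) by (intro character_ext[of x s "Suc m" y]) (auto simp: Ja_def)
  qed
  have c1: "card (?f ` Ja a) = card (Ja a)" by (rule card_image[OF inj])
  have c2: "card {x \<in> ?f ` Ja a. simple_tab s m T x = w} = card {x \<in> Ja a. simple_tab s m T x = w}" for T
  proof -
   have "{x \<in> ?f ` Ja a. simple_tab s m T x = w} = ?f ` {x \<in> Ja a. simple_tab s m T x = w}"
    by (auto simp: simple_tab_mod)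
   then show ?thesis by (simp add: card_image[OF inj_on_subset[OF inj]])
  qed
  have "?f ` Ja a \<subseteq> {..<2 ^ (s * m)}" by auto
  from Suc.IH[OF this that Suc.prems(3)] show ?thesis
   unfolding c1 c2 Bad_def N_def na_def A_def E_def p_def by simp
 qed
 have cond: "prob ?R {y. \<bar>real (card {x \<in> J. simple_tab s (Suc m) (T(m := y)) x = v}) - n * p\<bar> >
   (sqrt (n * p) + 1) * (2 * \<tau>) ^ Suc m} \<le> 2 * exp (1 - \<tau>)"
  if T: "T \<in> table_set s m b" and good: "\<And>a w. a < 2 ^ s \<Longrightarrow> w < 2 ^ b \<Longrightarrow> T \<notin> Bad a w" for T
 proof -
  define Z where "Z a y = N T a (v XOR y) - na a * p" for a y
  have dev: "\<bar>N T a w - na a * p\<bar> \<le> (sqrt (na a * p) + 1) * A" if "a < 2 ^ s" "w < 2 ^ b" for a w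
   using good[OF that] by (simp add: Bad_def not_less)
  have cnt: "real (card {x \<in> J. simple_tab s (Suc m) (T(m := y)) x = v}) - n * p = (\<Sum>a<2 ^ s. Z a (y a))" for y
  proof -
   have xe: "(t XOR u = v) = (t = v XOR u)" for t u :: nat
    by (metis xor.assoc xor.right_neutral xor_self_eq)
   have "{x \<in> J. simple_tab s (Suc m) (T(m := y)) x = v} =
     (\<Union>a\<in>{..<2 ^ s}. {x \<in> Ja a. simple_tab s m T x = v XOR y a})"
    unfolding simple_tab_upd xe by (auto simp: Ja_def character_less)
   then have "card {x \<in> J. simple_tab s (Suc m) (T(m := y)) x = v} =
     (\<Sum>a<2 ^ s. card {x \<in> Ja a. simple_tab s m T x = v XOR y a})"
    using finJ by (simp only:) (intro card_UN_disjoint, auto simp: Ja_def)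
   then show ?thesis
    by (simp add: Z_def N_def sum_subtractf sum_distrib_right[symmetric] sum_na)
  qed
  have U: "expect (uniform_bits b) h = p * (\<Sum>y<2 ^ b. h y)" for h :: "nat \<Rightarrow> real"
   by (subst integral_pmf_of_set) (auto simp: lessThan_empty_iff p_def)
  have sumN: "(\<Sum>y<2 ^ b. N T a (v XOR y)) = na a" for a
  proof -
   have "(\<Sum>y<2 ^ b. N T a (v XOR y)) = (\<Sum>w<2 ^ b. N T a w)"
    by (rule sum.reindex_bij_betw[OF bij_betw_xor[OF Suc.prems(2)]])
   also have "\<dots> = na a"
   proof -
    have "Ja a = (\<Union>w\<in>{..<2 ^ b}. {x \<in> Ja a. simple_tab s m T x = w})"
     using T simple_tab_less[of T b s m] by (auto simp: table_set_iff)
    then have "card (Ja a) = card (\<Union>w\<in>{..<2 ^ b}. {x \<in> Ja a. simple_tab s m T x = w})" by (rule arg_cong)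
    also have "\<dots> = (\<Sum>w<2 ^ b. card {x \<in> Ja a. simple_tab s m T x = w})"
     using finJ by (intro card_UN_disjoint) (auto simp: Ja_def)
    finally show ?thesis by (simp add: N_def na_def)
   qed
   finally show ?thesis .
  qed
  have mean: "expect (uniform_bits b) (Z a) = 0" for a
   unfolding U Z_def sum_subtractf sumN by (simp add: p_def)
  have sq: "sqrt (na a * p) \<le> sqrt (n * p)" for a
   using na_le p0 by (intro real_sqrt_le_mono mult_right_mono) auto
  have bd: "\<bar>Z a y\<bar> \<le> M" if "a < 2 ^ s" "y < 2 ^ b" for a y
  proof -
   have "\<bar>Z a y\<bar> \<le> (sqrt (na a * p) + 1) * A"
    unfolding Z_def using that Suc.prems(2) by (intro dev xor_less_power) auto
   also have "\<dots> \<le> M" unfolding M_def using sq A1 by (intro mult_right_mono) auto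
   finally show ?thesis .
  qed
  \<comment> \<open>For a mean of at least 1 the range of \<open>Z a\<close> bounds the variance
    well enough. For a smaller mean the variance has to be proportional to it; there the counts are
    at most \<open>3 * A\<close>, so the second moment is at most \<open>3 * A\<close> times the
    mean.\<close>
  have var: "expect (uniform_bits b) (\<lambda>y. (Z a y)\<^sup>2) \<le> 4 * A\<^sup>2 * (na a * p)"
   if a: "a < 2 ^ s" for a
  proof (cases "na a * p \<ge> 1")
   case True
   have "(Z a y)\<^sup>2 \<le> 4 * A\<^sup>2 * (na a * p)" if "y < 2 ^ b" for y
   proof -
    have "\<bar>Z a y\<bar> \<le> (sqrt (na a * p) + 1) * A"
     unfolding Z_def using that a Suc.prems(2) by (intro dev xor_less_power) auto
    also have "\<dots> \<le> (sqrt (na a * p) + sqrt (na a * p)) * A"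
     using True A1 by (intro mult_right_mono add_left_mono) (auto simp: real_le_rsqrt)
    finally have "\<bar>Z a y\<bar> \<le> 2 * A * sqrt (na a * p)" by (simp add: mult_ac)
    then have "\<bar>Z a y\<bar>\<^sup>2 \<le> (2 * A * sqrt (na a * p))\<^sup>2" by (intro power_mono) auto
    also have "\<dots> = 4 * A\<^sup>2 * (na a * p)" using True by (simp add: power_mult_distrib)
    finally show ?thesis by simp
   qed
   then show ?thesis by (intro expectation_bounds(1)[where l = 0]) (auto simp: lessThan_empty_iff)
  next
   case False
   have ge: "na a * p \<ge> 0" using p0 by (simp add: na_def)
   have Nb: "N T a w \<le> 3 * A" if "w < 2 ^ b" for w
   proof -
    have "sqrt (na a * p) \<le> 1" using False by simp
    then have "(sqrt (na a * p) + 1) * A \<le> 2 * A" using A1 by (intro mult_right_mono) auto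
    then show ?thesis using abs_le_D1[OF dev[OF a that]] False A1 by linarith
   qed
   have "expect (uniform_bits b) (\<lambda>y. (Z a y)\<^sup>2) =
    p * (\<Sum>y<2 ^ b. (N T a (v XOR y))\<^sup>2 - 2 * (na a * p) * N T a (v XOR y) + (na a * p)\<^sup>2)"
    unfolding U Z_def by (simp add: power2_diff algebra_simps)
   also have "\<dots> = p * (\<Sum>y<2 ^ b. (N T a (v XOR y))\<^sup>2) - (na a * p)\<^sup>2"
    unfolding sum.distrib sum_subtractf sum_distrib_left[symmetric] sumN
    by (simp add: p_def power2_eq_square field_simps)
   also have "\<dots> \<le> p * (\<Sum>y<2 ^ b. 3 * A * N T a (v XOR y))"
   proof -
    have "(\<Sum>y<2 ^ b. (N T a (v XOR y))\<^sup>2) \<le> (\<Sum>y<2 ^ b. 3 * A * N T a (v XOR y))"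
     unfolding power2_eq_square using Suc.prems(2)
     by (intro sum_mono mult_right_mono Nb xor_less_power) (auto simp: N_def)
    then have "p * (\<Sum>y<2 ^ b. (N T a (v XOR y))\<^sup>2) \<le> p * (\<Sum>y<2 ^ b. 3 * A * N T a (v XOR y))"
     using p0 by (intro mult_left_mono) auto
    then show ?thesis by (smt (verit) zero_le_power2)
   qed
   also have "\<dots> = 3 * A * (na a * p)" unfolding sum_distrib_left[symmetric] sumN by simp
   also have "\<dots> \<le> 4 * A\<^sup>2 * (na a * p)"
    using A1 ge by (intro mult_right_mono) (auto simp: power2_eq_square)
   finally show ?thesis .
  qed
  \<comment> \<open>With this choice the quadratic term of the exponent is at most 1 and the linear
    term equals \<tau>.\<close>
  define \<theta> where "\<theta> = 1 / (2 * M)"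
  have np0: "n * p \<ge> 0" using p0 by (simp add: n_def)
  have M1: "M \<ge> 1" unfolding M_def using A1 np0
   by (metis add_increasing mult_ge1_I order_refl real_sqrt_ge_0_iff)
  have "prob ?R {y. (sqrt (n * p) + 1) * (2 * \<tau>) ^ Suc m \<le> \<bar>\<Sum>a<2 ^ s. Z a (y a)\<bar>} \<le>
   2 * exp (\<theta>\<^sup>2 * (\<Sum>a<2 ^ s. 4 * A\<^sup>2 * (na a * p)) - \<theta> * ((sqrt (n * p) + 1) * (2 * \<tau>) ^ Suc m))"
  proof (rule prob_abs_sum_ge)
   fix a y assume "a \<in> {..<2 ^ s :: nat}" "y \<in> set_pmf (uniform_bits b)"
   then have "\<bar>Z a y\<bar> \<le> M" by (intro bd) (auto simp: lessThan_empty_iff)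
   then show "\<theta> * \<bar>Z a y\<bar> \<le> 1" using M1 by (simp add: \<theta>_def field_simps)
  qed (use mean var M1 in \<open>auto simp: \<theta>_def lessThan_empty_iff\<close>)
  also have "\<dots> \<le> 2 * exp (1 - \<tau>)"
  proof -
   have eq: "(sqrt (n * p) + 1) * (2 * \<tau>) ^ Suc m = 2 * \<tau> * M" by (simp add: M_def A_def)
   have 1: "\<theta> * ((sqrt (n * p) + 1) * (2 * \<tau>) ^ Suc m) = \<tau>"
    unfolding eq using M1 by (simp add: \<theta>_def)
   have "(\<Sum>a<2 ^ s. 4 * A\<^sup>2 * (na a * p)) = 4 * A\<^sup>2 * (n * p)"
    by (simp add: sum_distrib_left[symmetric] sum_distrib_right[symmetric] sum_na)
   also have "\<dots> = 4 * (sqrt (n * p) * A)\<^sup>2" using np0 by (simp add: power_mult_distrib)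
   also have "\<dots> \<le> 4 * M\<^sup>2" unfolding M_def using A1 np0
    by (intro mult_left_mono power_mono mult_right_mono) auto
   finally have "\<theta>\<^sup>2 * (\<Sum>a<2 ^ s. 4 * A\<^sup>2 * (na a * p)) \<le> \<theta>\<^sup>2 * (4 * M\<^sup>2)" by (intro mult_left_mono) auto
   also have "\<dots> = 1" using M1 by (simp add: \<theta>_def power_divide power_mult_distrib)
   finally show ?thesis unfolding 1 by simp
  qed
  finally have *: "prob ?R {y. (sqrt (n * p) + 1) * (2 * \<tau>) ^ Suc m \<le> \<bar>\<Sum>a<2 ^ s. Z a (y a)\<bar>} \<le> 2 * exp (1 - \<tau>)" .
  have "prob ?R {y. \<bar>real (card {x \<in> J. simple_tab s (Suc m) (T(m := y)) x = v}) - n * p\<bar> >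
   (sqrt (n * p) + 1) * (2 * \<tau>) ^ Suc m} \<le>
   prob ?R {y. (sqrt (n * p) + 1) * (2 * \<tau>) ^ Suc m \<le> \<bar>\<Sum>a<2 ^ s. Z a (y a)\<bar>}"
   unfolding cnt by (intro prob_mono) auto
  then show ?thesis using * by linarith
 qed
 define BB where "BB = (\<Union>a\<in>{..<2 ^ s}. \<Union>w\<in>{..<2 ^ b}. Bad a w)"
 have pBB: "prob (random_tables s m b) BB \<le> 2 ^ s * 2 ^ b * E"
 proof -
  have "prob (random_tables s m b) BB \<le> (\<Sum>a<(2::nat) ^ s. \<Sum>w<(2::nat) ^ b. E)"
   unfolding BB_def by (intro prob_UN_le bad) auto
  then show ?thesis by simp
 qed
 have "prob (random_tables s (Suc m) b)
   {T. \<bar>real (card {x \<in> J. simple_tab s (Suc m) T x = v}) - n * p\<bar> > (sqrt (n * p) + 1) * (2 * \<tau>) ^ Suc m} =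
  expect (random_tables s m b) (\<lambda>T. prob ?R
   {y. \<bar>real (card {x \<in> J. simple_tab s (Suc m) (T(m := y)) x = v}) - n * p\<bar> > (sqrt (n * p) + 1) * (2 * \<tau>) ^ Suc m})"
  unfolding random_tables_Suc measure_map_pmf prob_pair by (simp del: simple_tab.simps)
 also have "\<dots> \<le> expect (random_tables s m b) (\<lambda>T. 2 * exp (1 - \<tau>) + indicator BB T)"
 proof (intro integral_mono_AE AE_pmfI)
  fix T assume "T \<in> set_pmf (random_tables s m b)"
  then have T: "T \<in> table_set s m b" using finite_table_set by (simp add: random_tables_eq)
  show "prob ?R {y. \<bar>real (card {x \<in> J. simple_tab s (Suc m) (T(m := y)) x = v}) - n * p\<bar> >
    (sqrt (n * p) + 1) * (2 * \<tau>) ^ Suc m} \<le> 2 * exp (1 - \<tau>) + indicator BB T"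
  proof (cases "T \<in> BB")
   case True
   then show ?thesis by (simp del: simple_tab.simps add: order.trans[OF measure_pmf.prob_le_1])
  next
   case False
   then show ?thesis using cond[OF T] by (auto simp: BB_def simp del: simple_tab.simps)
  qed
 qed (auto simp: random_tables_eq finite_table_set intro!: integrable_measure_pmf_finite)
 also have "\<dots> = 2 * exp (1 - \<tau>) + prob (random_tables s m b) BB"
  by (rule expectation_const_indicator)
 also have "\<dots> \<le> 2 * exp (1 - \<tau>) + 2 ^ s * 2 ^ b * E" using pBB by simp
 also have "\<dots> \<le> real (Suc m) * (2 ^ s * 2 ^ b) ^ Suc m * 2 * exp (1 - \<tau>)"
 proof -
  have "(1::real) \<le> (2 ^ s * 2 ^ b) ^ Suc m" by (intro one_le_power) (simp flip: power_add)
  then have "2 * exp (1 - \<tau>) * 1 \<le> 2 * exp (1 - \<tau>) * (2 ^ s * 2 ^ b) ^ Suc m" by (intro mult_left_mono) auto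
  then show ?thesis by (simp add: E_def algebra_simps)
 qed
 finally show ?case unfolding n_def p_def by simp
qed

section \<open>Revealing the bits of hash values in stages\<close>

lemma xor_concat:
 fixes a a' b b' :: nat
 assumes "b < 2 ^ r" "b' < 2 ^ r"
 shows "(a * 2 ^ r + b) XOR (a' * 2 ^ r + b') = (a XOR a') * 2 ^ r + (b XOR b')"
proof -
 let ?z = "(a * 2 ^ r + b) XOR (a' * 2 ^ r + b')"
 have "drop_bit r ?z = a XOR a'" using assms by (simp only: drop_bit_xor) (simp add: drop_bit_eq_div)
 moreover have "take_bit r ?z = b XOR b'" using assms by (simp only: take_bit_xor) (simp add: take_bit_eq_mod)
 ultimately show ?thesis
  by (metis add.commute bits_ident mult.commute push_bit_eq_mult)
qed

definition concat_tables :: "nat \<Rightarrow> (nat \<Rightarrow> nat \<Rightarrow> nat) \<Rightarrow> (nat \<Rightarrow> nat \<Rightarrow> nat) \<Rightarrow> nat \<Rightarrow> nat \<Rightarrow> nat" where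
 "concat_tables r T1 T2 = (\<lambda>i a. T1 i a * 2 ^ r + T2 i a)"

lemma simple_tab_concat:
 assumes "\<And>i a. T2 i a < 2 ^ r"
 shows "simple_tab s m (concat_tables r T1 T2) x = simple_tab s m T1 x * 2 ^ r + simple_tab s m T2 x"
proof (induction m)
 case (Suc m)
 have "simple_tab s m T2 x < 2 ^ r" using assms by (rule simple_tab_less)
 with Suc assms show ?case by (simp add: concat_tables_def xor_concat)
qed simp

lemma pair_pmf_of_set:
 assumes "finite A" "A \<noteq> {}" "finite B" "B \<noteq> {}"
 shows "pair_pmf (pmf_of_set A) (pmf_of_set B) = pmf_of_set (A \<times> B)"
proof (rule pmf_eqI)
 fix q :: "'a \<times> 'b"
 obtain a b where "q = (a, b)" by (cases q)
 then show "pmf (pair_pmf (pmf_of_set A) (pmf_of_set B)) q = pmf (pmf_of_set (A \<times> B)) q"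
  using assms by (simp add: pmf_pair card_cartesian_product indicator_def)
qed

text \<open>High and low bits of uniform table entries are independent. So one may condition on some
  bits of all hash values and keep fresh tables for the others.\<close>

lemma random_tables_concat:
 "random_tables s m (r1 + r2) = map_pmf (\<lambda>(T1, T2). concat_tables r2 T1 T2)
  (pair_pmf (random_tables s m r1) (random_tables s m r2))"
proof -
 let ?A = "table_set s m r1 \<times> table_set s m r2"
 have bij: "bij_betw (\<lambda>(T1, T2). concat_tables r2 T1 T2) ?A (table_set s m (r1 + r2))"
 proof (rule bij_betwI[where g = "\<lambda>T. (\<lambda>i a. T i a div 2 ^ r2, \<lambda>i a. T i a mod 2 ^ r2)"])
  show "(\<lambda>(T1, T2). concat_tables r2 T1 T2) \<in> ?A \<rightarrow> table_set s m (r1 + r2)"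
  proof (clarsimp simp: table_set_iff concat_tables_def)
   fix T1 T2 :: "nat \<Rightarrow> nat \<Rightarrow> nat" and i a
   assume "\<forall>i a. T1 i a < 2 ^ r1" "\<forall>i a. T2 i a < 2 ^ r2"
   then have "T1 i a * 2 ^ r2 + T2 i a < (T1 i a + 1) * 2 ^ r2" "(T1 i a + 1) * 2 ^ r2 \<le> 2 ^ r1 * 2 ^ r2"
    by (simp, intro mult_le_mono1) (simp add: Suc_le_eq)
   then show "T1 i a * 2 ^ r2 + T2 i a < 2 ^ (r1 + r2)" by (simp add: power_add)
  qed
  show "(\<lambda>T. (\<lambda>i a. T i a div 2 ^ r2, \<lambda>i a. T i a mod 2 ^ r2)) \<in> table_set s m (r1 + r2) \<rightarrow> ?A"
   by (auto simp: table_set_iff power_add less_mult_imp_div_less)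
 qed (auto simp: concat_tables_def table_set_iff fun_eq_iff div_mult_mod_eq)
 show ?thesis
  unfolding random_tables_eq using finite_table_set
  by (subst pair_pmf_of_set) (auto simp: map_pmf_of_set_bij_betw[OF bij])
qed

lemma prob_simple_tab_indep:
 assumes "indep s m \<kappa> Y"
  and "\<And>T. T \<in> table_set s m r \<Longrightarrow> (T \<in> E \<longleftrightarrow> (\<lambda>x. if x \<in> Y then simple_tab s m T (\<kappa> x) else 0) \<in> F)"
 shows "prob (random_tables s m r) E = prob (Pi_pmf Y 0 (\<lambda>_. (uniform_bits r))) F"
proof -
 have "prob (random_tables s m r) E =
  prob (random_tables s m r) ((\<lambda>T x. if x \<in> Y then simple_tab s m T (\<kappa> x) else 0) -` F)"
  using assms(2) finite_table_set
  by (intro measure_pmf.finite_measure_eq_AE AE_pmfI) (auto simp: random_tables_eq)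
 then show ?thesis
  by (simp add: simple_tab_indep_uniform[OF assms(1), symmetric])
qed

lemma random_bits_deviation:
 assumes fin: "finite Y" and u: "u < 2" and K: "K > 0"
 shows "prob (Pi_pmf Y 0 (\<lambda>_. (uniform_bits 1)))
  {g. \<bar>real (card {x \<in> Y. g x = u}) - real (card Y) / 2\<bar> > sqrt (K * real (card Y))} \<le> 2 * exp (- K)"
proof -
 define N where "N = real (card Y)"
 define t where "t = sqrt (K * N)"
 define Z where "Z = (\<lambda>(_::'a) y. (if y = u then 1 / 2 else - 1 / 2 :: real))"
 have N0: "N \<ge> 0" by (simp add: N_def)
 have sum: "real (card {x \<in> Y. g x = u}) - N / 2 = (\<Sum>x\<in>Y. Z x (g x))" for g
 proof -
  have "(\<Sum>x\<in>Y. Z x (g x)) = (\<Sum>x\<in>Y. (if g x = u then 1 else 0) - 1 / 2)"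
   by (intro sum.cong) (auto simp: Z_def)
  also have "\<dots> = (\<Sum>x\<in>Y. if g x = u then 1 else 0) - N / 2" by (simp add: sum_subtractf N_def)
  also have "(\<Sum>x\<in>Y. if g x = u then 1 else 0 :: real) = real (card {x \<in> Y. g x = u})"
   using fin by (simp add: sum.If_cases Int_def)
  finally show ?thesis by simp
 qed
 show ?thesis
 proof (cases "t \<le> N \<and> N > 0")
  case False
  have "\<bar>real (card {x \<in> Y. g x = u}) - N / 2\<bar> \<le> N" for g
  proof -
   have "card {x \<in> Y. g x = u} \<le> card Y" using fin by (intro card_mono) auto
   then have "real (card {x \<in> Y. g x = u}) \<le> N" unfolding N_def by (rule of_nat_mono)
   then show ?thesis using N0 by (simp add: abs_le_iff)
  qed
  moreover have "N \<le> t" using False N0 by (auto simp: t_def)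
  ultimately have "\<not> \<bar>real (card {x \<in> Y. g x = u}) - N / 2\<bar> > t" for g by (meson not_less order.trans)
  then have "{g. \<bar>real (card {x \<in> Y. g x = u}) - N / 2\<bar> > t} = {}" by blast
  then show ?thesis unfolding N_def[symmetric] t_def[symmetric] by (simp only: measure_empty) simp
 next
  case True
  \<comment> \<open>This minimises \<theta>^2 N / 4 - \<theta> t, with value -\<open>K\<close>. The
    summands have modulus 1/2, so \<theta> must not exceed 2, which is why \<open>t > N\<close> was
    treated apart.\<close>
  define \<theta> where "\<theta> = 2 * t / N"
  have t0: "t \<ge> 0" using K N0 by (simp add: t_def)
  have th: "\<theta> \<ge> 0" "\<theta> \<le> 2" using True t0 by (auto simp: \<theta>_def divide_le_eq)
  have U: "expect (uniform_bits 1) h = (h 0 + h 1) / 2" for h :: "nat \<Rightarrow> real"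
   by (subst integral_pmf_of_set) (auto simp: lessThan_empty_iff numeral_2_eq_2 lessThan_Suc)
  have "prob (Pi_pmf Y 0 (\<lambda>_. (uniform_bits 1))) {g. t \<le> \<bar>\<Sum>x\<in>Y. Z x (g x)\<bar>} \<le>
   2 * exp (\<theta>\<^sup>2 * (\<Sum>x\<in>Y. 1 / 4) - \<theta> * t)"
  proof (rule prob_abs_sum_ge[OF fin])
   show "expect (uniform_bits 1) (Z a) = 0" for a
    unfolding U using u by (auto simp: Z_def less_2_cases_iff)
   show "expect (uniform_bits 1) (\<lambda>y. (Z a y)\<^sup>2) \<le> 1 / 4" for a
    unfolding U by (auto simp: Z_def power2_eq_square)
  qed (use th in \<open>auto simp: Z_def lessThan_empty_iff\<close>)
  also have "\<theta>\<^sup>2 * (\<Sum>x\<in>Y. 1 / 4) - \<theta> * t = - K"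
  proof -
   have "\<theta>\<^sup>2 * (\<Sum>x\<in>Y. 1 / 4) = (2 * t / N)\<^sup>2 * (N / 4)" by (simp add: \<theta>_def N_def)
   also have "\<dots> = t\<^sup>2 / N" using True by (simp add: power2_eq_square)
   also have "t\<^sup>2 / N = K" using True K by (simp add: t_def)
   finally have 1: "\<theta>\<^sup>2 * (\<Sum>x\<in>Y. 1 / 4) = K" .
   have "\<theta> * t = 2 * (t\<^sup>2 / N)" by (simp add: \<theta>_def power2_eq_square)
   also have "\<dots> = 2 * K" using True K by (simp add: t_def)
   finally show ?thesis using 1 by simp
  qed
  finally have "prob (Pi_pmf Y 0 (\<lambda>_. (uniform_bits 1))) {g. t \<le> \<bar>\<Sum>x\<in>Y. Z x (g x)\<bar>} \<le> 2 * exp (- K)" .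
  moreover have "prob (Pi_pmf Y 0 (\<lambda>_. (uniform_bits 1)))
   {g. \<bar>real (card {x \<in> Y. g x = u}) - N / 2\<bar> > t} \<le>
   prob (Pi_pmf Y 0 (\<lambda>_. (uniform_bits 1))) {g. t \<le> \<bar>\<Sum>x\<in>Y. Z x (g x)\<bar>}"
   unfolding sum by (intro prob_mono) auto
  ultimately show ?thesis unfolding N_def[symmetric] t_def[symmetric] by linarith
 qed
qed

text \<open>Splitting the keys selected at level \<open>b\<close> into \<open>2 ^ i\<close> groups by \<open>i\<close> further bits makes each
 group small enough to be independent; then the next bit halves every group, up to a deviation of
 the order of the square root of its size.\<close>

lemma halving:
 fixes K e :: real
 assumes X: "finite X" and v: "v < 2 ^ b" and u: "u < 2" and K: "K > 0"
  and A: "\<And>g. g < 2 ^ i \<Longrightarrow>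
   prob (table_pair s c d (b + i))
    {(T1, T2). \<not> derived_indep s c d T1
     (selected s c d X (v * 2 ^ i + g) T1 T2)} \<le> e"
 shows "prob (pair_pmf (random_tables s c (s * d))
   (pair_pmf (random_tables s (c + d) b) (random_tables s (c + d) 1)))
   {(T1, T2, T3). \<bar>real (card (selected s c d X (2 * v + u) T1 (concat_tables 1 T2 T3)))
     - real (card (selected s c d X v T1 T2)) / 2\<bar> >
    sqrt (K * 2 ^ i * real (card (selected s c d X v T1 T2)))} \<le> 2 ^ i * (e + 2 * exp (- K))"
proof -
 let ?m = "c + d"
 let ?R = "random_tables s ?m"
 let ?R1 = "random_tables s c (s * d)"
 define der where "der T1 = derived s c T1" for T1
 define Y where "Y T1 T2 = selected s c d X v T1 T2" for T1 T2
 define Yg where "Yg g T1 T2 T4 = {x \<in> Y T1 T2. simple_tab s ?m T4 (der T1 x) = g}" for g T1 T2 T4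
 define dev where "dev Z T1 T3 = real (card {x \<in> Z. simple_tab s ?m T3 (der T1 x) = u}) - real (card Z) / 2"
  for Z T1 T3
 define M where "M = pair_pmf ?R1 (pair_pmf (?R b) (pair_pmf (?R i) (?R 1)))"
 define Bg where "Bg g = {(T1, T2, T4, T3). \<bar>dev (Yg g T1 T2 T4) T1 T3\<bar> > sqrt (K * real (card (Yg g T1 T2 T4)))}" for g
 define B where "B = {(T1, T2, T3). \<bar>dev (Y T1 T2) T1 T3\<bar> > sqrt (K * 2 ^ i * real (card (Y T1 T2)))}"
 have finY: "finite (Y T1 T2)" for T1 T2 using X by (simp add: Y_def selected_def)
 have finYg: "finite (Yg g T1 T2 T4)" for g T1 T2 T4 using finY by (simp add: Yg_def)
 have setR: "set_pmf (?R r) = table_set s ?m r" for r using finite_table_set by (simp add: random_tables_eq)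
 have cover: "B' \<in> (\<Union>g<2 ^ i. Bg g)"
  if B': "B' = (T1, T2, T4, T3)" and inB: "(T1, T2, T3) \<in> B" and T4: "T4 \<in> table_set s ?m i" for B' T1 T2 T4 T3
 proof (rule ccontr)
  assume no: "\<not> ?thesis"
  have dg: "\<bar>dev (Yg g T1 T2 T4) T1 T3\<bar> \<le> sqrt (K * real (card (Yg g T1 T2 T4)))" if "g < 2 ^ i" for g
   using no that B' by (auto simp: Bg_def not_less)
  have less: "simple_tab s ?m T4 x < 2 ^ i" for x
   using T4 by (intro simple_tab_less) (simp add: table_set_iff)
  have un: "Y T1 T2 = (\<Union>g\<in>{..<2 ^ i}. Yg g T1 T2 T4)" using less by (auto simp: Yg_def)
  have c1: "card (Y T1 T2) = (\<Sum>g<2 ^ i. card (Yg g T1 T2 T4))"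
   unfolding un using finYg by (intro card_UN_disjoint) (auto simp: Yg_def)
  have un2: "{x \<in> Y T1 T2. simple_tab s ?m T3 (der T1 x) = u} =
   (\<Union>g\<in>{..<2 ^ i}. {x \<in> Yg g T1 T2 T4. simple_tab s ?m T3 (der T1 x) = u})" using less by (auto simp: Yg_def)
  have c2: "card {x \<in> Y T1 T2. simple_tab s ?m T3 (der T1 x) = u} =
   (\<Sum>g<2 ^ i. card {x \<in> Yg g T1 T2 T4. simple_tab s ?m T3 (der T1 x) = u})"
   unfolding un2 using finY by (intro card_UN_disjoint) (auto simp: Yg_def)
  have "dev (Y T1 T2) T1 T3 = (\<Sum>g<2 ^ i. dev (Yg g T1 T2 T4) T1 T3)"
   unfolding dev_def c1 c2 by (simp add: sum_subtractf sum_divide_distrib)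
  then have "\<bar>dev (Y T1 T2) T1 T3\<bar> \<le> (\<Sum>g<2 ^ i. \<bar>dev (Yg g T1 T2 T4) T1 T3\<bar>)" by (simp add: sum_abs)
  \<comment> \<open>Cauchy-Schwarz over the groups: adding up the square roots of the group sizes
    loses a factor sqrt(2^i).\<close>
  also have "\<dots> \<le> (\<Sum>g<2 ^ i. \<bar>1\<bar> * \<bar>sqrt (K * real (card (Yg g T1 T2 T4)))\<bar>)"
   using K by (intro sum_mono) (use dg in auto)
  also have "\<dots> \<le> L2_set (\<lambda>_. 1) {..<2 ^ i :: nat} * L2_set (\<lambda>g. sqrt (K * real (card (Yg g T1 T2 T4)))) {..<2 ^ i}"
   by (rule L2_set_mult_ineq)
  also have "\<dots> = sqrt (2 ^ i) * sqrt (K * real (card (Y T1 T2)))"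
   unfolding c1 using K by (simp add: L2_set_def sum_distrib_left)
  also have "\<dots> = sqrt (K * 2 ^ i * real (card (Y T1 T2)))"
   by (simp add: real_sqrt_mult mult_ac)
  finally show False using inB by (simp add: B_def)
 qed
 have one: "prob M (Bg g) \<le> e + 2 * exp (- K)" if g: "g < 2 ^ i" for g
 proof -
  define D where "D = {(T1, T2, T4). \<not> indep s ?m (der T1) (Yg g T1 T2 T4)}"
  have "prob (pair_pmf ?R1 (pair_pmf (?R b) (?R i))) D = prob (pair_pmf ?R1 (?R (b + i)))
    {(T1, T2). \<not> indep s ?m (derived s c T1) (selected s c d X (v * 2 ^ i + g) T1 T2)}"
  proof -
   \<comment> \<open>Grouping by \<open>i\<close> further bits amounts to selection at level
     \<open>b + i\<close>, where the assumption on dependence applies.\<close>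
   have sel: "selected s c d X (v * 2 ^ i + g) T1 (concat_tables i T2 T4) = Yg g T1 T2 T4"
    if "T4 \<in> table_set s ?m i" for T1 T2 T4
   proof -
    have "simple_tab s ?m T4 x < 2 ^ i" for x using that by (intro simple_tab_less) (simp add: table_set_iff)
    then have "simple_tab s ?m T2 x * 2 ^ i + simple_tab s ?m T4 x = v * 2 ^ i + g \<longleftrightarrow>
      simple_tab s ?m T2 x = v \<and> simple_tab s ?m T4 x = g" for x
     using g by (metis add_right_imp_eq div_mult_self3 div_less mod_less mod_mult_self3 add_0_right power_not_zero zero_neq_numeral)
    moreover have "T4 j a < 2 ^ i" for j a using that by (simp add: table_set_iff)
    ultimately show ?thesis by (auto simp: selected_def Yg_def Y_def der_def simple_tab_concat)
   qed
   have "pair_pmf ?R1 (?R (b + i)) = map_pmf (\<lambda>(T1, T2, T4). (T1, concat_tables i T2 T4)) (pair_pmf ?R1 (pair_pmf (?R b) (?R i)))"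
    unfolding random_tables_concat by (simp add: pair_map_pmf2 map_pmf_comp split_def apsnd_def map_prod_def)
   then show ?thesis
    by (simp only: measure_map_pmf)
     (intro measure_pmf.finite_measure_eq_AE AE_pmfI, auto simp: D_def setR sel der_def)
  qed
  then have PD: "prob (pair_pmf ?R1 (pair_pmf (?R b) (?R i))) D \<le> e" using A[OF g] by simp
  have Mr: "M = map_pmf (\<lambda>((T1, T2, T4), T3). (T1, T2, T4, T3)) (pair_pmf (pair_pmf ?R1 (pair_pmf (?R b) (?R i))) (?R 1))"
   unfolding M_def by (simp add: pair_pmf_def map_bind_pmf bind_assoc_pmf bind_return_pmf map_pmf_def)
  have "prob M (Bg g) = expect (pair_pmf ?R1 (pair_pmf (?R b) (?R i)))
   (\<lambda>(T1, T2, T4). prob (?R 1) {T3. (T1, T2, T4, T3) \<in> Bg g})"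
   unfolding Mr measure_map_pmf prob_pair by (simp add: split_def)
  also have "\<dots> \<le> expect (pair_pmf ?R1 (pair_pmf (?R b) (?R i))) (\<lambda>w. 2 * exp (- K) + indicator D w)"
  proof (intro integral_mono_AE AE_pmfI)
   fix w assume "w \<in> set_pmf (pair_pmf ?R1 (pair_pmf (?R b) (?R i)))"
   obtain T1 T2 T4 where w: "w = (T1, T2, T4)" by (cases w)
   show "(case w of (T1, T2, T4) \<Rightarrow> prob (?R 1) {T3. (T1, T2, T4, T3) \<in> Bg g}) \<le> 2 * exp (- K) + indicator D w"
   proof (cases "w \<in> D")
    case True
    then show ?thesis by (simp add: w order.trans[OF measure_pmf.prob_le_1])
   next
    case False
    then have ind: "indep s ?m (der T1) (Yg g T1 T2 T4)" by (simp add: D_def w)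
    have "prob (?R 1) {T3. (T1, T2, T4, T3) \<in> Bg g} =
     prob (Pi_pmf (Yg g T1 T2 T4) 0 (\<lambda>_. (uniform_bits 1)))
      {h. \<bar>real (card {x \<in> Yg g T1 T2 T4. h x = u}) - real (card (Yg g T1 T2 T4)) / 2\<bar> >
       sqrt (K * real (card (Yg g T1 T2 T4)))}"
    proof (rule prob_simple_tab_indep[OF ind])
     fix T3
     have "{x \<in> Yg g T1 T2 T4. (if x \<in> Yg g T1 T2 T4 then simple_tab s ?m T3 (der T1 x) else 0) = u} =
      {x \<in> Yg g T1 T2 T4. simple_tab s ?m T3 (der T1 x) = u}" by auto
     then show "(T3 \<in> {T3. (T1, T2, T4, T3) \<in> Bg g}) = ((\<lambda>x. if x \<in> Yg g T1 T2 T4 then simple_tab s ?m T3 (der T1 x) else 0) \<in>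
      {h. \<bar>real (card {x \<in> Yg g T1 T2 T4. h x = u}) - real (card (Yg g T1 T2 T4)) / 2\<bar> > sqrt (K * real (card (Yg g T1 T2 T4)))})"
      by (simp add: Bg_def dev_def)
    qed
    also have "\<dots> \<le> 2 * exp (- K)" by (rule random_bits_deviation[OF finYg u K])
    finally show ?thesis using False by (simp add: w)
   qed
  qed (auto intro!: integrable_measure_pmf_finite simp: random_tables_eq finite_table_set)
  also have "\<dots> = 2 * exp (- K) + prob (pair_pmf ?R1 (pair_pmf (?R b) (?R i))) D"
   by (subst Bochner_Integration.integral_add) (auto intro!: integrable_measure_pmf_finite simp: random_tables_eq finite_table_set)
  finally show ?thesis using PD by simp
 qed
 have "prob (pair_pmf ?R1 (pair_pmf (?R b) (?R 1))) B \<le> prob M (\<Union>g<2 ^ i. Bg g)"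
 proof -
  have "pair_pmf ?R1 (pair_pmf (?R b) (?R 1)) = map_pmf (\<lambda>(T1, T2, T4, T3). (T1, T2, T3)) M"
   unfolding M_def by (simp add: pair_pmf_def map_bind_pmf bind_assoc_pmf bind_return_pmf map_pmf_def bind_pmf_const)
  then have "prob (pair_pmf ?R1 (pair_pmf (?R b) (?R 1))) B =
   prob M ((\<lambda>(T1, T2, T4, T3). (T1, T2, T3)) -` B)" by simp
  also have "\<dots> \<le> prob M (\<Union>g<2 ^ i. Bg g)"
  proof (rule measure_pmf.finite_measure_mono_AE)
   show "AE w in M. w \<in> (\<lambda>(T1, T2, T4, T3). (T1, T2, T3)) -` B \<longrightarrow> w \<in> (\<Union>g<2 ^ i. Bg g)"
   proof (rule AE_pmfI, rule impI)
    fix w assume w: "w \<in> set_pmf M" "w \<in> (\<lambda>(T1, T2, T4, T3). (T1, T2, T3)) -` B"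
    obtain T1 T2 T4 T3 where ww: "w = (T1, T2, T4, T3)" by (cases w)
    show "w \<in> (\<Union>g<2 ^ i. Bg g)"
     using w by (intro cover[OF ww]) (auto simp: ww M_def setR)
   qed
  qed auto
  finally show ?thesis .
 qed
 also have "\<dots> \<le> (\<Sum>g<(2::nat) ^ i. e + 2 * exp (- K))" by (intro prob_UN_le one) auto
 also have "\<dots> = 2 ^ i * (e + 2 * exp (- K))" by simp
 finally have PB: "prob (pair_pmf ?R1 (pair_pmf (?R b) (?R 1))) B \<le> 2 ^ i * (e + 2 * exp (- K))" .
 have "prob (pair_pmf ?R1 (pair_pmf (?R b) (?R 1)))
   {(T1, T2, T3). \<bar>real (card (selected s c d X (2 * v + u) T1 (concat_tables 1 T2 T3)))
     - real (card (selected s c d X v T1 T2)) / 2\<bar> >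
    sqrt (K * 2 ^ i * real (card (selected s c d X v T1 T2)))} =
   prob (pair_pmf ?R1 (pair_pmf (?R b) (?R 1))) B"
 proof (intro measure_pmf.finite_measure_eq_AE AE_pmfI)
  fix w assume "w \<in> set_pmf (pair_pmf ?R1 (pair_pmf (?R b) (?R 1)))"
  moreover obtain T1 T2 T3 where w: "w = (T1, T2, T3)" by (cases w)
  ultimately have T3: "T3 \<in> table_set s ?m 1" by (simp add: setR)
  have lt: "simple_tab s ?m T3 x < 2 ^ 1" for x using T3 by (intro simple_tab_less) (simp add: table_set_iff)
  have "simple_tab s ?m T2 x * 2 + simple_tab s ?m T3 x = 2 * v + u \<longleftrightarrow>
    simple_tab s ?m T2 x = v \<and> simple_tab s ?m T3 x = u" for x
   using u lt[of x] by simp presburger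
  moreover have "T3 j a < 2 ^ 1" for j a using T3 by (simp add: table_set_iff)
  ultimately have "selected s c d X (2 * v + u) T1 (concat_tables 1 T2 T3) = {x \<in> Y T1 T2. simple_tab s ?m T3 (der T1 x) = u}"
   by (auto simp: selected_def Y_def der_def simple_tab_concat)
  then show "(w \<in> {(T1, T2, T3). \<bar>real (card (selected s c d X (2 * v + u) T1 (concat_tables 1 T2 T3)))
     - real (card (selected s c d X v T1 T2)) / 2\<bar> >
    sqrt (K * 2 ^ i * real (card (selected s c d X v T1 T2)))}) = (w \<in> B)"
   by (simp add: w B_def dev_def Y_def)
 qed auto
 then show ?thesis using PB by simp
qed

section \<open>Strong concentration by repeated halving\<close>

text \<open>In terms of |\<Sigma>| = 2^s, the function is soft-O of |\<Sigma>|^(1-D).\<close>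

definition negl :: "nat \<Rightarrow> (nat \<Rightarrow> real) \<Rightarrow> bool" where
 "negl D g \<longleftrightarrow> (\<exists>e. g \<in> O(\<lambda>s. real s ^ e * 2 ^ s / (2 ^ s) ^ D))"

lemma negl_add: "negl D f \<Longrightarrow> negl D g \<Longrightarrow> negl D (\<lambda>s. f s + g s)"
proof -
 assume "negl D f" "negl D g"
 then obtain e e' where e: "f \<in> O(\<lambda>s. real s ^ e * 2 ^ s / (2 ^ s) ^ D)" "g \<in> O(\<lambda>s. real s ^ e' * 2 ^ s / (2 ^ s) ^ D)"
  by (auto simp: negl_def)
 have "(\<lambda>s. real s ^ k * 2 ^ s / (2 ^ s) ^ D) \<in> O(\<lambda>s. real s ^ (e + e') * 2 ^ s / (2 ^ s) ^ D)" if "k \<le> e + e'" for k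
 proof (rule bigoI[of _ 1], rule eventually_mono[OF eventually_ge_at_top[of 1]])
  fix s :: nat assume "1 \<le> s"
  then show "norm (real s ^ k * 2 ^ s / (2 ^ s) ^ D) \<le> 1 * norm (real s ^ (e + e') * 2 ^ s / (2 ^ s) ^ D)"
   using that by (simp add: divide_right_mono mult_right_mono power_increasing)
 qed
 from this[of e] this[of e'] e have "f \<in> O(\<lambda>s. real s ^ (e + e') * 2 ^ s / (2 ^ s) ^ D)"
  "g \<in> O(\<lambda>s. real s ^ (e + e') * 2 ^ s / (2 ^ s) ^ D)"
  by (auto intro: landau_o.big.trans)
 then show ?thesis unfolding negl_def by (intro exI[of _ "e + e'"] sum_in_bigo)
qed

lemma negl_mult_power: "negl D f \<Longrightarrow> negl D (\<lambda>s. K * real s ^ k * f s)"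
proof -
 assume "negl D f"
 then obtain e where e: "f \<in> O(\<lambda>s. real s ^ e * 2 ^ s / (2 ^ s) ^ D)" by (auto simp: negl_def)
 have "(\<lambda>s. real s ^ k * f s) \<in> O(\<lambda>s. real s ^ k * (real s ^ e * 2 ^ s / (2 ^ s) ^ D))"
  by (intro landau_o.big.mult_left e)
 then have "(\<lambda>s. K * (real s ^ k * f s)) \<in> O(\<lambda>s. real s ^ k * (real s ^ e * 2 ^ s / (2 ^ s) ^ D))"
  by (cases "K = 0") auto
 then show ?thesis unfolding negl_def
  by (intro exI[of _ "k + e"]) (simp add: power_add mult_ac)
qed

lemma negl_power: "negl D (\<lambda>s. K * real s ^ k * 2 ^ s / (2 ^ s) ^ D)"
 unfolding negl_def
 by (intro exI[of _ k] bigoI[of _ "\<bar>K\<bar>"] always_eventually allI) (simp add: abs_mult mult.assoc)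

lemma negl_const: "negl D (\<lambda>s. K / (2 ^ s) ^ D)"
 unfolding negl_def
proof (intro exI[of _ 0] bigoI[of _ "\<bar>K\<bar>"] always_eventually allI)
 fix s :: nat
 have "\<bar>K\<bar> / (2 ^ s) ^ D * 1 \<le> \<bar>K\<bar> / (2 ^ s) ^ D * 2 ^ s" by (intro mult_left_mono) auto
 then show "norm (K / (2 ^ s) ^ D) \<le> \<bar>K\<bar> * norm (real s ^ 0 * 2 ^ s / (2 ^ s) ^ D)" by simp
qed

lemma exp_le_inverse_power:
 assumes "real (s * D) \<le> z"
 shows "exp (- z) \<le> 1 / (2 ^ s) ^ D"
proof -
 have "real (s * D) * ln 2 \<le> real (s * D) * 1" using ln_2_less_1 by (intro mult_left_mono) auto
 then have "exp (- z) \<le> exp (- (real (s * D) * ln 2))" using assms by simp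
 also have "\<dots> = 1 / (2 ^ s) ^ D"
  by (simp only: exp_minus exp_of_nat_mult exp_ln power_mult inverse_eq_divide zero_less_numeral)
 finally show ?thesis .
qed

definition dependent_prob :: "nat \<Rightarrow> nat \<Rightarrow> nat \<Rightarrow> nat set \<Rightarrow> nat \<Rightarrow> nat \<Rightarrow> real" where
 "dependent_prob s c d X b v = prob (table_pair s c d b)
   {(T1, T2). \<not> derived_indep s c d T1 (selected s c d X v T1 T2)}"

definition deviation_prob :: "nat \<Rightarrow> nat \<Rightarrow> nat \<Rightarrow> nat set \<Rightarrow> nat \<Rightarrow> nat \<Rightarrow> real \<Rightarrow> real" where
 "deviation_prob s c d X b v \<delta> = prob (table_pair s c d b)
   {(T1, T2). \<bar>real (card (selected s c d X v T1 T2)) - real (card X) / 2 ^ b\<bar> > \<delta> * (real (card X) / 2 ^ b)}"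

text \<open>Unless the previous level already deviates, the count there is at most twice its mean
  \<mu>. The square root in \<open>halving\<close> is then at most \<eta> times the new mean
  \<mu>/2, which explains the factor 8.\<close>

lemma deviation_prob_Suc:
 assumes X: "finite X" and v: "v < 2 ^ b" and u: "u < 2" and K: "K > 0"
  and A: "\<And>g. g < 2 ^ i \<Longrightarrow> dependent_prob s c d X (b + i) (v * 2 ^ i + g) \<le> e"
  and \<delta>: "0 \<le> \<delta>" "\<delta> \<le> 1" and \<eta>: "\<eta> \<ge> 0" "8 * K * 2 ^ i \<le> \<eta>\<^sup>2 * (real (card X) / 2 ^ b)"
 shows "deviation_prob s c d X (Suc b) (2 * v + u) (\<delta> + \<eta>) \<le>
  deviation_prob s c d X b v \<delta> + 2 ^ i * (e + 2 * exp (- K))"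
proof -
 let ?R = "random_tables s (c + d)"
 let ?R1 = "random_tables s c (s * d)"
 define \<mu> where "\<mu> = real (card X) / 2 ^ b"
 define S where "S T1 T2 = real (card (selected s c d X v T1 T2))" for T1 T2
 define S' where "S' T1 T2 T3 = real (card (selected s c d X (2 * v + u) T1 (concat_tables 1 T2 T3)))" for T1 T2 T3
 let ?M = "pair_pmf ?R1 (pair_pmf (?R b) (?R 1))"
 have mu0: "\<mu> \<ge> 0" by (simp add: \<mu>_def)
 have "deviation_prob s c d X (Suc b) (2 * v + u) (\<delta> + \<eta>) =
  prob ?M {(T1, T2, T3). \<bar>S' T1 T2 T3 - \<mu> / 2\<bar> > (\<delta> + \<eta>) * (\<mu> / 2)}"
 proof -
  have "pair_pmf ?R1 (?R (b + 1)) = map_pmf (\<lambda>(T1, T2, T3). (T1, concat_tables 1 T2 T3)) ?M"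
   unfolding random_tables_concat by (simp add: pair_map_pmf2 map_pmf_comp split_def apsnd_def map_prod_def)
  then show ?thesis unfolding deviation_prob_def
   by (simp add: S'_def \<mu>_def split_def vimage_def mult_ac)
 qed
 also have "\<dots> \<le> prob ?M ({(T1, T2, T3). \<bar>S T1 T2 - \<mu>\<bar> > \<delta> * \<mu>} \<union>
   {(T1, T2, T3). \<bar>S' T1 T2 T3 - S T1 T2 / 2\<bar> > sqrt (K * 2 ^ i * S T1 T2)})"
 proof (intro prob_mono subsetI)
  fix w assume w: "w \<in> {(T1, T2, T3). \<bar>S' T1 T2 T3 - \<mu> / 2\<bar> > (\<delta> + \<eta>) * (\<mu> / 2)}"
  obtain T1 T2 T3 where ww: "w = (T1, T2, T3)" by (cases w)
  have big: "\<bar>S' T1 T2 T3 - \<mu> / 2\<bar> > (\<delta> + \<eta>) * (\<mu> / 2)" using w by (simp add: ww)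
  show "w \<in> {(T1, T2, T3). \<bar>S T1 T2 - \<mu>\<bar> > \<delta> * \<mu>} \<union>
   {(T1, T2, T3). \<bar>S' T1 T2 T3 - S T1 T2 / 2\<bar> > sqrt (K * 2 ^ i * S T1 T2)}"
  proof (rule ccontr)
   assume "\<not> ?thesis"
   then have 1: "\<bar>S T1 T2 - \<mu>\<bar> \<le> \<delta> * \<mu>" and 2: "\<bar>S' T1 T2 T3 - S T1 T2 / 2\<bar> \<le> sqrt (K * 2 ^ i * S T1 T2)"
    by (auto simp: ww not_less)
   have "\<delta> * \<mu> \<le> 1 * \<mu>" using \<delta> mu0 by (intro mult_right_mono) auto
   then have "S T1 T2 \<le> 2 * \<mu>" using 1 by linarith
   then have "K * 2 ^ i * S T1 T2 \<le> K * 2 ^ i * (2 * \<mu>)" using K by (intro mult_left_mono) auto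
   also have "\<dots> = (8 * K * 2 ^ i) * (\<mu> / 4)" by simp
   also have "\<dots> \<le> (\<eta>\<^sup>2 * \<mu>) * (\<mu> / 4)" using \<eta>(2) mu0 by (intro mult_right_mono) (auto simp: \<mu>_def)
   also have "\<dots> = (\<eta> * (\<mu> / 2))\<^sup>2" by (simp add: power2_eq_square)
   finally have "sqrt (K * 2 ^ i * S T1 T2) \<le> \<eta> * (\<mu> / 2)" using \<eta>(1) mu0 by (intro real_le_lsqrt) auto
   then have "\<bar>S' T1 T2 T3 - \<mu> / 2\<bar> \<le> \<eta> * (\<mu> / 2) + \<delta> * \<mu> / 2" using 1 2 by linarith
   then show False using big by (simp add: algebra_simps)
  qed
 qed auto
 also have "\<dots> \<le> prob ?M {(T1, T2, T3). \<bar>S T1 T2 - \<mu>\<bar> > \<delta> * \<mu>} +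
   prob ?M {(T1, T2, T3). \<bar>S' T1 T2 T3 - S T1 T2 / 2\<bar> > sqrt (K * 2 ^ i * S T1 T2)}"
  by (intro measure_Un_le) auto
 also have "prob ?M {(T1, T2, T3). \<bar>S T1 T2 - \<mu>\<bar> > \<delta> * \<mu>} = deviation_prob s c d X b v \<delta>"
 proof -
  have "pair_pmf ?R1 (?R b) = map_pmf (\<lambda>(T1, T2, T3). (T1, T2)) ?M"
   by (simp add: pair_pmf_def map_bind_pmf bind_assoc_pmf bind_return_pmf map_pmf_def bind_pmf_const)
  then show ?thesis unfolding deviation_prob_def
   by (simp add: S_def \<mu>_def split_def vimage_def mult_ac)
 qed
 also have "prob ?M {(T1, T2, T3). \<bar>S' T1 T2 T3 - S T1 T2 / 2\<bar> > sqrt (K * 2 ^ i * S T1 T2)} \<le>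
   2 ^ i * (e + 2 * exp (- K))"
  unfolding S'_def S_def using A unfolding dependent_prob_def by (rule halving[OF X v u K])
 finally show ?thesis by simp
qed

text \<open>At \<open>i\<close> levels before the last one, 2^i groups are needed to obtain
  independent sets, but the mean is 2^i times as large. The two effects cancel, so each halving
  costs the same relative error \<eta>.\<close>

lemma deviation_prob_iterate:
 assumes X: "finite X" and v: "v < 2 ^ b" and K: "K > 0" and b: "b = b1 + i0"
  and A: "\<And>w. w < 2 ^ b \<Longrightarrow> dependent_prob s c d X b w \<le> e" and e: "e \<ge> 0"
  and \<delta>: "0 \<le> \<delta>0" "\<delta>0 + real i0 * \<eta> \<le> 1" and \<eta>: "\<eta> \<ge> 0" "8 * K \<le> \<eta>\<^sup>2 * (real (card X) / 2 ^ b)"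
 shows "deviation_prob s c d X b v (\<delta>0 + real i0 * \<eta>) \<le>
  deviation_prob s c d X b1 (v div 2 ^ i0) \<delta>0 + real i0 * (2 ^ i0 * (e + 2 * exp (- K)))"
proof -
 define B where "B = 2 ^ i0 * (e + 2 * exp (- K))"
 have "deviation_prob s c d X (b1 + j) (v div 2 ^ (i0 - j)) (\<delta>0 + real j * \<eta>) \<le>
   deviation_prob s c d X b1 (v div 2 ^ i0) \<delta>0 + real j * B" if "j \<le> i0" for j
  using that
 proof (induction j)
  case (Suc j)
  define i where "i = i0 - j"
  define w where "w = v div 2 ^ i"
  define u where "u = v div 2 ^ (i - 1) mod 2"
  have i: "i \<ge> 1" "i0 - Suc j = i - 1" "b1 + j + i = b" using Suc.prems b by (auto simp: i_def)
  have "v div 2 ^ (i - 1) = 2 * w + u"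
  proof -
   have "(2::nat) ^ i = 2 ^ (i - 1) * 2" using i(1) by (cases i) auto
   then have "w = v div 2 ^ (i - 1) div 2" by (simp add: w_def div_mult2_eq)
   then show ?thesis by (simp add: u_def)
  qed
  have w: "w < 2 ^ (b1 + j)"
   using v i(3) by (simp add: w_def less_mult_imp_div_less flip: power_add)
  have "deviation_prob s c d X (Suc (b1 + j)) (2 * w + u) ((\<delta>0 + real j * \<eta>) + \<eta>) \<le>
   deviation_prob s c d X (b1 + j) w (\<delta>0 + real j * \<eta>) + 2 ^ i * (e + 2 * exp (- K))"
  proof (rule deviation_prob_Suc[OF X w _ K])
   show "dependent_prob s c d X (b1 + j + i) (w * 2 ^ i + g) \<le> e" if "g < 2 ^ i" for g
   proof -
    have "w * 2 ^ i + g < (w + 1) * 2 ^ i" using that by simp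
    also have "\<dots> \<le> 2 ^ (b1 + j) * 2 ^ i" using w by (intro mult_le_mono1) simp
    also have "\<dots> = 2 ^ b" using i(3) by (simp flip: power_add)
    finally show ?thesis using A i(3) by simp
   qed
   show "8 * K * 2 ^ i \<le> \<eta>\<^sup>2 * (real (card X) / 2 ^ (b1 + j))"
   proof -
    have "(2::real) ^ b = 2 ^ (b1 + j) * 2 ^ i" using i(3) by (simp flip: power_add)
    then have "\<eta>\<^sup>2 * (real (card X) / 2 ^ (b1 + j)) = (\<eta>\<^sup>2 * (real (card X) / 2 ^ b)) * 2 ^ i" by simp
    then show ?thesis using mult_right_mono[OF \<eta>(2), of "2 ^ i"] by simp
   qed
   have "real j * \<eta> \<le> real i0 * \<eta>" using Suc.prems \<eta> by (intro mult_right_mono) auto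
   then show "\<delta>0 + real j * \<eta> \<le> 1" using \<delta> by linarith
  qed (use \<delta> \<eta> in \<open>auto simp: u_def\<close>)
  moreover have "2 ^ i * (e + 2 * exp (- K)) \<le> B"
   unfolding B_def using e by (intro mult_right_mono power_increasing) (auto simp: i_def add_nonneg_nonneg)
  ultimately show ?case using Suc.IH Suc.prems
   unfolding i(2) \<open>v div 2 ^ (i - 1) = 2 * w + u\<close> w_def i_def[symmetric] by (simp add: algebra_simps)
 qed simp
 from this[of i0] show ?thesis by (simp add: b B_def)
qed

lemma inj_on_derived_key: "inj_on (derived_key s c h) {..<2 ^ (s * c)}"
proof (rule inj_onI)
 fix x y assume "x \<in> {..<2 ^ (s * c)}" "y \<in> {..<2 ^ (s * c)}" "derived_key s c h x = derived_key s c h y"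
 then have "derived_key s c h x mod 2 ^ (s * c) = derived_key s c h y mod 2 ^ (s * c)"
  "x < 2 ^ (s * c)" "y < 2 ^ (s * c)" by auto
 then show "x = y" by (simp add: derived_key_def)
qed

text \<open>Whatever the first tables are, distinct keys have distinct derived keys; so this is
  concentration of simple tabulation with \<open>c + d\<close> characters.\<close>

lemma deviation_prob_weak:
 assumes X: "X \<subseteq> {..<2 ^ (s * c)}" and v: "v < 2 ^ b" and \<tau>: "\<tau> \<ge> 1"
  and \<delta>: "(sqrt (real (card X) / 2 ^ b) + 1) * (2 * \<tau>) ^ (c + d) \<le> \<delta> * (real (card X) / 2 ^ b)"
 shows "deviation_prob s c d X b v \<delta> \<le> real (c + d) * (2 ^ s * 2 ^ b) ^ (c + d) * 2 * exp (1 - \<tau>)"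
proof -
 let ?E = "real (c + d) * (2 ^ s * 2 ^ b) ^ (c + d) * 2 * exp (1 - \<tau>)"
 have "prob (random_tables s (c + d) b)
  {T2. \<bar>real (card (selected s c d X v T1 T2)) - real (card X) / 2 ^ b\<bar> > \<delta> * (real (card X) / 2 ^ b)} \<le> ?E"
  if T1: "T1 \<in> table_set s c (s * d)" for T1
 proof -
  define der where "der = derived s c T1"
  have inj: "inj_on der X" unfolding der_def using inj_on_derived_key X by (rule inj_on_subset)
  have "der ` X \<subseteq> {..<2 ^ (s * (c + d))}"
  proof (rule image_subsetI)
   fix x assume "x \<in> X"
   then have x: "x < 2 ^ (s * c)" using X by auto
   have "simple_tab s c T1 x < 2 ^ (s * d)" using T1 by (intro simple_tab_less) (simp add: table_set_iff)
   then have "x + 2 ^ (s * c) * simple_tab s c T1 x < 2 ^ (s * c) * (simple_tab s c T1 x + 1)"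
    "2 ^ (s * c) * (simple_tab s c T1 x + 1) \<le> 2 ^ (s * c) * (2::nat) ^ (s * d)"
    using x by (simp, intro mult_le_mono2) simp
   then show "der x \<in> {..<2 ^ (s * (c + d))}"
    by (simp add: der_def derived_key_def add_mult_distrib2 power_add)
  qed
  from simple_tab_concentration[OF this v \<tau>] have
   "prob (random_tables s (c + d) b)
    {T. \<bar>real (card {x \<in> der ` X. simple_tab s (c + d) T x = v}) - real (card (der ` X)) / 2 ^ b\<bar> >
     (sqrt (real (card (der ` X)) / 2 ^ b) + 1) * (2 * \<tau>) ^ (c + d)} \<le> ?E" .
  moreover have "card (der ` X) = card X" by (rule card_image[OF inj])
  moreover have "card {x \<in> der ` X. simple_tab s (c + d) T x = v} = card (selected s c d X v T1 T)" for T
  proof -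
   have "{x \<in> der ` X. simple_tab s (c + d) T x = v} = der ` selected s c d X v T1 T"
    by (auto simp: selected_def der_def)
   moreover have "inj_on der (selected s c d X v T1 T)"
    using inj by (rule inj_on_subset) (auto simp: selected_def)
   ultimately show ?thesis by (simp add: card_image)
  qed
  ultimately have *: "prob (random_tables s (c + d) b)
    {T. \<bar>real (card (selected s c d X v T1 T)) - real (card X) / 2 ^ b\<bar> >
     (sqrt (real (card X) / 2 ^ b) + 1) * (2 * \<tau>) ^ (c + d)} \<le> ?E" by simp
  have "prob (random_tables s (c + d) b)
   {T2. \<bar>real (card (selected s c d X v T1 T2)) - real (card X) / 2 ^ b\<bar> > \<delta> * (real (card X) / 2 ^ b)} \<le>
   prob (random_tables s (c + d) b)
    {T. \<bar>real (card (selected s c d X v T1 T)) - real (card X) / 2 ^ b\<bar> >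
     (sqrt (real (card X) / 2 ^ b) + 1) * (2 * \<tau>) ^ (c + d)}"
   using \<delta> by (intro prob_mono) auto
  then show ?thesis using * by linarith
 qed
 then show ?thesis unfolding deviation_prob_def prob_pair
  by (intro expectation_bounds(1)[where l = 0]) (auto simp: random_tables_eq finite_table_set)
qed

lemma deviation_prob_0:
 assumes "finite X" "\<delta> \<ge> 0"
 shows "deviation_prob s c d X 0 0 \<delta> = 0"
proof -
 have "selected s c d X 0 T1 T2 = X" if "T2 \<in> table_set s (c + d) 0" for T1 T2
 proof -
  have "simple_tab s (c + d) T2 x < 2 ^ 0" for x using that by (intro simple_tab_less) (simp add: table_set_iff)
  then show ?thesis by (simp add: selected_def)
 qed
 moreover have "\<not> \<delta> * real (card X) < 0" using assms by (simp add: not_less)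
 ultimately have "deviation_prob s c d X 0 0 \<delta> = prob (table_pair s c d 0) {}"
  unfolding deviation_prob_def
  by (intro measure_pmf.finite_measure_eq_AE AE_pmfI) (auto simp: random_tables_eq finite_table_set)
 then show ?thesis by simp
qed

text \<open>The number of halving steps is logarithmic in \<open>s\<close>: the weak concentration already suffices at
 a level where the mean exceeds \<open>2 ^ s\<close> by a power of \<open>s\<close>.\<close>

theorem deviation_prob_bound:
 fixes c d D :: nat
 assumes c: "c \<ge> 1" and D: "2 * D \<le> d"
 shows "\<exists>\<epsilon> g s0. \<epsilon> \<in> O(\<lambda>s. sqrt (real s / 2 ^ s) * ln (real s)) \<and> negl D g \<and> (\<forall>s\<ge>s0. 0 \<le> \<epsilon> s \<and>
  (\<forall>X b v. X \<subseteq> {..<2 ^ (s * c)} \<longrightarrow> v < 2 ^ b \<longrightarrow> 2 ^ s / 16 \<le> real (card X) / 2 ^ b \<longrightarrow>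
   real (card X) / 2 ^ b \<le> 3 / 4 * 2 ^ s \<longrightarrow> deviation_prob s c d X b v (\<epsilon> s) \<le> g s))"
proof -
 define C where "C = c + d"
 obtain KA eA sA where A: "\<And>s X b v. s \<ge> sA \<Longrightarrow> X \<subseteq> {..<2 ^ (s * c)} \<Longrightarrow> v < 2 ^ b \<Longrightarrow>
   real (card X) \<le> 3 / 4 * 2 ^ s * 2 ^ b \<Longrightarrow> dependent_prob s c d X b v \<le> KA * real s ^ eA * 2 ^ s / (2 ^ s) ^ D"
 proof -
  obtain K e s0 where "\<forall>s\<ge>s0. \<forall>X b v. X \<subseteq> {..<2 ^ (s * c)} \<longrightarrow> v < 2 ^ b \<longrightarrow>
    real (card X) \<le> 3 / 4 * 2 ^ s * 2 ^ b \<longrightarrow> dependent_prob s c d X b v \<le> K * real s ^ e * 2 ^ s / (2 ^ s) ^ D"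
   using prob_dependent[OF c D] unfolding dependent_prob_def by (elim exE)
  then show ?thesis by (intro that[of s0 K e]) (elim allE impE, assumption+)
 qed
 \<comment> \<open>With \<tau> = \<kappa> s, the factor exp(-\<tau>) outweighs the union bound of
   the weak concentration, a power |\<Sigma>|^(C(c+1)) up to constants, and leaves
   |\<Sigma>|^(-D).\<close>
 define \<kappa> where "\<kappa> = real (C * (c + 1) + D + 1)"
 \<comment> \<open>Going back so many levels raises the mean by a factor of at least s^(2C), the
   square of the polylogarithmic loss in the weak concentration.\<close>
 define \<iota> where "\<iota> s = nat \<lceil>2 * real C * log 2 (real s)\<rceil>" for s
 define K where "K s = real (D + 1) * real s" for s
 \<comment> \<open>128 is 8 * 16, as the mean at the last level is at least 2^s / 16.\<close>
 define \<eta> where "\<eta> s = sqrt (128 * K s / 2 ^ s)" for s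
 define \<delta>0 where "\<delta>0 s = 8 * (2 * \<kappa>) ^ C / sqrt (2 ^ s)" for s :: nat
 define \<epsilon> where "\<epsilon> s = \<delta>0 s + (2 * real C * log 2 (real s) + 1) * \<eta> s" for s
 define gA where "gA s = \<bar>KA\<bar> * real s ^ eA * 2 ^ s / (2 ^ s) ^ D" for s
 define C1 where "C1 = real C * 16 ^ C * 2 * exp 1"
 define g where "g s = C1 / (2 ^ s) ^ D + 4 * real s ^ (4 * C) * (gA s + 2 / (2 ^ s) ^ D)" for s
 have k1: "\<kappa> \<ge> 1" by (simp add: \<kappa>_def)
 have eps: "\<epsilon> \<in> O(\<lambda>s. sqrt (real s / 2 ^ s) * ln (real s))"
  unfolding \<epsilon>_def \<delta>0_def \<eta>_def K_def by real_asymp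
 have neg: "negl D g" unfolding g_def gA_def
  by (intro negl_add negl_const negl_mult_power negl_power)
 have "eventually (\<lambda>s. \<epsilon> s \<le> 1) at_top" unfolding \<epsilon>_def \<delta>0_def \<eta>_def K_def by real_asymp
 then obtain s1 where s1: "\<And>s. s \<ge> s1 \<Longrightarrow> \<epsilon> s \<le> 1" by (auto simp: eventually_at_top_linorder)
 have main: "deviation_prob s c d X b v (\<epsilon> s) \<le> g s"
  if s: "s \<ge> max (max sA s1) 4" and X: "X \<subseteq> {..<2 ^ (s * c)}" and v: "v < 2 ^ b"
   and lo: "2 ^ s / 16 \<le> real (card X) / 2 ^ b" and hi: "real (card X) / 2 ^ b \<le> 3 / 4 * 2 ^ s" for s X b v
 proof -
  define \<mu> where "\<mu> = real (card X) / 2 ^ b"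
  \<comment> \<open>If there are fewer than \<open>\<iota> s\<close> levels, halving starts at level
    0, where all keys are selected and the count is exact.\<close>
  define i0 where "i0 = min b (\<iota> s)"
  define b1 where "b1 = b - i0"
  have b: "b = b1 + i0" by (simp add: b1_def i0_def)
  have s4: "s \<ge> 4" "real s \<ge> 4" using s by auto
  have finX: "finite X" using X finite_subset by blast
  have K0: "K s > 0" using s4 by (simp add: K_def)
  have eta0: "\<eta> s \<ge> 0" using K0 by (simp add: \<eta>_def)
  have del0: "\<delta>0 s \<ge> 0" using k1 by (simp add: \<delta>0_def)
  have log0: "log 2 (real s) \<ge> 0" using s4 by simp
  have iota_le: "real (\<iota> s) \<le> 2 * real C * log 2 (real s) + 1"
   unfolding \<iota>_def using log0 by (simp add: of_nat_nat)
  have iota_ge: "2 * real C * log 2 (real s) \<le> real (\<iota> s)"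
   unfolding \<iota>_def by linarith
  have pows: "2 powr (2 * real C * log 2 (real s)) = real s ^ (2 * C)"
  proof -
   have "2 powr (2 * real C * log 2 (real s)) = (2 powr log 2 (real s)) powr (real (2 * C))"
    by (simp add: powr_powr mult_ac)
   also have "\<dots> = real s ^ (2 * C)" using s4 by (subst powr_realpow) auto
   finally show ?thesis .
  qed
  have pow_ge: "real s ^ (2 * C) \<le> 2 ^ \<iota> s"
   using iota_ge unfolding pows[symmetric] by (simp add: powr_realpow[symmetric])
  have pow_le: "2 ^ \<iota> s \<le> 2 * real s ^ (2 * C)"
  proof -
   have "(2::real) ^ \<iota> s = 2 powr real (\<iota> s)" by (simp add: powr_realpow)
   also have "\<dots> \<le> 2 powr (2 * real C * log 2 (real s) + 1)" using iota_le by simp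
   also have "\<dots> = 2 * real s ^ (2 * C)" by (simp add: powr_add pows)
   finally show ?thesis .
  qed
  have i0_le: "real i0 \<le> 2 * real C * log 2 (real s) + 1" using iota_le by (simp add: i0_def)
  have tot: "\<delta>0 s + real i0 * \<eta> s \<le> \<epsilon> s" unfolding \<epsilon>_def using i0_le eta0 by (simp add: mult_right_mono)
  have start: "deviation_prob s c d X b1 (v div 2 ^ i0) (\<delta>0 s) \<le> C1 / (2 ^ s) ^ D"
  proof (cases "b1 = 0")
   case True
   then have "v div 2 ^ i0 = 0" using v b by simp
   then show ?thesis using True deviation_prob_0[OF finX del0, of s c d] by (simp add: C1_def)
  next
   case False
   then have i0: "i0 = \<iota> s" by (auto simp: b1_def i0_def min_def split: if_splits)
   define \<mu>1 where "\<mu>1 = real (card X) / 2 ^ b1"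
   have mu1: "\<mu>1 = 2 ^ \<iota> s * \<mu>" by (simp add: \<mu>1_def \<mu>_def b i0 power_add)
   define \<tau> where "\<tau> = \<kappa> * real s"
   have tau1: "\<tau> \<ge> 1" unfolding \<tau>_def using k1 s4 by (metis mult_mono order.trans mult_1 zero_le_one less_eq_real_def one_le_numeral)
   have m1: "real s ^ (2 * C) * (2 ^ s / 16) \<le> \<mu>1"
    unfolding mu1 using pow_ge lo by (intro mult_mono) (auto simp: \<mu>_def)
   then have sq: "real s ^ C * (sqrt (2 ^ s) / 4) \<le> sqrt \<mu>1"
   proof -
    have "(real s ^ C * (sqrt (2 ^ s) / 4))\<^sup>2 = real s ^ (2 * C) * (2 ^ s / 16)"
     by (simp add: power_mult_distrib power_divide power_mult[symmetric] mult.commute)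
    then show ?thesis using m1 by (intro real_le_rsqrt) simp
   qed
   have "(1::real) \<le> real s ^ C * (sqrt (2 ^ s) / 4)"
   proof -
    have "(2::real) ^ 4 \<le> 2 ^ s" using s4 by (intro power_increasing) auto
    then have "4 \<le> sqrt (2 ^ s)" by (intro real_le_rsqrt) simp
    then have "1 \<le> sqrt (2 ^ s) / (4::real)" by simp
    moreover have "1 \<le> real s ^ C" using s4 by (intro one_le_power) auto
    ultimately show ?thesis by (metis mult_mono mult_1 zero_le_one order.trans)
   qed
   then have sq1: "1 \<le> sqrt \<mu>1" using sq by linarith
   then have mu1pos: "\<mu>1 > 0" by (metis less_le_trans real_sqrt_gt_0_iff zero_less_one)
   have "(sqrt \<mu>1 + 1) * (2 * \<tau>) ^ C \<le> (2 * sqrt \<mu>1) * (2 * \<tau>) ^ C"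
    using sq1 tau1 by (intro mult_right_mono) auto
   also have "\<dots> = (2 * \<kappa>) ^ C * 8 / sqrt (2 ^ s) * sqrt \<mu>1 * (real s ^ C * (sqrt (2 ^ s) / 4))"
    by (simp add: \<tau>_def power_mult_distrib field_simps)
   also have "\<dots> \<le> (2 * \<kappa>) ^ C * 8 / sqrt (2 ^ s) * sqrt \<mu>1 * sqrt \<mu>1"
    using k1 sq mu1pos by (intro mult_left_mono) auto
   also have "\<dots> = \<delta>0 s * \<mu>1" using mu1pos by (simp add: \<delta>0_def)
   finally have cond: "(sqrt \<mu>1 + 1) * (2 * \<tau>) ^ C \<le> \<delta>0 s * \<mu>1" .
   have "v div 2 ^ i0 < 2 ^ b1" using v b by (simp add: less_mult_imp_div_less power_add)
   from deviation_prob_weak[OF X this tau1, of d "\<delta>0 s"]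
   have "deviation_prob s c d X b1 (v div 2 ^ i0) (\<delta>0 s) \<le> real C * (2 ^ s * 2 ^ b1) ^ C * 2 * exp (1 - \<tau>)"
    using cond unfolding C_def \<mu>1_def by blast
   also have "\<dots> \<le> real C * (16 ^ C * (2 ^ s) ^ (C * (c + 1))) * 2 * (exp 1 / (2 ^ s) ^ (C * (c + 1) + D))"
   proof (intro mult_mono)
    have "2 ^ b * (2 ^ s / 16) \<le> real (card X)" using lo by (simp add: field_simps)
    also have "\<dots> \<le> 2 ^ (s * c)" proof -
     have "card X \<le> 2 ^ (s * c)" using card_mono[OF finite_lessThan X] by simp
     then have "real (card X) \<le> real (2 ^ (s * c))" by (rule of_nat_mono)
     then show ?thesis by simp
    qed
    finally have "2 ^ b * 2 ^ s \<le> (16::real) * 2 ^ (s * c)" by simp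
    moreover have "(2::real) ^ b1 * 2 ^ s \<le> 2 ^ b * 2 ^ s"
     by (intro mult_right_mono power_increasing) (auto simp: b)
    ultimately have "(2::real) ^ s * 2 ^ b1 \<le> 16 * 2 ^ (s * c)" by (simp only: mult.commute)
    also have "\<dots> \<le> 16 * 2 ^ (s * (c + 1))" by (intro mult_left_mono power_increasing) auto
    finally have "((2::real) ^ s * 2 ^ b1) ^ C \<le> (16 * 2 ^ (s * (c + 1))) ^ C" by (intro power_mono) auto
    also have "\<dots> = 16 ^ C * (2 ^ s) ^ (C * (c + 1))"
     by (simp only: power_mult_distrib power_mult[symmetric]) (simp add: algebra_simps)
    finally show "((2::real) ^ s * 2 ^ b1) ^ C \<le> 16 ^ C * (2 ^ s) ^ (C * (c + 1))" .
    have "exp (1 - \<tau>) = exp 1 * exp (- \<tau>)" by (simp add: exp_diff exp_minus field_simps)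
    also have "exp (- \<tau>) \<le> 1 / (2 ^ s) ^ (C * (c + 1) + D)"
     by (rule exp_le_inverse_power) (simp add: \<tau>_def \<kappa>_def algebra_simps)
    finally show "exp (1 - \<tau>) \<le> exp 1 / (2 ^ s) ^ (C * (c + 1) + D)" by simp
   qed auto
   also have "\<dots> = C1 / (2 ^ s) ^ D" by (simp add: C1_def power_add)
   finally show ?thesis .
  qed
  have "deviation_prob s c d X b v (\<epsilon> s) \<le> deviation_prob s c d X b v (\<delta>0 s + real i0 * \<eta> s)"
   unfolding deviation_prob_def
  proof (intro prob_mono subsetI)
   fix w assume w: "w \<in> {(T1, T2). \<bar>real (card (selected s c d X v T1 T2)) - real (card X) / 2 ^ b\<bar> > \<epsilon> s * (real (card X) / 2 ^ b)}"
   have "(\<delta>0 s + real i0 * \<eta> s) * (real (card X) / 2 ^ b) \<le> \<epsilon> s * (real (card X) / 2 ^ b)"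
    using tot by (intro mult_right_mono) auto
   then show "w \<in> {(T1, T2). \<bar>real (card (selected s c d X v T1 T2)) - real (card X) / 2 ^ b\<bar> > (\<delta>0 s + real i0 * \<eta> s) * (real (card X) / 2 ^ b)}"
    using w by auto
  qed auto
  also have "\<dots> \<le> deviation_prob s c d X b1 (v div 2 ^ i0) (\<delta>0 s) + real i0 * (2 ^ i0 * (gA s + 2 * exp (- K s)))"
  proof (rule deviation_prob_iterate[OF finX v K0 b _ _ del0 _ eta0])
   show "dependent_prob s c d X b w \<le> gA s" if "w < 2 ^ b" for w
   proof -
    have "dependent_prob s c d X b w \<le> KA * real s ^ eA * 2 ^ s / (2 ^ s) ^ D"
     using s hi by (intro A X that) (auto simp: field_simps)
    also have "\<dots> \<le> gA s" unfolding gA_def by (intro divide_right_mono mult_right_mono) auto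
    finally show ?thesis .
   qed
   show "\<delta>0 s + real i0 * \<eta> s \<le> 1" using tot s1[of s] s by simp
   have "8 * K s = (\<eta> s)\<^sup>2 * (2 ^ s / 16)" using K0 by (simp add: \<eta>_def)
   also have "\<dots> \<le> (\<eta> s)\<^sup>2 * (real (card X) / 2 ^ b)" using lo by (intro mult_left_mono) auto
   finally show "8 * K s \<le> (\<eta> s)\<^sup>2 * (real (card X) / 2 ^ b)" .
  qed (simp add: gA_def)
  also have "\<dots> \<le> C1 / (2 ^ s) ^ D + 4 * real s ^ (4 * C) * (gA s + 2 / (2 ^ s) ^ D)"
  proof (rule add_mono[OF start])
   have "real i0 \<le> 2 ^ i0" using of_nat_less_two_power[of i0, where 'a = real] by linarith
   also have i0p: "(2::real) ^ i0 \<le> 2 * real s ^ (2 * C)"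
   proof -
    have "(2::real) ^ i0 \<le> 2 ^ \<iota> s" by (intro power_increasing) (auto simp: i0_def)
    then show ?thesis using pow_le by linarith
   qed
   finally have i0': "real i0 \<le> 2 * real s ^ (2 * C)" .
   have ex: "exp (- K s) \<le> 1 / (2 ^ s) ^ D"
    by (rule exp_le_inverse_power) (simp add: K_def algebra_simps)
   have gA0: "gA s \<ge> 0" by (simp add: gA_def)
   have "real i0 * (2 ^ i0 * (gA s + 2 * exp (- K s))) \<le>
     (2 * real s ^ (2 * C)) * ((2 * real s ^ (2 * C)) * (gA s + 2 / (2 ^ s) ^ D))"
    using i0' i0p ex gA0 by (intro mult_mono add_left_mono) (auto intro!: mult_nonneg_nonneg add_nonneg_nonneg)
   also have "\<dots> = 4 * (real s ^ (2 * C) * real s ^ (2 * C)) * (gA s + 2 / (2 ^ s) ^ D)" by simp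
   also have "real s ^ (2 * C) * real s ^ (2 * C) = real s ^ (4 * C)" by (simp flip: power_add)
   finally show "real i0 * (2 ^ i0 * (gA s + 2 * exp (- K s))) \<le> 4 * real s ^ (4 * C) * (gA s + 2 / (2 ^ s) ^ D)" .
  qed
  finally show ?thesis by (simp add: g_def)
 qed
 have pos: "\<epsilon> s \<ge> 0" if "s \<ge> 4" for s
  using that k1 by (simp add: \<epsilon>_def \<delta>0_def \<eta>_def K_def add_nonneg_nonneg)
 show ?thesis
 proof (rule exI[of _ \<epsilon>], rule exI[of _ g], rule exI[of _ "max (max sA s1) 4"], intro conjI eps neg allI impI)
  show "0 \<le> \<epsilon> s" if "max (max sA s1) 4 \<le> s" for s using that by (intro pos) simp
 qed (rule main)
qed

section \<open>Binomial laws and thinning\<close>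

lemma map_pmf_eq_uniform:
 assumes "v < (2 ^ b :: nat)"
 shows "map_pmf (\<lambda>y. y = v) (uniform_bits b) = bernoulli_pmf (1 / 2 ^ b)"
proof -
 have T: "pmf (map_pmf (\<lambda>y. y = v) (uniform_bits b)) True = 1 / 2 ^ b"
 proof -
  have "(\<lambda>y. y = v) -` {True} = {v}" by auto
  then show ?thesis using assms by (simp add: pmf_map measure_pmf_single lessThan_empty_iff)
 qed
 show ?thesis
 proof (rule pmf_eqI)
  fix x show "pmf (map_pmf (\<lambda>y. y = v) (uniform_bits b)) x = pmf (bernoulli_pmf (1 / 2 ^ b)) x"
   using T by (cases x) (auto simp: pmf_False_conv_True)
 qed
qed

lemma card_uniform_eq:
 assumes A: "finite A" and v: "v < (2 ^ b :: nat)"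
 shows "map_pmf (\<lambda>g. card {x \<in> A. g x = v}) (Pi_pmf A dflt (\<lambda>_. (uniform_bits b))) = binom (card A) (1 / 2 ^ b)"
proof -
 have "binom (card A) (1 / 2 ^ b) =
  map_pmf (\<lambda>f. card {x \<in> A. f x}) (Pi_pmf A (dflt = v) (\<lambda>_. map_pmf (\<lambda>y. y = v) (uniform_bits b)))"
  unfolding map_pmf_eq_uniform[OF v] by (rule binomial_pmf_altdef'[OF A]) (auto simp: field_simps)
 also have "\<dots> = map_pmf (\<lambda>g. card {x \<in> A. g x = v}) (Pi_pmf A dflt (\<lambda>_. (uniform_bits b)))"
  by (subst Pi_pmf_map[OF A, where dflt = dflt]) (auto simp: map_pmf_comp)
 finally show ?thesis ..
qed

text \<open>Both laws count successes of the same tosses over nested index sets.\<close>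

lemma binomial_mono:
 assumes "N \<le> N'" and q: "q \<in> {0..1}"
 shows "prob (binom N q) {j..} \<le> prob (binom N' q) {j..}"
  and "prob (binom N' q) {..j} \<le> prob (binom N q) {..j}"
proof -
 let ?P = "Pi_pmf {..<N'} False (\<lambda>_. bernoulli_pmf q)"
 have N': "binom N' q = map_pmf (\<lambda>f. card {x \<in> {..<N'}. f x}) ?P"
  by (rule binomial_pmf_altdef') (use q in auto)
 have "binom N q = map_pmf (\<lambda>f. card {x \<in> {..<N}. f x}) (Pi_pmf {..<N} False (\<lambda>_. bernoulli_pmf q))"
  by (rule binomial_pmf_altdef') (use q in auto)
 also have "Pi_pmf {..<N} False (\<lambda>_. bernoulli_pmf q) = map_pmf (\<lambda>f x. if x \<in> {..<N} then f x else False) ?P"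
  by (rule Pi_pmf_subset) (use assms in auto)
 finally have N: "binom N q = map_pmf (\<lambda>f. card {x \<in> {..<N}. f x}) ?P"
  by (simp add: map_pmf_comp cong: conj_cong)
 have le: "card {x \<in> {..<N}. f x} \<le> card {x \<in> {..<N'}. f x}" for f
  using assms(1) by (intro card_mono) auto
 show "prob (binom N q) {j..} \<le> prob (binom N' q) {j..}"
  unfolding N N' measure_map_pmf using le
  by (intro prob_mono) (auto intro: order.trans)
 show "prob (binom N' q) {..j} \<le> prob (binom N q) {..j}"
  unfolding N N' measure_map_pmf using le
  by (intro prob_mono) (auto intro: order.trans)
qed

lemma bernoulli_mult:
 assumes q: "q1 \<in> {0..1}" "q2 \<in> {0..1}"
 shows "bernoulli_pmf (q1 * q2) = bind_pmf (bernoulli_pmf q1) (\<lambda>b. if b then bernoulli_pmf q2 else return_pmf False)"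
proof (rule pmf_eqI)
 have q12: "q1 * q2 \<in> {0..1}" using q by (auto intro: mult_le_one)
 have T: "pmf (bernoulli_pmf (q1 * q2)) True = pmf (bind_pmf (bernoulli_pmf q1) (\<lambda>b. if b then bernoulli_pmf q2 else return_pmf False)) True"
  using q q12 by (simp add: pmf_bind)
 fix x show "pmf (bernoulli_pmf (q1 * q2)) x = pmf (bind_pmf (bernoulli_pmf q1) (\<lambda>b. if b then bernoulli_pmf q2 else return_pmf False)) x"
  using T by (cases x) (simp_all only: pmf_False_conv_True)
qed

text \<open>Two successive independent tosses per element are one toss with the product
  probability.\<close>

lemma bind_binomial:
 assumes q: "q1 \<in> {0..1}" "q2 \<in> {0..1}"
 shows "bind_pmf (binom N q1) (\<lambda>k. binom k q2) = binom N (q1 * q2)"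
proof -
 let ?A = "{..<N}"
 have q12: "q1 * q2 \<in> {0..1}" using q by (auto intro: mult_le_one)
 note bern = bernoulli_mult[OF q]
 have inner: "map_pmf (\<lambda>g. card {x \<in> ?A. g x}) (Pi_pmf {x \<in> ?A. f x} False (\<lambda>_. bernoulli_pmf q2)) =
   binom (card {x \<in> ?A. f x}) q2" for f
 proof -
  have "map_pmf (\<lambda>g. card {x \<in> ?A. g x}) (Pi_pmf {x \<in> ?A. f x} False (\<lambda>_. bernoulli_pmf q2)) =
   map_pmf (\<lambda>g. card {x \<in> {x \<in> ?A. f x}. g x}) (Pi_pmf {x \<in> ?A. f x} False (\<lambda>_. bernoulli_pmf q2))"
  proof (rule map_pmf_cong[OF refl])
   fix g assume "g \<in> set_pmf (Pi_pmf {x \<in> ?A. f x} False (\<lambda>_. bernoulli_pmf q2))"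
   then have "\<forall>x. x \<notin> {x \<in> ?A. f x} \<longrightarrow> g x = False"
    using set_Pi_pmf_subset[of "{x \<in> ?A. f x}" False "\<lambda>_. bernoulli_pmf q2"] by auto
   then have "{x \<in> ?A. g x} = {x \<in> {x \<in> ?A. f x}. g x}" by auto
   then show "card {x \<in> ?A. g x} = card {x \<in> {x \<in> ?A. f x}. g x}" by simp
  qed
  also have "\<dots> = binom (card {x \<in> ?A. f x}) q2"
   by (rule binomial_pmf_altdef'[symmetric]) (use q in auto)
  finally show ?thesis .
 qed
 have "binom N (q1 * q2) = map_pmf (\<lambda>g. card {x \<in> ?A. g x}) (Pi_pmf ?A False (\<lambda>_. bernoulli_pmf (q1 * q2)))"
  by (rule binomial_pmf_altdef') (use q12 in auto)
 also have "\<dots> = bind_pmf (Pi_pmf ?A False (\<lambda>_. bernoulli_pmf q1)) (\<lambda>f. binom (card {x \<in> ?A. f x}) q2)"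
  unfolding bern by (subst Pi_pmf_bind[where d' = False]) (simp_all add: map_bind_pmf Pi_pmf_if_set inner[simplified])
 also have "\<dots> = bind_pmf (binom N q1) (\<lambda>k. binom k q2)"
  by (subst binomial_pmf_altdef'[of ?A N q1 False]) (use q in \<open>auto simp: bind_map_pmf\<close>)
 finally show ?thesis ..
qed

lemma binomial_deviation:
 assumes q: "q \<in> {0..1}" and \<theta>: "0 \<le> \<theta>" "\<theta> \<le> 1"
 shows "prob (binom N q) {k. t \<le> \<bar>real k - real N * q\<bar>} \<le> 2 * exp (\<theta>\<^sup>2 * (real N * q) - \<theta> * t)"
proof -
 define Z where "Z = (\<lambda>(_::nat) y. (if y then 1 - q else - q))"
 have sum: "real (card {x \<in> {..<N}. f x}) - real N * q = (\<Sum>a<N. Z a (f a))" for f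
 proof -
  have "(\<Sum>a<N. Z a (f a)) = (\<Sum>a<N. (if f a then 1 else 0) - q)"
   by (intro sum.cong) (auto simp: Z_def)
  also have "\<dots> = (\<Sum>a<N. if f a then 1 else 0) - real N * q" by (simp add: sum_subtractf)
  also have "(\<Sum>a<N. if f a then 1 else 0 :: real) = real (card {x \<in> {..<N}. f x})"
   by (simp add: sum.If_cases Int_def)
  finally show ?thesis by simp
 qed
 have E: "expect (bernoulli_pmf q) h = q * h True + (1 - q) * h False" for h :: "bool \<Rightarrow> real"
  using q by simp
 have "prob (Pi_pmf {..<N} False (\<lambda>_. bernoulli_pmf q)) {f. t \<le> \<bar>\<Sum>a<N. Z a (f a)\<bar>} \<le>
  2 * exp (\<theta>\<^sup>2 * (\<Sum>a<N. q) - \<theta> * t)"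
 proof (rule prob_abs_sum_ge)
  show "expect (bernoulli_pmf q) (Z a) = 0" for a
   unfolding E by (simp add: Z_def)
  have "q * (1 - q)\<^sup>2 + (1 - q) * q\<^sup>2 = q * (1 - q)" by (simp add: power2_eq_square algebra_simps)
  also have "\<dots> \<le> q * 1" using q by (intro mult_left_mono) auto
  finally show "expect (bernoulli_pmf q) (\<lambda>y. (Z a y)\<^sup>2) \<le> q" for a
   unfolding E by (simp add: Z_def)
  show "\<theta> * \<bar>Z a y\<bar> \<le> 1" for a y using q \<theta> by (auto simp: Z_def intro: mult_le_one)
 qed (use \<theta> in auto)
 moreover have "binom N q = map_pmf (\<lambda>f. card {x \<in> {..<N}. f x}) (Pi_pmf {..<N} False (\<lambda>_. bernoulli_pmf q))"
  by (rule binomial_pmf_altdef') (use q in auto)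
 ultimately show ?thesis by (simp add: sum[symmetric] vimage_def)
qed

section \<open>Numbers of selected keys compared with binomial counts\<close>

lemma prob_pair_le:
 assumes le: "\<And>x. x \<in> set_pmf M \<Longrightarrow> G x \<Longrightarrow> prob N {y. Q x y} \<le> u x"
  and u: "\<And>x. 0 \<le> u x" "\<And>x. u x \<le> 1"
 shows "prob (pair_pmf M N) {(x, y). Q x y} \<le> prob M {x. \<not> G x} + expect M u"
proof -
 have int: "integrable (measure_pmf M) u" by (rule measure_pmf.integrable_const_bound[of _ 1]) (use u in auto)
 have int': "integrable (measure_pmf M) (\<lambda>x. indicator {x. \<not> G x} x :: real)"
  by (rule measure_pmf.integrable_const_bound[of _ 1]) (auto simp: indicator_def)
 have "prob (pair_pmf M N) {(x, y). Q x y} = expect M (\<lambda>x. prob N {y. Q x y})"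
  by (simp add: prob_pair)
 also have "\<dots> \<le> expect M (\<lambda>x. indicator {x. \<not> G x} x + u x)"
 proof (rule integral_mono_AE)
  show "integrable (measure_pmf M) (\<lambda>x. prob N {y. Q x y})"
   by (rule measure_pmf.integrable_const_bound[of _ 1]) auto
  have "prob N {y. Q x y} \<le> indicator {x. \<not> G x} x + u x" if "x \<in> set_pmf M" for x
  proof (cases "G x")
   case True then show ?thesis using le[OF that] by simp
  next
   case False then show ?thesis using u(1)[of x] measure_pmf.prob_le_1[of N "{y. Q x y}"] by (simp add: add_increasing2)
  qed
  then show "AE x in measure_pmf M. prob N {y. Q x y} \<le> indicator {x. \<not> G x} x + u x" by (simp add: AE_measure_pmf_iff)
 qed (rule Bochner_Integration.integrable_add int int')+
 also have "\<dots> = prob M {x. \<not> G x} + expect M u"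
  by (subst Bochner_Integration.integral_add[OF int' int]) simp
 finally show ?thesis .
qed

text \<open>Keys pass the filter if \<open>bl\<close> bits of their hash value and \<open>e\<close> additional truly random bits vanish.\<close>

definition filtered_count :: "nat \<Rightarrow> nat \<Rightarrow> nat \<Rightarrow> nat set \<Rightarrow> nat \<Rightarrow> nat \<Rightarrow> nat pmf" where
 "filtered_count s c d X bl e =
   map_pmf (\<lambda>(z, T1, T2). card (selected s c d {x \<in> X. z x = 0} 0 T1 T2))
    (pair_pmf (Pi_pmf X 0 (\<lambda>_. (uniform_bits e)))
     (table_pair s c d bl))"

text \<open>If the derived keys selected by the first \<open>b1\<close> bits are independent, the
  other \<open>b2\<close> bits act on them as independent coin tosses.\<close>

lemma filtered_count_le:
 assumes X: "finite X" and bl: "bl = b1 + b2"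
 shows "prob (filtered_count s c d X bl e) S \<le>
   prob (pair_pmf (Pi_pmf X 0 (\<lambda>_. (uniform_bits e)))
     (table_pair s c d b1))
    {(z, T1, T2). \<not> derived_indep s c d T1 (selected s c d {x \<in> X. z x = 0} 0 T1 T2)} +
   expect (pair_pmf (Pi_pmf X 0 (\<lambda>_. (uniform_bits e)))
     (table_pair s c d b1))
    (\<lambda>(z, T1, T2). prob (binom (card (selected s c d {x \<in> X. z x = 0} 0 T1 T2)) (1 / 2 ^ b2)) S)"
proof -
 let ?Z = "Pi_pmf X 0 (\<lambda>_. (uniform_bits e))"
 let ?R1 = "random_tables s c (s * d)"
 let ?R = "random_tables s (c + d)"
 define \<kappa> where "\<kappa> T1 = derived s c T1" for T1
 define Y where "Y w = (case w of (z :: nat \<Rightarrow> nat, T1, T2) \<Rightarrow> selected s c d {x \<in> X. z x = 0} 0 T1 T2)" for w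
 let ?M = "pair_pmf ?Z (pair_pmf ?R1 (?R b1))"
 define Q where "Q w T3 = (case w of (z :: nat \<Rightarrow> nat, T1, T2) \<Rightarrow> card (selected s c d {x \<in> X. z x = 0} 0 T1 (concat_tables b2 T2 T3)) \<in> S)" for w T3
 have "pair_pmf ?Z (pair_pmf ?R1 (?R bl)) = map_pmf (\<lambda>((z, T1, T2), T3). (z, T1, concat_tables b2 T2 T3)) (pair_pmf ?M (?R b2))"
  unfolding bl random_tables_concat
  by (simp add: pair_pmf_def map_bind_pmf bind_map_pmf bind_assoc_pmf bind_return_pmf map_pmf_def)
 then have "prob (filtered_count s c d X bl e) S = prob (pair_pmf ?M (?R b2)) {(w, T3). Q w T3}"
  by (simp add: filtered_count_def Q_def split_def vimage_def)
 also have "\<dots> \<le> prob ?M {w. \<not> (case w of (z, T1, T2) \<Rightarrow> indep s (c + d) (\<kappa> T1) (Y w))} +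
   expect ?M (\<lambda>w. prob (binom (card (Y w)) (1 / 2 ^ b2)) S)"
 proof (rule prob_pair_le)
  fix w :: "(nat \<Rightarrow> nat) \<times> (nat \<Rightarrow> nat \<Rightarrow> nat) \<times> (nat \<Rightarrow> nat \<Rightarrow> nat)"
  obtain z T1 T2 where w: "w = (z, T1, T2)" by (cases w)
  assume "case w of (z, T1, T2) \<Rightarrow> indep s (c + d) (\<kappa> T1) (Y w)"
  then have ind: "indep s (c + d) (\<kappa> T1) (Y w)" by (simp add: w)
  have finY: "finite (Y w)" using X by (simp add: Y_def w selected_def)
  have "prob (?R b2) {T3. Q w T3} = prob (Pi_pmf (Y w) 0 (\<lambda>_. (uniform_bits b2))) {g. card {x \<in> Y w. g x = 0} \<in> S}"
  proof (rule prob_simple_tab_indep[OF ind])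
   fix T3 assume T3: "T3 \<in> table_set s (c + d) b2"
   then have lt: "T3 i a < 2 ^ b2" for i a by (simp add: table_set_iff)
   have "selected s c d {x \<in> X. z x = 0} 0 T1 (concat_tables b2 T2 T3) =
    {x \<in> Y w. (if x \<in> Y w then simple_tab s (c + d) T3 (\<kappa> T1 x) else 0) = 0}"
    by (auto simp: selected_def Y_def w \<kappa>_def simple_tab_concat[OF lt])
   then show "T3 \<in> {T3. Q w T3} \<longleftrightarrow> (\<lambda>x. if x \<in> Y w then simple_tab s (c + d) T3 (\<kappa> T1 x) else 0) \<in> {g. card {x \<in> Y w. g x = 0} \<in> S}"
    by (simp add: Q_def w)
  qed
  also have "\<dots> = prob (binom (card (Y w)) (1 / 2 ^ b2)) S"
   by (subst card_uniform_eq[OF finY, of 0 b2 0, symmetric]) (simp_all add: vimage_def)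
  finally show "prob (?R b2) {T3. Q w T3} \<le> prob (binom (card (Y w)) (1 / 2 ^ b2)) S" by simp
 qed auto
 finally show ?thesis by (simp add: Y_def \<kappa>_def split_def)
qed

text \<open>The binomial law with \<open>N\<close> and \<open>q1 * q2\<close> results from thinning
  a binomial number with \<open>N\<close> and \<open>q1\<close>. Unless this number lies on the
  wrong side of \<open>M\<close>, its thinning dominates that of \<open>M\<close> elements. This
  turns concentration of an intermediate count into a comparison of exact tails.\<close>

lemma binomial_thinning_le:
 assumes q: "q1 \<in> {0..1}" "q2 \<in> {0..1}"
 shows "prob (binom M q2) {j..} \<le>
   prob (binom N (q1 * q2)) {j..} + prob (binom N q1) {k. k < M}"
  and "prob (binom M q2) {..j} \<le>
   prob (binom N (q1 * q2)) {..j} + prob (binom N q1) {k. M < k}"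
proof -
 have gen: "prob (binom M q2) S \<le>
   prob (binom N (q1 * q2)) S + prob (binom N q1) {k. P k}"
  if le: "\<And>k. \<not> P k \<Longrightarrow> prob (binom M q2) S \<le> prob (binom k q2) S" for S P
 proof -
  have "prob (binom M q2) S = expect (binom N q1) (\<lambda>k. prob (binom M q2) S)"
   by simp
  also have "\<dots> \<le> expect (binom N q1) (\<lambda>k. prob (binom k q2) S + indicator {k. P k} k)"
  proof (rule integral_mono)
   fix k show "prob (binom M q2) S \<le> prob (binom k q2) S + indicator {k. P k} k"
    using le[of k] measure_pmf.prob_le_1[of "binom M q2" S] by (cases "P k") (auto simp: add_increasing)
  qed (simp, intro Bochner_Integration.integrable_add measure_pmf.integrable_const_bound[of _ 1], auto simp: indicator_def)
  also have "\<dots> = expect (binom N q1) (\<lambda>k. prob (binom k q2) S) +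
    expect (binom N q1) (indicator {k. P k})"
   by (rule Bochner_Integration.integral_add) (auto intro!: measure_pmf.integrable_const_bound[of _ 1] simp: indicator_def)
  also have "\<dots> = prob (binom N (q1 * q2)) S + prob (binom N q1) {k. P k}"
   by (simp add: bind_binomial[OF q, symmetric] prob_bind)
  finally show ?thesis .
 qed
 show "prob (binom M q2) {j..} \<le>
   prob (binom N (q1 * q2)) {j..} + prob (binom N q1) {k. k < M}"
  by (rule gen) (rule binomial_mono(1), use q in auto)
 show "prob (binom M q2) {..j} \<le>
   prob (binom N (q1 * q2)) {..j} + prob (binom N q1) {k. M < k}"
  by (rule gen) (rule binomial_mono(2), use q in auto)
qed

lemma binomial_relative_deviation:
 assumes q: "q \<in> {0..1}" and \<eta>: "0 \<le> \<eta>" "\<eta> \<le> 1" and x: "real N * q \<le> 2 * x" "0 \<le> x"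
 shows "prob (binom N q) {k. \<eta> * x \<le> \<bar>real k - real N * q\<bar>} \<le> 2 * exp (- (\<eta>\<^sup>2 * x / 8))"
proof -
 have "(\<eta> / 4)\<^sup>2 * (real N * q) - (\<eta> / 4) * (\<eta> * x) \<le> (\<eta> / 4)\<^sup>2 * (2 * x) - (\<eta> / 4) * (\<eta> * x)"
  using x by (intro diff_right_mono mult_left_mono) auto
 also have "\<dots> = - (\<eta>\<^sup>2 * x / 8)" by (simp add: power2_eq_square)
 finally have e: "exp ((\<eta> / 4)\<^sup>2 * (real N * q) - (\<eta> / 4) * (\<eta> * x)) \<le> exp (- (\<eta>\<^sup>2 * x / 8))" by simp
 have "prob (binom N q) {k. \<eta> * x \<le> \<bar>real k - real N * q\<bar>} \<le>
   2 * exp ((\<eta> / 4)\<^sup>2 * (real N * q) - (\<eta> / 4) * (\<eta> * x))"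
  using \<eta> by (intro binomial_deviation[OF q]) auto
 also have "\<dots> \<le> 2 * exp (- (\<eta>\<^sup>2 * x / 8))" using e by linarith
 finally show ?thesis .
qed

text \<open>Few random bits: the number of keys surviving them is exactly binomial.\<close>

lemma filtered_count_sparse:
 assumes X: "finite X" and n: "real (card X) / 2 ^ e \<le> 2 ^ s / 2" and gA0: "gA \<ge> 0"
  and A: "\<And>X'. X' \<subseteq> X \<Longrightarrow> real (card X') \<le> 3 / 4 * 2 ^ s \<Longrightarrow> dependent_prob s c d X' 0 0 \<le> gA"
 shows "prob (filtered_count s c d X bl e) S \<le>
  prob (binom (card X) (1 / 2 ^ (bl + e))) S + gA + 2 * exp (- (2 ^ s / 32))"
proof -
 let ?Z = "Pi_pmf X 0 (\<lambda>_. (uniform_bits e))"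
 let ?T = "table_pair s c d 0"
 define X' where "X' z = {x \<in> X. z x = (0::nat)}" for z
 define n where "n = card X"
 have bin: "map_pmf (\<lambda>z. card (X' z)) ?Z = binom n (1 / 2 ^ e)"
  unfolding X'_def n_def by (rule card_uniform_eq[OF X]) simp
 have sel: "selected s c d Y 0 T1 T2 = Y" if "T2 \<in> table_set s (c + d) 0" for T1 T2 Y
 proof -
  have "simple_tab s (c + d) T2 x < 2 ^ 0" for x using that by (intro simple_tab_less) (simp add: table_set_iff)
  then show ?thesis by (simp add: selected_def)
 qed
 have 1: "prob (pair_pmf ?Z ?T) {(z, T). case T of (T1, T2) \<Rightarrow> \<not> derived_indep s c d T1 (selected s c d (X' z) 0 T1 T2)}
  \<le> prob ?Z {z. \<not> real (card (X' z)) \<le> 3 / 4 * 2 ^ s} + expect ?Z (\<lambda>_. min 1 gA)"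
 proof (rule prob_pair_le)
  fix z assume "real (card (X' z)) \<le> 3 / 4 * 2 ^ s"
  then have "dependent_prob s c d (X' z) 0 0 \<le> gA" by (intro A) (auto simp: X'_def)
  then show "prob ?T {T. case T of (T1, T2) \<Rightarrow> \<not> derived_indep s c d T1 (selected s c d (X' z) 0 T1 T2)} \<le> min 1 gA"
   unfolding dependent_prob_def by simp
 qed (use gA0 in auto)
 have 2: "prob ?Z {z. \<not> real (card (X' z)) \<le> 3 / 4 * 2 ^ s} \<le> 2 * exp (- (2 ^ s / 32))"
 proof -
  have "prob ?Z {z. \<not> real (card (X' z)) \<le> 3 / 4 * 2 ^ s} = prob (binom n (1 / 2 ^ e)) {k. \<not> real k \<le> 3 / 4 * 2 ^ s}"
   unfolding bin[symmetric] by (simp add: vimage_def)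
  also have "\<dots> \<le> prob (binom n (1 / 2 ^ e)) {k. 2 ^ s / 4 \<le> \<bar>real k - real n * (1 / 2 ^ e)\<bar>}"
   using n unfolding n_def[symmetric] by (intro prob_mono) auto
  also have "\<dots> \<le> 2 * exp ((1/4)\<^sup>2 * (real n * (1 / 2 ^ e)) - 1 / 4 * (2 ^ s / 4))"
   by (rule binomial_deviation) auto
  also have "\<dots> \<le> 2 * exp (- (2 ^ s / 32))"
  proof -
   define m where "m = real n / 2 ^ e"
   have "m \<le> 2 ^ s / 2" using n by (simp add: m_def n_def)
   moreover have "(1/4)\<^sup>2 * (real n * (1 / 2 ^ e)) - 1 / 4 * (2 ^ s / 4) = m / 16 - 2 ^ s / 16"
    by (simp add: m_def power2_eq_square)
   ultimately show ?thesis by simp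
  qed
  finally show ?thesis .
 qed
 have "expect (pair_pmf ?Z ?T) (\<lambda>(z, T1, T2). prob (binom (card (selected s c d (X' z) 0 T1 T2)) (1 / 2 ^ bl)) S)
  = expect (pair_pmf ?Z ?T) (\<lambda>w. prob (binom (card (X' (fst w))) (1 / 2 ^ bl)) S)"
 proof (rule integral_cong_AE)
  show "AE w in measure_pmf (pair_pmf ?Z ?T). (case w of (z, T1, T2) \<Rightarrow> prob (binom (card (selected s c d (X' z) 0 T1 T2)) (1 / 2 ^ bl)) S)
    = prob (binom (card (X' (fst w))) (1 / 2 ^ bl)) S"
   by (rule AE_pmfI) (auto simp: random_tables_eq finite_table_set sel)
 qed auto
 also have "\<dots> = expect (map_pmf fst (pair_pmf ?Z ?T)) (\<lambda>z. prob (binom (card (X' z)) (1 / 2 ^ bl)) S)"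
  by simp
 also have "\<dots> = expect (map_pmf (\<lambda>z. card (X' z)) ?Z) (\<lambda>k. prob (binom k (1 / 2 ^ bl)) S)"
  by (simp add: map_fst_pair_pmf)
 also have "\<dots> = prob (binom n (1 / 2 ^ (bl + e))) S"
  unfolding bin prob_bind[symmetric] by (subst bind_binomial) (auto simp: field_simps power_add)
 finally have 3: "expect (pair_pmf ?Z ?T) (\<lambda>(z, T1, T2). prob (binom (card (selected s c d (X' z) 0 T1 T2)) (1 / 2 ^ bl)) S)
  = prob (binom n (1 / 2 ^ (bl + e))) S" .
 \<comment> \<open>No hash bit is exposed in advance: once the keys that survive the random bits are
   independent, all \<open>bl\<close> bits toss coins for them.\<close>
 have "bl = 0 + bl" by simp
 from filtered_count_le[OF X this, of s c d e S]
 have "prob (filtered_count s c d X bl e) S \<le>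
   prob (pair_pmf ?Z ?T) {(z, T). case T of (T1, T2) \<Rightarrow> \<not> derived_indep s c d T1 (selected s c d (X' z) 0 T1 T2)}
   + prob (binom n (1 / 2 ^ (bl + e))) S"
  unfolding X'_def[symmetric] 3 by (simp add: split_def)
 then show ?thesis using 1 2 unfolding n_def by simp
qed

text \<open>Many keys survive the random bits: the number of keys surviving these and the first \<open>b1\<close>
 bits of the hash values is concentrated, and the remaining bits act as truly random.\<close>

lemma filtered_count_dense:
 assumes X: "finite X" and bl: "bl = b1 + b2"
  and x: "x = real (card X) / 2 ^ (e + b1)" "2 ^ s / 4 \<le> x" "x \<le> 2 ^ s / 2"
  and gA0: "gA \<ge> 0" and gB0: "gB \<ge> 0" and \<delta>: "0 \<le> \<delta>" "2 * \<delta> + 3 * \<eta> \<le> 1" and \<eta>: "0 \<le> \<eta>" "4 \<le> \<eta> * 2 ^ s"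
  and A: "\<And>X'. X' \<subseteq> X \<Longrightarrow> real (card X') / 2 ^ b1 \<le> 3 / 4 * 2 ^ s \<Longrightarrow> dependent_prob s c d X' b1 0 \<le> gA"
  and B: "\<And>X'. X' \<subseteq> X \<Longrightarrow> 2 ^ s / 16 \<le> real (card X') / 2 ^ b1 \<Longrightarrow> real (card X') / 2 ^ b1 \<le> 3 / 4 * 2 ^ s \<Longrightarrow> deviation_prob s c d X' b1 0 \<delta> \<le> gB"
 shows "(1 + 2 * \<delta> + 3 * \<eta>) * real (card X) \<le> real N + 1 \<Longrightarrow>
   prob (filtered_count s c d X bl e) {j..} \<le>
    prob (binom N (1 / 2 ^ (bl + e))) {j..} + 2 * gA + gB + 6 * exp (- (\<eta>\<^sup>2 * 2 ^ s / 32))" (is "_ \<Longrightarrow> ?th1")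
  and "real N \<le> (1 - 2 * \<delta> - 3 * \<eta>) * real (card X) + 1 \<Longrightarrow>
   prob (filtered_count s c d X bl e) {..j} \<le>
    prob (binom N (1 / 2 ^ (bl + e))) {..j} + 2 * gA + gB + 6 * exp (- (\<eta>\<^sup>2 * 2 ^ s / 32))" (is "_ \<Longrightarrow> ?th2")
proof -
 let ?Z = "Pi_pmf X 0 (\<lambda>_. (uniform_bits e))"
 let ?T = "table_pair s c d b1"
 let ?E = "exp (- (\<eta>\<^sup>2 * 2 ^ s / 32))"
 define X' where "X' z = {x \<in> X. z x = (0::nat)}" for z
 define n where "n = real (card X)"
 define y where "y = n / 2 ^ e"
 define q1 where "q1 = (1::real) / 2 ^ (e + b1)"
 define q2 where "q2 = (1::real) / 2 ^ b2"
 define Y where "Y = (\<lambda>(z, T1, T2). selected s c d (X' z) 0 T1 T2)"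
 \<comment> \<open>The factors with \<eta> account for the random bits, those with \<delta> for the
   first \<open>b1\<close> hash bits.\<close>
 define G where "G w \<longleftrightarrow> (1 - \<delta>) * (1 - \<eta>) * x \<le> real (card (Y w)) \<and> real (card (Y w)) \<le> (1 + \<delta>) * (1 + \<eta>) * x" for w
 have q: "q1 \<in> {0..1}" "q2 \<in> {0..1}" "q1 * q2 = 1 / 2 ^ (bl + e)"
  by (simp_all add: q1_def q2_def bl del: power_add) (simp add: power_add)
 have nx: "n * q1 = x" by (simp add: n_def q1_def x(1))
 have yx: "y / 2 ^ b1 = x" by (simp add: y_def n_def x(1) power_add)
 have x0: "x > 0" using x(2) less_le_trans[of 0 "2 ^ s / 4" x] by simp
 have eta1: "\<eta> \<le> 1 / 3" "\<delta> \<le> 1 / 2" using \<delta> \<eta> by auto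
 have yx': "x \<le> y"
 proof -
  have "x * 1 \<le> x * 2 ^ b1" using x0 by (intro mult_left_mono) auto
  moreover have "x * 2 ^ b1 = y" unfolding yx[symmetric] by simp
  ultimately show ?thesis by linarith
 qed
 have exE: "exp (- (\<eta>\<^sup>2 * w / 8)) \<le> ?E" if "x \<le> w" for w
 proof -
  have "\<eta>\<^sup>2 * (2 ^ s / 4) \<le> \<eta>\<^sup>2 * w" using x(2) that by (intro mult_left_mono) auto
  then show ?thesis by simp
 qed
 have bin: "map_pmf (\<lambda>z. card (X' z)) ?Z = binom (card X) (1 / 2 ^ e)"
  unfolding X'_def by (rule card_uniform_eq[OF X]) simp
 define GZ where "GZ z \<longleftrightarrow> \<bar>real (card (X' z)) - y\<bar> < \<eta> * y" for z
 have pZ: "prob ?Z {z. \<not> GZ z} \<le> 2 * ?E"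
 proof -
  have "prob ?Z {z. \<not> GZ z} = prob (binom (card X) (1 / 2 ^ e)) {k. \<eta> * y \<le> \<bar>real k - real (card X) * (1 / 2 ^ e)\<bar>}"
   unfolding bin[symmetric] by (simp add: vimage_def GZ_def y_def n_def not_less)
  also have "\<dots> \<le> 2 * exp (- (\<eta>\<^sup>2 * y / 8))"
   by (rule binomial_relative_deviation) (use \<eta> eta1 x0 yx' in \<open>auto simp: y_def n_def\<close>)
  finally show ?thesis using exE[OF yx'] by linarith
 qed
 have GZ_range: "(1 - \<eta>) * x \<le> real (card (X' z)) / 2 ^ b1" "real (card (X' z)) / 2 ^ b1 \<le> (1 + \<eta>) * x"
   "2 ^ s / 16 \<le> real (card (X' z)) / 2 ^ b1" "real (card (X' z)) / 2 ^ b1 \<le> 3 / 4 * 2 ^ s" if "GZ z" for z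
 proof -
  have "(1 - \<eta>) * y \<le> real (card (X' z))" "real (card (X' z)) \<le> (1 + \<eta>) * y"
   using that by (auto simp: GZ_def algebra_simps)
  then have "(1 - \<eta>) * y / 2 ^ b1 \<le> real (card (X' z)) / 2 ^ b1" "real (card (X' z)) / 2 ^ b1 \<le> (1 + \<eta>) * y / 2 ^ b1"
   by (auto intro: divide_right_mono)
  then show 1: "(1 - \<eta>) * x \<le> real (card (X' z)) / 2 ^ b1" "real (card (X' z)) / 2 ^ b1 \<le> (1 + \<eta>) * x"
   unfolding yx[symmetric] by simp_all
  have "1 / 4 * x \<le> (1 - \<eta>) * x" "(1 + \<eta>) * x \<le> 3 / 2 * x" using eta1 x0 by (auto intro: mult_right_mono)
  then show "2 ^ s / 16 \<le> real (card (X' z)) / 2 ^ b1" "real (card (X' z)) / 2 ^ b1 \<le> 3 / 4 * 2 ^ s" using 1 x by linarith+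
 qed
 have 1: "prob (pair_pmf ?Z ?T) {(z, T). case T of (T1, T2) \<Rightarrow> \<not> derived_indep s c d T1 (selected s c d (X' z) 0 T1 T2)}
  \<le> prob ?Z {z. \<not> GZ z} + expect ?Z (\<lambda>_. min 1 gA)"
 proof (rule prob_pair_le)
  fix z assume "GZ z"
  then have "dependent_prob s c d (X' z) b1 0 \<le> gA" by (intro A GZ_range) (auto simp: X'_def)
  then show "prob ?T {T. case T of (T1, T2) \<Rightarrow> \<not> derived_indep s c d T1 (selected s c d (X' z) 0 T1 T2)} \<le> min 1 gA"
   unfolding dependent_prob_def by simp
 qed (use gA0 in auto)
 have 2: "prob (pair_pmf ?Z ?T) {(z, T). \<not> G (z, T)}
  \<le> prob ?Z {z. \<not> GZ z} + expect ?Z (\<lambda>_. min 1 gB)"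
 proof (rule prob_pair_le)
  fix z assume z: "GZ z"
  then have "deviation_prob s c d (X' z) b1 0 \<delta> \<le> gB" by (intro B GZ_range) (auto simp: X'_def)
  moreover have "prob ?T {T. \<not> G (z, T)} \<le> deviation_prob s c d (X' z) b1 0 \<delta>"
   unfolding deviation_prob_def
  proof (intro prob_mono subsetI)
   fix T assume T: "T \<in> {T. \<not> G (z, T)}"
   obtain T1 T2 where TT: "T = (T1, T2)" by (cases T)
   define w where "w = real (card (X' z)) / 2 ^ b1"
   show "T \<in> {(T1, T2). \<bar>real (card (selected s c d (X' z) 0 T1 T2)) - real (card (X' z)) / 2 ^ b1\<bar> > \<delta> * (real (card (X' z)) / 2 ^ b1)}"
   proof (rule ccontr)
    assume "\<not> ?thesis"
    then have "\<bar>real (card (Y (z, T))) - w\<bar> \<le> \<delta> * w" by (simp add: TT Y_def w_def not_less)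
    then have "(1 - \<delta>) * w \<le> real (card (Y (z, T)))" "real (card (Y (z, T))) \<le> (1 + \<delta>) * w"
     by (auto simp: algebra_simps)
    moreover have "(1 - \<delta>) * ((1 - \<eta>) * x) \<le> (1 - \<delta>) * w" "(1 + \<delta>) * w \<le> (1 + \<delta>) * ((1 + \<eta>) * x)"
     using GZ_range[OF z] eta1 \<delta> unfolding w_def[symmetric] by (auto intro: mult_left_mono)
    ultimately have "G (z, T)" unfolding G_def by (simp add: mult.assoc)
    then show False using T by simp
   qed
  qed auto
  ultimately show "prob ?T {T. \<not> G (z, T)} \<le> min 1 gB" by simp
 qed (use gB0 in auto)
 have core: "prob (filtered_count s c d X bl e) S \<le> u + 2 * gA + gB + 4 * ?E"
  if u: "\<And>M. (1 - \<delta>) * (1 - \<eta>) * x \<le> real M \<Longrightarrow> real M \<le> (1 + \<delta>) * (1 + \<eta>) * x \<Longrightarrow> prob (binom M q2) S \<le> u"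
   and u0: "u \<ge> 0" for S u
 proof -
  have "expect (pair_pmf ?Z ?T) (\<lambda>w. prob (binom (card (Y w)) q2) S)
   \<le> expect (pair_pmf ?Z ?T) (\<lambda>w. u + indicator {w. \<not> G w} w)"
  proof (rule integral_mono)
   fix w show "prob (binom (card (Y w)) q2) S \<le> u + indicator {w. \<not> G w} w"
    using u[of "card (Y w)"] u0 measure_pmf.prob_le_1[of "binom (card (Y w)) q2" S]
    by (cases "G w") (auto simp: G_def intro: order.trans add_increasing)
  qed (auto intro!: integrable_const_indicator measure_pmf.integrable_const_bound[of _ 1])
  also have "\<dots> = u + prob (pair_pmf ?Z ?T) {w. \<not> G w}" by (simp only: expectation_const_indicator)
  finally have 3: "expect (pair_pmf ?Z ?T) (\<lambda>w. prob (binom (card (Y w)) q2) S)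
   \<le> u + prob (pair_pmf ?Z ?T) {w. \<not> G w}" .
  from filtered_count_le[OF X bl, of s c d e S]
  have "prob (filtered_count s c d X bl e) S \<le>
    prob (pair_pmf ?Z ?T) {(z, T). case T of (T1, T2) \<Rightarrow> \<not> derived_indep s c d T1 (selected s c d (X' z) 0 T1 T2)}
    + expect (pair_pmf ?Z ?T) (\<lambda>w. prob (binom (card (Y w)) q2) S)"
   unfolding X'_def[symmetric] q2_def by (simp add: split_def Y_def)
  moreover have "{w. \<not> G w} = {(z, T). \<not> G (z, T)}" by auto
  ultimately show ?thesis using 1 2 3 pZ gA0 by simp
 qed
 have dex: "\<eta> * x \<ge> 1"
 proof -
  have "\<eta> * (2 ^ s / 4) \<le> \<eta> * x" using x \<eta> by (intro mult_left_mono) auto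
  then show ?thesis using \<eta> by simp
 qed
 have de: "\<delta> * \<eta> \<le> \<delta>" using \<delta> eta1 by (simp add: mult_left_le)
 show ?th1 if N: "(1 + 2 * \<delta> + 3 * \<eta>) * real (card X) \<le> real N + 1"
 proof -
  \<comment> \<open>\<open>N\<close> may be arbitrarily large, while the deviation bound wants a
    mean of at most \<open>2 * x\<close>. It is applied to the least admissible number
    \<open>N0\<close>, and monotonicity leads on to \<open>N\<close>.\<close>
  define N0 where "N0 = nat \<lceil>(1 + 2 * \<delta> + 3 * \<eta>) * n - 1\<rceil>"
  have N0: "(1 + 2 * \<delta> + 3 * \<eta>) * n - 1 \<le> real N0" unfolding N0_def by linarith
  have N0': "real N0 \<le> (1 + 2 * \<delta> + 3 * \<eta>) * n"
  proof -
   have "0 \<le> (1 + 2 * \<delta> + 3 * \<eta>) * n" using \<delta> \<eta> by (simp add: n_def)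
   then show ?thesis unfolding N0_def by linarith
  qed
  have N0N: "N0 \<le> N" using N unfolding N0_def n_def[symmetric] by linarith
  have "(1 + 2 * \<delta> + 3 * \<eta>) * n \<le> 2 * n" using \<delta> by (intro mult_right_mono) (auto simp: n_def)
  then have le2: "real N0 * q1 \<le> 2 * x" using N0' q(1) nx[symmetric] mult_right_mono[of "real N0" "2 * n" q1] by simp
  have "((1 + 2 * \<delta> + 3 * \<eta>) * n - 1) * q1 \<le> real N0 * q1" using N0 q by (intro mult_right_mono) auto
  then have ge: "(1 + 2 * \<delta> + 3 * \<eta>) * x - 1 \<le> real N0 * q1" using q nx by (auto simp: algebra_simps)
  have "prob (filtered_count s c d X bl e) {j..} \<le>
   (prob (binom N (1 / 2 ^ (bl + e))) {j..} + 2 * ?E) + 2 * gA + gB + 4 * ?E"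
  proof (rule core)
   fix M assume M: "real M \<le> (1 + \<delta>) * (1 + \<eta>) * x"
   have "(1 + \<delta>) * (1 + \<eta>) * x \<le> (1 + 2 * \<delta> + \<eta>) * x" using de x0 by (intro mult_right_mono) (auto simp: algebra_simps)
   also have "\<dots> \<le> real N0 * q1 - \<eta> * x" using ge dex by (simp add: algebra_simps)
   finally have "prob (binom N0 q1) {k. k < M} \<le> prob (binom N0 q1) {k. \<eta> * x \<le> \<bar>real k - real N0 * q1\<bar>}"
    using M by (intro prob_mono) auto
   also have "\<dots> \<le> 2 * exp (- (\<eta>\<^sup>2 * x / 8))"
    by (rule binomial_relative_deviation) (use q \<eta> eta1 le2 x0 in auto)
   also have "\<dots> \<le> 2 * ?E" using exE[of x] by simp
   finally have "prob (binom N0 q1) {k. k < M} \<le> 2 * ?E" .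
   moreover have "prob (binom N0 (q1 * q2)) {j..} \<le> prob (binom N (q1 * q2)) {j..}"
    by (rule binomial_mono[OF N0N]) (simp add: q(3))
   ultimately show "prob (binom M q2) {j..} \<le> prob (binom N (1 / 2 ^ (bl + e))) {j..} + 2 * ?E"
    using binomial_thinning_le(1)[OF q(1,2), of M j N0] unfolding q(3) by linarith
  qed simp
  then show ?thesis by simp
 qed
 show ?th2 if N: "real N \<le> (1 - 2 * \<delta> - 3 * \<eta>) * real (card X) + 1"
 proof -
  have "real N * q1 \<le> ((1 - 2 * \<delta> - 3 * \<eta>) * n + 1) * q1" using N q by (intro mult_right_mono) (auto simp: n_def)
  then have ge: "real N * q1 \<le> (1 - 2 * \<delta> - 3 * \<eta>) * x + 1" using q nx by (auto simp: algebra_simps)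
  have le2: "real N * q1 \<le> 2 * x" 
  proof -
   have "0 \<le> \<delta> * x" "0 \<le> \<eta> * x" using \<delta> \<eta> x0 by auto
   then show ?thesis using ge dex x0 by (simp add: algebra_simps)
  qed
  have "prob (filtered_count s c d X bl e) {..j} \<le>
   (prob (binom N (1 / 2 ^ (bl + e))) {..j} + 2 * ?E) + 2 * gA + gB + 4 * ?E"
  proof (rule core)
   fix M assume M: "(1 - \<delta>) * (1 - \<eta>) * x \<le> real M"
   have "real N * q1 + \<eta> * x \<le> (1 - 2 * \<delta> - \<eta>) * x" using ge dex by (simp add: algebra_simps)
   also have "\<dots> \<le> (1 - \<delta>) * (1 - \<eta>) * x" using \<delta> \<eta> x0 by (intro mult_right_mono) (auto simp: algebra_simps add_increasing2)
   finally have "prob (binom N q1) {k. M < k} \<le> prob (binom N q1) {k. \<eta> * x \<le> \<bar>real k - real N * q1\<bar>}"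
    using M by (intro prob_mono) auto
   also have "\<dots> \<le> 2 * exp (- (\<eta>\<^sup>2 * x / 8))"
    by (rule binomial_relative_deviation) (use q \<eta> eta1 le2 x0 in auto)
   also have "\<dots> \<le> 2 * ?E" using exE[of x] by simp
   finally have "prob (binom N q1) {k. M < k} \<le> 2 * ?E" .
   then show "prob (binom M q2) {..j} \<le> prob (binom N (1 / 2 ^ (bl + e))) {..j} + 2 * ?E"
    using binomial_thinning_le(2)[OF q(1,2), of M j N] unfolding q(3) by linarith
  qed simp
  then show ?thesis by simp
 qed
qed

lemma negl_abs: "negl D g \<Longrightarrow> negl D (\<lambda>s. \<bar>g s\<bar>)"
 by (simp add: negl_def)

text \<open>The slack of 1 in the conditions on \<open>N\<close> admits a rounded down, respectively
  rounded up, number of balls. If the random bits alone leave at most |\<Sigma>|/2 keys in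
  expectation, \<open>filtered_count_sparse\<close> applies. Otherwise the least number of hash bits
  that achieves this is exposed first; then at least |\<Sigma>|/4 keys are expected, and
  \<open>filtered_count_dense\<close> applies.\<close>

theorem filtered_count_bound:
 fixes c d D :: nat
 assumes c: "c \<ge> 1" and D: "2 * D \<le> d"
 shows "\<exists>\<epsilon> g s0. \<epsilon> \<in> O(\<lambda>s. sqrt (real s / 2 ^ s) * ln (real s)) \<and> negl D g \<and> (\<forall>s\<ge>s0. 0 \<le> \<epsilon> s \<and>
  (\<forall>X bl e N j. X \<subseteq> {..<2 ^ (s * c)} \<longrightarrow> real (card X) / 2 ^ (bl + e) \<le> 2 ^ s / 2 \<longrightarrow>
   ((1 + \<epsilon> s) * real (card X) < real N + 1 \<longrightarrow>
    prob (filtered_count s c d X bl e) {j..} \<le> prob (binom N (1 / 2 ^ (bl + e))) {j..} + g s) \<and>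
   (real N < (1 - \<epsilon> s) * real (card X) + 1 \<longrightarrow>
    prob (filtered_count s c d X bl e) {..j} \<le> prob (binom N (1 / 2 ^ (bl + e))) {..j} + g s)))"
proof -
 obtain KA eA sA where A: "\<forall>s\<ge>sA. \<forall>X b v. X \<subseteq> {..<2 ^ (s * c)} \<longrightarrow> v < 2 ^ b \<longrightarrow>
   real (card X) \<le> 3 / 4 * 2 ^ s * 2 ^ b \<longrightarrow> dependent_prob s c d X b v \<le> KA * real s ^ eA * 2 ^ s / (2 ^ s) ^ D"
  using prob_dependent[OF c D] unfolding dependent_prob_def by (elim exE)
 obtain \<delta> gB sB where \<delta>: "\<delta> \<in> O(\<lambda>s. sqrt (real s / 2 ^ s) * ln (real s))" and gB: "negl D gB"
  and B: "\<forall>s\<ge>sB. 0 \<le> \<delta> s \<and>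
  (\<forall>X b v. X \<subseteq> {..<2 ^ (s * c)} \<longrightarrow> v < 2 ^ b \<longrightarrow> 2 ^ s / 16 \<le> real (card X) / 2 ^ b \<longrightarrow>
   real (card X) / 2 ^ b \<le> 3 / 4 * 2 ^ s \<longrightarrow> deviation_prob s c d X b v (\<delta> s) \<le> gB s)"
  using deviation_prob_bound[OF c D] by (elim exE conjE)
 define \<eta> where "\<eta> s = sqrt (32 * real (D + 1) * real s / 2 ^ s)" for s
 define \<epsilon> where "\<epsilon> s = 2 * \<delta> s + 3 * \<eta> s" for s
 define gA where "gA s = \<bar>KA\<bar> * real s ^ eA * 2 ^ s / (2 ^ s) ^ D" for s
 define g where "g s = 2 * gA s + \<bar>gB s\<bar> + 6 / (2 ^ s) ^ D" for s
 have eta: "\<eta> \<in> O(\<lambda>s. sqrt (real s / 2 ^ s) * ln (real s))" unfolding \<eta>_def by real_asymp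
 have eps: "\<epsilon> \<in> O(\<lambda>s. sqrt (real s / 2 ^ s) * ln (real s))" unfolding \<epsilon>_def
  using \<delta> eta by (intro sum_in_bigo) simp_all
 have neg: "negl D g"
 proof -
  have "negl D (\<lambda>s. 2 * real s ^ 0 * gA s)" unfolding gA_def by (intro negl_mult_power negl_power)
  then show ?thesis unfolding g_def using gB by (intro negl_add negl_const negl_abs) simp_all
 qed
 have "eventually (\<lambda>s. \<epsilon> s < 1) at_top"
 proof -
  have "(\<lambda>s. sqrt (real s / 2 ^ s) * ln (real s)) \<in> o(\<lambda>_. 1)" by real_asymp
  with eps have "\<epsilon> \<in> o(\<lambda>_. 1)" by (rule landau_o.big_small_trans)
  from smalloD_tendsto[OF this] have "\<epsilon> \<longlonglongrightarrow> 0" by simp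
  then show ?thesis by (rule order_tendstoD) simp
 qed
 moreover have "eventually (\<lambda>s. 4 \<le> \<eta> s * 2 ^ s) at_top" unfolding \<eta>_def by real_asymp
 moreover have "eventually (\<lambda>s::nat. exp (- (2 ^ s / 32)) \<le> 1 / (2 ^ s :: real) ^ D) at_top" by real_asymp
 ultimately have "eventually (\<lambda>s. \<epsilon> s < 1 \<and> 4 \<le> \<eta> s * 2 ^ s \<and> exp (- (2 ^ s / 32)) \<le> 1 / (2 ^ s :: real) ^ D) at_top"
  by (intro eventually_conj)
 then obtain s1 where s1: "\<And>s. s \<ge> s1 \<Longrightarrow> \<epsilon> s < 1 \<and> 4 \<le> \<eta> s * 2 ^ s \<and> exp (- (2 ^ s / 32)) \<le> 1 / (2 ^ s :: real) ^ D"
  unfolding eventually_at_top_linorder by blast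
 have main: "((1 + \<epsilon> s) * real (card X) < real N + 1 \<longrightarrow>
    prob (filtered_count s c d X bl e) {j..} \<le> prob (binom N (1 / 2 ^ (bl + e))) {j..} + g s) \<and>
   (real N < (1 - \<epsilon> s) * real (card X) + 1 \<longrightarrow>
    prob (filtered_count s c d X bl e) {..j} \<le> prob (binom N (1 / 2 ^ (bl + e))) {..j} + g s)"
  if s: "s \<ge> max (max sA sB) s1" and X: "X \<subseteq> {..<2 ^ (s * c)}" and n: "real (card X) / 2 ^ (bl + e) \<le> 2 ^ s / 2" for s X bl e N j
 proof -
  have finX: "finite X" using X finite_subset by blast
  have eta0: "0 \<le> \<eta> s" by (simp add: \<eta>_def)
  have del0: "0 \<le> \<delta> s" using B s by simp
  have gA0: "gA s \<ge> 0" by (simp add: gA_def)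
  have eps0: "\<epsilon> s \<ge> 0" using del0 eta0 by (simp add: \<epsilon>_def)
  have A': "dependent_prob s c d X' b 0 \<le> gA s" if "X' \<subseteq> X" "real (card X') / 2 ^ b \<le> 3 / 4 * 2 ^ s" for X' b
  proof -
   have sA: "sA \<le> s" using s by simp
   have X': "X' \<subseteq> {..<2 ^ (s * c)}" using that(1) X by (rule order.trans)
   have "real (card X') \<le> 3 / 4 * 2 ^ s * 2 ^ b" using that(2) by (simp add: field_simps)
   then have "dependent_prob s c d X' b 0 \<le> KA * real s ^ eA * 2 ^ s / (2 ^ s) ^ D"
    using A[rule_format, OF sA X', of 0 b] by simp
   also have "\<dots> \<le> gA s" unfolding gA_def by (intro divide_right_mono mult_right_mono) auto
   finally show ?thesis .
  qed
  have B': "deviation_prob s c d X' b 0 (\<delta> s) \<le> \<bar>gB s\<bar>"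
   if "X' \<subseteq> X" "2 ^ s / 16 \<le> real (card X') / 2 ^ b" "real (card X') / 2 ^ b \<le> 3 / 4 * 2 ^ s" for X' b
  proof -
   have sB: "sB \<le> s" using s by simp
   have X': "X' \<subseteq> {..<2 ^ (s * c)}" using that(1) X by (rule order.trans)
   have "deviation_prob s c d X' b 0 (\<delta> s) \<le> gB s"
    using conjunct2[OF B[rule_format, OF sB]] X' that(2,3) zero_less_power[of "2::nat" b] by simp
   then show ?thesis by linarith
  qed
  have "(\<eta> s)\<^sup>2 * 2 ^ s / 32 = real (D + 1) * real s" by (simp add: \<eta>_def)
  then have E: "exp (- ((\<eta> s)\<^sup>2 * 2 ^ s / 32)) \<le> 1 / (2 ^ s) ^ D"
   by (intro exp_le_inverse_power) (simp only:, simp add: algebra_simps)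
  show ?thesis
  proof (cases "real (card X) / 2 ^ e \<le> 2 ^ s / 2")
   case True
   have le: "prob (filtered_count s c d X bl e) S \<le> prob (binom (card X) (1 / 2 ^ (bl + e))) S + g s" for S
   proof -
    have "exp (- (2 ^ s / 32)) \<le> 1 / (2 ^ s :: real) ^ D" using s1[of s] s by simp
    moreover have "prob (filtered_count s c d X bl e) S \<le>
      prob (binom (card X) (1 / 2 ^ (bl + e))) S + gA s + 2 * exp (- (2 ^ s / 32))"
     by (rule filtered_count_sparse[OF finX True gA0]) (use A'[where b = 0] in auto)
    moreover have "6 / (2 ^ s) ^ D = 6 * (1 / (2 ^ s :: real) ^ D)" "0 \<le> 1 / (2 ^ s :: real) ^ D" by simp_all
    ultimately show ?thesis unfolding g_def using gA0 abs_ge_zero[of "gB s"] by linarith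
   qed
   have q: "1 / 2 ^ (bl + e) \<in> {0..(1::real)}" by simp
   have e0: "0 \<le> \<epsilon> s * real (card X)" using eps0 by simp
   show ?thesis
   proof (intro conjI impI)
    assume "(1 + \<epsilon> s) * real (card X) < real N + 1"
    then have "card X \<le> N" using e0 by (simp add: algebra_simps)
    from binomial_mono(1)[OF this q, of j] show "prob (filtered_count s c d X bl e) {j..} \<le> prob (binom N (1 / 2 ^ (bl + e))) {j..} + g s"
     using le[of "{j..}"] by linarith
   next
    assume "real N < (1 - \<epsilon> s) * real (card X) + 1"
    then have "N \<le> card X" using e0 by (simp add: algebra_simps)
    from binomial_mono(2)[OF this q, of j] show "prob (filtered_count s c d X bl e) {..j} \<le> prob (binom N (1 / 2 ^ (bl + e))) {..j} + g s"
     using le[of "{..j}"] by linarith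
   qed
  next
   case False
   define P where "P b \<longleftrightarrow> real (card X) / 2 ^ (e + b) \<le> 2 ^ s / 2" for b
   define b1 where "b1 = (LEAST b. P b)"
   have Pbl: "P bl" using n by (simp add: P_def add.commute)
   then have Pb1: "P b1" and b1: "b1 \<le> bl" unfolding b1_def by (rule LeastI, rule Least_le)
   have "b1 \<noteq> 0" using False Pb1 by (intro notI) (simp add: P_def)
   then obtain b0 where b0: "b1 = Suc b0" by (cases b1) auto
   have "\<not> P b0" using not_less_Least[of b0 P] b0 unfolding b1_def by simp
   then have lo: "2 ^ s / 4 \<le> real (card X) / 2 ^ (e + b1)" by (simp add: P_def b0 field_simps)
   have hi: "real (card X) / 2 ^ (e + b1) \<le> 2 ^ s / 2" using Pb1 by (simp add: P_def)
   have bl: "bl = b1 + (bl - b1)" using b1 by simp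
   have e1: "2 * \<delta> s + 3 * \<eta> s \<le> 1" and e4: "4 \<le> \<eta> s * 2 ^ s" using s1[of s] s by (auto simp: \<epsilon>_def)
   have gge: "2 * gA s + \<bar>gB s\<bar> + 6 * exp (- ((\<eta> s)\<^sup>2 * 2 ^ s / 32)) \<le> g s" unfolding g_def using E by simp
   note dense = filtered_count_dense[OF finX bl refl lo hi gA0 abs_ge_zero del0 e1 eta0 e4 A' B']
   show ?thesis
   proof (intro conjI impI)
    assume "(1 + \<epsilon> s) * real (card X) < real N + 1"
    then have "(1 + 2 * \<delta> s + 3 * \<eta> s) * real (card X) \<le> real N + 1" by (simp add: \<epsilon>_def add.assoc)
    from dense(1)[OF _ _ _ _ _ this, of j] gge
    show "prob (filtered_count s c d X bl e) {j..} \<le> prob (binom N (1 / 2 ^ (bl + e))) {j..} + g s"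
     by simp
   next
    assume "real N < (1 - \<epsilon> s) * real (card X) + 1"
    then have "real N \<le> (1 - 2 * \<delta> s - 3 * \<eta> s) * real (card X) + 1" by (simp add: \<epsilon>_def algebra_simps)
    from dense(2)[OF _ _ _ _ _ this, of j] gge
    show "prob (filtered_count s c d X bl e) {..j} \<le> prob (binom N (1 / 2 ^ (bl + e))) {..j} + g s"
     by simp
   qed
  qed
 qed
 show ?thesis
 proof (rule exI[of _ \<epsilon>], rule exI[of _ g], rule exI[of _ "max (max sA sB) s1"], intro conjI[OF eps] conjI[OF neg] allI impI conjI)
  show "0 \<le> \<epsilon> s" if "max (max sA sB) s1 \<le> s" for s using B that by (simp add: \<epsilon>_def \<eta>_def)
 qed (use main in blast)+
qed

section \<open>The colour of the ball selected in a bin\<close>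

definition argmins :: "('a \<Rightarrow> nat) \<Rightarrow> 'a set \<Rightarrow> 'a set" where
 "argmins l S = {x \<in> S. \<forall>y\<in>S. l x \<le> l y}"

text \<open>The probability that a uniformly chosen minimiser is red. Division by zero gives 0 for
  an empty bin, which thus counts as not red.\<close>

definition red_share :: "('a \<Rightarrow> nat) \<Rightarrow> 'a set \<Rightarrow> 'a set \<Rightarrow> real" where
 "red_share l S R = real (card (argmins l S \<inter> R)) / real (card (argmins l S))"

lemma argmins_nonempty: "finite S \<Longrightarrow> S \<noteq> {} \<Longrightarrow> argmins l S \<noteq> {}"
proof -
 assume S: "finite S" "S \<noteq> {}"
 from arg_min_if_finite[OF S, of l] have "arg_min_on l S \<in> argmins l S" by (auto simp: argmins_def not_less)
 then show ?thesis by blast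
qed

lemma finite_argmins: "finite S \<Longrightarrow> finite (argmins l S)"
 by (simp add: argmins_def)

lemma argmins_eq: "w \<in> argmins l S \<Longrightarrow> argmins l S = {x \<in> S. l x = l w}"
proof (intro equalityI subsetI)
 assume w: "w \<in> argmins l S"
 { fix x assume "x \<in> argmins l S"
  then have "l x \<le> l w" "l w \<le> l x" "x \<in> S" using w by (auto simp: argmins_def)
  then show "x \<in> {x \<in> S. l x = l w}" by simp }
 { fix x assume "x \<in> {x \<in> S. l x = l w}"
  then show "x \<in> argmins l S" using w by (simp add: argmins_def) }
qed

lemma red_share_range: "red_share l S R \<in> {0..1}"
proof (cases "finite (argmins l S)")
 case True
 then have "card (argmins l S \<inter> R) \<le> card (argmins l S)" by (intro card_mono) auto
 then show ?thesis by (simp add: red_share_def divide_le_eq)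
qed (simp add: red_share_def)

text \<open>\<open>S'\<close> arises from \<open>S\<close> by adding red and removing blue balls. If
  \<open>S\<close> has a red minimiser and \<open>S'\<close> a blue one, both balls lie in both
  sets, so the minimal values agree and only the numbers of red and blue minimisers have to be
  compared. Otherwise one of the shares is 0 or 1.\<close>

lemma red_share_mono:
 assumes fin: "finite S" "finite S'" and sub: "S \<inter> R \<subseteq> S'" "S' - R \<subseteq> S"
 shows "red_share l S R \<le> red_share l S' R"
proof (cases "argmins l S \<inter> R = {}")
 case True
 then show ?thesis using red_share_range[of l S' R] by (simp add: red_share_def)
next
 case False
 then obtain x where x: "x \<in> argmins l S" "x \<in> R" by auto
 then have xS': "x \<in> S'" using sub by (auto simp: argmins_def)
 then have ne: "argmins l S' \<noteq> {}" using fin by (intro argmins_nonempty) auto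
 show ?thesis
 proof (cases "argmins l S' \<subseteq> R")
  case True
  then have "red_share l S' R = 1" using ne finite_argmins[OF fin(2), of l] by (simp add: red_share_def Int_absorb2)
  then show ?thesis using red_share_range[of l S R] by simp
 next
  case False
  then obtain y where y: "y \<in> argmins l S'" "y \<notin> R" by auto
  then have yS: "y \<in> S" using sub by (auto simp: argmins_def)
  have "l y = l x" using x y xS' yS by (auto simp: argmins_def intro: antisym)
  then have M: "argmins l S = {w \<in> S. l w = l x}" "argmins l S' = {w \<in> S'. l w = l x}"
   using argmins_eq[OF x(1)] argmins_eq[OF y(1)] by auto
  define r r' b b' where "r = real (card (argmins l S \<inter> R))" "r' = real (card (argmins l S' \<inter> R))"
   "b = real (card (argmins l S - R))" "b' = real (card (argmins l S' - R))"
  have "r \<le> r'" "b' \<le> b" unfolding r_r'_b_b'_def M using fin sub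
   by (auto intro!: of_nat_mono card_mono)
  moreover have "r > 0" unfolding r_r'_b_b'_def using x finite_argmins[OF fin(1), of l] by (auto simp: card_gt_0_iff)
  moreover have "real (card (argmins l S)) = r + b" "real (card (argmins l S')) = r' + b'"
   unfolding r_r'_b_b'_def of_nat_add[symmetric]
   using finite_argmins[OF fin(1), of l] finite_argmins[OF fin(2), of l]
   by (subst card_Un_disjoint[symmetric]; auto intro!: arg_cong[where f = card])+
  moreover have "b' \<ge> 0" by (simp add: r_r'_b_b'_def)
  ultimately have "r / (r + b) \<le> r' / (r' + b')"
  proof -
   assume a: "r \<le> r'" "b' \<le> b" "0 < r" "0 \<le> b'"
   have "r * (r' + b') \<le> r' * (r + b)" using mult_mono[OF a(1,2)] a by (simp add: algebra_simps)
   then show ?thesis using a by (simp add: divide_le_eq pos_le_divide_eq field_simps)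
  qed
  then show ?thesis using \<open>real (card (argmins l S)) = r + b\<close> \<open>real (card (argmins l S')) = r' + b'\<close>
   by (simp add: red_share_def r_r'_b_b'_def)
 qed
qed

text \<open>Coupling: keep each success under \<open>p'\<close> with probability
  \<open>p i / p' i\<close>.\<close>

lemma Pi_bernoulli_mono:
 assumes I: "finite I" and p: "\<And>i. i \<in> I \<Longrightarrow> 0 \<le> p i \<and> p i \<le> p' i \<and> p' i \<le> 1"
 shows "prob (Pi_pmf I False (\<lambda>i. bernoulli_pmf (p i))) {f. \<theta> \<le> real (card {i \<in> I. f i})} \<le>
  prob (Pi_pmf I False (\<lambda>i. bernoulli_pmf (p' i))) {f. \<theta> \<le> real (card {i \<in> I. f i})}"
proof -
 let ?Q = "Pi_pmf I False (\<lambda>i. bernoulli_pmf (p' i))"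
 let ?U = "{f. \<theta> \<le> real (card {i \<in> I. f i})}"
 define q where "q i = p i / p' i" for i
 have q: "q i \<in> {0..1}" "p' i * q i = p i" if "i \<in> I" for i
  using p[OF that] by (auto simp: q_def divide_le_eq)
 have "Pi_pmf I False (\<lambda>i. bernoulli_pmf (p i)) =
   Pi_pmf I False (\<lambda>i. bind_pmf (bernoulli_pmf (p' i)) (\<lambda>y. if y then bernoulli_pmf (q i) else return_pmf False))"
 proof (intro Pi_pmf_cong refl)
  fix i assume i: "i \<in> I"
  have "p' i \<in> {0..1}" using p[OF i] by auto
  from bernoulli_mult[OF this q(1)[OF i]]
  show "bernoulli_pmf (p i) = bind_pmf (bernoulli_pmf (p' i)) (\<lambda>y. if y then bernoulli_pmf (q i) else return_pmf False)"
   by (simp only: q(2)[OF i])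
 qed
 also have "\<dots> = bind_pmf ?Q (\<lambda>f. Pi_pmf I False (\<lambda>i. if f i then bernoulli_pmf (q i) else return_pmf False))"
  by (rule Pi_pmf_bind[OF I])
 finally have "prob (Pi_pmf I False (\<lambda>i. bernoulli_pmf (p i))) ?U =
  expect ?Q (\<lambda>f. prob (Pi_pmf {i \<in> I. f i} False (\<lambda>i. bernoulli_pmf (q i))) ?U)"
  by (simp add: prob_bind Pi_pmf_if_set[OF I])
 also have "\<dots> \<le> expect ?Q (indicator ?U)"
 proof (rule integral_mono)
  fix f
  show "prob (Pi_pmf {i \<in> I. f i} False (\<lambda>i. bernoulli_pmf (q i))) ?U \<le> indicator ?U f"
  proof (cases "f \<in> ?U")
   case False
   have "prob (Pi_pmf {i \<in> I. f i} False (\<lambda>i. bernoulli_pmf (q i))) ?U =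
    prob (Pi_pmf {i \<in> I. f i} False (\<lambda>i. bernoulli_pmf (q i))) {}"
   proof (intro measure_pmf.finite_measure_eq_AE AE_pmfI)
    fix g assume "g \<in> set_pmf (Pi_pmf {i \<in> I. f i} False (\<lambda>i. bernoulli_pmf (q i)))"
    then have "\<forall>i. i \<notin> {i \<in> I. f i} \<longrightarrow> g i = False"
     using set_Pi_pmf_subset[of "{i \<in> I. f i}" False "\<lambda>i. bernoulli_pmf (q i)"] I by auto
    then have "card {i \<in> I. g i} \<le> card {i \<in> I. f i}" using I by (intro card_mono) auto
    then have "real (card {i \<in> I. g i}) \<le> real (card {i \<in> I. f i})" by (rule of_nat_mono)
    then show "(g \<in> ?U) = (g \<in> {})" using False by simp
   qed auto
   then show ?thesis by simp
  qed simp
 qed (auto intro!: measure_pmf.integrable_const_bound[of _ 1] simp: indicator_def)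
 finally show ?thesis by simp
qed

text \<open>Since \<open>F i\<close> looks only at the coordinates in \<open>A i\<close>, the
  randomness can be drawn block by block.\<close>

lemma Pi_pmf_bind_disjoint:
 assumes "finite I" and "\<And>i. i \<in> I \<Longrightarrow> finite (A i)" and "disjoint_family_on A I"
  and "\<And>i z z'. i \<in> I \<Longrightarrow> (\<And>x. x \<in> A i \<Longrightarrow> z x = z' x) \<Longrightarrow> F i z = F i z'"
 shows "bind_pmf (Pi_pmf (\<Union>i\<in>I. A i) dflt U) (\<lambda>z. Pi_pmf I dflt' (\<lambda>i. F i z)) =
  Pi_pmf I dflt' (\<lambda>i. bind_pmf (Pi_pmf (A i) dflt U) (F i))"
 using assms
proof (induction I rule: finite_induct)
 case (insert i I)
 define V where "V = (\<Union>j\<in>I. A j)"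
 have fA: "finite (A i)" by (rule insert.prems(1)) simp
 have fV: "finite V" unfolding V_def by (intro finite_UN_I insert.hyps(1) insert.prems(1)) simp
 have disj: "A i \<inter> V = {}"
 proof (rule equals0I)
  fix x assume "x \<in> A i \<inter> V"
  then obtain j where j: "j \<in> I" "x \<in> A i" "x \<in> A j" unfolding V_def by blast
  then have "i \<noteq> j" using insert.hyps(2) by blast
  then have "A i \<inter> A j = {}" using disjoint_family_onD[OF insert.prems(2), of i j] j(1) by simp
  then show False using j by blast
 qed
 have dfI: "disjoint_family_on A I" using insert.prems(2) by (rule disjoint_family_on_mono[rotated]) blast
 have IH: "bind_pmf (Pi_pmf V dflt U) (\<lambda>z. Pi_pmf I dflt' (\<lambda>i. F i z)) = Pi_pmf I dflt' (\<lambda>i. bind_pmf (Pi_pmf (A i) dflt U) (F i))"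
  unfolding V_def by (rule insert.IH[OF _ dfI]) (rule insert.prems(1) insert.prems(3); simp)+
 define mrg where "mrg f g = (\<lambda>x. if x \<in> A i then f x else g x)" for f g :: "'b \<Rightarrow> 'c"
 have F1: "F i (mrg f g) = F i f" for f g by (rule insert.prems(3)) (auto simp: mrg_def)
 have F2: "F j (mrg f g) = F j g" if "j \<in> I" for j f g
 proof (rule insert.prems(3))
  show "j \<in> insert i I" using that by simp
  fix x assume "x \<in> A j"
  then have "x \<in> V" using that by (auto simp: V_def)
  then show "mrg f g x = g x" using disj by (auto simp: mrg_def)
 qed
 have step: "Pi_pmf (insert i I) dflt' (\<lambda>j. F j (mrg f g)) =
   bind_pmf (F i f) (\<lambda>y. bind_pmf (Pi_pmf I dflt' (\<lambda>j. F j g)) (\<lambda>h. return_pmf (h(i := y))))" for f g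
 proof -
  have "Pi_pmf I dflt' (\<lambda>j. F j (mrg f g)) = Pi_pmf I dflt' (\<lambda>j. F j g)" by (intro Pi_pmf_cong refl F2)
  then show ?thesis by (simp add: Pi_pmf_insert'[OF insert.hyps] F1)
 qed
 have "Pi_pmf (\<Union>j\<in>insert i I. A j) dflt U = map_pmf (\<lambda>(f, g). mrg f g) (pair_pmf (Pi_pmf (A i) dflt U) (Pi_pmf V dflt U))"
  using Pi_pmf_union[OF fA fV disj, of dflt U] by (simp add: V_def mrg_def)
 then have "bind_pmf (Pi_pmf (\<Union>j\<in>insert i I. A j) dflt U) (\<lambda>z. Pi_pmf (insert i I) dflt' (\<lambda>j. F j z)) =
  bind_pmf (Pi_pmf (A i) dflt U) (\<lambda>f. bind_pmf (Pi_pmf V dflt U) (\<lambda>g. bind_pmf (F i f) (\<lambda>y.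
   bind_pmf (Pi_pmf I dflt' (\<lambda>j. F j g)) (\<lambda>h. return_pmf (h(i := y))))))"
  by (simp add: bind_map_pmf pair_pmf_def bind_assoc_pmf bind_return_pmf step)
 also have "\<dots> = bind_pmf (Pi_pmf (A i) dflt U) (\<lambda>f. bind_pmf (F i f) (\<lambda>y. bind_pmf (Pi_pmf V dflt U) (\<lambda>g.
   bind_pmf (Pi_pmf I dflt' (\<lambda>j. F j g)) (\<lambda>h. return_pmf (h(i := y))))))"
  by (subst bind_commute_pmf) (rule refl)
 also have "\<dots> = bind_pmf (bind_pmf (Pi_pmf (A i) dflt U) (F i)) (\<lambda>y.
   bind_pmf (bind_pmf (Pi_pmf V dflt U) (\<lambda>g. Pi_pmf I dflt' (\<lambda>j. F j g))) (\<lambda>h. return_pmf (h(i := y))))"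
  by (simp add: bind_assoc_pmf)
 also have "\<dots> = Pi_pmf (insert i I) dflt' (\<lambda>i. bind_pmf (Pi_pmf (A i) dflt U) (F i))"
  by (simp add: IH Pi_pmf_insert'[OF insert.hyps])
 finally show ?case .
qed (simp add: bind_pmf_const)

lemma argmins_refine:
 assumes z: "\<And>x. x \<in> S \<Longrightarrow> z x < 2 ^ e"
 shows "argmins (\<lambda>x. l x * 2 ^ e + z x) S = argmins z (argmins l S)"
proof -
 have lt: "l x * 2 ^ e + z x < l y * 2 ^ e + z y" if "l x < l y" "x \<in> S" for x y
 proof -
  have "l x * 2 ^ e + z x < (l x + 1) * 2 ^ e" using z[OF that(2)] by simp
  also have "\<dots> \<le> l y * 2 ^ e" using that by (intro mult_right_mono) auto
  finally show ?thesis by simp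
 qed
 show ?thesis
 proof (intro equalityI subsetI)
  fix x assume "x \<in> argmins (\<lambda>x. l x * 2 ^ e + z x) S"
  then have x: "x \<in> S" "\<And>y. y \<in> S \<Longrightarrow> l x * 2 ^ e + z x \<le> l y * 2 ^ e + z y" by (auto simp: argmins_def)
  have m: "l x \<le> l y" if "y \<in> S" for y using x(2)[OF that] lt[of y x] that by (meson not_less)
  have "z x \<le> z y" if "y \<in> S" "\<forall>w\<in>S. l y \<le> l w" for y
   using x(2)[OF that(1)] m[OF that(1)] that(2) x(1) by (metis add_le_cancel_left antisym)
  then show "x \<in> argmins z (argmins l S)" using x(1) m by (auto simp: argmins_def)
 next
  fix x assume "x \<in> argmins z (argmins l S)"
  then have x: "x \<in> S" "\<And>y. y \<in> S \<Longrightarrow> l x \<le> l y" "\<And>y. y \<in> argmins l S \<Longrightarrow> z x \<le> z y" by (auto simp: argmins_def)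
  have "l x * 2 ^ e + z x \<le> l y * 2 ^ e + z y" if y: "y \<in> S" for y
  proof (cases "l x < l y")
   case True then show ?thesis using lt[OF True x(1)] by simp
  next
   case False
   then have eq: "l y = l x" using x(2)[OF y] by simp
   then have "y \<in> argmins l S" using x(2) y by (auto simp: argmins_def)
   then show ?thesis using x(3) eq by simp
  qed
  then show "x \<in> argmins (\<lambda>x. l x * 2 ^ e + z x) S" using x(1) by (auto simp: argmins_def)
 qed
qed

text \<open>Transpositions inside \<open>M\<close> preserve the law of \<open>z\<close>, so all
  elements of \<open>M\<close> have the same expected share, and the shares add up to 1.\<close>

lemma expectation_uniform_argmin:
 fixes S :: "'a set"
 assumes S: "finite S" and M: "M \<subseteq> S" "M \<noteq> {}" and x: "x \<in> M"
 shows "expect (Pi_pmf S 0 (\<lambda>_. (uniform_bits e)))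
  (\<lambda>z. indicator (argmins z M) x / real (card (argmins z M))) = 1 / real (card M)"
proof -
 let ?Z = "Pi_pmf S 0 (\<lambda>_. (uniform_bits e))"
 define h where "h x z = indicator (argmins z M) x / real (card (argmins z M))" for x :: 'a and z
 have finM: "finite M" using M S finite_subset by auto
 have sym: "expect ?Z (h x) = expect ?Z (h y)" if xy: "x \<in> M" "y \<in> M" for x y
 proof -
  define t where "t = Transposition.transpose x y"
  have tM: "t w \<in> M" if "w \<in> M" for w using xy that by (simp add: t_def Transposition.transpose_def)
  have tt: "t (t w) = w" for w by (simp add: t_def)
  have tS: "t w \<in> S" if "w \<in> S" for w using xy M that by (auto simp: t_def Transposition.transpose_def)
  have bij: "bij_betw t S S" by (rule bij_betw_byWitness[where f' = t]) (use tt tS in auto)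
  have img: "argmins (z \<circ> t) M = t ` argmins z M" for z
  proof (intro equalityI subsetI)
   fix w assume "w \<in> argmins (z \<circ> t) M"
   then have w: "w \<in> M" "\<And>v. v \<in> M \<Longrightarrow> z (t w) \<le> z (t v)" by (auto simp: argmins_def)
   have "z (t w) \<le> z v" if "v \<in> M" for v using w(2)[OF tM[OF that]] by (simp add: tt)
   then have "t w \<in> argmins z M" using w(1) tM by (auto simp: argmins_def)
   then have "t (t w) \<in> t ` argmins z M" by (rule imageI)
   then show "w \<in> t ` argmins z M" by (simp add: tt)
  next
   fix w assume "w \<in> t ` argmins z M"
   then obtain v where v: "w = t v" "v \<in> M" "\<And>u. u \<in> M \<Longrightarrow> z v \<le> z u" by (auto simp: argmins_def)
   then show "w \<in> argmins (z \<circ> t) M" using tM tt by (auto simp: argmins_def)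
  qed
  have injt: "inj t" by (metis tt injI)
  have hh: "h x (z \<circ> t) = h y z" for z
  proof -
   have "x \<in> t ` argmins z M \<longleftrightarrow> y \<in> argmins z M"
    using injt inj_image_mem_iff[of t y "argmins z M"] by (simp add: t_def)
   moreover have "card (t ` argmins z M) = card (argmins z M)" using injt by (intro card_image) (auto intro: inj_on_subset)
   ultimately show ?thesis by (simp add: h_def img indicator_def)
  qed
  have "?Z = map_pmf (\<lambda>g. g \<circ> t) ?Z"
   by (rule Pi_pmf_bij_betw[OF S bij]) (use xy M in \<open>auto simp: t_def Transposition.transpose_def\<close>)
  then have "expect ?Z (h x) = expect (map_pmf (\<lambda>g. g \<circ> t) ?Z) (h x)" by simp
  also have "\<dots> = expect ?Z (h y)" by (simp add: hh)
  finally show ?thesis .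
 qed
 have int: "integrable (measure_pmf ?Z) (h y)" for y
  by (rule measure_pmf.integrable_const_bound[of _ 1]) (auto simp: h_def indicator_def divide_le_eq)
 have "real (card M) * expect ?Z (h x) = (\<Sum>y\<in>M. expect ?Z (h y))"
 proof -
  have "(\<Sum>y\<in>M. expect ?Z (h y)) = (\<Sum>y\<in>M. expect ?Z (h x))"
   by (intro sum.cong refl sym x)
  then show ?thesis by simp
 qed
 also have "\<dots> = expect ?Z (\<lambda>z. \<Sum>y\<in>M. h y z)"
  by (rule Bochner_Integration.integral_sum[symmetric]) (rule int)
 also have "(\<lambda>z. \<Sum>y\<in>M. h y z) = (\<lambda>z. 1)"
 proof
  fix z
  have "(\<Sum>y\<in>M. h y z) = (\<Sum>y\<in>M. indicator (argmins z M) y) / real (card (argmins z M))"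
   by (simp add: h_def sum_divide_distrib)
  also have "(\<Sum>y\<in>M. indicator (argmins z M) y) = real (card (argmins z M))"
   using finM by (simp add: indicator_def sum.If_cases argmins_def Int_def)
  also have "real (card (argmins z M)) / real (card (argmins z M)) = 1"
   using argmins_nonempty[OF finM M(2), of z] finite_argmins[OF finM, of z] by simp
  finally show "(\<Sum>y\<in>M. h y z) = 1" .
 qed
 finally have "real (card M) * expect ?Z (h x) = 1" by simp
 moreover have "card M \<noteq> 0" using finM M by simp
 ultimately show ?thesis unfolding h_def by (simp add: field_simps)
qed

text \<open>Breaking ties uniformly is the same as refining the local hash values by further random bits.\<close>

lemma red_share_refine:
 assumes S: "finite S"
 shows "bind_pmf (Pi_pmf S 0 (\<lambda>_. (uniform_bits e))) (\<lambda>z. bernoulli_pmf (red_share (\<lambda>x. l x * 2 ^ e + z x) S R)) =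
  bernoulli_pmf (red_share l S R)"
proof (cases "S = {}")
 case True
 then show ?thesis by (simp add: red_share_def argmins_def bind_return_pmf)
next
 case False
 let ?Z = "Pi_pmf S 0 (\<lambda>_. (uniform_bits e))"
 define M where "M = argmins l S"
 have M: "M \<subseteq> S" "M \<noteq> {}" using argmins_nonempty[OF S False, of l] by (auto simp: M_def argmins_def)
 have finM: "finite M" using M S finite_subset by auto
 have supp: "z x < 2 ^ e" if "z \<in> set_pmf ?Z" for z x
  using that S by (auto simp: set_Pi_pmf PiE_dflt_def lessThan_empty_iff) (metis lessThan_iff zero_less_numeral zero_less_power)
 have int: "integrable (measure_pmf ?Z) (\<lambda>z. indicator (argmins z M) x / real (card (argmins z M)))" for x
  by (rule measure_pmf.integrable_const_bound[of _ 1]) (auto simp: indicator_def divide_le_eq)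
 have "expect ?Z (\<lambda>z. red_share (\<lambda>x. l x * 2 ^ e + z x) S R) =
  expect ?Z (\<lambda>z. \<Sum>x\<in>M \<inter> R. indicator (argmins z M) x / real (card (argmins z M)))"
 proof (rule integral_cong_AE)
  show "AE z in measure_pmf ?Z. red_share (\<lambda>x. l x * 2 ^ e + z x) S R = (\<Sum>x\<in>M \<inter> R. indicator (argmins z M) x / real (card (argmins z M)))"
  proof (rule AE_pmfI)
   fix z assume z: "z \<in> set_pmf ?Z"
   have "argmins (\<lambda>x. l x * 2 ^ e + z x) S = argmins z M"
    unfolding M_def using supp[OF z] by (rule argmins_refine)
   moreover have "(\<Sum>x\<in>M \<inter> R. indicator (argmins z M) x) = real (card (argmins z M \<inter> R))"
   proof -
    have "M \<inter> R \<inter> {x. x \<in> argmins z M} = argmins z M \<inter> R" by (auto simp: argmins_def)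
    then show ?thesis using finM by (simp add: indicator_def sum.If_cases)
   qed
   ultimately show "red_share (\<lambda>x. l x * 2 ^ e + z x) S R = (\<Sum>x\<in>M \<inter> R. indicator (argmins z M) x / real (card (argmins z M)))"
    by (simp add: red_share_def sum_divide_distrib[symmetric])
  qed
 qed auto
 also have "\<dots> = (\<Sum>x\<in>M \<inter> R. 1 / real (card M))"
  by (subst Bochner_Integration.integral_sum[OF int]) (intro sum.cong refl expectation_uniform_argmin[OF S M], auto)
 also have "\<dots> = red_share l S R" by (simp add: red_share_def M_def)
 finally have E: "expect ?Z (\<lambda>z. red_share (\<lambda>x. l x * 2 ^ e + z x) S R) = red_share l S R" .
 have r: "0 \<le> red_share l S R" "red_share l S R \<le> 1" for l using red_share_range[of l S R] by auto
 have T: "pmf (bind_pmf ?Z (\<lambda>z. bernoulli_pmf (red_share (\<lambda>x. l x * 2 ^ e + z x) S R))) True = pmf (bernoulli_pmf (red_share l S R)) True"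
  by (simp add: pmf_bind r E)
 show ?thesis
 proof (rule pmf_eqI)
  fix y show "pmf (bind_pmf ?Z (\<lambda>z. bernoulli_pmf (red_share (\<lambda>x. l x * 2 ^ e + z x) S R))) y = pmf (bernoulli_pmf (red_share l S R)) y"
   using T by (cases y) (simp_all only: pmf_False_conv_True)
 qed
qed

section \<open>The number of red bins and the estimator\<close>

text \<open>The conditional probability of at least \<theta> red bins, given the bins
  \<open>g\<close> and local hash values \<open>l\<close> of the balls, when ties are broken
  independently in each bin.\<close>

definition many_red :: "nat \<Rightarrow> ('a \<Rightarrow> nat) \<Rightarrow> ('a \<Rightarrow> nat) \<Rightarrow> 'a set \<Rightarrow> 'a set \<Rightarrow> real \<Rightarrow> real" where
 "many_red K g l A R \<theta> = prob (Pi_pmf {..<K} False (\<lambda>b. bernoulli_pmf (red_share l {x \<in> A. g x = b} R)))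
   {f. \<theta> \<le> real (card {b \<in> {..<K}. f b})}"

lemma many_red_range: "0 \<le> many_red K g l A R \<theta>" "many_red K g l A R \<theta> \<le> 1"
 by (auto simp: many_red_def)

lemma many_red_mono:
 assumes "finite A" "finite A'" "A \<inter> R \<subseteq> A'" "A' - R \<subseteq> A"
 shows "many_red K g l A R \<theta> \<le> many_red K g l A' R \<theta>"
 unfolding many_red_def
proof (rule Pi_bernoulli_mono)
 fix b
 have "red_share l {x \<in> A. g x = b} R \<le> red_share l {x \<in> A'. g x = b} R"
  by (rule red_share_mono) (use assms in auto)
 then show "0 \<le> red_share l {x \<in> A. g x = b} R \<and> red_share l {x \<in> A. g x = b} R \<le> red_share l {x \<in> A'. g x = b} R \<and>
   red_share l {x \<in> A'. g x = b} R \<le> 1"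
  using red_share_range[of l "{x \<in> A. g x = b}" R] red_share_range[of l "{x \<in> A'. g x = b}" R] by auto
qed simp

lemma many_red_refine:
 assumes A: "finite A" and g: "g ` A \<subseteq> {..<K}"
 shows "expect (Pi_pmf A 0 (\<lambda>_. (uniform_bits e))) (\<lambda>z. many_red K g (\<lambda>x. l x * 2 ^ e + z x) A R \<theta>) =
  many_red K g l A R \<theta>"
proof -
 define F where "F b z = bernoulli_pmf (red_share (\<lambda>x. l x * 2 ^ e + z x) {x \<in> A. g x = b} R)" for b z
 have Un: "(\<Union>b\<in>{..<K}. {x \<in> A. g x = b}) = A" using g by auto
 have "bind_pmf (Pi_pmf (\<Union>b\<in>{..<K}. {x \<in> A. g x = b}) 0 (\<lambda>_. (uniform_bits e))) (\<lambda>z. Pi_pmf {..<K} False (\<lambda>b. F b z)) =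
  Pi_pmf {..<K} False (\<lambda>b. bind_pmf (Pi_pmf {x \<in> A. g x = b} 0 (\<lambda>_. (uniform_bits e))) (F b))"
 proof (rule Pi_pmf_bind_disjoint)
  fix b and z z' :: "'a \<Rightarrow> nat"
  assume "\<And>x. x \<in> {x \<in> A. g x = b} \<Longrightarrow> z x = z' x"
  then have "argmins (\<lambda>x. l x * 2 ^ e + z x) {x \<in> A. g x = b} = argmins (\<lambda>x. l x * 2 ^ e + z' x) {x \<in> A. g x = b}"
   by (auto simp: argmins_def)
  then show "F b z = F b z'" by (simp add: F_def red_share_def)
 qed (use A in \<open>auto simp: disjoint_family_on_def\<close>)
 also have "\<dots> = Pi_pmf {..<K} False (\<lambda>b. bernoulli_pmf (red_share l {x \<in> A. g x = b} R))"
  unfolding F_def by (intro Pi_pmf_cong refl red_share_refine) (use A in auto)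
 finally show ?thesis unfolding many_red_def F_def Un by (simp only: prob_bind[symmetric])
qed

lemma smallest_in_bin_eq:
 "smallest_in_bin r k h A b = argmins (\<lambda>x. local_hash r k (h x)) {x \<in> A. bin_of r k (h x) = b}"
 unfolding smallest_in_bin_def argmins_def is_arg_min_def by (auto simp: not_less)

lemma map_pmf_of_set_mem:
 assumes "finite M" "M \<noteq> {}"
 shows "map_pmf (\<lambda>x. x \<in> R) (pmf_of_set M) = bernoulli_pmf (real (card (M \<inter> R)) / real (card M))"
proof (rule pmf_eqI)
 have "card (M \<inter> R) \<le> card M" using assms by (intro card_mono) auto
 then have r: "real (card (M \<inter> R)) / real (card M) \<le> 1" by (simp add: divide_le_eq)
 have "(\<lambda>x. x \<in> R) -` {True} = R" by auto
 then have T: "pmf (map_pmf (\<lambda>x. x \<in> R) (pmf_of_set M)) True = pmf (bernoulli_pmf (real (card (M \<inter> R)) / real (card M))) True"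
  using r assms by (simp add: pmf_map measure_pmf_of_set)
 fix y show "pmf (map_pmf (\<lambda>x. x \<in> R) (pmf_of_set M)) y = pmf (bernoulli_pmf (real (card (M \<inter> R)) / real (card M))) y"
  using T by (cases y) (simp_all only: pmf_False_conv_True)
qed

text \<open>Selections in different bins are independent, hence so are the colours of the bins.
  Empty bins join as bins that are red with probability 0, which makes the index set independent of
  the hash function.\<close>

lemma red_count_law:
 assumes A: "finite A" and K: "nonempty_bins r k h A \<subseteq> {..<K}"
 shows "map_pmf (\<lambda>sel. card {b \<in> nonempty_bins r k h A. sel b \<in> R}) (minhash_selection r k h A) =
  map_pmf (\<lambda>f. card {b \<in> {..<K}. f b})
   (Pi_pmf {..<K} False (\<lambda>b. bernoulli_pmf (red_share (\<lambda>x. local_hash r k (h x)) {x \<in> A. bin_of r k (h x) = b} R)))"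
proof -
 define N where "N = nonempty_bins r k h A"
 define S where "S b = {x \<in> A. bin_of r k (h x) = b}" for b
 define l where "l x = local_hash r k (h x)" for x
 define p where "p b = bernoulli_pmf (red_share l (S b) R)" for b
 have finN: "finite N" using A by (simp add: N_def nonempty_bins_def)
 have NK: "N \<subseteq> {..<K}" using K by (simp add: N_def)
 have Sne: "S b \<noteq> {} \<longleftrightarrow> b \<in> N" for b by (auto simp: S_def N_def nonempty_bins_def)
 have sel: "minhash_selection r k h A = Pi_pmf N undefined (\<lambda>b. pmf_of_set (argmins l (S b)))"
  by (simp add: minhash_selection_def N_def smallest_in_bin_eq S_def l_def[abs_def])
 have "Pi_pmf N (undefined \<in> R) (\<lambda>b. map_pmf (\<lambda>x. x \<in> R) (pmf_of_set (argmins l (S b)))) = map_pmf (\<lambda>h. (\<lambda>x. x \<in> R) \<circ> h) (minhash_selection r k h A)"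
  unfolding sel by (rule Pi_pmf_map[OF finN refl])
 moreover have "Pi_pmf N (undefined \<in> R) (\<lambda>b. map_pmf (\<lambda>x. x \<in> R) (pmf_of_set (argmins l (S b)))) = Pi_pmf N (undefined \<in> R) p"
 proof (rule Pi_pmf_cong[OF refl refl])
  fix b assume "b \<in> N"
  then have "S b \<noteq> {}" by (simp add: Sne)
  moreover have "finite (S b)" using A by (simp add: S_def)
  ultimately show "map_pmf (\<lambda>x. x \<in> R) (pmf_of_set (argmins l (S b))) = p b"
   unfolding p_def red_share_def by (intro map_pmf_of_set_mem finite_argmins argmins_nonempty)
 qed
 ultimately have 1: "map_pmf (\<lambda>h. (\<lambda>x. x \<in> R) \<circ> h) (minhash_selection r k h A) = Pi_pmf N (undefined \<in> R) p" by simp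
 have "map_pmf (\<lambda>sel. card {b \<in> N. sel b \<in> R}) (minhash_selection r k h A) =
  map_pmf (\<lambda>f. card {b \<in> N. f b}) (map_pmf (\<lambda>h. (\<lambda>x. x \<in> R) \<circ> h) (minhash_selection r k h A))"
  by (simp add: map_pmf_comp)
 also have "\<dots> = map_pmf (\<lambda>f. card {b \<in> N. f b}) (map_pmf (\<lambda>f b. if b \<in> N then f b else False) (Pi_pmf N (undefined \<in> R) p))"
  unfolding 1 by (simp add: map_pmf_comp cong: conj_cong)
 also have "\<dots> = map_pmf (\<lambda>f. card {b \<in> N. f b}) (Pi_pmf N False p)"
  by (simp only: Pi_pmf_default_swap[OF finN])
 also have "\<dots> = map_pmf (\<lambda>f. card {b \<in> {..<K}. f b}) (Pi_pmf N False p)"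
 proof (rule map_pmf_cong[OF refl])
  fix f assume "f \<in> set_pmf (Pi_pmf N False p)"
  then have "\<forall>b. b \<notin> N \<longrightarrow> f b = False" using set_Pi_pmf_subset[OF finN, of False p] by auto
  then have "{b \<in> N. f b} = {b \<in> {..<K}. f b}" using NK by auto
  then show "card {b \<in> N. f b} = card {b \<in> {..<K}. f b}" by simp
 qed
 also have "Pi_pmf N False p = Pi_pmf {..<K} False p"
 proof (rule Pi_pmf_subset'[symmetric])
  fix b assume "b \<in> {..<K} - N"
  then have "S b = {}" using Sne by blast
  moreover have "bernoulli_pmf 0 = return_pmf False"
   by (rule pmf_eqI) (rename_tac y, case_tac y, auto)
  ultimately show "p b = return_pmf False" by (simp add: p_def red_share_def argmins_def)
 qed (use NK in auto)
 finally show ?thesis unfolding N_def p_def S_def l_def[abs_def] .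
qed

context
 fixes r k :: nat and R B :: "'a set" and H :: "('a \<Rightarrow> nat) pmf" and K w :: nat
 assumes fin: "finite R" "finite B" and br: "bin_bits k \<le> r" and H: "\<And>h x. h \<in> set_pmf H \<Longrightarrow> h x < 2 ^ r"
  and K: "K = 2 ^ bin_bits k" and w: "w = r - bin_bits k"
begin

private lemma bins_subset: "h \<in> set_pmf H \<Longrightarrow> (\<lambda>x. h x div 2 ^ w) ` A \<subseteq> {..<K}"
proof -
 assume h: "h \<in> set_pmf H"
 have "h x div 2 ^ w < K" for x
 proof -
  have "r = bin_bits k + w" using br by (simp add: w)
  then show ?thesis using H[OF h, of x] by (simp add: K power_add less_mult_imp_div_less)
 qed
 then show ?thesis by auto
qed

private lemma count_law:
 assumes h: "h \<in> set_pmf H"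
 shows "map_pmf (\<lambda>sel. card {b \<in> nonempty_bins r k h (R \<union> B). sel b \<in> R}) (minhash_selection r k h (R \<union> B)) =
  map_pmf (\<lambda>f. card {b \<in> {..<K}. f b})
   (Pi_pmf {..<K} False (\<lambda>b. bernoulli_pmf (red_share (\<lambda>x. h x mod 2 ^ w) {x \<in> R \<union> B. h x div 2 ^ w = b} R)))"
proof -
 have "nonempty_bins r k h (R \<union> B) \<subseteq> {..<K}"
  using bins_subset[OF h, of "R \<union> B"] by (simp add: nonempty_bins_def bin_of_def w)
 from red_count_law[OF _ this, of R] fin show ?thesis by (simp add: bin_of_def local_hash_def w)
qed

private lemma estimator_prob:
 "prob (minhash_estimator r k R B H) {t..} = expect H (\<lambda>h.
   prob (map_pmf (\<lambda>sel. card {b \<in> nonempty_bins r k h (R \<union> B). sel b \<in> R}) (minhash_selection r k h (R \<union> B)))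
    {n. t \<le> real n / real (card (nonempty_bins r k h (R \<union> B)))})"
 unfolding minhash_estimator_def
 by (subst prob_bind, intro Bochner_Integration.integral_cong refl)
   (simp only: map_pmf_def[symmetric] measure_map_pmf vimage_def mem_Collect_eq atLeast_iff)

private lemma card_bins: "h \<in> set_pmf H \<Longrightarrow> card (nonempty_bins r k h A) \<le> K"
 using card_mono[OF _ bins_subset[of h A]] by (simp add: nonempty_bins_def bin_of_def w)

text \<open>If every bin is hit, the denominator of the estimator is \<open>K\<close>; otherwise the
  probability is bounded by 1.\<close>

lemma minhash_estimator_le:
 "prob (minhash_estimator r k R B H) {t..} \<le> expect H (\<lambda>h.
   if (\<lambda>x. h x div 2 ^ w) ` (R \<union> B) = {..<K}
   then many_red K (\<lambda>x. h x div 2 ^ w) (\<lambda>x. h x mod 2 ^ w) (R \<union> B) R (t * real K) else 1)"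
 unfolding estimator_prob
proof (rule integral_mono_AE)
 have K0: "K > 0" by (simp add: K)
 show "AE h in measure_pmf H. prob (map_pmf (\<lambda>sel. card {b \<in> nonempty_bins r k h (R \<union> B). sel b \<in> R}) (minhash_selection r k h (R \<union> B)))
    {n. t \<le> real n / real (card (nonempty_bins r k h (R \<union> B)))} \<le> (if (\<lambda>x. h x div 2 ^ w) ` (R \<union> B) = {..<K}
   then many_red K (\<lambda>x. h x div 2 ^ w) (\<lambda>x. h x mod 2 ^ w) (R \<union> B) R (t * real K) else 1)"
 proof (rule AE_pmfI)
  fix h assume h: "h \<in> set_pmf H"
  show "prob (map_pmf (\<lambda>sel. card {b \<in> nonempty_bins r k h (R \<union> B). sel b \<in> R}) (minhash_selection r k h (R \<union> B)))
    {n. t \<le> real n / real (card (nonempty_bins r k h (R \<union> B)))} \<le> (if (\<lambda>x. h x div 2 ^ w) ` (R \<union> B) = {..<K}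
   then many_red K (\<lambda>x. h x div 2 ^ w) (\<lambda>x. h x mod 2 ^ w) (R \<union> B) R (t * real K) else 1)"
  proof (cases "(\<lambda>x. h x div 2 ^ w) ` (R \<union> B) = {..<K}")
   case True
   then have "card (nonempty_bins r k h (R \<union> B)) = K" by (simp add: nonempty_bins_def bin_of_def w)
   then have "prob (map_pmf (\<lambda>sel. card {b \<in> nonempty_bins r k h (R \<union> B). sel b \<in> R}) (minhash_selection r k h (R \<union> B)))
     {n. t \<le> real n / real (card (nonempty_bins r k h (R \<union> B)))} =
    many_red K (\<lambda>x. h x div 2 ^ w) (\<lambda>x. h x mod 2 ^ w) (R \<union> B) R (t * real K)"
    unfolding count_law[OF h] many_red_def using K0 by (simp add: vimage_def le_divide_eq)
   then show ?thesis using True by simp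
  qed simp
 qed
qed (auto intro!: measure_pmf.integrable_const_bound[of _ 1] simp: many_red_range)

text \<open>There are at most \<open>K\<close> nonempty bins, so dividing by their number instead of
  \<open>K\<close> can only enlarge the quotient.\<close>

lemma minhash_estimator_ge:
 "expect H (\<lambda>h. many_red K (\<lambda>x. h x div 2 ^ w) (\<lambda>x. h x mod 2 ^ w) (R \<union> B) R (t * real K)) \<le>
   prob (minhash_estimator r k R B H) {t..}"
 unfolding estimator_prob
proof (rule integral_mono_AE)
 show "AE h in measure_pmf H. many_red K (\<lambda>x. h x div 2 ^ w) (\<lambda>x. h x mod 2 ^ w) (R \<union> B) R (t * real K) \<le>
   prob (map_pmf (\<lambda>sel. card {b \<in> nonempty_bins r k h (R \<union> B). sel b \<in> R}) (minhash_selection r k h (R \<union> B)))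
    {n. t \<le> real n / real (card (nonempty_bins r k h (R \<union> B)))}"
 proof (rule AE_pmfI)
  fix h assume h: "h \<in> set_pmf H"
  define k' where "k' = card (nonempty_bins r k h (R \<union> B))"
  let ?M = "minhash_selection r k h (R \<union> B)"
  have le: "t \<le> real (card {b \<in> nonempty_bins r k h (R \<union> B). sel b \<in> R}) / real k'"
   if "t * real K \<le> real (card {b \<in> nonempty_bins r k h (R \<union> B). sel b \<in> R})" for sel
  proof -
   define n where "n = real (card {b \<in> nonempty_bins r k h (R \<union> B). sel b \<in> R})"
   have fN: "finite (nonempty_bins r k h (R \<union> B))" using fin by (simp add: nonempty_bins_def)
   have K0: "real K > 0" by (simp add: K)
   have t: "t \<le> n / real K" using that K0 by (simp add: n_def le_divide_eq)
   have "n / real K \<le> n / real k'"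
   proof (cases "k' = 0")
    case True
    then have "nonempty_bins r k h (R \<union> B) = {}" using fN by (simp add: k'_def)
    then show ?thesis by (simp add: n_def)
   next
    case False
    have "k' \<le> K" unfolding k'_def by (rule card_bins[OF h])
    then show ?thesis using False by (intro divide_left_mono) (auto simp: n_def)
   qed
   then show ?thesis using t unfolding n_def by linarith
  qed
  have "many_red K (\<lambda>x. h x div 2 ^ w) (\<lambda>x. h x mod 2 ^ w) (R \<union> B) R (t * real K) =
   prob (map_pmf (\<lambda>sel. card {b \<in> nonempty_bins r k h (R \<union> B). sel b \<in> R}) ?M) {n. t * real K \<le> real n}"
   unfolding count_law[OF h] many_red_def by (simp add: vimage_def)
  also have "\<dots> \<le> prob (map_pmf (\<lambda>sel. card {b \<in> nonempty_bins r k h (R \<union> B). sel b \<in> R}) ?M) {n. t \<le> real n / real k'}"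
   unfolding measure_map_pmf by (intro prob_mono) (auto intro: le)
  finally show "many_red K (\<lambda>x. h x div 2 ^ w) (\<lambda>x. h x mod 2 ^ w) (R \<union> B) R (t * real K) \<le>
   prob (map_pmf (\<lambda>sel. card {b \<in> nonempty_bins r k h (R \<union> B). sel b \<in> R}) ?M)
    {n. t \<le> real n / real (card (nonempty_bins r k h (R \<union> B)))}" unfolding k'_def .
 qed
qed (auto intro!: measure_pmf.integrable_const_bound[of _ 1] simp: many_red_range)

end

text \<open>Each nonempty bin is either red or blue. This converts lower tails into upper
  tails.\<close>

lemma minhash_estimator_swap:
 assumes fin: "finite R" "finite B" and disj: "R \<inter> B = {}" and ne: "R \<union> B \<noteq> {}"
 shows "minhash_estimator r k B R H = map_pmf (\<lambda>x. 1 - x) (minhash_estimator r k R B H)"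
proof -
 have "bind_pmf (minhash_selection r k h (R \<union> B)) (\<lambda>sel. return_pmf (real (card {b \<in> nonempty_bins r k h (R \<union> B). sel b \<in> B}) / real (card (nonempty_bins r k h (R \<union> B))))) =
  bind_pmf (minhash_selection r k h (R \<union> B)) (\<lambda>sel. return_pmf (1 - real (card {b \<in> nonempty_bins r k h (R \<union> B). sel b \<in> R}) / real (card (nonempty_bins r k h (R \<union> B)))))" for h
 proof (rule bind_pmf_cong[OF refl])
  fix sel assume sel: "sel \<in> set_pmf (minhash_selection r k h (R \<union> B))"
  define N where "N = nonempty_bins r k h (R \<union> B)"
  have N: "finite N" "N \<noteq> {}" using fin ne by (auto simp: N_def nonempty_bins_def)
  have mem: "sel b \<in> R \<union> B" if b: "b \<in> N" for b
  proof -
   define S where "S = {x \<in> R \<union> B. bin_of r k (h x) = b}"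
   have S: "finite S" "S \<noteq> {}" using fin b by (auto simp: S_def N_def nonempty_bins_def)
   have "sel b \<in> set_pmf (pmf_of_set (smallest_in_bin r k h (R \<union> B) b))"
    using sel b N(1) unfolding minhash_selection_def N_def[symmetric]
    by (auto simp: set_Pi_pmf PiE_dflt_def)
   also have "\<dots> = argmins (\<lambda>x. local_hash r k (h x)) S"
    unfolding smallest_in_bin_eq S_def[symmetric] by (intro set_pmf_of_set argmins_nonempty finite_argmins S)
   finally show ?thesis by (auto simp: argmins_def S_def)
  qed
  have "card {b \<in> N. sel b \<in> R} + card {b \<in> N. sel b \<in> B} = card ({b \<in> N. sel b \<in> R} \<union> {b \<in> N. sel b \<in> B})"
   using N disj by (intro card_Un_disjoint[symmetric]) auto
  also have "{b \<in> N. sel b \<in> R} \<union> {b \<in> N. sel b \<in> B} = N" using mem by auto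
  finally have "real (card {b \<in> N. sel b \<in> B}) = real (card N) - real (card {b \<in> N. sel b \<in> R})" by simp
  then show "return_pmf (real (card {b \<in> nonempty_bins r k h (R \<union> B). sel b \<in> B}) / real (card (nonempty_bins r k h (R \<union> B)))) =
   return_pmf (1 - real (card {b \<in> nonempty_bins r k h (R \<union> B). sel b \<in> R}) / real (card (nonempty_bins r k h (R \<union> B))))"
   using N unfolding N_def[symmetric] by (simp add: diff_divide_distrib)
 qed
 then show ?thesis unfolding minhash_estimator_def by (simp add: Un_commute map_bind_pmf)
qed

section \<open>Restriction to balls whose leading local bits vanish\<close>

lemma argmins_restrict:
 assumes "Y \<subseteq> S" "Y \<noteq> {}" and less: "\<And>x y. y \<in> Y \<Longrightarrow> x \<in> S - Y \<Longrightarrow> l y < l x"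
 shows "argmins l S = argmins l Y"
proof (intro equalityI subsetI)
 fix x assume x: "x \<in> argmins l S"
 obtain y where y: "y \<in> Y" using assms by auto
 have "x \<in> Y"
 proof (rule ccontr)
  assume "x \<notin> Y"
  then have "l y < l x" using x y by (intro less) (auto simp: argmins_def)
  moreover have "l x \<le> l y" using x y assms(1) by (auto simp: argmins_def)
  ultimately show False by simp
 qed
 then show "x \<in> argmins l Y" using x assms(1) by (auto simp: argmins_def)
next
 fix x assume x: "x \<in> argmins l Y"
 have "l x \<le> l y" if "y \<in> S" for y
 proof (cases "y \<in> Y")
  case True then show ?thesis using x by (simp add: argmins_def)
 next
  case False then show ?thesis using less[of x y] x that by (simp add: argmins_def)
 qed
 then show "x \<in> argmins l S" using x assms(1) by (auto simp: argmins_def)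
qed

text \<open>Once every bin contains a filtered ball, balls outside the filter are never selected.\<close>

lemma many_red_filter:
 assumes f: "\<And>x. x \<in> A \<Longrightarrow> rest x < 2 ^ \<rho>" and z: "\<And>x. x \<in> A \<Longrightarrow> z x < 2 ^ e" and e\<rho>: "e = 0 \<or> \<rho> = 0"
  and Y: "Y = {x \<in> A. f x = 0 \<and> z x = 0}" and hit: "g ` Y = {..<K}"
 shows "many_red K g (\<lambda>x. (f x * 2 ^ \<rho> + rest x) * 2 ^ e + z x) A R \<theta> = many_red K g rest Y R \<theta>"
proof -
 define l where "l x = (f x * 2 ^ \<rho> + rest x) * 2 ^ e + z x" for x
 have "red_share l {x \<in> A. g x = b} R = red_share rest {x \<in> Y. g x = b} R" if b: "b < K" for b
 proof -
  have "b \<in> g ` Y" using b hit by simp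
  then have ne: "{x \<in> Y. g x = b} \<noteq> {}" by auto
  have "argmins l {x \<in> A. g x = b} = argmins l {x \<in> Y. g x = b}"
  proof (rule argmins_restrict[OF _ ne])
   show "{x \<in> Y. g x = b} \<subseteq> {x \<in> A. g x = b}" by (auto simp: Y)
   fix x y assume "y \<in> {x \<in> Y. g x = b}" and "x \<in> {x \<in> A. g x = b} - {x \<in> Y. g x = b}"
   then have y: "y \<in> A" "f y = 0" "z y = 0" and x: "x \<in> A" "f x > 0 \<or> z x > 0" by (auto simp: Y)
   have ly: "l y = rest y * 2 ^ e" using y by (simp add: l_def)
   show "l y < l x"
   proof (cases "f x = 0")
    case False
    have "rest y * 2 ^ e < 2 ^ \<rho> * 2 ^ e" using f[OF y(1)] by simp
    also have "\<dots> \<le> f x * 2 ^ \<rho> * 2 ^ e" using False by simp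
    also have "\<dots> \<le> l x" by (simp add: l_def add_mult_distrib)
    finally show ?thesis by (simp add: ly)
   next
    case True
    then have "z x > 0" using x by simp
    \<comment> \<open>Here the decision falls in the random bits \<open>z\<close>. They may be part
      of the filter only if no bits of \<open>rest\<close> precede them.\<close>
    then have "\<rho> = 0" using z[OF x(1)] e\<rho> by auto
    then show ?thesis using f[OF y(1)] \<open>z x > 0\<close> y by (simp add: l_def)
   qed
  qed
  also have "\<dots> = argmins rest {x \<in> Y. g x = b}"
   by (auto simp: argmins_def Y l_def)
  finally show ?thesis by (simp add: red_share_def)
 qed
 then have "Pi_pmf {..<K} False (\<lambda>b. bernoulli_pmf (red_share l {x \<in> A. g x = b} R)) =
  Pi_pmf {..<K} False (\<lambda>b. bernoulli_pmf (red_share rest {x \<in> Y. g x = b} R))" by (intro Pi_pmf_cong refl) simp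
 then show ?thesis by (simp add: many_red_def l_def[abs_def])
qed

section \<open>Red bins under fully random hashing\<close>

lemma integrable_unit:
 fixes f :: "'a \<Rightarrow> real"
 assumes "\<And>x. 0 \<le> f x" "\<And>x. f x \<le> 1"
 shows "integrable (measure_pmf M) f"
 using assms by (intro measure_pmf.integrable_const_bound[of _ 1]) auto

lemma expectation_unit:
 fixes f :: "'a \<Rightarrow> real"
 assumes "\<And>x. 0 \<le> f x" "\<And>x. f x \<le> 1"
 shows "0 \<le> expect M f" "expect M f \<le> 1"
 using expectation_bounds[of M f 1 0] assms by auto

lemma expectation_pair:
 fixes f :: "'a \<times> 'b \<Rightarrow> real"
 assumes f: "\<And>x. 0 \<le> f x" "\<And>x. f x \<le> 1"
 shows "expect (pair_pmf A B) f = expect A (\<lambda>x. expect B (\<lambda>y. f (x, y)))"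
proof -
 have "ennreal (expect (pair_pmf A B) f) = (\<integral>\<^sup>+x. ennreal (f x) \<partial>pair_pmf A B)"
  by (intro nn_integral_eq_integral[symmetric] integrable_unit f) (simp add: f)
 also have "\<dots> = (\<integral>\<^sup>+x. \<integral>\<^sup>+y. ennreal (f (x, y)) \<partial>B \<partial>A)"
  by (rule nn_integral_pair_pmf')
 also have "\<dots> = (\<integral>\<^sup>+x. ennreal (expect B (\<lambda>y. f (x, y))) \<partial>A)"
  by (intro nn_integral_cong nn_integral_eq_integral integrable_unit f) (simp add: f)
 also have "\<dots> = ennreal (expect A (\<lambda>x. expect B (\<lambda>y. f (x, y))))"
  by (intro nn_integral_eq_integral integrable_unit expectation_unit f) (simp add: expectation_unit f)
 finally show ?thesis by (simp add: expectation_unit f)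
qed

lemma finite_fully_random: "finite A \<Longrightarrow> h \<in> set_pmf (fully_random A r) \<Longrightarrow> h x < 2 ^ r \<and> (x \<notin> A \<longrightarrow> h x = 0)"
 unfolding fully_random_def by (cases "x \<in> A") (auto simp: set_Pi_pmf PiE_dflt_def lessThan_empty_iff)

lemma fully_random_concat:
 assumes A: "finite A"
 shows "fully_random A (r1 + r2) = map_pmf (\<lambda>(f, g) x. f x * 2 ^ r2 + g x) (pair_pmf (fully_random A r1) (fully_random A r2))"
proof -
 define S where "S r = PiE_dflt A 0 (\<lambda>_. {..<2 ^ r :: nat})" for r
 have S: "h \<in> S r \<longleftrightarrow> (\<forall>x. h x < 2 ^ r \<and> (x \<notin> A \<longrightarrow> h x = 0))" for h r
 proof
  assume "h \<in> S r"
  then have "h x < 2 ^ r \<and> (x \<notin> A \<longrightarrow> h x = 0)" for x by (cases "x \<in> A") (auto simp: S_def PiE_dflt_def)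
  then show "\<forall>x. h x < 2 ^ r \<and> (x \<notin> A \<longrightarrow> h x = 0)" by blast
 qed (auto simp: S_def PiE_dflt_def)
 have fr: "fully_random A r = pmf_of_set (S r)" for r
  unfolding fully_random_def S_def by (rule Pi_pmf_of_set[OF A]) (auto simp: lessThan_empty_iff)
 have fin: "finite (S r)" for r unfolding S_def using A by (intro finite_PiE_dflt) auto
 have "(\<lambda>_. 0) \<in> S r" for r by (simp add: S)
 then have ne: "S r \<noteq> {}" for r by blast
 have bij: "bij_betw (\<lambda>(f, g) x. f x * 2 ^ r2 + g x) (S r1 \<times> S r2) (S (r1 + r2))"
 proof (rule bij_betwI[where g = "\<lambda>h. (\<lambda>x. h x div 2 ^ r2, \<lambda>x. h x mod 2 ^ r2)"])
  show "(\<lambda>(f, g) x. f x * 2 ^ r2 + g x) \<in> S r1 \<times> S r2 \<rightarrow> S (r1 + r2)"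
  proof (clarsimp simp: S)
   fix f g :: "'a \<Rightarrow> nat" and x
   assume "\<forall>x. f x < 2 ^ r1 \<and> (x \<notin> A \<longrightarrow> f x = 0)" "\<forall>x. g x < 2 ^ r2 \<and> (x \<notin> A \<longrightarrow> g x = 0)"
   then have "f x * 2 ^ r2 + g x < (f x + 1) * 2 ^ r2" "(f x + 1) * 2 ^ r2 \<le> 2 ^ r1 * 2 ^ r2"
    by (simp, intro mult_le_mono1) (simp add: Suc_le_eq)
   then show "f x * 2 ^ r2 + g x < 2 ^ (r1 + r2)" by (simp add: power_add)
  qed
  show "(\<lambda>h. (\<lambda>x. h x div 2 ^ r2, \<lambda>x. h x mod 2 ^ r2)) \<in> S (r1 + r2) \<rightarrow> S r1 \<times> S r2"
   by (auto simp: S power_add less_mult_imp_div_less)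
 qed (auto simp: S fun_eq_iff div_mult_mod_eq)
 show ?thesis
  unfolding fr by (subst pair_pmf_of_set[OF fin ne fin ne]) (simp add: map_pmf_of_set_bij_betw[OF bij] fin ne)
qed

lemma many_red_cong:
 assumes "\<And>x. x \<in> A \<Longrightarrow> g x = g' x" "\<And>x. x \<in> A \<Longrightarrow> l x = l' x" "A \<inter> R = A \<inter> R'"
 shows "many_red K g l A R \<theta> = many_red K g' l' A R' \<theta>"
proof -
 have "red_share l {x \<in> A. g x = b} R = red_share l' {x \<in> A. g' x = b} R'" for b
 proof -
  have 1: "argmins l {x \<in> A. g x = b} = argmins l' {x \<in> A. g' x = b}"
   unfolding argmins_def using assms(1,2) by auto
  have "argmins l' {x \<in> A. g' x = b} \<subseteq> A" by (auto simp: argmins_def)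
  then have "argmins l' {x \<in> A. g' x = b} \<inter> R = argmins l' {x \<in> A. g' x = b} \<inter> R'" using assms(3) by blast
  with 1 show ?thesis by (simp add: red_share_def)
 qed
 then show ?thesis by (simp add: many_red_def)
qed

text \<open>The average of \<open>many_red\<close> when \<beta> bits name the bin and \<rho> bits
  form the local hash value.\<close>

definition red_prob :: "nat \<Rightarrow> nat \<Rightarrow> 'a set \<Rightarrow> 'a set \<Rightarrow> real \<Rightarrow> real" where
 "red_prob \<beta> \<rho> A R \<theta> = expect (fully_random A (\<beta> + \<rho>))
   (\<lambda>h. many_red (2 ^ \<beta>) (\<lambda>x. h x div 2 ^ \<rho>) (\<lambda>x. h x mod 2 ^ \<rho>) A R \<theta>)"

lemma red_prob_range: "0 \<le> red_prob \<beta> \<rho> A R \<theta>" "red_prob \<beta> \<rho> A R \<theta> \<le> 1"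
 unfolding red_prob_def by (intro expectation_unit many_red_range)+

lemma fully_random_restrict:
 "finite W \<Longrightarrow> A \<subseteq> W \<Longrightarrow> fully_random A r = map_pmf (\<lambda>f x. if x \<in> A then f x else 0) (fully_random W r)"
 unfolding fully_random_def by (rule Pi_pmf_subset)

lemma red_prob_superset:
 assumes W: "finite W" "A \<subseteq> W"
 shows "red_prob \<beta> \<rho> A R \<theta> = expect (fully_random W (\<beta> + \<rho>))
   (\<lambda>h. many_red (2 ^ \<beta>) (\<lambda>x. h x div 2 ^ \<rho>) (\<lambda>x. h x mod 2 ^ \<rho>) A R \<theta>)"
 unfolding red_prob_def fully_random_restrict[OF W]
 by (simp, intro Bochner_Integration.integral_cong refl many_red_cong) auto

text \<open>Coupling: both ball sets use the same hash values on their union.\<close>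

lemma red_prob_mono:
 assumes fin: "finite A" "finite A'" and sub: "A \<inter> R \<subseteq> A'" "A' - R \<subseteq> A"
 shows "red_prob \<beta> \<rho> A R \<theta> \<le> red_prob \<beta> \<rho> A' R \<theta>"
proof -
 have W: "finite (A \<union> A')" "A \<subseteq> A \<union> A'" "A' \<subseteq> A \<union> A'" using fin by auto
 show ?thesis unfolding red_prob_superset[OF W(1,2)] red_prob_superset[OF W(1,3)]
  by (intro integral_mono integrable_unit many_red_range many_red_mono fin sub)
qed

lemma many_red_image:
 assumes "inj_on f A" "R \<subseteq> A"
 shows "many_red K g l (f ` A) (f ` R) \<theta> = many_red K (g \<circ> f) (l \<circ> f) A R \<theta>"
proof -
 have "red_share l {x \<in> f ` A. g x = b} (f ` R) = red_share (l \<circ> f) {x \<in> A. (g \<circ> f) x = b} R" for b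
 proof -
  define S where "S = {x \<in> A. (g \<circ> f) x = b}"
  have S: "{x \<in> f ` A. g x = b} = f ` S" by (auto simp: S_def)
  have M: "argmins l (f ` S) = f ` argmins (l \<circ> f) S" by (auto simp: argmins_def)
  have MA: "argmins (l \<circ> f) S \<subseteq> A" by (auto simp: argmins_def S_def)
  have "f ` argmins (l \<circ> f) S \<inter> f ` R = f ` (argmins (l \<circ> f) S \<inter> R)"
   using assms MA by (intro inj_on_image_Int[symmetric]) auto
  moreover have "card (f ` X) = card X" if "X \<subseteq> A" for X using assms(1) that by (intro card_image) (rule inj_on_subset)
  ultimately show ?thesis using MA unfolding red_share_def S M S_def[symmetric] by (simp add: le_infI1)
 qed
 then show ?thesis by (simp add: many_red_def)
qed

lemma red_prob_card:
 fixes A A' :: "nat set"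
 assumes fin: "finite A" "finite A'" and eq: "card (A \<inter> R) = card (A' \<inter> R')" "card (A - R) = card (A' - R')"
 shows "red_prob \<beta> \<rho> A R \<theta> = red_prob \<beta> \<rho> A' R' \<theta>"
proof -
 obtain f1 where f1: "bij_betw f1 (A \<inter> R) (A' \<inter> R')" using eq fin by (meson finite_Int finite_same_card_bij)
 obtain f2 where f2: "bij_betw f2 (A - R) (A' - R')" using eq fin by (meson finite_Diff finite_same_card_bij)
 \<comment> \<open>Points outside \<open>A\<close> are sent outside \<open>A'\<close>, where hash
   functions take their default value.\<close>
 obtain a where a: "a \<notin> A'" using ex_new_if_finite[OF infinite_UNIV_nat fin(2)] by blast
 define f where "f x = (if x \<in> A \<inter> R then f1 x else if x \<in> A - R then f2 x else a)" for x
 have fR: "bij_betw f (A \<inter> R) (A' \<inter> R')" using f1 by (rule bij_betw_cong[THEN iffD1, rotated]) (simp add: f_def)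
 have fB: "bij_betw f (A - R) (A' - R')" using f2 by (rule bij_betw_cong[THEN iffD1, rotated]) (auto simp: f_def)
 have "bij_betw f ((A \<inter> R) \<union> (A - R)) ((A' \<inter> R') \<union> (A' - R'))" using fR fB by (rule bij_betw_combine) auto
 then have bij: "bij_betw f A A'" by (simp add: Int_Diff_Un)
 have out: "f x \<notin> A'" if "x \<notin> A" for x using that a by (simp add: f_def)
 have im: "f ` A = A'" "f ` (A \<inter> R) = A' \<inter> R'" and inj: "inj_on f A" using bij fR by (auto simp: bij_betw_def)
 have fr: "fully_random A r = map_pmf (\<lambda>g. g \<circ> f) (fully_random A' r)" for r
  unfolding fully_random_def by (rule Pi_pmf_bij_betw[OF fin(1) bij out])
 have "many_red (2 ^ \<beta>) (\<lambda>x. (h \<circ> f) x div 2 ^ \<rho>) (\<lambda>x. (h \<circ> f) x mod 2 ^ \<rho>) A R \<theta> =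
  many_red (2 ^ \<beta>) (\<lambda>x. h x div 2 ^ \<rho>) (\<lambda>x. h x mod 2 ^ \<rho>) A' R' \<theta>" for h :: "nat \<Rightarrow> nat"
 proof -
  have "many_red (2 ^ \<beta>) (\<lambda>x. h x div 2 ^ \<rho>) (\<lambda>x. h x mod 2 ^ \<rho>) A' R' \<theta> =
   many_red (2 ^ \<beta>) (\<lambda>x. h x div 2 ^ \<rho>) (\<lambda>x. h x mod 2 ^ \<rho>) (f ` A) (f ` (A \<inter> R)) \<theta>"
   unfolding im by (rule many_red_cong) auto
  also have "\<dots> = many_red (2 ^ \<beta>) (\<lambda>x. (h \<circ> f) x div 2 ^ \<rho>) (\<lambda>x. (h \<circ> f) x mod 2 ^ \<rho>) A (A \<inter> R) \<theta>"
   by (subst many_red_image[OF inj]) (auto simp: comp_def)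
  also have "\<dots> = many_red (2 ^ \<beta>) (\<lambda>x. (h \<circ> f) x div 2 ^ \<rho>) (\<lambda>x. (h \<circ> f) x mod 2 ^ \<rho>) A R \<theta>"
   by (rule many_red_cong) auto
  finally show ?thesis ..
 qed
 then show ?thesis unfolding red_prob_def fr by (simp only: integral_map_pmf)
qed

definition red_prob_of :: "nat \<Rightarrow> nat \<Rightarrow> real \<Rightarrow> nat \<Rightarrow> nat \<Rightarrow> real" where
 "red_prob_of \<beta> \<rho> \<theta> a b = red_prob \<beta> \<rho> {..<a + b} {..<a} \<theta>"

lemma red_prob_eq_of:
 fixes A :: "nat set"
 assumes "finite A"
 shows "red_prob \<beta> \<rho> A R \<theta> = red_prob_of \<beta> \<rho> \<theta> (card (A \<inter> R)) (card (A - R))"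
proof -
 have "{..<a + b} \<inter> {..<a} = {..<a}" "{..<a + b} - {..<a} = {a..<a + b}" for a b :: nat by auto
 then show ?thesis unfolding red_prob_of_def by (intro red_prob_card assms) auto
qed

lemma red_prob_of_range: "0 \<le> red_prob_of \<beta> \<rho> \<theta> a b" "red_prob_of \<beta> \<rho> \<theta> a b \<le> 1"
 unfolding red_prob_of_def by (rule red_prob_range)+

lemma red_prob_of_mono:
 assumes "a \<le> a'" "b' \<le> b"
 shows "red_prob_of \<beta> \<rho> \<theta> a b \<le> red_prob_of \<beta> \<rho> \<theta> a' b'"
proof -
 \<comment> \<open>With the red balls at the bottom and both blue blocks starting at
   \<open>a'\<close>, one set arises from the other by adding red and removing blue balls.\<close>
 define A where "A = {..<a} \<union> {a'..<a' + b}"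
 define A' where "A' = {..<a'} \<union> {a'..<a' + b'}"
 have 1: "A \<inter> {..<a'} = {..<a}" "A - {..<a'} = {a'..<a' + b}" "A' \<inter> {..<a'} = {..<a'}" "A' - {..<a'} = {a'..<a' + b'}"
  using assms by (auto simp: A_def A'_def)
 have fin: "finite A" "finite A'" by (auto simp: A_def A'_def)
 have "red_prob \<beta> \<rho> A {..<a'} \<theta> \<le> red_prob \<beta> \<rho> A' {..<a'} \<theta>"
  by (rule red_prob_mono[OF fin]) (use assms in \<open>auto simp: A_def A'_def\<close>)
 then show ?thesis unfolding red_prob_eq_of[OF fin(1)] red_prob_eq_of[OF fin(2)] 1 by simp
qed

text \<open>Union bound over the bins; a given bin is missed with probability (1 -
  2^(-\<beta>))^(\<open>card Y\<close>).\<close>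

lemma prob_bin_missed:
 assumes Y: "finite Y"
 shows "prob (fully_random Y (\<beta> + \<rho>)) {h. (\<lambda>x. h x div 2 ^ \<rho>) ` Y \<noteq> {..<2 ^ \<beta>}} \<le> 2 ^ \<beta> * exp (- (real (card Y) / 2 ^ \<beta>))"
proof -
 let ?U = "(uniform_bits (\<beta> + \<rho>))"
 have one: "prob (fully_random Y (\<beta> + \<rho>)) {h. \<forall>x\<in>Y. h x div 2 ^ \<rho> \<noteq> b} \<le> exp (- (real (card Y) / 2 ^ \<beta>))" if b: "b < 2 ^ \<beta>" for b
 proof -
  have set: "{..<2 ^ (\<beta> + \<rho>)} \<inter> {v. v div 2 ^ \<rho> = b} = {b * 2 ^ \<rho>..<b * 2 ^ \<rho> + 2 ^ \<rho>}"
  proof (intro equalityI subsetI)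
   fix v assume "v \<in> {..<2 ^ (\<beta> + \<rho>)} \<inter> {v. v div 2 ^ \<rho> = b}"
   then have "v = b * 2 ^ \<rho> + v mod 2 ^ \<rho>" using div_mult_mod_eq[of v "2 ^ \<rho>"] by simp
   moreover have "v mod 2 ^ \<rho> < 2 ^ \<rho>" by simp
   ultimately show "v \<in> {b * 2 ^ \<rho>..<b * 2 ^ \<rho> + 2 ^ \<rho>}" by (simp only: atLeastLessThan_iff) linarith
  next
   fix v assume v: "v \<in> {b * 2 ^ \<rho>..<b * 2 ^ \<rho> + 2 ^ \<rho>}"
   have "b * 2 ^ \<rho> + 2 ^ \<rho> = (b + 1) * 2 ^ \<rho>" by simp
   also have "\<dots> \<le> 2 ^ \<beta> * 2 ^ \<rho>" using b by (intro mult_le_mono1) simp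
   finally have "v < 2 ^ (\<beta> + \<rho>)" using v by (simp add: power_add)
   moreover have "v div 2 ^ \<rho> = b" using v by (intro div_nat_eqI) (auto simp: algebra_simps)
   ultimately show "v \<in> {..<2 ^ (\<beta> + \<rho>)} \<inter> {v. v div 2 ^ \<rho> = b}" by simp
  qed
  have "prob ?U {v. v div 2 ^ \<rho> = b} = 1 / 2 ^ \<beta>"
  proof -
   have "prob ?U {v. v div 2 ^ \<rho> = b} = real (card ({..<2 ^ (\<beta> + \<rho>)} \<inter> {v. v div 2 ^ \<rho> = b})) / real (card {..<2 ^ (\<beta> + \<rho>) :: nat})"
    by (rule measure_pmf_of_set) (auto simp: lessThan_empty_iff)
   also have "\<dots> = 1 / 2 ^ \<beta>" unfolding set by (simp add: power_add)
   finally show ?thesis .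
  qed
  then have U: "prob ?U {v. v div 2 ^ \<rho> \<noteq> b} = 1 - 1 / 2 ^ \<beta>"
   using measure_pmf.prob_compl[of "{v. v div 2 ^ \<rho> = b}" ?U] by (simp add: Compl_eq_Diff_UNIV[symmetric] Collect_neg_eq)
  have "{h. \<forall>x\<in>Y. h x div 2 ^ \<rho> \<noteq> b} = Pi Y (\<lambda>_. {v. v div 2 ^ \<rho> \<noteq> b})" by (auto simp: Pi_def)
  then have "prob (fully_random Y (\<beta> + \<rho>)) {h. \<forall>x\<in>Y. h x div 2 ^ \<rho> \<noteq> b} = (1 - 1 / 2 ^ \<beta>) ^ card Y"
   unfolding fully_random_def by (simp add: measure_Pi_pmf_Pi[OF Y] U)
  also have "\<dots> \<le> exp (- (1 / 2 ^ \<beta>)) ^ card Y"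
   using exp_ge_add_one_self[of "- (1 / 2 ^ \<beta>)"] by (intro power_mono) auto
  also have "\<dots> = exp (- (real (card Y) / 2 ^ \<beta>))" by (simp add: exp_of_nat_mult[symmetric])
  finally show ?thesis .
 qed
 have "prob (fully_random Y (\<beta> + \<rho>)) {h. (\<lambda>x. h x div 2 ^ \<rho>) ` Y \<noteq> {..<2 ^ \<beta>}} \<le>
  prob (fully_random Y (\<beta> + \<rho>)) (\<Union>b\<in>{..<2 ^ \<beta>}. {h. \<forall>x\<in>Y. h x div 2 ^ \<rho> \<noteq> b})"
 proof (rule measure_pmf.finite_measure_mono_AE, rule AE_pmfI, rule impI)
  fix h assume h: "h \<in> set_pmf (fully_random Y (\<beta> + \<rho>))" and m: "h \<in> {h. (\<lambda>x. h x div 2 ^ \<rho>) ` Y \<noteq> {..<2 ^ \<beta>}}"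
  have "h x div 2 ^ \<rho> < 2 ^ \<beta>" for x
   using finite_fully_random[OF Y h, of x] by (simp add: power_add less_mult_imp_div_less)
  then have "(\<lambda>x. h x div 2 ^ \<rho>) ` Y \<subseteq> {..<2 ^ \<beta>}" by auto
  then obtain b where "b < 2 ^ \<beta>" "b \<notin> (\<lambda>x. h x div 2 ^ \<rho>) ` Y" using m by blast
  then have "h \<in> {h. \<forall>x\<in>Y. h x div 2 ^ \<rho> \<noteq> b}" by blast
  with \<open>b < 2 ^ \<beta>\<close> show "h \<in> (\<Union>b\<in>{..<2 ^ \<beta>}. {h. \<forall>x\<in>Y. h x div 2 ^ \<rho> \<noteq> b})" by blast
 qed simp
 also have "\<dots> \<le> (\<Sum>b\<in>{..<2 ^ \<beta> :: nat}. exp (- (real (card Y) / 2 ^ \<beta>)))"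
  by (rule prob_UN_le) (auto intro: one)
 also have "\<dots> = 2 ^ \<beta> * exp (- (real (card Y) / 2 ^ \<beta>))" by simp
 finally show ?thesis .
qed

definition miss_bound :: "nat \<Rightarrow> nat \<Rightarrow> real" where
 "miss_bound \<beta> y = min 1 (2 ^ \<beta> * exp (- (real y / 2 ^ \<beta>)))"

lemma miss_bound_range: "0 \<le> miss_bound \<beta> y" "miss_bound \<beta> y \<le> 1"
 by (auto simp: miss_bound_def)

lemma prob_bin_missed_superset:
 assumes W: "finite W" and Y: "Y \<subseteq> W"
 shows "prob (fully_random W (\<beta> + \<rho>)) {h. (\<lambda>x. h x div 2 ^ \<rho>) ` Y \<noteq> {..<2 ^ \<beta>}} \<le> miss_bound \<beta> (card Y)"
proof -
 have "finite Y" using W Y finite_subset by blast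
 from prob_bin_missed[OF this, of \<beta> \<rho>]
 have "prob (fully_random W (\<beta> + \<rho>)) {h. (\<lambda>x. (if x \<in> Y then h x else 0) div 2 ^ \<rho>) ` Y \<noteq> {..<2 ^ \<beta>}} \<le> 2 ^ \<beta> * exp (- (real (card Y) / 2 ^ \<beta>))"
  unfolding fully_random_restrict[OF W Y] by (simp add: vimage_def)
 moreover have "(\<lambda>x. (if x \<in> Y then h x else 0) div 2 ^ \<rho>) ` Y = (\<lambda>x. h x div 2 ^ \<rho>) ` Y" for h :: "'a \<Rightarrow> nat"
  by (intro image_cong) auto
 ultimately show ?thesis by (simp add: miss_bound_def)
qed

lemma pair_pmf_shuffle:
 "pair_pmf (pair_pmf A B) (pair_pmf C D) = map_pmf (\<lambda>(((c, a), d), b). ((a, b), (c, d))) (pair_pmf (pair_pmf (pair_pmf C A) D) B)"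
proof (rule pmf_eqI)
 fix w :: "('a \<times> 'b) \<times> 'c \<times> 'd"
 let ?f = "\<lambda>(((c, a), d), b). ((a, b), (c, d))"
 have inj: "inj ?f" by (auto simp: inj_def)
 obtain a b c d where w: "w = ((a, b), (c, d))" by (metis prod.exhaust)
 have "pmf (map_pmf ?f (pair_pmf (pair_pmf (pair_pmf C A) D) B)) (?f (((c, a), d), b)) = pmf (pair_pmf (pair_pmf (pair_pmf C A) D) B) (((c, a), d), b)"
  by (rule pmf_map_inj'[OF inj])
 then show "pmf (pair_pmf (pair_pmf A B) (pair_pmf C D)) w = pmf (map_pmf ?f (pair_pmf (pair_pmf (pair_pmf C A) D) B)) w"
  by (simp add: w pmf_pair)
qed

lemma pair_pmf_shuffle':
 "pair_pmf (pair_pmf Z (pair_pmf R F)) (pair_pmf B C) =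
  map_pmf (\<lambda>((r, ((b, f), c)), z). ((z, (r, f)), (b, c))) (pair_pmf (pair_pmf R (pair_pmf (pair_pmf B F) C)) Z)"
proof (rule pmf_eqI)
 fix w :: "('a \<times> 'b \<times> 'c) \<times> 'd \<times> 'e"
 let ?f = "\<lambda>((r, ((b, f), c)), z). ((z, (r, f)), (b, c))"
 have inj: "inj ?f" by (auto simp: inj_def)
 obtain z r f b c where w: "w = ((z, (r, f)), (b, c))" by (metis prod.exhaust)
 have "pmf (map_pmf ?f (pair_pmf (pair_pmf R (pair_pmf (pair_pmf B F) C)) Z)) (?f ((r, ((b, f), c)), z)) = pmf (pair_pmf (pair_pmf R (pair_pmf (pair_pmf B F) C)) Z) ((r, ((b, f), c)), z)"
  by (rule pmf_map_inj'[OF inj])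
 then show "pmf (pair_pmf (pair_pmf Z (pair_pmf R F)) (pair_pmf B C)) w = pmf (map_pmf ?f (pair_pmf (pair_pmf R (pair_pmf (pair_pmf B F) C)) Z)) w"
  by (simp add: w pmf_pair)
qed

lemma concat_div_mod:
 fixes f t :: nat
 assumes "f < 2 ^ bl" "t < 2 ^ \<rho>"
 shows "((v * 2 ^ bl + f) * 2 ^ \<rho> + t) div 2 ^ (bl + \<rho>) = v"
  and "((v * 2 ^ bl + f) * 2 ^ \<rho> + t) mod 2 ^ (bl + \<rho>) = f * 2 ^ \<rho> + t"
proof -
 have "f * 2 ^ \<rho> + t < (f + 1) * 2 ^ \<rho>" "(f + 1) * 2 ^ \<rho> \<le> 2 ^ bl * 2 ^ \<rho>"
  using assms by (simp, intro mult_le_mono1) (simp add: Suc_le_eq)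
 then have lt: "f * 2 ^ \<rho> + t < 2 ^ (bl + \<rho>)" by (simp add: power_add)
 have eq: "(v * 2 ^ bl + f) * 2 ^ \<rho> + t = (f * 2 ^ \<rho> + t) + 2 ^ (bl + \<rho>) * v"
  by (simp add: power_add algebra_simps)
 show "((v * 2 ^ bl + f) * 2 ^ \<rho> + t) div 2 ^ (bl + \<rho>) = v" unfolding eq using lt by simp
 show "((v * 2 ^ bl + f) * 2 ^ \<rho> + t) mod 2 ^ (bl + \<rho>) = f * 2 ^ \<rho> + t" unfolding eq using lt by simp
qed

lemma expectation_mono_unit:
 fixes f g :: "'a \<Rightarrow> real"
 assumes "\<And>x. x \<in> set_pmf M \<Longrightarrow> f x \<le> g x" "\<And>x. 0 \<le> f x" "\<And>x. f x \<le> 1" "integrable (measure_pmf M) g"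
 shows "expect M f \<le> expect M g"
proof (rule integral_mono_AE)
 show "integrable (measure_pmf M) f" using assms(2,3) by (rule integrable_unit)
qed (use assms in \<open>auto simp: AE_measure_pmf_iff\<close>)

text \<open>The reduction for the fully random experiment. If the survivors hit every bin, they
  alone determine the red bins (\<open>many_red_filter\<close>), and the \<open>e\<close> bits
  behind the hash value merely break ties (\<open>many_red_refine\<close>). Missed bins are charged
  to \<open>miss_bound\<close>.\<close>

lemma red_prob_filter_le:
 assumes W: "finite W" and e\<rho>: "e = 0 \<or> \<rho> = 0"
 shows "expect (fully_random W (bl + e)) (\<lambda>v. red_prob \<beta> \<rho> {x \<in> W. v x = 0} R \<theta>) \<le>
  expect (fully_random W (\<beta> + bl + \<rho>)) (\<lambda>h. many_red (2 ^ \<beta>) (\<lambda>x. h x div 2 ^ (bl + \<rho>)) (\<lambda>x. h x mod 2 ^ (bl + \<rho>)) W R \<theta>) +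
  expect (fully_random W (bl + e)) (\<lambda>v. miss_bound \<beta> (card {x \<in> W. v x = 0}))"
proof -
 let ?F = "\<lambda>r. fully_random W r"
 let ?K = "2 ^ \<beta> :: nat"
 define Y where "Y f z = {x \<in> W. f x = 0 \<and> z x = (0::nat)}" for f z :: "'a \<Rightarrow> nat"
 let ?FZ = "pair_pmf (?F bl) (?F e)"
 let ?BC = "pair_pmf (?F \<beta>) (?F \<rho>)"
 define V where "V = (\<lambda>((f, z), (b, t)). many_red ?K b t (Y f z) R \<theta>)"
 define V' where "V' = (\<lambda>((f, z), (b, t)). many_red ?K b (\<lambda>x. (f x * 2 ^ \<rho> + t x) * 2 ^ e + z x) W R \<theta>)"
 define H where "H = (\<lambda>((f, z), (b, t :: 'a \<Rightarrow> nat)). b ` Y f z = {..<?K})"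
 have lt: "h x < 2 ^ r" if "h \<in> set_pmf (?F r)" for h r x using finite_fully_random[OF W that] by blast
 have split: "expec = expect ?FZ (\<lambda>(f, z). G (Y f z))"
  if "expec = expect (?F (bl + e)) (\<lambda>v. G {x \<in> W. v x = 0})" for expec and G :: "'a set \<Rightarrow> real"
  unfolding that fully_random_concat[OF W, of bl e] by (simp add: split_def Y_def)
 have Vr: "0 \<le> V w" "V w \<le> 1" "0 \<le> V' w" "V' w \<le> 1" for w
  by (auto simp: V_def V'_def split_def many_red_range)
 have "expect ?FZ (\<lambda>(f, z). red_prob \<beta> \<rho> (Y f z) R \<theta>) = expect (pair_pmf ?FZ ?BC) V"
 proof -
  have "red_prob \<beta> \<rho> (Y f z) R \<theta> = expect ?BC (\<lambda>y. V ((f, z), y))" for f z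
  proof -
   have sub: "Y f z \<subseteq> W" by (auto simp: Y_def)
   have "red_prob \<beta> \<rho> (Y f z) R \<theta> = expect ?BC (\<lambda>(b, t). many_red ?K (\<lambda>x. (b x * 2 ^ \<rho> + t x) div 2 ^ \<rho>) (\<lambda>x. (b x * 2 ^ \<rho> + t x) mod 2 ^ \<rho>) (Y f z) R \<theta>)"
    unfolding red_prob_superset[OF W sub] fully_random_concat[OF W, of \<beta> \<rho>] by (simp add: split_def)
   also have "\<dots> = expect ?BC (\<lambda>y. V ((f, z), y))"
   proof (rule integral_cong_AE)
    show "AE y in measure_pmf ?BC. (case y of (b, t) \<Rightarrow> many_red ?K (\<lambda>x. (b x * 2 ^ \<rho> + t x) div 2 ^ \<rho>) (\<lambda>x. (b x * 2 ^ \<rho> + t x) mod 2 ^ \<rho>) (Y f z) R \<theta>) = V ((f, z), y)"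
     by (rule AE_pmfI) (auto simp: V_def lt)
   qed auto
   finally show ?thesis .
  qed
  then show ?thesis by (subst expectation_pair) (auto simp: Vr split_def)
 qed
 also have "\<dots> \<le> expect (pair_pmf ?FZ ?BC) (\<lambda>w. V' w + indicator {w. \<not> H w} w)"
 proof (rule expectation_mono_unit)
  fix w assume w: "w \<in> set_pmf (pair_pmf ?FZ ?BC)"
  obtain f z b t where ww: "w = ((f, z), (b, t))" by (metis prod.exhaust)
  show "V w \<le> V' w + indicator {w. \<not> H w} w"
  proof (cases "H w")
   case True
   have "V' w = V w"
    unfolding ww V_def V'_def prod.case
    by (rule many_red_filter[OF _ _ e\<rho>]) (use w True in \<open>auto simp: ww H_def Y_def lt\<close>)
   then show ?thesis by simp
  next
   case False then show ?thesis using Vr[of w] by simp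
  qed
 next
  show "integrable (measure_pmf (pair_pmf ?FZ ?BC)) (\<lambda>w. V' w + indicator {w. \<not> H w} w)"
   by (intro Bochner_Integration.integrable_add integrable_unit) (auto simp: Vr)
 qed (auto simp: Vr)
 also have "\<dots> = expect (pair_pmf ?FZ ?BC) V' + prob (pair_pmf ?FZ ?BC) {w. \<not> H w}"
  by (subst Bochner_Integration.integral_add) (auto simp: Vr intro!: integrable_unit)
 also have "expect (pair_pmf ?FZ ?BC) V' =
   expect (?F (\<beta> + bl + \<rho>)) (\<lambda>h. many_red ?K (\<lambda>x. h x div 2 ^ (bl + \<rho>)) (\<lambda>x. h x mod 2 ^ (bl + \<rho>)) W R \<theta>)"
 proof -
  have "expect (pair_pmf ?FZ ?BC) V' =
   expect (pair_pmf (pair_pmf (pair_pmf (?F \<beta>) (?F bl)) (?F \<rho>)) (?F e))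
    (\<lambda>w. V' ((\<lambda>(((c, a), d), b). ((a, b), (c, d))) w))"
   unfolding pair_pmf_shuffle[of "?F bl" "?F e"] by simp
  also have "\<dots> = expect (pair_pmf (pair_pmf (?F \<beta>) (?F bl)) (?F \<rho>)) (\<lambda>y. expect (?F e) (\<lambda>z.
    V' ((\<lambda>(((c, a), d), b). ((a, b), (c, d))) (y, z))))"
   by (rule expectation_pair) (rule Vr)+
  also have "\<dots> = expect (pair_pmf (pair_pmf (?F \<beta>) (?F bl)) (?F \<rho>)) (\<lambda>((b, f), t). many_red ?K b (\<lambda>x. f x * 2 ^ \<rho> + t x) W R \<theta>)"
  proof (rule integral_cong_AE)
   show "AE y in measure_pmf (pair_pmf (pair_pmf (?F \<beta>) (?F bl)) (?F \<rho>)). expect (?F e) (\<lambda>z.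
    V' ((\<lambda>(((c, a), d), b). ((a, b), (c, d))) (y, z))) = (\<lambda>((b, f), t). many_red ?K b (\<lambda>x. f x * 2 ^ \<rho> + t x) W R \<theta>) y"
   proof (rule AE_pmfI)
    fix y assume y: "y \<in> set_pmf (pair_pmf (pair_pmf (?F \<beta>) (?F bl)) (?F \<rho>))"
    obtain b f t where yy: "y = ((b, f), t)" by (metis prod.exhaust)
    have "b ` W \<subseteq> {..<?K}" using y by (auto simp: yy lt)
    from many_red_refine[OF W this, of e "\<lambda>x. f x * 2 ^ \<rho> + t x" R \<theta>]
    show "expect (?F e) (\<lambda>z. V' ((\<lambda>(((c, a), d), b). ((a, b), (c, d))) (y, z))) =
      (\<lambda>((b, f), t). many_red ?K b (\<lambda>x. f x * 2 ^ \<rho> + t x) W R \<theta>) y"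
     by (simp add: yy V'_def fully_random_def)
   qed
  qed auto
  also have "\<dots> = expect (pair_pmf (pair_pmf (?F \<beta>) (?F bl)) (?F \<rho>)) (\<lambda>((b, f), t).
    many_red ?K (\<lambda>x. ((b x * 2 ^ bl + f x) * 2 ^ \<rho> + t x) div 2 ^ (bl + \<rho>)) (\<lambda>x. ((b x * 2 ^ bl + f x) * 2 ^ \<rho> + t x) mod 2 ^ (bl + \<rho>)) W R \<theta>)"
  proof (rule integral_cong_AE)
   show "AE y in measure_pmf (pair_pmf (pair_pmf (?F \<beta>) (?F bl)) (?F \<rho>)).
    (\<lambda>((b, f), t). many_red ?K b (\<lambda>x. f x * 2 ^ \<rho> + t x) W R \<theta>) y =
    (\<lambda>((b, f), t). many_red ?K (\<lambda>x. ((b x * 2 ^ bl + f x) * 2 ^ \<rho> + t x) div 2 ^ (bl + \<rho>)) (\<lambda>x. ((b x * 2 ^ bl + f x) * 2 ^ \<rho> + t x) mod 2 ^ (bl + \<rho>)) W R \<theta>) y"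
   proof (rule AE_pmfI)
    fix y assume y: "y \<in> set_pmf (pair_pmf (pair_pmf (?F \<beta>) (?F bl)) (?F \<rho>))"
    obtain b f t where yy: "y = ((b, f), t)" by (metis prod.exhaust)
    have "f x < 2 ^ bl" "t x < 2 ^ \<rho>" for x using y by (auto simp: yy lt)
    then show "(\<lambda>((b, f), t). many_red ?K b (\<lambda>x. f x * 2 ^ \<rho> + t x) W R \<theta>) y =
     (\<lambda>((b, f), t). many_red ?K (\<lambda>x. ((b x * 2 ^ bl + f x) * 2 ^ \<rho> + t x) div 2 ^ (bl + \<rho>)) (\<lambda>x. ((b x * 2 ^ bl + f x) * 2 ^ \<rho> + t x) mod 2 ^ (bl + \<rho>)) W R \<theta>) y"
     by (simp add: yy concat_div_mod)
   qed
  qed auto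
  also have "\<dots> = expect (?F (\<beta> + bl + \<rho>)) (\<lambda>h. many_red ?K (\<lambda>x. h x div 2 ^ (bl + \<rho>)) (\<lambda>x. h x mod 2 ^ (bl + \<rho>)) W R \<theta>)"
   unfolding fully_random_concat[OF W, of "\<beta> + bl" \<rho>] fully_random_concat[OF W, of \<beta> bl]
   by (simp add: pair_map_pmf1 map_pmf_comp split_def)
  finally show ?thesis .
 qed
 also have "prob (pair_pmf ?FZ ?BC) {w. \<not> H w} \<le> expect ?FZ (\<lambda>(f, z). miss_bound \<beta> (card (Y f z)))"
 proof -
  have "prob (pair_pmf ?FZ ?BC) {w. \<not> H w} = expect ?FZ (\<lambda>y. prob ?BC {u. \<not> H (y, u)})"
   by (simp add: prob_pair)
  also have "\<dots> \<le> expect ?FZ (\<lambda>(f, z). miss_bound \<beta> (card (Y f z)))"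
  proof (rule expectation_mono_unit)
   fix y :: "('a \<Rightarrow> nat) \<times> ('a \<Rightarrow> nat)"
   obtain f z where y: "y = (f, z)" by (cases y)
   have sub: "Y f z \<subseteq> W" by (auto simp: Y_def)
   have "prob ?BC {u. \<not> H (y, u)} = prob (?F (\<beta> + 0)) {h. (\<lambda>x. h x div 2 ^ 0) ` Y f z \<noteq> {..<2 ^ \<beta>}}"
   proof -
    have "prob ?BC {u. \<not> H (y, u)} = prob (map_pmf fst ?BC) {b. b ` Y f z \<noteq> {..<2 ^ \<beta>}}"
     by (simp add: H_def y split_def vimage_def del: map_fst_pair_pmf)
    then show ?thesis by (simp add: map_fst_pair_pmf)
   qed
   also have "\<dots> \<le> miss_bound \<beta> (card (Y f z))" by (rule prob_bin_missed_superset[OF W sub])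
   finally show "prob ?BC {u. \<not> H (y, u)} \<le> (case y of (f, z) \<Rightarrow> miss_bound \<beta> (card (Y f z)))" by (simp add: y)
  qed (auto simp: split_def intro!: integrable_unit miss_bound_range)
  finally show ?thesis .
 qed
 finally show ?thesis
  unfolding split[OF refl, of "\<lambda>Y. red_prob \<beta> \<rho> Y R \<theta>"] split[OF refl, of "\<lambda>Y. miss_bound \<beta> (card Y)"] by simp
qed

section \<open>Mixed tabulation on the surviving balls\<close>

lemma mixed_tabulation_eq:
 "mixed_tabulation s c d r = map_pmf (\<lambda>(T1, T2) x. simple_tab s (c + d) T2 (derived s c T1 x))
  (table_pair s c d r)"
 by (simp add: mixed_tabulation_def map_pmf_def pair_pmf_def bind_assoc_pmf bind_return_pmf)

lemma table_less: "T \<in> set_pmf (random_tables s m r) \<Longrightarrow> T i a < 2 ^ r"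
 by (simp add: random_tables_eq finite_table_set table_set_iff)

lemma simple_tab_random_less: "T \<in> set_pmf (random_tables s m r) \<Longrightarrow> simple_tab s m T x < 2 ^ r"
 by (intro simple_tab_less table_less)

text \<open>The reduction for mixed tabulation. The hash value splits into \<beta> bits for the bin,
  \<open>bl\<close> filter bits and \<rho> remaining bits, which come from independent tables. Given
  the first tables and the filter bits, bins and remaining bits are fully random on the survivors if
  their derived keys are independent.\<close>

lemma mixed_estimator_le:
 fixes s c d r k bl \<rho> e \<beta> :: nat and R B X :: "nat set"
 assumes fin: "finite R" "finite B" and \<beta>: "bin_bits k = \<beta>" and r: "r = \<beta> + bl + \<rho>" and e\<rho>: "e = 0 \<or> \<rho> = 0"
  and X: "X = R \<union> B" and \<theta>: "\<theta> = t * 2 ^ \<beta>"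
 defines "M \<equiv> pair_pmf (fully_random X e) (table_pair s c d bl)"
 shows "prob (mixed_estimator s c d r k R B) {t..} \<le>
   prob M {(z, T1, Tf). \<not> derived_indep s c d T1 (selected s c d {x \<in> X. z x = 0} 0 T1 Tf)} +
   expect M (\<lambda>(z, T1, Tf). red_prob \<beta> \<rho> (selected s c d {x \<in> X. z x = 0} 0 T1 Tf) R \<theta>) +
   expect M (\<lambda>(z, T1, Tf). miss_bound \<beta> (card (selected s c d {x \<in> X. z x = 0} 0 T1 Tf)))"
proof -
 let ?R1 = "random_tables s c (s * d)"
 let ?R = "random_tables s (c + d)"
 let ?K = "2 ^ \<beta> :: nat"
 define st where "st T1 T x = simple_tab s (c + d) T (derived s c T1 x)" for T1 T x
 define Y where "Y z T1 Tf = selected s c d {x \<in> X. z x = (0::nat)} 0 T1 Tf" for z T1 Tf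
 have Y_eq: "Y z T1 Tf = {x \<in> X. st T1 Tf x = 0 \<and> z x = 0}" for z T1 Tf by (auto simp: Y_def selected_def st_def)
 have finX: "finite X" using fin by (simp add: X)
 have finY: "finite (Y z T1 Tf)" for z T1 Tf using finX by (simp add: Y_eq)
 define G where "G h = (if (\<lambda>x. h x div 2 ^ (bl + \<rho>)) ` X = {..<?K}
   then many_red ?K (\<lambda>x. h x div 2 ^ (bl + \<rho>)) (\<lambda>x. h x mod 2 ^ (bl + \<rho>)) X R \<theta> else 1)" for h :: "nat \<Rightarrow> nat"
 \<comment> \<open>\<open>V1\<close> is the bound for the original experiment, \<open>V2\<close>
   adds \<open>e\<close> random bits that break ties, and \<open>V3\<close> keeps the survivors
   only.\<close>
 define V1 where "V1 = (\<lambda>(T1, ((Tb, Tf), Tr)). if st T1 Tb ` X = {..<?K}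
   then many_red ?K (st T1 Tb) (\<lambda>x. st T1 Tf x * 2 ^ \<rho> + st T1 Tr x) X R \<theta> else 1)"
 define V2 where "V2 = (\<lambda>((z, (T1, Tf)), (Tb, Tr)). if st T1 Tb ` X = {..<?K}
   then many_red ?K (st T1 Tb) (\<lambda>x. (st T1 Tf x * 2 ^ \<rho> + st T1 Tr x) * 2 ^ e + z x) X R \<theta> else 1)"
 define V3 where "V3 = (\<lambda>((z, (T1, Tf)), (Tb, Tr)). if st T1 Tb ` Y z T1 Tf = {..<?K}
   then many_red ?K (st T1 Tb) (st T1 Tr) (Y z T1 Tf) R \<theta> else 1)"
 define P where "P = pair_pmf ?R1 (pair_pmf (pair_pmf (?R \<beta>) (?R bl)) (?R \<rho>))"
 define BC where "BC = pair_pmf (?R \<beta>) (?R \<rho>)"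
 let ?sh = "\<lambda>((r, ((b, f), c)), z). ((z, (r, f)), (b, c))"
 have r1: "0 \<le> V1 w" "V1 w \<le> 1" for w by (auto simp: V1_def split_def many_red_range)
 have r2: "0 \<le> V2 w" "V2 w \<le> 1" for w by (auto simp: V2_def split_def many_red_range)
 have r3: "0 \<le> V3 w" "V3 w \<le> 1" for w by (auto simp: V3_def split_def many_red_range)
 have lt: "st T1 T x < 2 ^ q" if "T \<in> set_pmf (?R q)" for T1 T x q
  unfolding st_def by (rule simple_tab_random_less[OF that])
 have "prob (mixed_estimator s c d r k R B) {t..} \<le> expect (mixed_tabulation s c d r) G"
 proof -
  have "h x < 2 ^ r" if "h \<in> set_pmf (mixed_tabulation s c d r)" for h x
   using that by (auto simp: mixed_tabulation_eq intro!: simple_tab_random_less)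
  moreover have "bin_bits k \<le> r" by (simp add: \<beta> r)
  ultimately have "prob (minhash_estimator r k R B (mixed_tabulation s c d r)) {t..} \<le>
   expect (mixed_tabulation s c d r) (\<lambda>h. if (\<lambda>x. h x div 2 ^ (bl + \<rho>)) ` (R \<union> B) = {..<?K}
     then many_red ?K (\<lambda>x. h x div 2 ^ (bl + \<rho>)) (\<lambda>x. h x mod 2 ^ (bl + \<rho>)) (R \<union> B) R (t * real ?K) else 1)"
   by (intro minhash_estimator_le fin) (simp_all add: \<beta> r)
  then show ?thesis by (simp add: mixed_estimator_def G_def[abs_def] X \<theta> cong: if_cong)
 qed
 also have "expect (mixed_tabulation s c d r) G = expect P V1"
 proof -
  have "pair_pmf ?R1 (?R r) = map_pmf (\<lambda>(T1, ((Tb, Tf), Tr)). (T1, concat_tables \<rho> (concat_tables bl Tb Tf) Tr)) P"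
   unfolding r random_tables_concat[of s "c + d" "\<beta> + bl" \<rho>] random_tables_concat[of s "c + d" \<beta> bl] P_def
   by (simp add: pair_map_pmf1 pair_map_pmf2 map_pmf_comp split_def apsnd_def apfst_def map_prod_def)
  then have "expect (mixed_tabulation s c d r) G = expect P (\<lambda>(T1, ((Tb, Tf), Tr)).
    G (\<lambda>x. st T1 (concat_tables \<rho> (concat_tables bl Tb Tf) Tr) x))"
   by (simp add: mixed_tabulation_eq split_def st_def)
  also have "\<dots> = expect P V1"
  proof (rule integral_cong_AE)
   show "AE y in measure_pmf P. (\<lambda>(T1, ((Tb, Tf), Tr)). G (\<lambda>x. st T1 (concat_tables \<rho> (concat_tables bl Tb Tf) Tr) x)) y = V1 y"
   proof (rule AE_pmfI)
    fix y assume y: "y \<in> set_pmf P"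
    obtain T1 Tb Tf Tr where yy: "y = (T1, ((Tb, Tf), Tr))" by (metis prod.exhaust)
    have mem: "Tf \<in> set_pmf (?R bl)" "Tr \<in> set_pmf (?R \<rho>)" using y by (auto simp: P_def yy)
    have "st T1 (concat_tables \<rho> (concat_tables bl Tb Tf) Tr) x = (st T1 Tb x * 2 ^ bl + st T1 Tf x) * 2 ^ \<rho> + st T1 Tr x" for x
     unfolding st_def by (simp only: simple_tab_concat table_less[OF mem(1)] table_less[OF mem(2)])
    then have "st T1 (concat_tables \<rho> (concat_tables bl Tb Tf) Tr) x div 2 ^ (bl + \<rho>) = st T1 Tb x"
     "st T1 (concat_tables \<rho> (concat_tables bl Tb Tf) Tr) x mod 2 ^ (bl + \<rho>) = st T1 Tf x * 2 ^ \<rho> + st T1 Tr x" for x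
     using concat_div_mod[OF lt[OF mem(1)] lt[OF mem(2)]] by simp_all
    then show "(\<lambda>(T1, ((Tb, Tf), Tr)). G (\<lambda>x. st T1 (concat_tables \<rho> (concat_tables bl Tb Tf) Tr) x)) y = V1 y"
     by (simp add: yy G_def V1_def)
   qed
  qed auto
  finally show ?thesis .
 qed
 also have "\<dots> = expect P (\<lambda>y. expect (fully_random X e) (\<lambda>z. V2 (?sh (y, z))))"
 proof (rule integral_cong_AE)
  show "AE y in measure_pmf P. V1 y = expect (fully_random X e) (\<lambda>z. V2 (?sh (y, z)))"
  proof (rule AE_pmfI)
   fix y assume y: "y \<in> set_pmf P"
   obtain T1 Tb Tf Tr where yy: "y = (T1, ((Tb, Tf), Tr))" by (metis prod.exhaust)
   show "V1 y = expect (fully_random X e) (\<lambda>z. V2 (?sh (y, z)))"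
   proof (cases "st T1 Tb ` X = {..<?K}")
    case True
    then have "st T1 Tb ` X \<subseteq> {..<?K}" by simp
    from many_red_refine[OF finX this, of e "\<lambda>x. st T1 Tf x * 2 ^ \<rho> + st T1 Tr x" R \<theta>] True
    show ?thesis by (simp add: yy V1_def V2_def fully_random_def)
   qed (simp add: yy V1_def V2_def)
  qed
 qed auto
 also have "\<dots> = expect (pair_pmf P (fully_random X e)) (\<lambda>w. V2 (?sh w))"
  by (rule expectation_pair[symmetric]) (rule r2)+
 also have "\<dots> = expect (pair_pmf M BC) V2"
  unfolding M_def BC_def P_def pair_pmf_shuffle'[of "fully_random X e"] by simp
 also have "\<dots> \<le> expect (pair_pmf M BC) V3"
 proof (rule expectation_mono_unit)
  fix w assume w: "w \<in> set_pmf (pair_pmf M BC)"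
  obtain z T1 Tf Tb Tr where ww: "w = ((z, (T1, Tf)), (Tb, Tr))" by (metis prod.exhaust)
  have mem: "z \<in> set_pmf (fully_random X e)" "Tb \<in> set_pmf (?R \<beta>)" "Tr \<in> set_pmf (?R \<rho>)"
   using w by (auto simp: ww M_def BC_def)
  show "V2 w \<le> V3 w"
  proof (cases "st T1 Tb ` Y z T1 Tf = {..<?K}")
   case True
   have "st T1 Tb ` X \<subseteq> {..<?K}" using lt[OF mem(2)] by auto
   moreover have "st T1 Tb ` Y z T1 Tf \<subseteq> st T1 Tb ` X" by (auto simp: Y_eq)
   ultimately have hit: "st T1 Tb ` X = {..<?K}" using True by auto
   have "many_red ?K (st T1 Tb) (\<lambda>x. (st T1 Tf x * 2 ^ \<rho> + st T1 Tr x) * 2 ^ e + z x) X R \<theta> = many_red ?K (st T1 Tb) (st T1 Tr) (Y z T1 Tf) R \<theta>"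
   proof (rule many_red_filter[OF _ _ e\<rho> Y_eq True])
    show "st T1 Tr x < 2 ^ \<rho>" for x by (rule lt[OF mem(3)])
    show "z x < 2 ^ e" for x using finite_fully_random[OF finX mem(1)] by blast
   qed
   then show ?thesis using True hit by (simp add: ww V2_def V3_def)
  next
   case False
   then have "V3 w = 1" by (simp add: ww V3_def)
   then show ?thesis using r2[of w] by simp
  qed
 qed (auto simp: r2 r3 intro!: integrable_unit)
 also have "\<dots> = expect M (\<lambda>y. expect BC (\<lambda>u. V3 (y, u)))"
  by (rule expectation_pair) (rule r3)+
 also have "\<dots> \<le> expect M (\<lambda>y. indicator {(z, T1, Tf). \<not> derived_indep s c d T1 (Y z T1 Tf)} y +
    (\<lambda>(z, T1, Tf). red_prob \<beta> \<rho> (Y z T1 Tf) R \<theta>) y + (\<lambda>(z, T1, Tf). miss_bound \<beta> (card (Y z T1 Tf))) y)"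
 proof (rule expectation_mono_unit)
  fix y :: "(nat \<Rightarrow> nat) \<times> (nat \<Rightarrow> nat \<Rightarrow> nat) \<times> (nat \<Rightarrow> nat \<Rightarrow> nat)"
  obtain z T1 Tf where y: "y = (z, (T1, Tf))" by (metis prod.exhaust)
  let ?Y = "Y z T1 Tf"
  show "expect BC (\<lambda>u. V3 (y, u)) \<le> indicator {(z, T1, Tf). \<not> derived_indep s c d T1 (Y z T1 Tf)} y +
    (\<lambda>(z, T1, Tf). red_prob \<beta> \<rho> (Y z T1 Tf) R \<theta>) y + (\<lambda>(z, T1, Tf). miss_bound \<beta> (card (Y z T1 Tf))) y"
  proof (cases "derived_indep s c d T1 ?Y")
   case False
   have "expect BC (\<lambda>u. V3 (y, u)) \<le> 1" by (intro expectation_unit r3)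
   then show ?thesis using False red_prob_range[of \<beta> \<rho> ?Y R \<theta>] miss_bound_range[of \<beta> "card ?Y"] by (simp add: y)
  next
   case True
   define G' where "G' h = (if (\<lambda>x. h x div 2 ^ \<rho>) ` ?Y = {..<?K}
    then many_red ?K (\<lambda>x. h x div 2 ^ \<rho>) (\<lambda>x. h x mod 2 ^ \<rho>) ?Y R \<theta> else 1)" for h :: "nat \<Rightarrow> nat"
   have "expect BC (\<lambda>u. V3 (y, u)) = expect BC (\<lambda>(Tb, Tr). G' (\<lambda>x. if x \<in> ?Y then st T1 (concat_tables \<rho> Tb Tr) x else 0))"
   proof (rule integral_cong_AE)
    show "AE u in measure_pmf BC. V3 (y, u) = (\<lambda>(Tb, Tr). G' (\<lambda>x. if x \<in> ?Y then st T1 (concat_tables \<rho> Tb Tr) x else 0)) u"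
    proof (rule AE_pmfI)
     fix u assume u: "u \<in> set_pmf BC"
     obtain Tb Tr where uu: "u = (Tb, Tr)" by (cases u)
     have mem: "Tr \<in> set_pmf (?R \<rho>)" using u by (simp add: uu BC_def)
     have eq: "st T1 (concat_tables \<rho> Tb Tr) x = st T1 Tb x * 2 ^ \<rho> + st T1 Tr x" for x
      unfolding st_def by (rule simple_tab_concat[OF table_less[OF mem]])
     have dm: "st T1 (concat_tables \<rho> Tb Tr) x div 2 ^ \<rho> = st T1 Tb x" "st T1 (concat_tables \<rho> Tb Tr) x mod 2 ^ \<rho> = st T1 Tr x" for x
      unfolding eq using lt[OF mem, of T1 x] by simp_all
     have im: "(\<lambda>x. (if x \<in> ?Y then st T1 (concat_tables \<rho> Tb Tr) x else 0) div 2 ^ \<rho>) ` ?Y = st T1 Tb ` ?Y"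
      by (rule image_cong) (simp_all add: dm)
     have mr: "many_red ?K (\<lambda>x. (if x \<in> ?Y then st T1 (concat_tables \<rho> Tb Tr) x else 0) div 2 ^ \<rho>)
       (\<lambda>x. (if x \<in> ?Y then st T1 (concat_tables \<rho> Tb Tr) x else 0) mod 2 ^ \<rho>) ?Y R \<theta> = many_red ?K (st T1 Tb) (st T1 Tr) ?Y R \<theta>"
      by (rule many_red_cong) (simp_all add: dm)
     show "V3 (y, u) = (\<lambda>(Tb, Tr). G' (\<lambda>x. if x \<in> ?Y then st T1 (concat_tables \<rho> Tb Tr) x else 0)) u"
      unfolding V3_def y uu prod.case G'_def im mr ..
    qed
   qed auto
   also have "\<dots> = expect (?R (\<beta> + \<rho>)) (\<lambda>T. G' (\<lambda>x. if x \<in> ?Y then st T1 T x else 0))"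
    unfolding random_tables_concat BC_def by (simp add: split_def)
   also have "\<dots> = expect (fully_random ?Y (\<beta> + \<rho>)) G'"
    unfolding fully_random_def simple_tab_indep_uniform[OF True, symmetric] by (simp add: st_def cong: if_cong)
   also have "\<dots> \<le> expect (fully_random ?Y (\<beta> + \<rho>)) (\<lambda>h. many_red ?K (\<lambda>x. h x div 2 ^ \<rho>) (\<lambda>x. h x mod 2 ^ \<rho>) ?Y R \<theta> +
     indicator {h. (\<lambda>x. h x div 2 ^ \<rho>) ` ?Y \<noteq> {..<?K}} h)"
   proof (rule expectation_mono_unit)
    show "integrable (measure_pmf (fully_random ?Y (\<beta> + \<rho>))) (\<lambda>h. many_red ?K (\<lambda>x. h x div 2 ^ \<rho>) (\<lambda>x. h x mod 2 ^ \<rho>) ?Y R \<theta> +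
     indicator {h. (\<lambda>x. h x div 2 ^ \<rho>) ` ?Y \<noteq> {..<?K}} h)"
     by (intro Bochner_Integration.integrable_add integrable_unit many_red_range) auto
   qed (auto simp: G'_def many_red_range)
   also have "\<dots> = red_prob \<beta> \<rho> ?Y R \<theta> + prob (fully_random ?Y (\<beta> + \<rho>)) {h. (\<lambda>x. h x div 2 ^ \<rho>) ` ?Y \<noteq> {..<?K}}"
    by (subst Bochner_Integration.integral_add) (auto simp: red_prob_def many_red_range intro!: integrable_unit)
   also have "\<dots> \<le> red_prob \<beta> \<rho> ?Y R \<theta> + miss_bound \<beta> (card ?Y)"
    using prob_bin_missed_superset[OF finY order.refl, of z T1 Tf \<beta> \<rho>] by simp
   finally show ?thesis using True by (simp add: y)
  qed
 next
  show "integrable (measure_pmf M) (\<lambda>y. indicator {(z, T1, Tf). \<not> derived_indep s c d T1 (Y z T1 Tf)} y +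
    (\<lambda>(z, T1, Tf). red_prob \<beta> \<rho> (Y z T1 Tf) R \<theta>) y + (\<lambda>(z, T1, Tf). miss_bound \<beta> (card (Y z T1 Tf))) y)"
   by (intro Bochner_Integration.integrable_add integrable_unit) (auto simp: red_prob_range miss_bound_range indicator_def)
 qed (intro expectation_unit r3)+
 also have "\<dots> = prob M {(z, T1, Tf). \<not> derived_indep s c d T1 (Y z T1 Tf)} +
    expect M (\<lambda>(z, T1, Tf). red_prob \<beta> \<rho> (Y z T1 Tf) R \<theta>) +
    expect M (\<lambda>(z, T1, Tf). miss_bound \<beta> (card (Y z T1 Tf)))"
 proof -
  have i: "integrable (measure_pmf M) (indicator {(z, T1, Tf). \<not> derived_indep s c d T1 (Y z T1 Tf)} :: _ \<Rightarrow> real)"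
   "integrable (measure_pmf M) (\<lambda>(z, T1, Tf). red_prob \<beta> \<rho> (Y z T1 Tf) R \<theta>)"
   "integrable (measure_pmf M) (\<lambda>(z, T1, Tf). miss_bound \<beta> (card (Y z T1 Tf)))"
   by (intro integrable_unit; auto simp: red_prob_range miss_bound_range indicator_def)+
  show ?thesis
   by (simp only: Bochner_Integration.integral_add[OF Bochner_Integration.integrable_add[OF i(1,2)] i(3)]
     Bochner_Integration.integral_add[OF i(1,2)]) simp
 qed
 finally show ?thesis by (simp only: Y_def)
qed

section \<open>Stochastic comparison of pairs of counts\<close>

text \<open>Summation by parts: apart from a constant, \<open>h\<close> is a combination of
  indicators of tails with total weight at most 1, so the error \<open>g\<close> is paid only
  once.\<close>

lemma expectation_mono_tail:
 fixes h :: "nat \<Rightarrow> real"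
 assumes mono: "\<And>j. h j \<le> h (Suc j)" and range: "\<And>j. 0 \<le> h j" "\<And>j. h j \<le> 1"
  and supp: "set_pmf \<mu> \<subseteq> {..N}" "set_pmf \<nu> \<subseteq> {..N}"
  and tail: "\<And>j. prob \<mu> {j..} \<le> prob \<nu> {j..} + g" and g: "g \<ge> 0"
 shows "expect \<mu> h \<le> expect \<nu> h + g"
proof -
 have tel: "h k = h 0 + (\<Sum>j<N. (h (Suc j) - h j) * indicator {Suc j..} k)" if "k \<le> N" for k
 proof -
  have "(\<Sum>j<M. (h (Suc j) - h j) * indicator {Suc j..} k) = h (min k M) - h 0" for M
   by (induction M) (auto simp: min_def indicator_def not_le le_Suc_eq)
  then show ?thesis using that by (simp add: min_absorb1)
 qed
 have E: "expect P h = h 0 + (\<Sum>j<N. (h (Suc j) - h j) * prob P {Suc j..})" if P: "set_pmf P \<subseteq> {..N}" for P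
 proof -
  have "expect P h = expect P (\<lambda>k. h 0 + (\<Sum>j<N. (h (Suc j) - h j) * indicator {Suc j..} k))"
  proof (rule integral_cong_AE)
   show "AE k in measure_pmf P. h k = h 0 + (\<Sum>j<N. (h (Suc j) - h j) * indicator {Suc j..} k)"
    by (rule AE_pmfI) (rule tel, use P in auto)
  qed auto
  also have "\<dots> = h 0 + (\<Sum>j<N. (h (Suc j) - h j) * prob P {Suc j..})"
  proof -
   have i: "integrable (measure_pmf P) (\<lambda>k. (h (Suc j) - h j) * indicator {Suc j..} k)" for j
    by (intro integrable_mult_right integrable_unit) auto
   have "expect P (\<lambda>k. h 0 + (\<Sum>j<N. (h (Suc j) - h j) * indicator {Suc j..} k)) =
    expect P (\<lambda>k. h 0) + expect P (\<lambda>k. \<Sum>j<N. (h (Suc j) - h j) * indicator {Suc j..} k)"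
    by (rule Bochner_Integration.integral_add[OF _ Bochner_Integration.integrable_sum[OF i]]) simp
   also have "expect P (\<lambda>k. \<Sum>j<N. (h (Suc j) - h j) * indicator {Suc j..} k) =
    (\<Sum>j<N. expect P (\<lambda>k. (h (Suc j) - h j) * indicator {Suc j..} k))"
    by (rule Bochner_Integration.integral_sum) (rule i)
   also have "\<dots> = (\<Sum>j<N. (h (Suc j) - h j) * prob P {Suc j..})"
    by (intro sum.cong refl) (subst integral_mult_right_zero, simp)
   finally show ?thesis by simp
  qed
  finally show ?thesis .
 qed
 have "(\<Sum>j<N. (h (Suc j) - h j) * prob \<mu> {Suc j..}) \<le> (\<Sum>j<N. (h (Suc j) - h j) * (prob \<nu> {Suc j..} + g))"
  by (intro sum_mono mult_left_mono tail) (simp add: mono)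
 also have "\<dots> = (\<Sum>j<N. (h (Suc j) - h j) * prob \<nu> {Suc j..}) + (h N - h 0) * g"
  by (simp add: distrib_left sum.distrib sum_distrib_right[symmetric] sum_lessThan_telescope)
 also have "(h N - h 0) * g \<le> 1 * g" using range(2)[of N] range(1)[of 0] g by (intro mult_right_mono) auto
 finally show ?thesis unfolding E[OF supp(1)] E[OF supp(2)] by simp
qed

lemma expectation_antimono_tail:
 fixes h :: "nat \<Rightarrow> real"
 assumes mono: "\<And>j. h (Suc j) \<le> h j" and range: "\<And>j. 0 \<le> h j" "\<And>j. h j \<le> 1"
  and supp: "set_pmf \<mu> \<subseteq> {..N}" "set_pmf \<nu> \<subseteq> {..N}"
  and tail: "\<And>j. prob \<mu> {..j} \<le> prob \<nu> {..j} + g" and g: "g \<ge> 0"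
 shows "expect \<mu> h \<le> expect \<nu> h + g"
proof -
 have c: "prob P {j..} = 1 - (if j = 0 then 0 else prob P {..j - 1})" for P :: "nat pmf" and j
 proof (cases j)
  case (Suc i)
  have "{j..} = UNIV - {..i}" using Suc by auto
  then show ?thesis using measure_pmf.prob_compl[of "{..i}" P] Suc by simp
 qed simp
 have i: "integrable (measure_pmf P) h" for P by (rule integrable_unit) (rule range)+
 have "expect \<nu> (\<lambda>k. 1 - h k) \<le> expect \<mu> (\<lambda>k. 1 - h k) + g"
 proof (rule expectation_mono_tail[OF _ _ _ supp(2,1) _ g])
  show "prob \<nu> {j..} \<le> prob \<mu> {j..} + g" for j
   using tail[of "j - 1"] g unfolding c by auto
 qed (use mono range in auto)
 then show ?thesis using i by (simp add: Bochner_Integration.integral_diff)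
qed

lemma expectation_le_off_event:
 fixes f h :: "'a \<Rightarrow> real"
 assumes le: "\<And>x. \<not> P x \<Longrightarrow> f x \<le> h x" and range: "\<And>x. 0 \<le> f x \<and> f x \<le> 1 \<and> 0 \<le> h x \<and> h x \<le> 1"
 shows "expect M f \<le> expect M h + prob M {x. P x}"
proof -
 have "expect M f \<le> expect M (\<lambda>x. h x + indicator {x. P x} x)"
 proof (rule expectation_mono_unit)
  show "f x \<le> h x + indicator {x. P x} x" for x using le[of x] range[of x] by (cases "P x") auto
  show "integrable (measure_pmf M) (\<lambda>x. h x + indicator {x. P x} x)"
   by (intro Bochner_Integration.integrable_add integrable_unit) (use range in auto)
 qed (use range in auto)
 also have "\<dots> = expect M h + prob M {x. P x}"
  by (subst Bochner_Integration.integral_add) (use range in \<open>auto intro!: integrable_unit\<close>)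
 finally show ?thesis .
qed

text \<open>The coordinates of \<open>L\<close> may be correlated. The second one is replaced by a
  constant \<open>b0\<close> that, with high probability, is not undercut under \<open>L\<close> and
  not exceeded under \<open>\<nu>B\<close>. As \<phi> is antitone there, both replacements go in the
  right direction, and only the first coordinates remain to be compared.\<close>

lemma expectation_le_first:
 fixes \<phi> :: "nat \<Rightarrow> nat \<Rightarrow> real"
 assumes mono: "\<And>a a' b b'. a \<le> a' \<Longrightarrow> b' \<le> b \<Longrightarrow> \<phi> a b \<le> \<phi> a' b'" and range: "\<And>a b. 0 \<le> \<phi> a b" "\<And>a b. \<phi> a b \<le> 1"
  and supp: "set_pmf (map_pmf fst L) \<subseteq> {..N}" "set_pmf \<nu>A \<subseteq> {..N}"
  and tail: "\<And>j. prob (map_pmf fst L) {j..} \<le> prob \<nu>A {j..} + g" and g: "g \<ge> 0"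
  and conc: "prob (map_pmf snd L) {b. b < b0} \<le> g1" "prob \<nu>B {b. b0 < b} \<le> g2"
 shows "expect L (\<lambda>(a, b). \<phi> a b) \<le> expect (pair_pmf \<nu>A \<nu>B) (\<lambda>(a, b). \<phi> a b) + g + g1 + g2"
proof -
 have "expect L (\<lambda>(a, b). \<phi> a b) \<le> expect L (\<lambda>x. \<phi> (fst x) b0) + prob L {x. snd x < b0}"
  by (rule expectation_le_off_event) (auto simp: split_def range intro!: mono)
 moreover have "prob L {x. snd x < b0} \<le> g1" using conc(1) by (simp add: vimage_def)
 moreover have "expect L (\<lambda>x. \<phi> (fst x) b0) \<le> expect \<nu>A (\<lambda>a. \<phi> a b0) + g"
  using expectation_mono_tail[OF _ _ _ supp tail g, of "\<lambda>a. \<phi> a b0"] by (simp add: range mono)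
 moreover have "expect (pair_pmf \<nu>A \<nu>B) (\<lambda>x. \<phi> (fst x) b0) \<le> expect (pair_pmf \<nu>A \<nu>B) (\<lambda>(a, b). \<phi> a b) + prob (pair_pmf \<nu>A \<nu>B) {x. b0 < snd x}"
  by (rule expectation_le_off_event) (auto simp: split_def range intro!: mono)
 moreover have "expect (pair_pmf \<nu>A \<nu>B) (\<lambda>x. \<phi> (fst x) b0) = expect \<nu>A (\<lambda>a. \<phi> a b0)"
  using integral_map_pmf[of fst "pair_pmf \<nu>A \<nu>B" "\<lambda>a. \<phi> a b0"] by (simp add: map_fst_pair_pmf)
 moreover have "prob (pair_pmf \<nu>A \<nu>B) {x. b0 < snd x} \<le> g2"
  using conc(2) measure_map_pmf[of snd "pair_pmf \<nu>A \<nu>B" "{b. b0 < b}"] by (simp add: map_snd_pair_pmf vimage_def)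
 ultimately show ?thesis by linarith
qed

lemma expectation_le_second:
 fixes \<phi> :: "nat \<Rightarrow> nat \<Rightarrow> real"
 assumes mono: "\<And>a a' b b'. a \<le> a' \<Longrightarrow> b' \<le> b \<Longrightarrow> \<phi> a b \<le> \<phi> a' b'" and range: "\<And>a b. 0 \<le> \<phi> a b" "\<And>a b. \<phi> a b \<le> 1"
  and supp: "set_pmf (map_pmf snd L) \<subseteq> {..N}" "set_pmf \<nu>B \<subseteq> {..N}"
  and tail: "\<And>j. prob (map_pmf snd L) {..j} \<le> prob \<nu>B {..j} + g" and g: "g \<ge> 0"
  and conc: "prob (map_pmf fst L) {a. a0 < a} \<le> g1" "prob \<nu>A {a. a < a0} \<le> g2"
 shows "expect L (\<lambda>(a, b). \<phi> a b) \<le> expect (pair_pmf \<nu>A \<nu>B) (\<lambda>(a, b). \<phi> a b) + g + g1 + g2"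
proof -
 have "expect L (\<lambda>(a, b). \<phi> a b) \<le> expect L (\<lambda>x. \<phi> a0 (snd x)) + prob L {x. a0 < fst x}"
  by (rule expectation_le_off_event) (auto simp: split_def range intro!: mono)
 moreover have "prob L {x. a0 < fst x} \<le> g1" using conc(1) by (simp add: vimage_def)
 moreover have "expect L (\<lambda>x. \<phi> a0 (snd x)) \<le> expect \<nu>B (\<lambda>b. \<phi> a0 b) + g"
  using expectation_antimono_tail[OF _ _ _ supp tail g, of "\<lambda>b. \<phi> a0 b"] by (simp add: range mono)
 moreover have "expect (pair_pmf \<nu>A \<nu>B) (\<lambda>x. \<phi> a0 (snd x)) \<le> expect (pair_pmf \<nu>A \<nu>B) (\<lambda>(a, b). \<phi> a b) + prob (pair_pmf \<nu>A \<nu>B) {x. fst x < a0}"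
  by (rule expectation_le_off_event) (auto simp: split_def range intro!: mono)
 moreover have "expect (pair_pmf \<nu>A \<nu>B) (\<lambda>x. \<phi> a0 (snd x)) = expect \<nu>B (\<lambda>b. \<phi> a0 b)"
  using integral_map_pmf[of snd "pair_pmf \<nu>A \<nu>B" "\<lambda>b. \<phi> a0 b"] by (simp add: map_snd_pair_pmf)
 moreover have "prob (pair_pmf \<nu>A \<nu>B) {x. fst x < a0} \<le> g2"
  using conc(2) measure_map_pmf[of fst "pair_pmf \<nu>A \<nu>B" "{a. a < a0}"] by (simp add: map_fst_pair_pmf vimage_def)
 ultimately show ?thesis by linarith
qed

text \<open>The survivors of one colour are determined without the random bits of the other
  balls.\<close>

lemma filtered_count_marginal:
 assumes X: "finite X" "S \<subseteq> X"
 shows "map_pmf (\<lambda>(z, T1, Tf). card (selected s c d {x \<in> S. z x = 0} 0 T1 Tf))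
   (pair_pmf (fully_random X e) (table_pair s c d bl)) = filtered_count s c d S bl e"
proof -
 have "{x \<in> S. (if x \<in> S then z x else 0) = 0} = {x \<in> S. z x = 0}" for z :: "nat \<Rightarrow> nat" by auto
 then show ?thesis
  unfolding filtered_count_def fully_random_def[symmetric] fully_random_restrict[OF X]
  by (simp add: pair_map_pmf1 map_pmf_comp split_def apfst_def map_prod_def)
qed

lemma set_pmf_filtered_count: "finite X \<Longrightarrow> set_pmf (filtered_count s c d X bl e) \<subseteq> {..card X}"
 unfolding filtered_count_def by (auto simp: selected_def intro!: card_mono)

lemma set_pmf_binomial_le: "q \<in> {0..1} \<Longrightarrow> set_pmf (binom n q) \<subseteq> {..n}"
 by (auto simp: set_pmf_binomial_eq split: if_splits)

text \<open>In the fully random experiment the survivor counts of the two colours are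
  independent.\<close>

lemma random_filter_counts:
 fixes q :: real
 assumes W: "finite R" "finite B" "R \<inter> B = {}" and q: "q = 1 / 2 ^ b"
 shows "map_pmf (\<lambda>v. (card {x \<in> R. v x = 0}, card {x \<in> B. v x = 0})) (fully_random (R \<union> B) b) =
  pair_pmf (binom (card R) q) (binom (card B) q)"
proof -
 have "map_pmf (\<lambda>v. (card {x \<in> R. v x = 0}, card {x \<in> B. v x = 0})) (fully_random (R \<union> B) b) =
  map_pmf (\<lambda>(f, g). (card {x \<in> R. f x = 0}, card {x \<in> B. g x = 0})) (pair_pmf (fully_random R b) (fully_random B b))"
  unfolding fully_random_def Pi_pmf_union[OF W] map_pmf_comp
 proof (rule map_pmf_cong[OF refl])
  fix w :: "('a \<Rightarrow> nat) \<times> ('a \<Rightarrow> nat)"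
  obtain f g where w: "w = (f, g)" by (cases w)
  have "{x \<in> R. (if x \<in> R then f x else g x) = 0} = {x \<in> R. f x = 0}" "{x \<in> B. (if x \<in> R then f x else g x) = 0} = {x \<in> B. g x = 0}"
   using W(3) by auto
  then show "(card {x \<in> R. (case w of (f, g) \<Rightarrow> \<lambda>x. if x \<in> R then f x else g x) x = 0}, card {x \<in> B. (case w of (f, g) \<Rightarrow> \<lambda>x. if x \<in> R then f x else g x) x = 0}) =
   (case w of (f, g) \<Rightarrow> (card {x \<in> R. f x = 0}, card {x \<in> B. g x = 0}))" by (simp add: w)
 qed
 also have "\<dots> = pair_pmf (map_pmf (\<lambda>f. card {x \<in> R. f x = 0}) (fully_random R b)) (map_pmf (\<lambda>f. card {x \<in> B. f x = 0}) (fully_random B b))"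
  by (rule map_pair)
 also have "\<dots> = pair_pmf (binom (card R) q) (binom (card B) q)"
  unfolding fully_random_def q using W by (simp add: card_uniform_eq)
 finally show ?thesis .
qed

lemma miss_bound_antimono: "y \<le> y' \<Longrightarrow> miss_bound \<beta> y' \<le> miss_bound \<beta> y"
 unfolding miss_bound_def by (intro min.mono mult_left_mono) (auto intro: divide_right_mono)

lemma expectation_miss_bound:
 "expect \<mu> (miss_bound \<beta>) \<le> prob \<mu> {y. y < y0} + miss_bound \<beta> y0"
proof -
 have "expect \<mu> (miss_bound \<beta>) \<le> expect \<mu> (\<lambda>y. miss_bound \<beta> y0 + indicator {y. y < y0} y)"
 proof (rule expectation_mono_unit)
  show "miss_bound \<beta> y \<le> miss_bound \<beta> y0 + indicator {y. y < y0} y" for y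
   using miss_bound_antimono[of y0 y \<beta>] miss_bound_range[of \<beta>] by (cases "y < y0") (auto simp: add_increasing)
 qed (auto simp: miss_bound_range integrable_const_indicator)
 then show ?thesis by (simp add: expectation_const_indicator)
qed

section \<open>Comparison of the two experiments\<close>

text \<open>The filter has \<open>b\<close> bits, so that the expected number \<open>x\<close> of
  survivors lies between |\<Sigma>|/4 and |\<Sigma>|/2. The excess of \<epsilon> over \<epsilon>1
  opens a gap of at least \<open>4 * (\<eta> * x)\<close> between the counts of the majority colour
  in the two experiments, wide enough for deviations of \<open>\<eta> * x\<close> on both sides and
  for rounding. The minority colour, which need not be concentrated, is compared through
  \<open>SD1\<close> or \<open>SD2\<close>.\<close>

lemma estimator_comparison:
 fixes s c d r k :: nat and R B R' B' :: "nat set" and \<epsilon> \<epsilon>1 \<eta> g gA m t :: real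
 assumes R: "R \<subseteq> {..<2 ^ (s * c)}" and B: "B \<subseteq> {..<2 ^ (s * c)}" and disj: "R \<inter> B = {}"
  and fin': "finite R'" "finite B'" and disj': "R' \<inter> B' = {}"
  and big: "2 ^ s / 2 < real (card R + card B)" and br: "bin_bits k \<le> r"
  and SD1: "\<And>X bl e N j. X \<subseteq> {..<2 ^ (s * c)} \<Longrightarrow> real (card X) / 2 ^ (bl + e) \<le> 2 ^ s / 2 \<Longrightarrow> (1 + \<epsilon>1) * real (card X) < real N + 1 \<Longrightarrow>
    prob (filtered_count s c d X bl e) {j..} \<le> prob (binom N (1 / 2 ^ (bl + e))) {j..} + g"
  and SD2: "\<And>X bl e N j. X \<subseteq> {..<2 ^ (s * c)} \<Longrightarrow> real (card X) / 2 ^ (bl + e) \<le> 2 ^ s / 2 \<Longrightarrow> real N < (1 - \<epsilon>1) * real (card X) + 1 \<Longrightarrow>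
    prob (filtered_count s c d X bl e) {..j} \<le> prob (binom N (1 / 2 ^ (bl + e))) {..j} + g"
  and DP: "\<And>X b. X \<subseteq> {..<2 ^ (s * c)} \<Longrightarrow> real (card X) \<le> 3 / 4 * 2 ^ s * 2 ^ b \<Longrightarrow> dependent_prob s c d X b 0 \<le> gA"
  and pos: "0 \<le> \<epsilon>1" "0 \<le> g" "0 \<le> gA" "0 \<le> \<eta>" "4 \<le> \<eta> * 2 ^ s" "\<epsilon>1 + 8 * \<eta> \<le> \<epsilon>" "\<epsilon> \<le> 1 / 2"
  and cR: "(1 + \<epsilon>) * real (card R) < real (card R') + 1" "real (card R') \<le> (1 + \<epsilon>) * real (card R)"
  and cB: "(1 - \<epsilon>) * real (card B) \<le> real (card B')" "real (card B') < (1 - \<epsilon>) * real (card B) + 1"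
  and miss: "\<And>y. (1 - 2 * \<epsilon>) * (2 ^ s / 4) \<le> real y \<Longrightarrow> miss_bound (bin_bits k) y \<le> m"
 shows "prob (mixed_estimator s c d r k R B) {t..} \<le>
  prob (minhash_estimator r k R' B' (fully_random (R' \<union> B') r)) {t..} +
  (gA + 3 * g + 8 * exp (- (\<eta>\<^sup>2 * 2 ^ s / 32)) + 2 * m + 2 * exp (- (2 ^ s / 32)))"
proof -
 define X where "X = R \<union> B"
 define n where "n = real (card X)"
 define \<beta> where "\<beta> = bin_bits k"
 define \<theta> where "\<theta> = t * 2 ^ \<beta>"
 have finR: "finite R" and finB: "finite B" using R B finite_subset by blast+
 have finX: "finite X" and XS: "X \<subseteq> {..<2 ^ (s * c)}" using finR finB R B by (auto simp: X_def)
 have n: "n = real (card R) + real (card B)" unfolding n_def X_def using finR finB disj by (simp add: card_Un_disjoint)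
 have eta_small: "\<eta> \<le> 1 / 16" using pos by simp
 have s64: "(64::real) \<le> 2 ^ s"
 proof -
  have "\<eta> * 2 ^ s \<le> 1 / 16 * 2 ^ s" using eta_small by (intro mult_right_mono) auto
  then show ?thesis using pos(5) by linarith
 qed
 define P where "P b \<longleftrightarrow> n / 2 ^ b \<le> 2 ^ s / 2" for b
 define b where "b = (LEAST b. P b)"
 have "P (card X)"
 proof -
  have "n \<le> 2 ^ card X" using of_nat_less_two_power[of "card X", where 'a = real] by (simp add: n_def)
  then have "n / 2 ^ card X \<le> 1" by simp
  then show ?thesis unfolding P_def using s64 by linarith
 qed
 then have Pb: "P b" unfolding b_def by (rule LeastI)
 have "b \<noteq> 0" using Pb big by (intro notI) (simp add: P_def n)
 then obtain b' where b': "b = Suc b'" by (cases b) auto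
 have "\<not> P b'" using not_less_Least[of b' P] b' unfolding b_def by simp
 define x where "x = n / 2 ^ b"
 define q where "q = 1 / (2::real) ^ b"
 have x_hi: "x \<le> 2 ^ s / 2" using Pb by (simp add: P_def x_def)
 have x_lo: "2 ^ s / 4 \<le> x" using \<open>\<not> P b'\<close> by (simp add: P_def x_def b' field_simps)
 have x16: "16 \<le> x" using x_lo s64 by simp
 have q01: "q \<in> {0..1}" by (simp add: q_def)
 define bl where "bl = min b (r - \<beta>)"
 define e where "e = b - bl"
 define \<rho> where "\<rho> = r - \<beta> - bl"
 have ble: "bl + e = b" and r: "r = \<beta> + bl + \<rho>" and e\<rho>: "e = 0 \<or> \<rho> = 0"
  using br by (auto simp: bl_def e_def \<rho>_def \<beta>_def)
 let ?E = "exp (- (\<eta>\<^sup>2 * 2 ^ s / 32))"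
 have ex1: "\<eta> * x \<ge> 1"
 proof -
  have "\<eta> * (2 ^ s / 4) \<le> \<eta> * x" using x_lo pos by (intro mult_left_mono) auto
  then show ?thesis using pos(5) by linarith
 qed
 define xr where "xr = real (card R) * q"
 define xb where "xb = real (card B) * q"
 have xrb: "xr + xb = x" "0 \<le> xr" "0 \<le> xb" by (auto simp: xr_def xb_def x_def q_def n add_divide_distrib)
 have nx: "n * q = x" by (simp add: x_def q_def)
 have exE: "2 * exp (- (\<eta>\<^sup>2 * x / 8)) \<le> 2 * ?E"
 proof -
  have "\<eta>\<^sup>2 * (2 ^ s / 4) \<le> \<eta>\<^sup>2 * x" using x_lo by (intro mult_left_mono) auto
  then show ?thesis by simp
 qed
 have dev: "prob (binom N q) {k. \<eta> * x \<le> \<bar>real k - real N * q\<bar>} \<le> 2 * ?E" if "real N * q \<le> 2 * x" for N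
  using binomial_relative_deviation[OF q01 pos(4) _ that] exE eta_small x16 by linarith
 have dev_lo: "prob (binom N q) {k. k < y} \<le> 2 * ?E" if "real N * q \<le> 2 * x" "real y \<le> real N * q - \<eta> * x" for N y :: nat
 proof -
  have "prob (binom N q) {k. k < y} \<le> prob (binom N q) {k. \<eta> * x \<le> \<bar>real k - real N * q\<bar>}"
   using that(2) by (intro prob_mono) auto
  then show ?thesis using dev[OF that(1)] by linarith
 qed
 have dev_hi: "prob (binom N q) {k. y < k} \<le> 2 * ?E" if "real N * q \<le> 2 * x" "real N * q + \<eta> * x \<le> real y" for N y :: nat
 proof -
  have "prob (binom N q) {k. y < k} \<le> prob (binom N q) {k. \<eta> * x \<le> \<bar>real k - real N * q\<bar>}"
   using that(2) by (intro prob_mono) auto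
  then show ?thesis using dev[OF that(1)] by linarith
 qed
 have mean_le: "real S * q \<le> A * (w * q) + C" if "real S \<le> A * w + C" "0 \<le> C" for S :: nat and A w C
 proof -
  have "real S * q \<le> (A * w + C) * q" using that(1) q01 by (intro mult_right_mono) auto
  also have "\<dots> = A * (w * q) + C * q" by (simp add: algebra_simps)
  also have "\<dots> \<le> A * (w * q) + C * 1" using that(2) q01 by (intro add_left_mono mult_left_mono) auto
  finally show ?thesis by simp
 qed
 have mean_ge: "A * (w * q) - C \<le> real S * q" if "A * w - C \<le> real S" "0 \<le> C" for S :: nat and A w C
 proof -
  have "A * (w * q) - C * 1 \<le> A * (w * q) - C * q" using that(2) q01 by (intro diff_left_mono mult_left_mono) auto
  also have "\<dots> = (A * w - C) * q" by (simp add: algebra_simps)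
  also have "\<dots> \<le> real S * q" using that(1) q01 by (intro mult_right_mono) auto
  finally show ?thesis by simp
 qed
 have small: "real (card S) / 2 ^ (bl + e) \<le> 2 ^ s / 2" if "S \<subseteq> X" for S
 proof -
  have "real (card S) \<le> n" unfolding n_def using card_mono[OF finX that] by (rule of_nat_mono)
  then have "real (card S) / 2 ^ b \<le> n / 2 ^ b" by (rule divide_right_mono) simp
  then show ?thesis unfolding ble x_def[symmetric] using x_hi by (rule order.trans)
 qed
 note SD1' = SD1[OF _ small, unfolded ble, folded q_def]
 note SD2' = SD2[OF _ small, unfolded ble, folded q_def]
 have RX: "R \<subseteq> X" and BX: "B \<subseteq> X" by (auto simp: X_def)
 have e01: "0 \<le> \<epsilon>" using pos by simp

 let ?R1 = "random_tables s c (s * d)"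
 let ?R = "random_tables s (c + d)"
 define M where "M = pair_pmf (fully_random X e) (pair_pmf ?R1 (?R bl))"
 define \<phi> where "\<phi> = red_prob_of \<beta> \<rho> \<theta>"
 define Y where "Y S z T1 Tf = selected s c d {x \<in> S. z x = (0::nat)} 0 T1 Tf" for S z T1 Tf
 define L where "L = map_pmf (\<lambda>(z, T1, Tf). (card (Y R z T1 Tf), card (Y B z T1 Tf))) M"
 have law: "map_pmf (\<lambda>(z, T1, Tf). card (Y S z T1 Tf)) M = filtered_count s c d S bl e" if "S \<subseteq> X" for S
  unfolding Y_def M_def by (rule filtered_count_marginal[OF finX that])
 have L1: "map_pmf fst L = filtered_count s c d R bl e" and L2: "map_pmf snd L = filtered_count s c d B bl e"
  using law[OF RX] law[OF BX] by (simp_all add: L_def map_pmf_comp split_def)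
 \<comment> \<open>A number of survivors that is reached with high probability in both experiments;
   it controls the missed bins.\<close>
 define y0 where "y0 = nat \<lfloor>(1 - \<epsilon>) * x - 1 - \<eta> * x\<rfloor>"
 have y0: "real y0 \<le> (1 - \<epsilon>) * x - 1 - \<eta> * x" "(1 - \<epsilon>) * x - 2 - \<eta> * x \<le> real y0"
 proof -
  have "1 / 2 * x \<le> (1 - \<epsilon>) * x" "\<eta> * x \<le> 1 / 16 * x" using pos eta_small x16 by (auto intro!: mult_right_mono)
  then have "0 \<le> (1 - \<epsilon>) * x - 1 - \<eta> * x" using x16 by linarith
  then show "real y0 \<le> (1 - \<epsilon>) * x - 1 - \<eta> * x" "(1 - \<epsilon>) * x - 2 - \<eta> * x \<le> real y0" unfolding y0_def by linarith+
 qed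
 have eps8: "\<epsilon>1 * x + 8 * (\<eta> * x) \<le> \<epsilon> * x"
  using mult_right_mono[OF pos(6), of x] x16 by (simp add: distrib_right)
 have eps1x: "0 \<le> \<epsilon>1 * x" using pos x16 by simp
 have my0: "miss_bound \<beta> y0 \<le> m"
 proof -
  have "(1 - 2 * \<epsilon>) * (2 ^ s / 4) \<le> (1 - 2 * \<epsilon>) * x" using pos x_lo by (intro mult_left_mono) auto
  also have "\<dots> \<le> real y0" using y0(2) eps8 eps1x ex1 by (simp add: algebra_simps)
  finally show ?thesis unfolding \<beta>_def by (rule miss)
 qed

 have 1: "prob M {(z, T1, Tf). \<not> derived_indep s c d T1 (Y X z T1 Tf)} \<le> gA + 2 * exp (- (2 ^ s / 32))"
 proof -
  define Q where "Q z T = (case T of (T1, Tf) \<Rightarrow> \<not> derived_indep s c d T1 (Y X z T1 Tf))" for z T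
  have "prob (pair_pmf (fully_random X e) (pair_pmf ?R1 (?R bl))) {(z, T). Q z T} \<le>
   prob (fully_random X e) {z. \<not> real (card {x \<in> X. z x = 0}) \<le> 3 / 4 * 2 ^ s * 2 ^ bl} + expect (fully_random X e) (\<lambda>_. min 1 gA)"
  proof (rule prob_pair_le)
   fix z :: "nat \<Rightarrow> nat" assume z: "real (card {x \<in> X. z x = 0}) \<le> 3 / 4 * 2 ^ s * 2 ^ bl"
   have "{x \<in> X. z x = 0} \<subseteq> {..<2 ^ (s * c)}" using XS by auto
   from DP[OF this z] show "prob (pair_pmf ?R1 (?R bl)) {T. Q z T} \<le> min 1 gA"
    by (simp add: dependent_prob_def Q_def Y_def split_def)
  qed (use pos in auto)
  also have "prob (fully_random X e) {z. \<not> real (card {x \<in> X. z x = 0}) \<le> 3 / 4 * 2 ^ s * 2 ^ bl} \<le> 2 * exp (- (2 ^ s / 32))"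
  proof -
   define m1 where "m1 = n * (1 / 2 ^ e)"
   define v where "v = (2::real) ^ s * 2 ^ bl"
   have m1: "m1 \<le> v / 2"
   proof -
    have "m1 = x * 2 ^ bl" by (simp add: m1_def x_def ble[symmetric] power_add)
    also have "\<dots> \<le> 2 ^ s / 2 * 2 ^ bl" using x_hi by (intro mult_right_mono) auto
    finally show ?thesis by (simp add: v_def)
   qed
   have vs: "2 ^ s * 1 \<le> v" unfolding v_def by (intro mult_left_mono) auto
   have "prob (fully_random X e) {z. \<not> real (card {x \<in> X. z x = 0}) \<le> 3 / 4 * 2 ^ s * 2 ^ bl} =
    prob (map_pmf (\<lambda>z. card {x \<in> X. z x = 0}) (fully_random X e)) {k. \<not> real k \<le> 3 / 4 * 2 ^ s * 2 ^ bl}"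
    by (simp add: vimage_def)
   also have "map_pmf (\<lambda>z. card {x \<in> X. z x = 0}) (fully_random X e) = binom (card X) (1 / 2 ^ e)"
    unfolding fully_random_def by (rule card_uniform_eq[OF finX]) simp
   also have "prob (binom (card X) (1 / 2 ^ e)) {k. \<not> real k \<le> 3 / 4 * 2 ^ s * 2 ^ bl} \<le>
    prob (binom (card X) (1 / 2 ^ e)) {k. v / 4 \<le> \<bar>real k - real (card X) * (1 / 2 ^ e)\<bar>}"
    using m1 by (intro prob_mono) (auto simp: m1_def n_def v_def)
   also have "\<dots> \<le> 2 * exp ((1 / 4)\<^sup>2 * (real (card X) * (1 / 2 ^ e)) - 1 / 4 * (v / 4))"
    by (rule binomial_deviation) auto
   also have "(1 / 4)\<^sup>2 * (real (card X) * (1 / 2 ^ e)) - 1 / 4 * (v / 4) = m1 / 16 - v / 16"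
    by (simp add: m1_def n_def power2_eq_square)
   also have "2 * exp (m1 / 16 - v / 16) \<le> 2 * exp (- (2 ^ s / 32))" using m1 vs by simp
   finally show ?thesis .
  qed
  finally have "prob M {(z, T). Q z T} \<le> 2 * exp (- (2 ^ s / 32)) + min 1 gA" unfolding M_def by simp
  then show ?thesis by (simp add: Q_def split_def)
 qed

 have 2: "expect M (\<lambda>(z, T1, Tf). red_prob \<beta> \<rho> (Y X z T1 Tf) R \<theta>) = expect L (\<lambda>(a, b). \<phi> a b)"
 proof -
  have YR: "Y X z T1 Tf \<inter> R = Y R z T1 Tf" and YB: "Y X z T1 Tf - R = Y B z T1 Tf" and fY: "finite (Y X z T1 Tf)" for z T1 Tf
   using disj finX by (auto simp: Y_def selected_def X_def)
  have "red_prob \<beta> \<rho> (Y X z T1 Tf) R \<theta> = \<phi> (card (Y R z T1 Tf)) (card (Y B z T1 Tf))" for z T1 Tf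
   unfolding red_prob_eq_of[OF fY] YR YB \<phi>_def ..
  then show ?thesis by (simp add: L_def split_def)
 qed

 have N1: "\<exists>N. real N < (1 - \<epsilon>1) * w + 1 \<and> (1 - \<epsilon>1) * w \<le> real N" if "0 \<le> w" for w
 proof (intro exI conjI)
  have "0 \<le> (1 - \<epsilon>1) * w" using that pos by simp
  then show "real (nat \<lceil>(1 - \<epsilon>1) * w\<rceil>) < (1 - \<epsilon>1) * w + 1" "(1 - \<epsilon>1) * w \<le> real (nat \<lceil>(1 - \<epsilon>1) * w\<rceil>)" by linarith+
 qed
 have SD2_lt: "prob (filtered_count s c d S bl e) {k. k < y} \<le> prob (binom N q) {k. k < y} + g"
  if "S \<subseteq> X" "real N < (1 - \<epsilon>1) * real (card S) + 1" for S N y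
 proof (cases y)
  case 0 then show ?thesis using pos by simp
 next
  case (Suc j)
  then have "{k. k < y} = {..j}" by auto
  moreover have "S \<subseteq> {..<2 ^ (s * c)}" using that(1) XS by auto
  ultimately show ?thesis using SD2'[OF _ that] by simp
 qed
 have SD1_gt: "prob (filtered_count s c d S bl e) {k. y < k} \<le> prob (binom N q) {k. y < k} + g"
  if "S \<subseteq> X" "(1 + \<epsilon>1) * real (card S) < real N + 1" for S N y
 proof -
  have "{k. y < k} = {Suc y..}" by auto
  moreover have "S \<subseteq> {..<2 ^ (s * c)}" using that(1) XS by auto
  ultimately show ?thesis using SD1'[OF _ that] by simp
 qed

 have 3: "expect M (\<lambda>(z, T1, Tf). miss_bound \<beta> (card (Y X z T1 Tf))) \<le> g + 2 * ?E + m"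
 proof -
  have "expect M (\<lambda>(z, T1, Tf). miss_bound \<beta> (card (Y X z T1 Tf))) = expect (filtered_count s c d X bl e) (miss_bound \<beta>)"
   unfolding law[OF order.refl, symmetric] by (simp add: split_def)
  also have "\<dots> \<le> prob (filtered_count s c d X bl e) {y. y < y0} + miss_bound \<beta> y0" by (rule expectation_miss_bound)
  finally have a: "expect M (\<lambda>(z, T1, Tf). miss_bound \<beta> (card (Y X z T1 Tf))) \<le> prob (filtered_count s c d X bl e) {y. y < y0} + m"
   using my0 by linarith
  obtain N where N: "real N < (1 - \<epsilon>1) * n + 1" "(1 - \<epsilon>1) * n \<le> real N" using N1[of n] by (auto simp: n_def)
  have "real N * q \<le> (1 - \<epsilon>1) * (n * q) + 1" using N(1) by (intro mean_le) auto
  moreover have "(1 - \<epsilon>1) * (n * q) - 0 \<le> real N * q" using N(2) by (intro mean_ge) auto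
  ultimately have N': "real N * q \<le> (1 - \<epsilon>1) * x + 1" "(1 - \<epsilon>1) * x \<le> real N * q" by (simp_all add: nx)
  have "prob (binom N q) {y. y < y0} \<le> 2 * ?E"
  proof (rule dev_lo)
   show "real N * q \<le> 2 * x" using N'(1) eps1x x16 by (simp add: algebra_simps)
   show "real y0 \<le> real N * q - \<eta> * x" using N'(2) y0(1) eps8 ex1 by (simp add: algebra_simps)
  qed
  then show ?thesis using a SD2_lt[OF order.refl, of N y0] N(1) unfolding n_def by linarith
 qed

 define \<nu>A where "\<nu>A = binom (card R') q"
 define \<nu>B where "\<nu>B = binom (card B') q"
 have R'q: "(1 + \<epsilon>) * xr - 1 \<le> real (card R') * q" "real (card R') * q \<le> (1 + \<epsilon>) * xr + 0"
  unfolding xr_def using cR by (intro mean_ge mean_le; simp)+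
 have B'q: "(1 - \<epsilon>) * xb - 0 \<le> real (card B') * q" "real (card B') * q \<le> (1 - \<epsilon>) * xb + 1"
  unfolding xb_def using cB by (intro mean_ge mean_le; simp)+
 have exr: "\<epsilon> * xr \<le> \<epsilon> * x" "\<epsilon> * xb \<le> \<epsilon> * x" "0 \<le> \<epsilon> * xr" "0 \<le> \<epsilon> * xb" "\<epsilon> * x \<le> 1 / 2 * x"
  using e01 pos xrb x16 by (auto intro!: mult_left_mono mult_right_mono)
 have hR: "(1 + \<epsilon>) * xr \<le> 3 / 2 * xr" using pos xrb by (intro mult_right_mono) auto
 have hB: "(1 - \<epsilon>) * xb \<le> 1 * xb" using e01 xrb by (intro mult_right_mono) auto
 have hL: "(1 - \<epsilon>) * x \<le> (1 + \<epsilon>) * xr + (1 - \<epsilon>) * xb"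
 proof -
  have "(1 - \<epsilon>) * x = (1 - \<epsilon>) * xr + (1 - \<epsilon>) * xb" using xrb by (simp add: distrib_left[symmetric])
  moreover have "(1 - \<epsilon>) * xr \<le> (1 + \<epsilon>) * xr" using e01 xrb by (intro mult_right_mono) auto
  ultimately show ?thesis by linarith
 qed
 \<comment> \<open>If blue is the majority, \<open>b0\<close> separates the blue counts and the red
   counts are compared by their tails; otherwise \<open>a0\<close> separates the red counts and the
   blue ones are compared.\<close>
 have 4: "expect L (\<lambda>(a, b). \<phi> a b) \<le> expect (pair_pmf \<nu>A \<nu>B) (\<lambda>(a, b). \<phi> a b) + g + (g + 2 * ?E) + 2 * ?E"
 proof (cases "xr \<le> xb")
  case True
  have xb2: "x / 2 \<le> xb" using True xrb by linarith
  have "(\<epsilon> - \<epsilon>1) * (x / 2) \<le> (\<epsilon> - \<epsilon>1) * xb" using pos xb2 by (intro mult_left_mono) auto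
  moreover have "(\<epsilon> - \<epsilon>1) * (x / 2) = (\<epsilon> * x - \<epsilon>1 * x) / 2" "(\<epsilon> - \<epsilon>1) * xb = \<epsilon> * xb - \<epsilon>1 * xb"
   by (simp_all add: left_diff_distrib)
  ultimately have "(\<epsilon> * x - \<epsilon>1 * x) / 2 \<le> \<epsilon> * xb - \<epsilon>1 * xb" by (simp only:)
  moreover have "4 * w \<le> D" if "(w1 - w2) / 2 \<le> D" "w2 + 8 * w \<le> w1" for w w1 w2 D :: real
   using that by (simp add: field_simps)
  ultimately have gap: "4 * (\<eta> * x) \<le> \<epsilon> * xb - \<epsilon>1 * xb" using eps8 by blast
  define b0 where "b0 = nat \<lceil>(1 - \<epsilon>) * xb + 1 + \<eta> * x\<rceil>"
  have b0: "(1 - \<epsilon>) * xb + 1 + \<eta> * x \<le> real b0" "real b0 \<le> (1 - \<epsilon>) * xb + 2 + \<eta> * x"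
  proof -
   have "0 \<le> (1 - \<epsilon>) * xb" using pos xrb by simp
   then have "0 \<le> (1 - \<epsilon>) * xb + 1 + \<eta> * x" using ex1 by linarith
   then show "(1 - \<epsilon>) * xb + 1 + \<eta> * x \<le> real b0" "real b0 \<le> (1 - \<epsilon>) * xb + 2 + \<eta> * x" unfolding b0_def by linarith+
  qed
  obtain N where N: "real N < (1 - \<epsilon>1) * real (card B) + 1" "(1 - \<epsilon>1) * real (card B) \<le> real N" using N1[of "real (card B)"] by auto
  have N': "real N * q \<le> (1 - \<epsilon>1) * xb + 1" "(1 - \<epsilon>1) * xb - 0 \<le> real N * q"
   unfolding xb_def using N by (intro mean_ge mean_le; simp)+
  have e1b: "0 \<le> \<epsilon>1 * xb" using pos xrb by simp
  have "prob (binom N q) {y. y < b0} \<le> 2 * ?E"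
  proof (rule dev_lo)
   show "real N * q \<le> 2 * x" using N'(1) e1b x16 xrb by (simp add: algebra_simps)
   show "real b0 \<le> real N * q - \<eta> * x" using N'(2) b0(2) gap ex1 by (simp add: algebra_simps)
  qed
  then have c1: "prob (map_pmf snd L) {b. b < b0} \<le> g + 2 * ?E"
   unfolding L2 using SD2_lt[OF BX N(1), of b0] by linarith
  have c2: "prob \<nu>B {b. b0 < b} \<le> 2 * ?E"
   unfolding \<nu>B_def
  proof (rule dev_hi)
   show "real (card B') * q \<le> 2 * x" using B'q(2) exr xrb x16 by (simp add: algebra_simps)
   show "real (card B') * q + \<eta> * x \<le> real b0" using B'q(2) b0(1) by simp
  qed
  have tail: "prob (map_pmf fst L) {j..} \<le> prob \<nu>A {j..} + g" for j
  proof -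
   have "\<epsilon>1 * real (card R) \<le> \<epsilon> * real (card R)" using pos by (intro mult_right_mono) auto
   then have "(1 + \<epsilon>1) * real (card R) < real (card R') + 1" using cR(1) by (simp add: algebra_simps)
   then show ?thesis unfolding L1 \<nu>A_def by (rule SD1'[OF R RX])
  qed
  show ?thesis
  proof (rule expectation_le_first[OF _ _ _ _ _ tail pos(2) c1 c2, where N = "max (card R) (card R')"])
   show "set_pmf (map_pmf fst L) \<subseteq> {..max (card R) (card R')}" unfolding L1 using set_pmf_filtered_count[OF finR, of s c d bl e] by auto
   show "set_pmf \<nu>A \<subseteq> {..max (card R) (card R')}" unfolding \<nu>A_def using set_pmf_binomial_le[OF q01, of "card R'"] by auto
  qed (auto simp: \<phi>_def red_prob_of_range intro: red_prob_of_mono)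
 next
  case False
  have xr2: "x / 2 \<le> xr" using False xrb by linarith
  have "(\<epsilon> - \<epsilon>1) * (x / 2) \<le> (\<epsilon> - \<epsilon>1) * xr" using pos xr2 by (intro mult_left_mono) auto
  moreover have "(\<epsilon> - \<epsilon>1) * (x / 2) = (\<epsilon> * x - \<epsilon>1 * x) / 2" "(\<epsilon> - \<epsilon>1) * xr = \<epsilon> * xr - \<epsilon>1 * xr"
   by (simp_all add: left_diff_distrib)
  ultimately have "(\<epsilon> * x - \<epsilon>1 * x) / 2 \<le> \<epsilon> * xr - \<epsilon>1 * xr" by (simp only:)
  moreover have "4 * w \<le> D" if "(w1 - w2) / 2 \<le> D" "w2 + 8 * w \<le> w1" for w w1 w2 D :: real
   using that by (simp add: field_simps)
  ultimately have gap: "4 * (\<eta> * x) \<le> \<epsilon> * xr - \<epsilon>1 * xr" using eps8 by blast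
  have e1r: "0 \<le> \<epsilon>1 * xr" "\<epsilon>1 * xr \<le> \<epsilon> * xr" using pos xrb by (auto intro!: mult_right_mono)
  define a0 where "a0 = nat \<lceil>(1 + \<epsilon>1) * xr + \<eta> * x\<rceil>"
  have a0: "(1 + \<epsilon>1) * xr + \<eta> * x \<le> real a0" "real a0 \<le> (1 + \<epsilon>1) * xr + 1 + \<eta> * x"
  proof -
   have "0 \<le> (1 + \<epsilon>1) * xr + \<eta> * x" using pos xrb ex1 by simp
   then show "(1 + \<epsilon>1) * xr + \<eta> * x \<le> real a0" "real a0 \<le> (1 + \<epsilon>1) * xr + 1 + \<eta> * x" unfolding a0_def by linarith+
  qed
  define N where "N = nat \<lfloor>(1 + \<epsilon>1) * real (card R)\<rfloor>"
  have N: "(1 + \<epsilon>1) * real (card R) < real N + 1" "real N \<le> (1 + \<epsilon>1) * real (card R)"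
  proof -
   have "0 \<le> (1 + \<epsilon>1) * real (card R)" using pos by simp
   then show "(1 + \<epsilon>1) * real (card R) < real N + 1" "real N \<le> (1 + \<epsilon>1) * real (card R)" unfolding N_def by linarith+
  qed
  have N': "real N * q \<le> (1 + \<epsilon>1) * xr + 0" unfolding xr_def using N by (intro mean_le) simp_all
  have "prob (binom N q) {y. a0 < y} \<le> 2 * ?E"
  proof (rule dev_hi)
   have "(1 + \<epsilon>1) * xr \<le> 2 * x" using pos xrb by (intro mult_mono) auto
   then show "real N * q \<le> 2 * x" using N' by linarith
   show "real N * q + \<eta> * x \<le> real a0" using N' a0(1) by simp
  qed
  then have c1: "prob (map_pmf fst L) {a. a0 < a} \<le> g + 2 * ?E"
   unfolding L1 using SD1_gt[OF RX N(1), of a0] by linarith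
  have c2: "prob \<nu>A {a. a < a0} \<le> 2 * ?E"
   unfolding \<nu>A_def
  proof (rule dev_lo)
   show "real (card R') * q \<le> 2 * x" using R'q(2) hR xrb by linarith
   show "real a0 \<le> real (card R') * q - \<eta> * x" using R'q(1) a0(2) gap ex1 by (simp add: algebra_simps)
  qed
  have tail: "prob (map_pmf snd L) {..j} \<le> prob \<nu>B {..j} + g" for j
  proof -
   have "\<epsilon>1 * real (card B) \<le> \<epsilon> * real (card B)" using pos by (intro mult_right_mono) auto
   then have "real (card B') < (1 - \<epsilon>1) * real (card B) + 1" using cB(2) by (simp add: algebra_simps)
   then show ?thesis unfolding L2 \<nu>B_def by (rule SD2'[OF B BX])
  qed
  show ?thesis
  proof (rule expectation_le_second[OF _ _ _ _ _ tail pos(2) c1 c2, where N = "max (card B) (card B')"])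
   show "set_pmf (map_pmf snd L) \<subseteq> {..max (card B) (card B')}" unfolding L2 using set_pmf_filtered_count[OF finB, of s c d bl e] by auto
   show "set_pmf \<nu>B \<subseteq> {..max (card B) (card B')}" unfolding \<nu>B_def using set_pmf_binomial_le[OF q01, of "card B'"] by auto
  qed (auto simp: \<phi>_def red_prob_of_range intro: red_prob_of_mono)
 qed

 define W where "W = R' \<union> B'"
 have finW: "finite W" using fin' by (simp add: W_def)
 have cW: "real (card W) = real (card R') + real (card B')" unfolding W_def using fin' disj' by (simp add: card_Un_disjoint)
 have 5: "expect (fully_random W b) (\<lambda>v. red_prob \<beta> \<rho> {x \<in> W. v x = 0} R' \<theta>) = expect (pair_pmf \<nu>A \<nu>B) (\<lambda>(a, b). \<phi> a b)"
 proof -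
  have i: "{x \<in> W. v x = 0} \<inter> R' = {x \<in> R'. v x = 0}" "{x \<in> W. v x = 0} - R' = {x \<in> B'. v x = 0}" "finite {x \<in> W. v x = 0}" for v :: "nat \<Rightarrow> nat"
   using disj' finW by (auto simp: W_def)
  have "red_prob \<beta> \<rho> {x \<in> W. v x = 0} R' \<theta> = \<phi> (card {x \<in> R'. v x = 0}) (card {x \<in> B'. v x = 0})" for v :: "nat \<Rightarrow> nat"
   unfolding red_prob_eq_of[OF i(3)] i(1,2) \<phi>_def ..
  then show ?thesis
   unfolding \<nu>A_def \<nu>B_def random_filter_counts[OF fin' disj' q_def, symmetric] W_def[symmetric] by simp
 qed
 have 6: "expect (fully_random W b) (\<lambda>v. miss_bound \<beta> (card {x \<in> W. v x = 0})) \<le> 2 * ?E + m"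
 proof -
  have "expect (fully_random W b) (\<lambda>v. miss_bound \<beta> (card {x \<in> W. v x = 0})) =
   expect (map_pmf (\<lambda>v. card {x \<in> W. v x = 0}) (fully_random W b)) (miss_bound \<beta>)" by simp
  also have "map_pmf (\<lambda>v. card {x \<in> W. v x = 0}) (fully_random W b) = binom (card W) q"
   unfolding fully_random_def q_def by (rule card_uniform_eq[OF finW]) simp
  also have "expect (binom (card W) q) (miss_bound \<beta>) \<le> prob (binom (card W) q) {y. y < y0} + miss_bound \<beta> y0" by (rule expectation_miss_bound)
  also have "prob (binom (card W) q) {y. y < y0} \<le> 2 * ?E"
  proof (rule dev_lo)
   have "real (card W) * q = real (card R') * q + real (card B') * q" by (simp add: cW distrib_right)
   then show "real (card W) * q \<le> 2 * x" "real y0 \<le> real (card W) * q - \<eta> * x"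
    using R'q B'q y0(1) hR hB hL xrb x16 by linarith+
  qed
  finally show ?thesis using my0 by linarith
 qed
 have 7: "expect (fully_random W b) (\<lambda>v. red_prob \<beta> \<rho> {x \<in> W. v x = 0} R' \<theta>) \<le>
   prob (minhash_estimator r k R' B' (fully_random W r)) {t..} +
   expect (fully_random W b) (\<lambda>v. miss_bound \<beta> (card {x \<in> W. v x = 0}))"
 proof -
  have supp: "h x < 2 ^ r" if "h \<in> set_pmf (fully_random W r)" for h x using finite_fully_random[OF finW that] by blast
  have "expect (fully_random W r) (\<lambda>h. many_red (2 ^ \<beta>) (\<lambda>x. h x div 2 ^ (bl + \<rho>)) (\<lambda>x. h x mod 2 ^ (bl + \<rho>)) (R' \<union> B') R' (t * real (2 ^ \<beta>))) \<le>
    prob (minhash_estimator r k R' B' (fully_random W r)) {t..}"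
   by (intro minhash_estimator_ge fin' br supp) (simp_all add: r \<beta>_def)
  then have "expect (fully_random W (\<beta> + bl + \<rho>)) (\<lambda>h. many_red (2 ^ \<beta>) (\<lambda>x. h x div 2 ^ (bl + \<rho>)) (\<lambda>x. h x mod 2 ^ (bl + \<rho>)) W R' \<theta>) \<le>
    prob (minhash_estimator r k R' B' (fully_random W r)) {t..}"
   unfolding r[symmetric] W_def[symmetric] \<theta>_def by simp
  then show ?thesis using red_prob_filter_le[OF finW e\<rho>, of bl \<beta> R' \<theta>] unfolding ble by linarith
 qed
 have "prob (mixed_estimator s c d r k R B) {t..} \<le>
   prob M {(z, T1, Tf). \<not> derived_indep s c d T1 (Y X z T1 Tf)} +
   expect M (\<lambda>(z, T1, Tf). red_prob \<beta> \<rho> (Y X z T1 Tf) R \<theta>) +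
   expect M (\<lambda>(z, T1, Tf). miss_bound \<beta> (card (Y X z T1 Tf)))"
  unfolding M_def Y_def by (rule mixed_estimator_le[OF finR finB \<beta>_def[symmetric] r e\<rho> X_def \<theta>_def])
 then show ?thesis using 1 2 3 4 5 6 7 unfolding W_def[symmetric] by linarith
qed

section \<open>Choice of parameters and conclusion\<close>

lemma two_power_bin_bits: "1 \<le> k \<Longrightarrow> 2 ^ bin_bits k \<le> 2 * real k"
proof -
 assume k: "1 \<le> k"
 then have "0 \<le> log 2 (real k)" by simp
 then have "real (bin_bits k) \<le> log 2 (real k) + 1" unfolding bin_bits_def by linarith
 then have "(2::real) powr real (bin_bits k) \<le> 2 powr (log 2 (real k) + 1)" by simp
 also have "\<dots> = 2 * real k" using k by (simp add: powr_add)
 finally show ?thesis by (simp add: powr_realpow)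
qed

text \<open>Rounding up to a power of two gives at most 2k <= |\<Sigma>| / (2 d ln |\<Sigma>|) bins.
  With about |\<Sigma>|/4 survivors, a bin is missed with probability about exp(-(d/2) ln
  |\<Sigma>|) <= |\<Sigma>|^(-D); the third condition on \<epsilon> limits the loss to a factor
  2.\<close>

lemma miss_bound_small:
 assumes s: "s \<ge> 1" and d: "d \<ge> 1" and D: "2 * D \<le> d" and k: "1 \<le> k" "real k \<le> 2 ^ s / (4 * real d * ln (2 ^ s))"
  and \<epsilon>: "0 \<le> \<epsilon>" "\<epsilon> \<le> 1 / 2" "\<epsilon> * real d * real s \<le> 1" and y: "(1 - 2 * \<epsilon>) * (2 ^ s / 4) \<le> real y"
 shows "miss_bound (bin_bits k) y \<le> 2 * 2 ^ s / (2 ^ s) ^ D"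
proof -
 define K where "K = (2::real) ^ bin_bits k"
 define L where "L = real d * (real s * ln 2)"
 have K0: "K > 0" by (simp add: K_def)
 have l2: "1 / 2 \<le> ln (2::real)"
 proof -
  have "ln (1 / 2 :: real) \<le> 1 / 2 - 1" by (rule ln_le_minus_one) simp
  then show ?thesis by (simp add: ln_div)
 qed
 have "1 * (1 * (1 / 2)) \<le> L" unfolding L_def using s d l2 by (intro mult_mono) auto
 then have L: "1 / 2 \<le> L" by simp
 have "real k \<le> 2 ^ s / (4 * L)" using k(2) by (simp add: L_def ln_realpow mult_ac)
 then have "K \<le> 2 * (2 ^ s / (4 * L))" using two_power_bin_bits[OF k(1)] unfolding K_def by linarith
 then have K: "K \<le> 2 ^ s / (2 * L)" by simp
 have KL: "K * (2 * L) \<le> 2 ^ s" using K L by (simp add: pos_le_divide_eq)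
 have K2: "K \<le> 2 ^ s"
 proof -
  have "K * 1 \<le> K * (2 * L)" using K0 L by (intro mult_left_mono) auto
  then show ?thesis using KL by linarith
 qed
 have "(1 - 2 * \<epsilon>) * (K * (2 * L) / 4) \<le> (1 - 2 * \<epsilon>) * (2 ^ s / 4)" using KL \<epsilon> by (intro mult_left_mono divide_right_mono) auto
 then have "(1 - 2 * \<epsilon>) * (K * (2 * L) / 4) \<le> real y" using y by linarith
 then have yK: "(1 - 2 * \<epsilon>) * L / 2 \<le> real y / K" using K0 by (simp add: pos_le_divide_eq mult_ac)
 have "\<epsilon> * L = (\<epsilon> * real d * real s) * ln 2" by (simp add: L_def)
 also have "\<dots> \<le> 1 * ln 2" using \<epsilon>(3) by (intro mult_right_mono) auto
 finally have eL: "\<epsilon> * L \<le> ln 2" by simp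
 have DL: "real (s * D) * ln 2 \<le> L / 2"
 proof -
  have "2 * real D \<le> real d" using of_nat_mono[OF D, where 'a = real] by simp
  then have "(2 * real D) * (real s * ln 2) \<le> real d * (real s * ln 2)" by (intro mult_right_mono) auto
  then show ?thesis unfolding L_def by (simp add: mult_ac)
 qed
 have "(1 - 2 * \<epsilon>) * L / 2 = L / 2 - \<epsilon> * L" by (simp add: left_diff_distrib diff_divide_distrib)
 then have "- (real y / K) \<le> ln 2 + - (real (s * D) * ln 2)" using yK eL DL by linarith
 then have "exp (- (real y / K)) \<le> exp (ln 2 + - (real (s * D) * ln 2))" by simp
 also have "\<dots> = 2 * exp (- (real (s * D) * ln 2))" by (simp only: exp_add exp_ln zero_less_numeral)
 also have "\<dots> = 2 * (1 / (2 ^ s) ^ D)"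
  by (simp only: exp_minus exp_of_nat_mult exp_ln power_mult inverse_eq_divide zero_less_numeral)
 finally have "K * exp (- (real y / K)) \<le> 2 ^ s * (2 * (1 / (2 ^ s) ^ D))" using K2 K0 by (intro mult_mono) auto
 then show ?thesis unfolding miss_bound_def K_def by (intro min.coboundedI2) (simp add: mult_ac)
qed

lemma minhash_estimator_prob_le:
 assumes "finite R" "finite B" "R \<inter> B = {}" "R \<union> B \<noteq> {}"
 shows "prob (minhash_estimator r k R B H) {X. X \<le> t} = prob (minhash_estimator r k B R H) {1 - t..}"
 by (simp add: minhash_estimator_swap[OF assms] vimage_def)

text \<open>The constant \<open>C\<close> is such that \<open>C * h\<close> exceeds the error
  \<epsilon>1 of the counts plus the \<open>8 * \<eta>\<close> required for the gap; both are of the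
  order of \<open>h\<close>. The random experiment is stated for arbitrary sets of the prescribed
  sizes, so that the colours can be exchanged afterwards.\<close>

theorem mixed_estimator_bound:
 fixes c d :: nat
 assumes c: "c \<ge> 1" and d: "d \<ge> 1"
 defines "h \<equiv> (\<lambda>n. sqrt (ln (real n) * (ln (ln (real n)))\<^sup>2 / real n))"
 shows "\<exists>C e Ce S. 0 < C \<and> 0 \<le> Ce \<and> 2 \<le> S \<and> (\<forall>s\<ge>S. 0 \<le> C * h (2 ^ s) \<and> C * h (2 ^ s) \<le> 1 / 2 \<and>
  (\<forall>r k R B (R' :: nat set) (B' :: nat set) t. R \<subseteq> {..<2 ^ (s * c)} \<longrightarrow> B \<subseteq> {..<2 ^ (s * c)} \<longrightarrow> R \<inter> B = {} \<longrightarrow>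
   finite R' \<longrightarrow> finite B' \<longrightarrow> R' \<inter> B' = {} \<longrightarrow> 2 ^ s / 2 < real (card R + card B) \<longrightarrow>
   bin_bits k \<le> r \<longrightarrow> 1 \<le> k \<longrightarrow> real k \<le> 2 ^ s / (4 * real d * ln (2 ^ s)) \<longrightarrow>
   card R' = nat \<lfloor>real (card R) * (1 + C * h (2 ^ s))\<rfloor> \<longrightarrow> card B' = nat \<lceil>real (card B) * (1 - C * h (2 ^ s))\<rceil> \<longrightarrow>
   prob (mixed_estimator s c d r k R B) {t..} \<le>
    prob (minhash_estimator r k R' B' (fully_random (R' \<union> B') r)) {t..} +
    Ce * real s ^ e * 2 ^ s / (2 ^ s) ^ (d div 2)))"
proof -
 define D where "D = d div 2"
 have D: "2 * D \<le> d" by (simp add: D_def)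
 obtain KA eA sA where A: "\<forall>s\<ge>sA. \<forall>X b v. X \<subseteq> {..<2 ^ (s * c)} \<longrightarrow> v < 2 ^ b \<longrightarrow>
   real (card X) \<le> 3 / 4 * 2 ^ s * 2 ^ b \<longrightarrow> dependent_prob s c d X b v \<le> KA * real s ^ eA * 2 ^ s / (2 ^ s) ^ D"
  using prob_dependent[OF c D] unfolding dependent_prob_def by (elim exE)
 obtain \<epsilon>1 g sB where \<epsilon>1: "\<epsilon>1 \<in> O(\<lambda>s. sqrt (real s / 2 ^ s) * ln (real s))" and g: "negl D g"
  and SD: "\<forall>s\<ge>sB. 0 \<le> \<epsilon>1 s \<and>
  (\<forall>X bl e N j. X \<subseteq> {..<2 ^ (s * c)} \<longrightarrow> real (card X) / 2 ^ (bl + e) \<le> 2 ^ s / 2 \<longrightarrow>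
   ((1 + \<epsilon>1 s) * real (card X) < real N + 1 \<longrightarrow>
    prob (filtered_count s c d X bl e) {j..} \<le> prob (binom N (1 / 2 ^ (bl + e))) {j..} + g s) \<and>
   (real N < (1 - \<epsilon>1 s) * real (card X) + 1 \<longrightarrow>
    prob (filtered_count s c d X bl e) {..j} \<le> prob (binom N (1 / 2 ^ (bl + e))) {..j} + g s))"
  using filtered_count_bound[OF c D] by (elim exE conjE)
 define \<eta> where "\<eta> s = sqrt (32 * real (D + 1) * real s / 2 ^ s)" for s
 define gA where "gA s = \<bar>KA\<bar> * real s ^ eA * 2 ^ s / (2 ^ s) ^ D" for s
 define m where "m s = 2 * 2 ^ s / (2 ^ s :: real) ^ D" for s
 define G where "G s = gA s + 3 * \<bar>g s\<bar> + 2 * m s + 10 / (2 ^ s) ^ D" for s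
 have G: "negl D G"
 proof -
  have "negl D (\<lambda>s. 3 * real s ^ 0 * \<bar>g s\<bar>)" by (intro negl_mult_power negl_abs g)
  moreover have "negl D (\<lambda>s. 2 * real s ^ 0 * (2 * real s ^ 0 * 2 ^ s / (2 ^ s) ^ D))" by (intro negl_mult_power negl_power)
  ultimately show ?thesis unfolding G_def gA_def m_def by (intro negl_add negl_power negl_const) simp_all
 qed
 then obtain e where "G \<in> O(\<lambda>s. real s ^ e * 2 ^ s / (2 ^ s) ^ D)" by (auto simp: negl_def)
 then obtain Ce where Ce: "Ce > 0" "eventually (\<lambda>s. norm (G s) \<le> Ce * norm (real s ^ e * 2 ^ s / (2 ^ s) ^ D)) at_top"
  by (rule landau_o.bigE)
 have hs: "h (2 ^ s) = sqrt (ln (2 ^ s) * (ln (ln (2 ^ s)))\<^sup>2 / 2 ^ s)" for s by (simp add: h_def)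
 have "(\<lambda>s. \<epsilon>1 s + 8 * \<eta> s) \<in> O(\<lambda>s. h (2 ^ s))"
 proof (rule landau_o.big.trans)
  have "\<eta> \<in> O(\<lambda>s. sqrt (real s / 2 ^ s) * ln (real s))" unfolding \<eta>_def by real_asymp
  then show "(\<lambda>s. \<epsilon>1 s + 8 * \<eta> s) \<in> O(\<lambda>s. sqrt (real s / 2 ^ s) * ln (real s))" using \<epsilon>1 by (intro sum_in_bigo) simp_all
  show "(\<lambda>s. sqrt (real s / 2 ^ s) * ln (real s)) \<in> O(\<lambda>s. h (2 ^ s))" unfolding hs by real_asymp
 qed
 then obtain C where C: "C > 0" "eventually (\<lambda>s. norm (\<epsilon>1 s + 8 * \<eta> s) \<le> C * norm (h (2 ^ s))) at_top"
  by (rule landau_o.bigE)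
 have h0: "0 \<le> h (2 ^ s)" for s unfolding hs by simp
 have "eventually (\<lambda>s. C * h (2 ^ s) \<le> 1 / 2) at_top" unfolding hs by real_asymp
 moreover have "eventually (\<lambda>s. C * h (2 ^ s) * real d * real s \<le> 1) at_top" unfolding hs by real_asymp
 moreover have "eventually (\<lambda>s. 4 \<le> \<eta> s * 2 ^ s) at_top" unfolding \<eta>_def by real_asymp
 moreover have "eventually (\<lambda>s::nat. exp (- (2 ^ s / 32)) \<le> 1 / (2 ^ s :: real) ^ D) at_top" by real_asymp
 ultimately have "eventually (\<lambda>s. C * h (2 ^ s) \<le> 1 / 2 \<and> C * h (2 ^ s) * real d * real s \<le> 1 \<and> 4 \<le> \<eta> s * 2 ^ s \<and>
   exp (- (2 ^ s / 32)) \<le> 1 / (2 ^ s :: real) ^ D \<and> norm (\<epsilon>1 s + 8 * \<eta> s) \<le> C * norm (h (2 ^ s)) \<and>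
   norm (G s) \<le> Ce * norm (real s ^ e * 2 ^ s / (2 ^ s) ^ D)) at_top"
  by (intro eventually_conj C(2) Ce(2))
 then obtain S1 where S1: "\<And>s. s \<ge> S1 \<Longrightarrow> C * h (2 ^ s) \<le> 1 / 2 \<and> C * h (2 ^ s) * real d * real s \<le> 1 \<and> 4 \<le> \<eta> s * 2 ^ s \<and>
   exp (- (2 ^ s / 32)) \<le> 1 / (2 ^ s :: real) ^ D \<and> norm (\<epsilon>1 s + 8 * \<eta> s) \<le> C * norm (h (2 ^ s)) \<and>
   norm (G s) \<le> Ce * norm (real s ^ e * 2 ^ s / (2 ^ s) ^ D)"
  unfolding eventually_at_top_linorder by blast
 define S where "S = max (max sA sB) (max S1 2)"
 have main: "prob (mixed_estimator s c d r k R B) {t..} \<le>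
    prob (minhash_estimator r k R' B' (fully_random (R' \<union> B') r)) {t..} + Ce * real s ^ e * 2 ^ s / (2 ^ s) ^ D"
  if s: "S \<le> s" and R: "R \<subseteq> {..<2 ^ (s * c)}" and B: "B \<subseteq> {..<2 ^ (s * c)}" and disj: "R \<inter> B = {}"
   and fin: "finite R'" "finite B'" and disj': "R' \<inter> B' = {}" and big: "2 ^ s / 2 < real (card R + card B)"
   and br: "bin_bits k \<le> r" and k: "1 \<le> k" "real k \<le> 2 ^ s / (4 * real d * ln (2 ^ s))"
   and cR: "card R' = nat \<lfloor>real (card R) * (1 + C * h (2 ^ s))\<rfloor>" and cB: "card B' = nat \<lceil>real (card B) * (1 - C * h (2 ^ s))\<rceil>"
  for s r k :: nat and R B R' B' :: "nat set" and t :: real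
 proof -
  define \<epsilon> where "\<epsilon> = C * h (2 ^ s)"
  have ss: "sA \<le> s" "sB \<le> s" "S1 \<le> s" "2 \<le> s" using s by (auto simp: S_def)
  note S1s = S1[OF ss(3), folded \<epsilon>_def]
  have eps: "0 \<le> \<epsilon>" "\<epsilon> \<le> 1 / 2" "\<epsilon> * real d * real s \<le> 1" using S1s C(1) h0[of s] by (auto simp: \<epsilon>_def)
  have eta0: "0 \<le> \<eta> s" by (simp add: \<eta>_def)
  have e1: "0 \<le> \<epsilon>1 s" using SD ss by simp
  have eps1: "\<epsilon>1 s + 8 * \<eta> s \<le> \<epsilon>" using S1s e1 eta0 h0[of s] unfolding \<epsilon>_def by simp
  have gA0: "0 \<le> gA s" by (simp add: gA_def)
  have SD1: "prob (filtered_count s c d X bl e) {j..} \<le> prob (binom N (1 / 2 ^ (bl + e))) {j..} + \<bar>g s\<bar>"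
   if "X \<subseteq> {..<2 ^ (s * c)}" "real (card X) / 2 ^ (bl + e) \<le> 2 ^ s / 2" "(1 + \<epsilon>1 s) * real (card X) < real N + 1" for X bl e N j
  proof -
   have "prob (filtered_count s c d X bl e) {j..} \<le> prob (binom N (1 / 2 ^ (bl + e))) {j..} + g s"
    by (rule conjunct1[OF conjunct2[OF SD[rule_format, OF ss(2)], rule_format, OF that(1,2)], rule_format, OF that(3)])
   then show ?thesis by linarith
  qed
  have SD2: "prob (filtered_count s c d X bl e) {..j} \<le> prob (binom N (1 / 2 ^ (bl + e))) {..j} + \<bar>g s\<bar>"
   if "X \<subseteq> {..<2 ^ (s * c)}" "real (card X) / 2 ^ (bl + e) \<le> 2 ^ s / 2" "real N < (1 - \<epsilon>1 s) * real (card X) + 1" for X bl e N j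
  proof -
   have "prob (filtered_count s c d X bl e) {..j} \<le> prob (binom N (1 / 2 ^ (bl + e))) {..j} + g s"
    by (rule conjunct2[OF conjunct2[OF SD[rule_format, OF ss(2)], rule_format, OF that(1,2)], rule_format, OF that(3)])
   then show ?thesis by linarith
  qed
  have DP: "dependent_prob s c d X b 0 \<le> gA s" if "X \<subseteq> {..<2 ^ (s * c)}" "real (card X) \<le> 3 / 4 * 2 ^ s * 2 ^ b" for X b
  proof -
   have "dependent_prob s c d X b 0 \<le> KA * real s ^ eA * 2 ^ s / (2 ^ s) ^ D"
    using A[rule_format, OF ss(1) that(1) _ that(2), of 0] by simp
   also have "\<dots> \<le> gA s" unfolding gA_def by (intro divide_right_mono mult_right_mono) auto
   finally show ?thesis .
  qed
  have cR': "(1 + \<epsilon>) * real (card R) < real (card R') + 1" "real (card R') \<le> (1 + \<epsilon>) * real (card R)"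
  proof -
   have "0 \<le> real (card R) * (1 + \<epsilon>)" using eps by simp
   then have "real (card R) * (1 + \<epsilon>) < real (card R') + 1" "real (card R') \<le> real (card R) * (1 + \<epsilon>)"
    unfolding cR \<epsilon>_def[symmetric] by linarith+
   then show "(1 + \<epsilon>) * real (card R) < real (card R') + 1" "real (card R') \<le> (1 + \<epsilon>) * real (card R)" by (simp_all only: mult.commute)
  qed
  have cB': "(1 - \<epsilon>) * real (card B) \<le> real (card B')" "real (card B') < (1 - \<epsilon>) * real (card B) + 1"
  proof -
   have "0 \<le> real (card B) * (1 - \<epsilon>)" using eps by simp
   then have "real (card B) * (1 - \<epsilon>) \<le> real (card B')" "real (card B') < real (card B) * (1 - \<epsilon>) + 1"
    unfolding cB \<epsilon>_def[symmetric] by linarith+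
   then show "(1 - \<epsilon>) * real (card B) \<le> real (card B')" "real (card B') < (1 - \<epsilon>) * real (card B) + 1" by (simp_all only: mult.commute)
  qed
  have miss: "miss_bound (bin_bits k) y \<le> m s" if "(1 - 2 * \<epsilon>) * (2 ^ s / 4) \<le> real y" for y
   unfolding m_def by (rule miss_bound_small[OF _ d D k eps that]) (use ss in simp)
  have "(\<eta> s)\<^sup>2 * 2 ^ s / 32 = real (D + 1) * real s" by (simp add: \<eta>_def)
  then have E: "exp (- ((\<eta> s)\<^sup>2 * 2 ^ s / 32)) \<le> 1 / (2 ^ s) ^ D"
   by (intro exp_le_inverse_power) (simp only:, simp add: algebra_simps)
  have "prob (mixed_estimator s c d r k R B) {t..} \<le>
   prob (minhash_estimator r k R' B' (fully_random (R' \<union> B') r)) {t..} +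
   (gA s + 3 * \<bar>g s\<bar> + 8 * exp (- ((\<eta> s)\<^sup>2 * 2 ^ s / 32)) + 2 * m s + 2 * exp (- (2 ^ s / 32)))"
   by (rule estimator_comparison[OF R B disj fin disj' big br SD1 SD2 DP e1 abs_ge_zero gA0 eta0 _ eps1 eps(2) cR' cB' miss])
     (use S1s in auto)
  also have "gA s + 3 * \<bar>g s\<bar> + 8 * exp (- ((\<eta> s)\<^sup>2 * 2 ^ s / 32)) + 2 * m s + 2 * exp (- (2 ^ s / 32)) \<le> G s"
  proof -
   have "exp (- (2 ^ s / 32)) \<le> 1 / (2 ^ s :: real) ^ D" using S1s by blast
   moreover have "10 / (2 ^ s) ^ D = 10 * (1 / (2 ^ s :: real) ^ D)" by simp
   ultimately show ?thesis unfolding G_def using E by linarith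
  qed
  also have "G s \<le> Ce * norm (real s ^ e * 2 ^ s / (2 ^ s) ^ D)" using S1s by auto
  also have "\<dots> = Ce * real s ^ e * 2 ^ s / (2 ^ s) ^ D" by simp
  finally show ?thesis by simp
 qed
 show ?thesis
 proof (rule exI[of _ C], rule exI[of _ e], rule exI[of _ Ce], rule exI[of _ S], intro conjI C(1) allI impI)
  show "0 \<le> Ce" using Ce(1) by simp
  show "2 \<le> S" by (simp add: S_def)
  show "0 \<le> C * h (2 ^ s)" for s using C(1) h0[of s] by simp
  show "C * h (2 ^ s) \<le> 1 / 2" if "S \<le> s" for s using S1[of s] that by (simp add: S_def)
 qed (unfold D_def[symmetric], rule main)
qed

theorem theorem2:
  fixes c d :: nat
  assumes "c \<ge> 1" and "d \<ge> 1"
  shows "\<exists>\<epsilon> err :: nat \<Rightarrow> real.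
    (\<forall>n. \<epsilon> n \<ge> 0) \<and>
    \<epsilon> \<in> O(\<lambda>n. sqrt (ln (real n) * (ln (ln (real n)))\<^sup>2 / real n)) \<and>
    err \<in> soft_O (\<lambda>n. real n powr (1 - real_of_int \<lfloor>real d / 2\<rfloor>)) \<and>
    (\<forall>(s::nat) (\<Sigma>::nat) (u::nat) (r::nat) (k::nat) (R::nat set) (B::nat set)
        (nR::nat) (nB::nat) (f::real).
      \<Sigma> = 2 ^ s \<longrightarrow> u \<le> \<Sigma> ^ c \<longrightarrow> \<Sigma> ^ (c - 1) \<le> u \<longrightarrow>
      R \<subseteq> {..<u} \<longrightarrow> B \<subseteq> {..<u} \<longrightarrow> R \<inter> B = {} \<longrightarrow>
      nR = card R \<longrightarrow> nB = card B \<longrightarrow>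
      real (nR + nB) > real \<Sigma> / 2 \<longrightarrow>
      f = real nR / real (nR + nB) \<longrightarrow>
      1 \<le> k \<longrightarrow> real k \<le> real \<Sigma> / (4 * real d * ln (real \<Sigma>)) \<longrightarrow>
      bin_bits k \<le> r \<longrightarrow>
      (\<forall>\<delta>::real.
        measure_pmf.prob (mixed_estimator s c d r k R B) {X. X \<ge> (1 + \<delta>) * f}
        \<le> measure_pmf.prob
             (random_estimator r k \<lfloor>real nR * (1 + \<epsilon> \<Sigma>)\<rfloor> \<lceil>real nB * (1 - \<epsilon> \<Sigma>)\<rceil>)
             {X. X \<ge> (1 + \<delta>) * f} + err \<Sigma>) \<and>
      (\<forall>\<delta>::real.
        measure_pmf.prob (mixed_estimator s c d r k R B) {X. X \<le> (1 - \<delta>) * f}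
        \<le> measure_pmf.prob
             (random_estimator r k \<lceil>real nR * (1 - \<epsilon> \<Sigma>)\<rceil> \<lfloor>real nB * (1 + \<epsilon> \<Sigma>)\<rfloor>)
             {X. X \<le> (1 - \<delta>) * f} + err \<Sigma>))"
proof -
 define h where "h = (\<lambda>n. sqrt (ln (real n) * (ln (ln (real n)))\<^sup>2 / real n))"
 define D where "D = d div 2"
 obtain C e Ce S where "0 < C \<and> 0 \<le> Ce \<and> 2 \<le> S \<and> (\<forall>s\<ge>S. 0 \<le> C * h (2 ^ s) \<and> C * h (2 ^ s) \<le> 1 / 2 \<and>
  (\<forall>r k R B (R' :: nat set) (B' :: nat set) t. R \<subseteq> {..<2 ^ (s * c)} \<longrightarrow> B \<subseteq> {..<2 ^ (s * c)} \<longrightarrow> R \<inter> B = {} \<longrightarrow>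
   finite R' \<longrightarrow> finite B' \<longrightarrow> R' \<inter> B' = {} \<longrightarrow> 2 ^ s / 2 < real (card R + card B) \<longrightarrow>
   bin_bits k \<le> r \<longrightarrow> 1 \<le> k \<longrightarrow> real k \<le> 2 ^ s / (4 * real d * ln (2 ^ s)) \<longrightarrow>
   card R' = nat \<lfloor>real (card R) * (1 + C * h (2 ^ s))\<rfloor> \<longrightarrow> card B' = nat \<lceil>real (card B) * (1 - C * h (2 ^ s))\<rceil> \<longrightarrow>
   prob (mixed_estimator s c d r k R B) {t..} \<le>
    prob (minhash_estimator r k R' B' (fully_random (R' \<union> B') r)) {t..} +
    Ce * real s ^ e * 2 ^ s / (2 ^ s) ^ D))"
  using mixed_estimator_bound[OF assms] unfolding h_def D_def by (elim exE)
 then have C: "0 < C" and Ce: "0 \<le> Ce" and S: "2 \<le> S"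
  and hpos: "\<And>s. S \<le> s \<Longrightarrow> 0 \<le> C * h (2 ^ s)" and hhalf: "\<And>s. S \<le> s \<Longrightarrow> C * h (2 ^ s) \<le> 1 / 2"
  and main: "\<And>s r k R B R' B' t. S \<le> s \<Longrightarrow> R \<subseteq> {..<2 ^ (s * c)} \<Longrightarrow> B \<subseteq> {..<2 ^ (s * c)} \<Longrightarrow> R \<inter> B = {} \<Longrightarrow>
   finite (R' :: nat set) \<Longrightarrow> finite (B' :: nat set) \<Longrightarrow> R' \<inter> B' = {} \<Longrightarrow> 2 ^ s / 2 < real (card R + card B) \<Longrightarrow>
   bin_bits k \<le> r \<Longrightarrow> 1 \<le> k \<Longrightarrow> real k \<le> 2 ^ s / (4 * real d * ln (2 ^ s)) \<Longrightarrow>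
   card R' = nat \<lfloor>real (card R) * (1 + C * h (2 ^ s))\<rfloor> \<Longrightarrow> card B' = nat \<lceil>real (card B) * (1 - C * h (2 ^ s))\<rceil> \<Longrightarrow>
   prob (mixed_estimator s c d r k R B) {t..} \<le>
    prob (minhash_estimator r k R' B' (fully_random (R' \<union> B') r)) {t..} + Ce * real s ^ e * 2 ^ s / (2 ^ s) ^ D"
  by metis+
 \<comment> \<open>Small alphabets, for which the asymptotic estimates say nothing, are covered by
   the error 1.\<close>
 define \<epsilon> where "\<epsilon> n = (if n < 2 ^ S then 0 else C * h n)" for n :: nat
 define err where "err n = (if n < 2 ^ S then 1 else Ce * log 2 (real n) ^ e * real n / real n ^ D)" for n :: nat
 have big: "real n \<ge> 1" if "\<not> n < 2 ^ S" for n :: nat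
 proof -
  have "(1::nat) \<le> 2 ^ S" by simp
  then have "1 \<le> n" using that by linarith
  then show ?thesis by simp
 qed
 have eps0: "\<epsilon> n \<ge> 0" for n
 proof (cases "n < 2 ^ S")
  case False
  have "0 \<le> ln (real n)" using big[OF False] by simp
  then show ?thesis using C False by (simp add: \<epsilon>_def h_def)
 qed (simp add: \<epsilon>_def)
 have epsO: "\<epsilon> \<in> O(h)"
  by (rule bigoI[of _ C], rule eventually_mono[OF eventually_ge_at_top[of "2 ^ S"]]) (use C in \<open>auto simp: \<epsilon>_def abs_mult\<close>)
 have errO: "err \<in> soft_O (\<lambda>n. real n powr (1 - real_of_int \<lfloor>real d / 2\<rfloor>))"
  unfolding soft_O_def
 proof (intro CollectI exI[of _ e] bigoI[of _ "Ce / ln 2 ^ e"] eventually_mono[OF eventually_ge_at_top[of "2 ^ S"]])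
  fix n :: nat assume "2 ^ S \<le> n"
  then have n: "\<not> n < 2 ^ S" by simp
  have "\<lfloor>real d / 2\<rfloor> = int D" using floor_divide_of_nat_eq[of d 2, where 'a = real] by (simp add: D_def)
  then have "real n powr (1 - real_of_int \<lfloor>real d / 2\<rfloor>) = real n / real n ^ D"
   using big[OF n] by (simp add: powr_diff powr_realpow)
  then have "Ce / ln 2 ^ e * (real n powr (1 - real_of_int \<lfloor>real d / 2\<rfloor>) * ln (real n) ^ e) = err n"
   using n by (simp add: err_def log_def power_divide)
  moreover have "0 \<le> err n" using n Ce big[OF n] by (simp add: err_def)
  moreover have "0 \<le> real n powr (1 - real_of_int \<lfloor>real d / 2\<rfloor>) * ln (real n) ^ e" using big[OF n] by simp
  ultimately show "norm (err n) \<le> Ce / ln 2 ^ e * norm (real n powr (1 - real_of_int \<lfloor>real d / 2\<rfloor>) * ln (real n) ^ e)" by simp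
 qed
 have bounds: "prob (mixed_estimator s c d r k R B) {X. X \<ge> t}
    \<le> prob (random_estimator r k \<lfloor>real (card R) * (1 + \<epsilon> (2 ^ s))\<rfloor> \<lceil>real (card B) * (1 - \<epsilon> (2 ^ s))\<rceil>) {X. X \<ge> t} + err (2 ^ s)"
  "prob (mixed_estimator s c d r k R B) {X. X \<le> t}
    \<le> prob (random_estimator r k \<lceil>real (card R) * (1 - \<epsilon> (2 ^ s))\<rceil> \<lfloor>real (card B) * (1 + \<epsilon> (2 ^ s))\<rfloor>) {X. X \<le> t} + err (2 ^ s)"
  if u: "u \<le> (2 ^ s) ^ c" and RB: "R \<subseteq> {..<u}" "B \<subseteq> {..<u}" and disj: "R \<inter> B = {}"
   and n: "2 ^ s / 2 < real (card R + card B)" and k: "1 \<le> k" "real k \<le> 2 ^ s / (4 * real d * ln (2 ^ s))" and br: "bin_bits k \<le> r"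
  for s u r k :: nat and R B :: "nat set" and t :: real
 proof -
  have "prob (mixed_estimator s c d r k R B) {X. X \<ge> t}
    \<le> prob (random_estimator r k \<lfloor>real (card R) * (1 + \<epsilon> (2 ^ s))\<rfloor> \<lceil>real (card B) * (1 - \<epsilon> (2 ^ s))\<rceil>) {X. X \<ge> t} + err (2 ^ s) \<and>
   prob (mixed_estimator s c d r k R B) {X. X \<le> t}
    \<le> prob (random_estimator r k \<lceil>real (card R) * (1 - \<epsilon> (2 ^ s))\<rceil> \<lfloor>real (card B) * (1 + \<epsilon> (2 ^ s))\<rfloor>) {X. X \<le> t} + err (2 ^ s)"
  proof (cases "s < S")
   case True
   then have "err (2 ^ s) = 1" by (simp add: err_def)
   then show ?thesis by (simp add: add_increasing)
  next
   case False
   then have s: "S \<le> s" by simp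
   have eps: "\<epsilon> (2 ^ s) = C * h (2 ^ s)" using s by (simp add: \<epsilon>_def)
   have err: "err (2 ^ s) = Ce * real s ^ e * 2 ^ s / (2 ^ s) ^ D" using s by (simp add: err_def)
   have "{..<u} \<subseteq> {..<2 ^ (s * c)}" using u by (auto simp: power_mult)
   then have R: "R \<subseteq> {..<2 ^ (s * c)}" and B: "B \<subseteq> {..<2 ^ (s * c)}" using RB by auto
   have fin: "finite R" "finite B" using RB finite_subset by blast+
   have U: "{..<a} \<union> {a..<a + b} = {..<a + b}" "{..<a} \<inter> {a..<a + b} = {}" for a b :: nat by auto
   define a b where "a = nat \<lfloor>real (card R) * (1 + \<epsilon> (2 ^ s))\<rfloor>" "b = nat \<lceil>real (card B) * (1 - \<epsilon> (2 ^ s))\<rceil>"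
   define a' b' where "a' = nat \<lceil>real (card R) * (1 - \<epsilon> (2 ^ s))\<rceil>" "b' = nat \<lfloor>real (card B) * (1 + \<epsilon> (2 ^ s))\<rfloor>"
   have 1: "prob (mixed_estimator s c d r k R B) {t..} \<le>
    prob (minhash_estimator r k {..<a} {a..<a + b} (fully_random ({..<a} \<union> {a..<a + b}) r)) {t..} + err (2 ^ s)"
    unfolding err by (rule main[OF s R B disj _ _ _ n br k]) (auto simp: a_b_def eps)
   \<comment> \<open>For the lower tail the colours are exchanged: blue plays the part of the colour
     whose balls become more numerous.\<close>
   have 2: "prob (mixed_estimator s c d r k B R) {1 - t..} \<le>
    prob (minhash_estimator r k {a'..<a' + b'} {..<a'} (fully_random ({a'..<a' + b'} \<union> {..<a'}) r)) {1 - t..} + err (2 ^ s)"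
    unfolding err
   proof (rule main[OF s B R _ _ _ _ _ br k])
    show "{a'..<a' + b'} \<inter> {..<a'} = {}" by auto
   qed (use disj n in \<open>simp_all add: a'_b'_def eps Int_commute add.commute\<close>)
   have ne: "R \<union> B \<noteq> {}"
   proof
    assume "R \<union> B = {}"
    then have "2 ^ s / 2 < (0::real)" using n by simp
    then show False by (simp add: not_less[symmetric])
   qed
   \<comment> \<open>Without any ball the estimator would be 0/0 = 0 for both colours, and
     exchanging them would not give the complement.\<close>
   have "a' + b' > 0"
   proof (cases "card R = 0")
    case True
    then have "1 \<le> real (card B)" using ne fin by (cases "card B") auto
    moreover have "real (card B) * 1 \<le> real (card B) * (1 + \<epsilon> (2 ^ s))" using eps0 by (intro mult_left_mono) auto
    ultimately have "0 < b'" unfolding a'_b'_def by linarith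
    then show ?thesis by simp
   next
    case False
    then have "0 < real (card R) * (1 - \<epsilon> (2 ^ s))" using hhalf[OF s] by (simp add: eps)
    then have "0 < a'" unfolding a'_b'_def by linarith
    then show ?thesis by simp
   qed
   then have ne': "{..<a'} \<union> {a'..<a' + b'} \<noteq> {}" by (simp add: U lessThan_empty_iff)
   have swap: "{a'..<a' + b'} \<union> {..<a'} = {..<a'} \<union> {a'..<a' + b'}" by (rule Un_commute)
   have "prob (mixed_estimator s c d r k R B) {X. X \<le> t} \<le>
    prob (minhash_estimator r k {..<a'} {a'..<a' + b'} (fully_random ({..<a'} \<union> {a'..<a' + b'}) r)) {X. X \<le> t} + err (2 ^ s)"
    using 2 unfolding swap mixed_estimator_def
    by (simp only: minhash_estimator_prob_le[OF fin disj ne] minhash_estimator_prob_le[OF finite_lessThan finite_atLeastLessThan U(2) ne'])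
   then show ?thesis using 1
    by (simp add: random_estimator_def U(1) a_b_def[symmetric] a'_b'_def[symmetric] atLeast_def)
  qed
  then show "prob (mixed_estimator s c d r k R B) {X. X \<ge> t}
    \<le> prob (random_estimator r k \<lfloor>real (card R) * (1 + \<epsilon> (2 ^ s))\<rfloor> \<lceil>real (card B) * (1 - \<epsilon> (2 ^ s))\<rceil>) {X. X \<ge> t} + err (2 ^ s)"
   "prob (mixed_estimator s c d r k R B) {X. X \<le> t}
    \<le> prob (random_estimator r k \<lceil>real (card R) * (1 - \<epsilon> (2 ^ s))\<rceil> \<lfloor>real (card B) * (1 + \<epsilon> (2 ^ s))\<rfloor>) {X. X \<le> t} + err (2 ^ s)"
   by (rule conjunct1, rule conjunct2)
 qed
 show ?thesis
 proof (rule exI[of _ \<epsilon>], rule exI[of _ err], intro conjI allI impI)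
  show "0 \<le> \<epsilon> n" for n by (rule eps0)
  show "\<epsilon> \<in> O(\<lambda>n. sqrt (ln (real n) * (ln (ln (real n)))\<^sup>2 / real n))" using epsO unfolding h_def .
  show "err \<in> soft_O (\<lambda>n. real n powr (1 - real_of_int \<lfloor>real d / 2\<rfloor>))" by (rule errO)
 next
  fix s \<Sigma> u r k :: nat and R B :: "nat set" and nR nB :: nat and f \<delta> :: real
  assume a: "\<Sigma> = 2 ^ s" "u \<le> \<Sigma> ^ c" "R \<subseteq> {..<u}" "B \<subseteq> {..<u}" "R \<inter> B = {}" "nR = card R" "nB = card B"
   "real \<Sigma> / 2 < real (nR + nB)" "1 \<le> k" "real k \<le> real \<Sigma> / (4 * real d * ln (real \<Sigma>))" "bin_bits k \<le> r"
  then show "prob (mixed_estimator s c d r k R B) {X. X \<ge> (1 + \<delta>) * f}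
    \<le> prob (random_estimator r k \<lfloor>real nR * (1 + \<epsilon> \<Sigma>)\<rfloor> \<lceil>real nB * (1 - \<epsilon> \<Sigma>)\<rceil>) {X. X \<ge> (1 + \<delta>) * f} + err \<Sigma>"
   unfolding a(1,6,7) by (intro bounds(1)[of u s]) simp_all
 next
  fix s \<Sigma> u r k :: nat and R B :: "nat set" and nR nB :: nat and f \<delta> :: real
  assume a: "\<Sigma> = 2 ^ s" "u \<le> \<Sigma> ^ c" "R \<subseteq> {..<u}" "B \<subseteq> {..<u}" "R \<inter> B = {}" "nR = card R" "nB = card B"
   "real \<Sigma> / 2 < real (nR + nB)" "1 \<le> k" "real k \<le> real \<Sigma> / (4 * real d * ln (real \<Sigma>))" "bin_bits k \<le> r"
  then show "prob (mixed_estimator s c d r k R B) {X. X \<le> (1 - \<delta>) * f}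
    \<le> prob (random_estimator r k \<lceil>real nR * (1 - \<epsilon> \<Sigma>)\<rceil> \<lfloor>real nB * (1 + \<epsilon> \<Sigma>)\<rfloor>) {X. X \<le> (1 - \<delta>) * f} + err \<Sigma>"
   unfolding a(1,6,7) by (intro bounds(2)[of u s]) simp_all
 qed
qed

end
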